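(* Let $\Bbbk$ be an algebraically closed field of characteristic $0$, let $A$ be a unital commutative Poisson algebra of finite type over $\Bbbk$, and let $\mathbf G$ be an affine algebraic group acting on $A$ by Poisson automorphisms. Then the invariant algebra $(J_\infty A)^{J_\infty\mathbf G}$ is a Poisson vertex subalgebra of $J_\infty A$, and the natural morphism $$j_A\colon J_\infty(A^{\mathbf G})\longrightarrow(J_\infty A)^{J_\infty\mathbf G}$$ induced by the inclusion $A^{\mathbf G}\hookrightarrow A$ is a morphism of Poisson vertex algebras.
   Context: A Poisson vertex algebra is a commutative unital algebra $V$ with a derivation $\partial$ and a linear map $\{-_\lambda-\}:V\otimes V\to V[\lambda]$ such that $\{\partial a_\lambda b\}=-\lambda\{a_\lambda b\}$, $\{a_\lambda\partial b\}=(\lambda+\partial)\{a_\lambda b\}$, $\{a_\lambda bc\}=\{a_\lambda b\}c+b\{a_\lambda c\}$, $\{ab_\lambda c\}=\{a_{\lambda+\partial}c\}_\to b+\{b_{\lambda+\partial}c\}_\to a$ (powers of $\partial$ act on the factor to the right of the arrow), $\{a_\lambda b\}=-\{b_{-\lambda-\partial}a\}$ ($\partial$ acting on the coefficients), and $\{a_\lambda\{b_\mu c\}\}-\{b_\mu\{a_\lambda c\}\}=\{\{a_\lambda b\}_{\lambda+\mu}c\}$. A Poisson vertex subalgebra is a subalgebra stable under $\partial$ and whose $\lambda$-brackets have coefficients in it. Morphisms are algebra morphisms commuting with $\partial$ and intertwining $\lambda$-brackets. For a commutative algebra $A$, the jet algebra $J_\infty A$ is the commutative differential algebra generated by symbols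 $\partial^k(a)$ ($a\in A$, $k\ge0$), linear in $a$, subject to $\partial^k(ab)=\sum_j\binom kj\partial^j(a)\partial^{k-j}(b)$, with $a=\partial^0(a)$ and $\partial(\partial^k(a))=\partial^{k+1}(a)$. It is universal: morphisms of differential algebras $J_\infty A\to B$ are the same as algebra morphisms $A\to B$. If $A$ is Poisson, $J_\infty A$ carries the unique Poisson vertex algebra structure with $\{a_\lambda b\}=\{a,b\}$ for $a,b\in A$. The action of $\mathbf G$ on $Y=\mathrm{Spec}\,A$ corresponds to a coaction $\rho:A\to\Bbbk[\mathbf G]\otimes A$, with $A^{\mathbf G}=\{f\in A\mid\rho(f)=1\otimes f\}$ (a Poisson subalgebra). Taking jets gives $\rho_\infty:J_\infty A\to J_\infty(\Bbbk[\mathbf G])\otimes J_\infty A$, i.e. an action of the group scheme $J_\infty\mathbf G=\mathrm{Spec}\,J_\infty(\Bbbk[\mathbf G])$, and $(J_\infty A)^{J_\infty\mathbf G}=\{f\mid\rho_\infty(f)=1\otimes f\}$. The jet $J_\infty(A^{\mathbf G})\to J_\infty A$ of the inclusion has image in $(J_\infty A)^{J_\infty\mathbf G}$; this defines $j_A$. *)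

theory Defs
  imports "HOL-Algebra.Algebraic_Closure" "HOL-Algebra.UnivPoly"
begin

section \<open>Commutative algebras over a commutative ring\<close>

text \<open>Commutative unital algebras are instances of the locale \<open>algebra\<close> of HOL-Algebra; the zero
  algebra is allowed.\<close>

definition alg_hom ::
  "('k,'m) ring_scheme \<Rightarrow> ('k,'a,'n) module_scheme \<Rightarrow> ('k,'b,'p) module_scheme \<Rightarrow> ('a \<Rightarrow> 'b) \<Rightarrow> bool"
where
  "alg_hom K A B f \<longleftrightarrow> f \<in> ring_hom A B \<and>
     (\<forall>c\<in>carrier K. \<forall>a\<in>carrier A. f (c \<odot>\<^bsub>A\<^esub> a) = c \<odot>\<^bsub>B\<^esub> f a)"

definition subalg :: "('k,'m) ring_scheme \<Rightarrow> ('k,'a,'n) module_scheme \<Rightarrow> 'a set \<Rightarrow> bool" where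
  "subalg K A B \<longleftrightarrow> subring B A \<and> (\<forall>c\<in>carrier K. \<forall>b\<in>B. c \<odot>\<^bsub>A\<^esub> b \<in> B)"

definition finite_type :: "('k,'m) ring_scheme \<Rightarrow> ('k,'a,'n) module_scheme \<Rightarrow> bool" where
  "finite_type K A \<longleftrightarrow> (\<exists>S. finite S \<and> S \<subseteq> carrier A \<and>
     (\<forall>B. subalg K A B \<and> S \<subseteq> B \<longrightarrow> B = carrier A))"

definition derivation ::
  "('k,'m) ring_scheme \<Rightarrow> ('k,'a,'n) module_scheme \<Rightarrow> ('a \<Rightarrow> 'a) \<Rightarrow> bool"
where
  "derivation K A D \<longleftrightarrow> D \<in> carrier A \<rightarrow> carrier A \<and>
     (\<forall>a\<in>carrier A. \<forall>b\<in>carrier A. D (a \<oplus>\<^bsub>A\<^esub> b) = D a \<oplus>\<^bsub>A\<^esub> D b) \<and>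
     (\<forall>c\<in>carrier K. \<forall>a\<in>carrier A. D (c \<odot>\<^bsub>A\<^esub> a) = c \<odot>\<^bsub>A\<^esub> D a) \<and>
     (\<forall>a\<in>carrier A. \<forall>b\<in>carrier A.
        D (a \<otimes>\<^bsub>A\<^esub> b) = D a \<otimes>\<^bsub>A\<^esub> b \<oplus>\<^bsub>A\<^esub> a \<otimes>\<^bsub>A\<^esub> D b)"


section \<open>Commutative algebras given by generators and relations\<close>

text \<open>\<open>presented K S R\<close> is the commutative \<open>K\<close>-algebra generated by the symbols in \<open>S\<close> subject to
  the relations \<open>s = t\<close> for \<open>(s, t) \<in> R\<close>: algebra expressions modulo the least congruence that
  contains \<open>R\<close> and the axioms of commutative \<open>K\<close>-algebras.\<close>

datatype ('k,'x) aterm =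
    Gen 'x
  | Scal 'k
  | Plus "('k,'x) aterm" "('k,'x) aterm"
  | Times "('k,'x) aterm" "('k,'x) aterm"

inductive_set aterms :: "('k,'m) ring_scheme \<Rightarrow> 'x set \<Rightarrow> ('k,'x) aterm set"
  for K :: "('k,'m) ring_scheme" and S :: "'x set"
where
  Gen: "x \<in> S \<Longrightarrow> Gen x \<in> aterms K S"
| Scal: "c \<in> carrier K \<Longrightarrow> Scal c \<in> aterms K S"
| Plus: "s \<in> aterms K S \<Longrightarrow> t \<in> aterms K S \<Longrightarrow> Plus s t \<in> aterms K S"
| Times: "s \<in> aterms K S \<Longrightarrow> t \<in> aterms K S \<Longrightarrow> Times s t \<in> aterms K S"

inductive_set acong ::
  "('k,'m) ring_scheme \<Rightarrow> 'x set \<Rightarrow> (('k,'x) aterm \<times> ('k,'x) aterm) set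
     \<Rightarrow> (('k,'x) aterm \<times> ('k,'x) aterm) set"
  for K :: "('k,'m) ring_scheme" and S :: "'x set" and R :: "(('k,'x) aterm \<times> ('k,'x) aterm) set"
where
  rel: "(s,t) \<in> R \<Longrightarrow> s \<in> aterms K S \<Longrightarrow> t \<in> aterms K S \<Longrightarrow> (s,t) \<in> acong K S R"
| refl: "t \<in> aterms K S \<Longrightarrow> (t,t) \<in> acong K S R"
| sym: "(s,t) \<in> acong K S R \<Longrightarrow> (t,s) \<in> acong K S R"
| trans: "(s,t) \<in> acong K S R \<Longrightarrow> (t,u) \<in> acong K S R \<Longrightarrow> (s,u) \<in> acong K S R"
| plus_cong: "(s,s') \<in> acong K S R \<Longrightarrow> (t,t') \<in> acong K S R \<Longrightarrow>
    (Plus s t, Plus s' t') \<in> acong K S R"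
| times_cong: "(s,s') \<in> acong K S R \<Longrightarrow> (t,t') \<in> acong K S R \<Longrightarrow>
    (Times s t, Times s' t') \<in> acong K S R"
| plus_assoc: "s \<in> aterms K S \<Longrightarrow> t \<in> aterms K S \<Longrightarrow> u \<in> aterms K S \<Longrightarrow>
    (Plus (Plus s t) u, Plus s (Plus t u)) \<in> acong K S R"
| plus_comm: "s \<in> aterms K S \<Longrightarrow> t \<in> aterms K S \<Longrightarrow> (Plus s t, Plus t s) \<in> acong K S R"
| plus_zero: "t \<in> aterms K S \<Longrightarrow> (Plus (Scal \<zero>\<^bsub>K\<^esub>) t, t) \<in> acong K S R"
| plus_neg: "t \<in> aterms K S \<Longrightarrow>
    (Plus (Times (Scal (\<ominus>\<^bsub>K\<^esub> \<one>\<^bsub>K\<^esub>)) t) t, Scal \<zero>\<^bsub>K\<^esub>) \<in> acong K S R"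
| times_assoc: "s \<in> aterms K S \<Longrightarrow> t \<in> aterms K S \<Longrightarrow> u \<in> aterms K S \<Longrightarrow>
    (Times (Times s t) u, Times s (Times t u)) \<in> acong K S R"
| times_comm: "s \<in> aterms K S \<Longrightarrow> t \<in> aterms K S \<Longrightarrow> (Times s t, Times t s) \<in> acong K S R"
| times_one: "t \<in> aterms K S \<Longrightarrow> (Times (Scal \<one>\<^bsub>K\<^esub>) t, t) \<in> acong K S R"
| distrib: "s \<in> aterms K S \<Longrightarrow> t \<in> aterms K S \<Longrightarrow> u \<in> aterms K S \<Longrightarrow>
    (Times (Plus s t) u, Plus (Times s u) (Times t u)) \<in> acong K S R"
| scal_plus: "c \<in> carrier K \<Longrightarrow> d \<in> carrier K \<Longrightarrow>
    (Scal (c \<oplus>\<^bsub>K\<^esub> d), Plus (Scal c) (Scal d)) \<in> acong K S R"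
| scal_times: "c \<in> carrier K \<Longrightarrow> d \<in> carrier K \<Longrightarrow>
    (Scal (c \<otimes>\<^bsub>K\<^esub> d), Times (Scal c) (Scal d)) \<in> acong K S R"

definition aclass ::
  "('k,'m) ring_scheme \<Rightarrow> 'x set \<Rightarrow> (('k,'x) aterm \<times> ('k,'x) aterm) set
     \<Rightarrow> ('k,'x) aterm \<Rightarrow> ('k,'x) aterm set"
where
  "aclass K S R t = acong K S R `` {t}"

definition arep :: "('k,'x) aterm set \<Rightarrow> ('k,'x) aterm" where
  "arep C = (SOME t. t \<in> C)"

definition presented ::
  "('k,'m) ring_scheme \<Rightarrow> 'x set \<Rightarrow> (('k,'x) aterm \<times> ('k,'x) aterm) set
     \<Rightarrow> ('k, ('k,'x) aterm set) module"
where
  "presented K S R = \<lparr>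
     carrier = aterms K S // acong K S R,
     monoid.mult = (\<lambda>C C'. aclass K S R (Times (arep C) (arep C'))),
     one = aclass K S R (Scal \<one>\<^bsub>K\<^esub>),
     zero = aclass K S R (Scal \<zero>\<^bsub>K\<^esub>),
     add = (\<lambda>C C'. aclass K S R (Plus (arep C) (arep C'))),
     smult = (\<lambda>c C. aclass K S R (Times (Scal c) (arep C)))\<rparr>"

primrec aeval :: "('k,'b,'n) module_scheme \<Rightarrow> ('x \<Rightarrow> 'b) \<Rightarrow> ('k,'x) aterm \<Rightarrow> 'b" where
  "aeval B \<phi> (Gen x) = \<phi> x"
| "aeval B \<phi> (Scal c) = c \<odot>\<^bsub>B\<^esub> \<one>\<^bsub>B\<^esub>"
| "aeval B \<phi> (Plus s t) = aeval B \<phi> s \<oplus>\<^bsub>B\<^esub> aeval B \<phi> t"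
| "aeval B \<phi> (Times s t) = aeval B \<phi> s \<otimes>\<^bsub>B\<^esub> aeval B \<phi> t"

text \<open>The algebra morphism from a presented algebra to \<open>B\<close> that sends each generator \<open>x\<close> to \<open>\<phi> x\<close>
  (meaningful when \<open>\<phi>\<close> respects the relations), and likewise the derivation that sends each
  generator \<open>x\<close> to the class of \<open>\<delta> x\<close>.\<close>

definition pres_lift ::
  "('k,'b,'n) module_scheme \<Rightarrow> ('x \<Rightarrow> 'b) \<Rightarrow> ('k,'x) aterm set \<Rightarrow> 'b"
where
  "pres_lift B \<phi> C = aeval B \<phi> (arep C)"

primrec aderiv ::
  "('k,'m) ring_scheme \<Rightarrow> ('x \<Rightarrow> ('k,'x) aterm) \<Rightarrow> ('k,'x) aterm \<Rightarrow> ('k,'x) aterm"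
where
  "aderiv K \<delta> (Gen x) = \<delta> x"
| "aderiv K \<delta> (Scal c) = Scal \<zero>\<^bsub>K\<^esub>"
| "aderiv K \<delta> (Plus s t) = Plus (aderiv K \<delta> s) (aderiv K \<delta> t)"
| "aderiv K \<delta> (Times s t) = Plus (Times (aderiv K \<delta> s) t) (Times s (aderiv K \<delta> t))"

definition pres_der ::
  "('k,'m) ring_scheme \<Rightarrow> 'x set \<Rightarrow> (('k,'x) aterm \<times> ('k,'x) aterm) set
     \<Rightarrow> ('x \<Rightarrow> ('k,'x) aterm) \<Rightarrow> ('k,'x) aterm set \<Rightarrow> ('k,'x) aterm set"
where
  "pres_der K S R \<delta> C = aclass K S R (aderiv K \<delta> (arep C))"


section \<open>Tensor products\<close>

inductive_set tensor_rel ::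
  "('k,'m) ring_scheme \<Rightarrow> ('k,'a,'n) module_scheme \<Rightarrow> ('k,'b,'p) module_scheme
     \<Rightarrow> (('k,'a \<times> 'b) aterm \<times> ('k,'a \<times> 'b) aterm) set"
  for K :: "('k,'m) ring_scheme"
    and A :: "('k,'a,'n) module_scheme" and B :: "('k,'b,'p) module_scheme"
where
  add_left: "a \<in> carrier A \<Longrightarrow> a' \<in> carrier A \<Longrightarrow> b \<in> carrier B \<Longrightarrow>
    (Gen (a \<oplus>\<^bsub>A\<^esub> a', b), Plus (Gen (a,b)) (Gen (a',b))) \<in> tensor_rel K A B"
| add_right: "a \<in> carrier A \<Longrightarrow> b \<in> carrier B \<Longrightarrow> b' \<in> carrier B \<Longrightarrow>
    (Gen (a, b \<oplus>\<^bsub>B\<^esub> b'), Plus (Gen (a,b)) (Gen (a,b'))) \<in> tensor_rel K A B"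
| smult_left: "c \<in> carrier K \<Longrightarrow> a \<in> carrier A \<Longrightarrow> b \<in> carrier B \<Longrightarrow>
    (Gen (c \<odot>\<^bsub>A\<^esub> a, b), Times (Scal c) (Gen (a,b))) \<in> tensor_rel K A B"
| smult_right: "c \<in> carrier K \<Longrightarrow> a \<in> carrier A \<Longrightarrow> b \<in> carrier B \<Longrightarrow>
    (Gen (a, c \<odot>\<^bsub>B\<^esub> b), Times (Scal c) (Gen (a,b))) \<in> tensor_rel K A B"
| one: "(Gen (\<one>\<^bsub>A\<^esub>, \<one>\<^bsub>B\<^esub>), Scal \<one>\<^bsub>K\<^esub>) \<in> tensor_rel K A B"
| mult: "a \<in> carrier A \<Longrightarrow> a' \<in> carrier A \<Longrightarrow> b \<in> carrier B \<Longrightarrow> b' \<in> carrier B \<Longrightarrow>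
    (Gen (a \<otimes>\<^bsub>A\<^esub> a', b \<otimes>\<^bsub>B\<^esub> b'), Times (Gen (a,b)) (Gen (a',b'))) \<in> tensor_rel K A B"

definition tensor ::
  "('k,'m) ring_scheme \<Rightarrow> ('k,'a,'n) module_scheme \<Rightarrow> ('k,'b,'p) module_scheme
     \<Rightarrow> ('k, ('k,'a \<times> 'b) aterm set) module"
where
  "tensor K A B = presented K (carrier A \<times> carrier B) (tensor_rel K A B)"

definition tens ::
  "('k,'m) ring_scheme \<Rightarrow> ('k,'a,'n) module_scheme \<Rightarrow> ('k,'b,'p) module_scheme
     \<Rightarrow> 'a \<Rightarrow> 'b \<Rightarrow> ('k,'a \<times> 'b) aterm set"
where
  "tens K A B a b = aclass K (carrier A \<times> carrier B) (tensor_rel K A B) (Gen (a,b))"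

text \<open>The morphism \<open>A \<otimes> B \<rightarrow> C\<close>, \<open>a \<otimes> b \<mapsto> f a \<cdot> g b\<close>, and the morphism
  \<open>f \<otimes> g : A \<otimes> B \<rightarrow> C \<otimes> C'\<close>.\<close>

definition tensor_lift ::
  "('k,'c,'n) module_scheme \<Rightarrow> ('a \<Rightarrow> 'c) \<Rightarrow> ('b \<Rightarrow> 'c) \<Rightarrow> ('k,'a \<times> 'b) aterm set \<Rightarrow> 'c"
where
  "tensor_lift C f g = pres_lift C (\<lambda>(a,b). f a \<otimes>\<^bsub>C\<^esub> g b)"

definition tensor_map ::
  "('k,'m) ring_scheme \<Rightarrow> ('k,'c,'n) module_scheme \<Rightarrow> ('k,'d,'p) module_scheme
     \<Rightarrow> ('a \<Rightarrow> 'c) \<Rightarrow> ('b \<Rightarrow> 'd) \<Rightarrow> ('k,'a \<times> 'b) aterm set \<Rightarrow> ('k,'c \<times> 'd) aterm set"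
where
  "tensor_map K C C' f g = pres_lift (tensor K C C') (\<lambda>(a,b). tens K C C' (f a) (g b))"

text \<open>The associativity isomorphism \<open>A \<otimes> (B \<otimes> C) \<rightarrow> (A \<otimes> B) \<otimes> C\<close>.\<close>

definition tensor_assoc ::
  "('k,'m) ring_scheme \<Rightarrow> ('k,'a,'n) module_scheme \<Rightarrow> ('k,'b,'p) module_scheme
     \<Rightarrow> ('k,'c,'q) module_scheme
     \<Rightarrow> ('k, 'a \<times> ('k,'b \<times> 'c) aterm set) aterm set
     \<Rightarrow> ('k, ('k,'a \<times> 'b) aterm set \<times> 'c) aterm set"
where
  "tensor_assoc K A B C =
     tensor_lift (tensor K (tensor K A B) C)
       (\<lambda>a. tens K (tensor K A B) C (tens K A B a \<one>\<^bsub>B\<^esub>) \<one>\<^bsub>C\<^esub>)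
       (tensor_map K (tensor K A B) C (\<lambda>b. tens K A B \<one>\<^bsub>A\<^esub> b) (\<lambda>c. c))"

text \<open>The derivation \<open>D \<otimes> 1 + 1 \<otimes> E\<close> of \<open>A \<otimes> B\<close>.\<close>

definition tensor_der ::
  "('k,'m) ring_scheme \<Rightarrow> ('k,'a,'n) module_scheme \<Rightarrow> ('k,'b,'p) module_scheme
     \<Rightarrow> ('a \<Rightarrow> 'a) \<Rightarrow> ('b \<Rightarrow> 'b) \<Rightarrow> ('k,'a \<times> 'b) aterm set \<Rightarrow> ('k,'a \<times> 'b) aterm set"
where
  "tensor_der K A B D E = pres_der K (carrier A \<times> carrier B) (tensor_rel K A B)
     (\<lambda>(a,b). Plus (Gen (D a, b)) (Gen (a, E b)))"


section \<open>Poisson algebras\<close>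

locale poisson_algebra = algebra K A
  for K :: "('k,'m) ring_scheme" (structure) and A :: "('k,'a,'n) module_scheme" (structure) +
  fixes P :: "'a \<Rightarrow> 'a \<Rightarrow> 'a"
  assumes bracket_closed: "a \<in> carrier A \<Longrightarrow> b \<in> carrier A \<Longrightarrow> P a b \<in> carrier A"
    and bracket_add_left: "a \<in> carrier A \<Longrightarrow> a' \<in> carrier A \<Longrightarrow> b \<in> carrier A \<Longrightarrow>
      P (a \<oplus>\<^bsub>A\<^esub> a') b = P a b \<oplus>\<^bsub>A\<^esub> P a' b"
    and bracket_add_right: "a \<in> carrier A \<Longrightarrow> b \<in> carrier A \<Longrightarrow> b' \<in> carrier A \<Longrightarrow>
      P a (b \<oplus>\<^bsub>A\<^esub> b') = P a b \<oplus>\<^bsub>A\<^esub> P a b'"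
    and bracket_smult_left: "r \<in> carrier K \<Longrightarrow> a \<in> carrier A \<Longrightarrow> b \<in> carrier A \<Longrightarrow>
      P (r \<odot>\<^bsub>A\<^esub> a) b = r \<odot>\<^bsub>A\<^esub> P a b"
    and bracket_smult_right: "r \<in> carrier K \<Longrightarrow> a \<in> carrier A \<Longrightarrow> b \<in> carrier A \<Longrightarrow>
      P a (r \<odot>\<^bsub>A\<^esub> b) = r \<odot>\<^bsub>A\<^esub> P a b"
    and bracket_alt: "a \<in> carrier A \<Longrightarrow> P a a = \<zero>\<^bsub>A\<^esub>"
    and bracket_jacobi: "a \<in> carrier A \<Longrightarrow> b \<in> carrier A \<Longrightarrow> c \<in> carrier A \<Longrightarrow>
      P a (P b c) \<oplus>\<^bsub>A\<^esub> P b (P c a) \<oplus>\<^bsub>A\<^esub> P c (P a b) = \<zero>\<^bsub>A\<^esub>"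
    and bracket_leibniz: "a \<in> carrier A \<Longrightarrow> b \<in> carrier A \<Longrightarrow> c \<in> carrier A \<Longrightarrow>
      P a (b \<otimes>\<^bsub>A\<^esub> c) = P a b \<otimes>\<^bsub>A\<^esub> c \<oplus>\<^bsub>A\<^esub> b \<otimes>\<^bsub>A\<^esub> P a c"

definition poisson_automorphism ::
  "('k,'m) ring_scheme \<Rightarrow> ('k,'a,'n) module_scheme \<Rightarrow> ('a \<Rightarrow> 'a \<Rightarrow> 'a) \<Rightarrow> ('a \<Rightarrow> 'a) \<Rightarrow> bool"
where
  "poisson_automorphism K A P f \<longleftrightarrow> alg_hom K A A f \<and> bij_betw f (carrier A) (carrier A) \<and>
     (\<forall>a\<in>carrier A. \<forall>b\<in>carrier A. f (P a b) = P (f a) (f b))"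


section \<open>Poisson vertex algebras\<close>

text \<open>\<open>V[\<lambda>]\<close> is \<open>UP V\<close>; so \<open>L a b n\<close> is the coefficient of \<open>\<lambda>^n\<close> in \<open>{a_\<lambda> b}\<close>. The operator
  \<open>\<lambda> + \<partial>\<close> acts on \<open>V[\<lambda>]\<close> by \<open>lam_plus_del\<close>, with \<open>\<partial>\<close> acting on coefficients.\<close>

definition lam :: "('v,'n) ring_scheme \<Rightarrow> nat \<Rightarrow> 'v" where
  "lam V = monom (UP V) \<one>\<^bsub>V\<^esub> 1"

definition lam_plus_del ::
  "('v,'n) ring_scheme \<Rightarrow> ('v \<Rightarrow> 'v) \<Rightarrow> (nat \<Rightarrow> 'v) \<Rightarrow> nat \<Rightarrow> 'v"
where
  "lam_plus_del V D p = lam V \<otimes>\<^bsub>UP V\<^esub> p \<oplus>\<^bsub>UP V\<^esub> (\<lambda>n. D (p n))"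

text \<open>For \<open>p = {a_\<lambda> c}\<close> this is \<open>{a_{\<lambda>+\<partial>} c}_\<rightarrow> b\<close>, the sum of the \<open>p n \<cdot> (\<lambda> + \<partial>)^n b\<close>.\<close>

definition shift_arrow ::
  "('v,'n) ring_scheme \<Rightarrow> ('v \<Rightarrow> 'v) \<Rightarrow> (nat \<Rightarrow> 'v) \<Rightarrow> 'v \<Rightarrow> nat \<Rightarrow> 'v"
where
  "shift_arrow V D p b =
     (\<Oplus>\<^bsub>UP V\<^esub>n\<in>{..deg V p}. p n \<odot>\<^bsub>UP V\<^esub> (lam_plus_del V D ^^ n) (monom (UP V) b 0))"

text \<open>For \<open>p = {b_\<lambda> a}\<close> this is \<open>{b_{-\<lambda>-\<partial>} a}\<close>, the sum of the \<open>(-\<lambda> - \<partial>)^n (p n)\<close>.\<close>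

definition neg_shift :: "('v,'n) ring_scheme \<Rightarrow> ('v \<Rightarrow> 'v) \<Rightarrow> (nat \<Rightarrow> 'v) \<Rightarrow> nat \<Rightarrow> 'v" where
  "neg_shift V D p =
     (\<Oplus>\<^bsub>UP V\<^esub>n\<in>{..deg V p}. ((\<lambda>q. \<ominus>\<^bsub>UP V\<^esub> lam_plus_del V D q) ^^ n) (monom (UP V) (p n) 0))"

text \<open>The Jacobi identity lives in \<open>V[\<lambda>,\<mu>]\<close>; it is stated as the equality of the coefficients of
  all \<open>\<lambda>^l \<mu>^m\<close>, where \<open>{{a_\<lambda> b}_{\<lambda>+\<mu>} c}\<close> is the sum of the
  \<open>\<lambda>^n (\<lambda> + \<mu>)^j L (L a b n) c j\<close>.\<close>

locale poisson_vertex_algebra = algebra K V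
  for K :: "('k,'m) ring_scheme" (structure) and V :: "('k,'v,'n) module_scheme" (structure) +
  fixes D :: "'v \<Rightarrow> 'v" and L :: "'v \<Rightarrow> 'v \<Rightarrow> nat \<Rightarrow> 'v"
  assumes der: "derivation K V D"
    and lbr_closed: "a \<in> carrier V \<Longrightarrow> b \<in> carrier V \<Longrightarrow> L a b \<in> carrier (UP V)"
    and lbr_add_left: "a \<in> carrier V \<Longrightarrow> a' \<in> carrier V \<Longrightarrow> b \<in> carrier V \<Longrightarrow>
      L (a \<oplus>\<^bsub>V\<^esub> a') b = L a b \<oplus>\<^bsub>UP V\<^esub> L a' b"
    and lbr_add_right: "a \<in> carrier V \<Longrightarrow> b \<in> carrier V \<Longrightarrow> b' \<in> carrier V \<Longrightarrow>
      L a (b \<oplus>\<^bsub>V\<^esub> b') = L a b \<oplus>\<^bsub>UP V\<^esub> L a b'"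
    and lbr_smult_left: "r \<in> carrier K \<Longrightarrow> a \<in> carrier V \<Longrightarrow> b \<in> carrier V \<Longrightarrow>
      L (r \<odot>\<^bsub>V\<^esub> a) b = (\<lambda>n. r \<odot>\<^bsub>V\<^esub> L a b n)"
    and lbr_smult_right: "r \<in> carrier K \<Longrightarrow> a \<in> carrier V \<Longrightarrow> b \<in> carrier V \<Longrightarrow>
      L a (r \<odot>\<^bsub>V\<^esub> b) = (\<lambda>n. r \<odot>\<^bsub>V\<^esub> L a b n)"
    and sesqui_left: "a \<in> carrier V \<Longrightarrow> b \<in> carrier V \<Longrightarrow>
      L (D a) b = \<ominus>\<^bsub>UP V\<^esub> (lam V \<otimes>\<^bsub>UP V\<^esub> L a b)"
    and sesqui_right: "a \<in> carrier V \<Longrightarrow> b \<in> carrier V \<Longrightarrow> L a (D b) = lam_plus_del V D (L a b)"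
    and leibniz_right: "a \<in> carrier V \<Longrightarrow> b \<in> carrier V \<Longrightarrow> c \<in> carrier V \<Longrightarrow>
      L a (b \<otimes>\<^bsub>V\<^esub> c) = c \<odot>\<^bsub>UP V\<^esub> L a b \<oplus>\<^bsub>UP V\<^esub> b \<odot>\<^bsub>UP V\<^esub> L a c"
    and leibniz_left: "a \<in> carrier V \<Longrightarrow> b \<in> carrier V \<Longrightarrow> c \<in> carrier V \<Longrightarrow>
      L (a \<otimes>\<^bsub>V\<^esub> b) c = shift_arrow V D (L a c) b \<oplus>\<^bsub>UP V\<^esub> shift_arrow V D (L b c) a"
    and skew: "a \<in> carrier V \<Longrightarrow> b \<in> carrier V \<Longrightarrow> L a b = \<ominus>\<^bsub>UP V\<^esub> neg_shift V D (L b a)"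
    and jacobi: "a \<in> carrier V \<Longrightarrow> b \<in> carrier V \<Longrightarrow> c \<in> carrier V \<Longrightarrow>
      L a (L b c m) l \<ominus>\<^bsub>V\<^esub> L b (L a c l) m =
        (\<Oplus>\<^bsub>V\<^esub>n\<in>{..l}. [((l - n + m) choose m)] \<cdot>\<^bsub>V\<^esub> L (L a b n) c (l - n + m))"

definition poisson_vertex_subalgebra ::
  "('k,'m) ring_scheme \<Rightarrow> ('k,'v,'n) module_scheme \<Rightarrow> ('v \<Rightarrow> 'v)
     \<Rightarrow> ('v \<Rightarrow> 'v \<Rightarrow> nat \<Rightarrow> 'v) \<Rightarrow> 'v set \<Rightarrow> bool"
where
  "poisson_vertex_subalgebra K V D L W \<longleftrightarrow>
     poisson_vertex_algebra K V D L \<and> subalg K V W \<and>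
     (\<forall>a\<in>W. D a \<in> W) \<and> (\<forall>a\<in>W. \<forall>b\<in>W. \<forall>n. L a b n \<in> W)"

definition pva_hom ::
  "('k,'m) ring_scheme
     \<Rightarrow> ('k,'v,'n) module_scheme \<Rightarrow> ('v \<Rightarrow> 'v) \<Rightarrow> ('v \<Rightarrow> 'v \<Rightarrow> nat \<Rightarrow> 'v)
     \<Rightarrow> ('k,'w,'p) module_scheme \<Rightarrow> ('w \<Rightarrow> 'w) \<Rightarrow> ('w \<Rightarrow> 'w \<Rightarrow> nat \<Rightarrow> 'w)
     \<Rightarrow> ('v \<Rightarrow> 'w) \<Rightarrow> bool"
where
  "pva_hom K V D L W E M f \<longleftrightarrow>
     poisson_vertex_algebra K V D L \<and> poisson_vertex_algebra K W E M \<and>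
     alg_hom K V W f \<and>
     (\<forall>a\<in>carrier V. f (D a) = E (f a)) \<and>
     (\<forall>a\<in>carrier V. \<forall>b\<in>carrier V. M (f a) (f b) = (\<lambda>n. f (L a b n)))"


section \<open>Jet algebras\<close>

text \<open>\<open>Gen (k, a)\<close> is the symbol \<open>\<partial>^k(a)\<close>. The relation \<open>unit\<close> makes \<open>a \<mapsto> \<partial>^0(a)\<close> unital.\<close>

inductive_set jet_rel ::
  "('k,'m) ring_scheme \<Rightarrow> ('k,'a,'n) module_scheme
     \<Rightarrow> (('k, nat \<times> 'a) aterm \<times> ('k, nat \<times> 'a) aterm) set"
  for K :: "('k,'m) ring_scheme" and A :: "('k,'a,'n) module_scheme"
where
  add: "a \<in> carrier A \<Longrightarrow> b \<in> carrier A \<Longrightarrow>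
    (Gen (k, a \<oplus>\<^bsub>A\<^esub> b), Plus (Gen (k,a)) (Gen (k,b))) \<in> jet_rel K A"
| smult: "c \<in> carrier K \<Longrightarrow> a \<in> carrier A \<Longrightarrow>
    (Gen (k, c \<odot>\<^bsub>A\<^esub> a), Times (Scal c) (Gen (k,a))) \<in> jet_rel K A"
| unit: "(Gen (0, \<one>\<^bsub>A\<^esub>), Scal \<one>\<^bsub>K\<^esub>) \<in> jet_rel K A"
| leibniz: "a \<in> carrier A \<Longrightarrow> b \<in> carrier A \<Longrightarrow>
    (Gen (k, a \<otimes>\<^bsub>A\<^esub> b),
     foldr Plus
       (map (\<lambda>j. Times (Scal ([(k choose j)] \<cdot>\<^bsub>K\<^esub> \<one>\<^bsub>K\<^esub>)) (Times (Gen (j,a)) (Gen (k - j, b)))) [0..<Suc k])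
       (Scal \<zero>\<^bsub>K\<^esub>)) \<in> jet_rel K A"

definition jet ::
  "('k,'m) ring_scheme \<Rightarrow> ('k,'a,'n) module_scheme \<Rightarrow> ('k, ('k, nat \<times> 'a) aterm set) module"
where
  "jet K A = presented K (UNIV \<times> carrier A) (jet_rel K A)"

definition jet_gen ::
  "('k,'m) ring_scheme \<Rightarrow> ('k,'a,'n) module_scheme \<Rightarrow> nat \<Rightarrow> 'a \<Rightarrow> ('k, nat \<times> 'a) aterm set"
where
  "jet_gen K A k a = aclass K (UNIV \<times> carrier A) (jet_rel K A) (Gen (k,a))"

definition jet_der ::
  "('k,'m) ring_scheme \<Rightarrow> ('k,'a,'n) module_scheme
     \<Rightarrow> ('k, nat \<times> 'a) aterm set \<Rightarrow> ('k, nat \<times> 'a) aterm set"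
where
  "jet_der K A = pres_der K (UNIV \<times> carrier A) (jet_rel K A) (\<lambda>(k,a). Gen (Suc k, a))"

text \<open>The morphism of differential algebras from a jet algebra to \<open>(C, D)\<close> that corresponds to an
  algebra morphism \<open>\<phi>\<close> into \<open>C\<close>, and the jet of an algebra morphism \<open>f\<close> into \<open>B\<close>.\<close>

definition jet_lift ::
  "('k,'c,'n) module_scheme \<Rightarrow> ('c \<Rightarrow> 'c) \<Rightarrow> ('a \<Rightarrow> 'c) \<Rightarrow> ('k, nat \<times> 'a) aterm set \<Rightarrow> 'c"
where
  "jet_lift C D \<phi> = pres_lift C (\<lambda>(k,a). (D ^^ k) (\<phi> a))"

definition jet_map ::
  "('k,'m) ring_scheme \<Rightarrow> ('k,'b,'n) module_scheme \<Rightarrow> ('a \<Rightarrow> 'b)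
     \<Rightarrow> ('k, nat \<times> 'a) aterm set \<Rightarrow> ('k, nat \<times> 'b) aterm set"
where
  "jet_map K B f = jet_lift (jet K B) (jet_der K B) (\<lambda>a. jet_gen K B 0 (f a))"

text \<open>The \<open>\<lambda>\<close>-bracket of the jet algebra of a Poisson algebra. Brackets are taken to be
  extensional functions on the carrier, so that uniqueness is literal.\<close>

definition jet_bracket ::
  "('k,'m) ring_scheme \<Rightarrow> ('k,'a,'n) module_scheme \<Rightarrow> ('a \<Rightarrow> 'a \<Rightarrow> 'a)
     \<Rightarrow> ('k, nat \<times> 'a) aterm set \<Rightarrow> ('k, nat \<times> 'a) aterm set \<Rightarrow> nat \<Rightarrow> ('k, nat \<times> 'a) aterm set"
where
  "jet_bracket K A P = (THE L.
     L \<in> carrier (jet K A) \<rightarrow>\<^sub>E (carrier (jet K A) \<rightarrow>\<^sub>E carrier (UP (jet K A))) \<and>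
     poisson_vertex_algebra K (jet K A) (jet_der K A) L \<and>
     (\<forall>a\<in>carrier A. \<forall>b\<in>carrier A.
        L (jet_gen K A 0 a) (jet_gen K A 0 b) = monom (UP (jet K A)) (jet_gen K A 0 (P a b)) 0))"


section \<open>Affine algebraic groups and their actions\<close>

text \<open>The \<open>K\<close>-points of \<open>Spec H\<close>.\<close>

definition points :: "('k,'m) ring_scheme \<Rightarrow> ('k,'h,'n) module_scheme \<Rightarrow> ('h \<Rightarrow> 'k) set" where
  "points K H = {g. g \<in> ring_hom H K \<and>
     (\<forall>c\<in>carrier K. \<forall>h\<in>carrier H. g (c \<odot>\<^bsub>H\<^esub> h) = c \<otimes>\<^bsub>K\<^esub> g h)}"

text \<open>An affine algebraic group is an affine variety with a group structure. It is given by its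
  coordinate ring \<open>H\<close>, a reduced commutative Hopf algebra of finite type (by Cartier's theorem,
  reducedness is automatic over a field of characteristic 0).\<close>

locale affine_algebraic_group = algebra K H
  for K :: "('k,'m) ring_scheme" (structure) and H :: "('k,'h,'n) module_scheme" (structure) +
  fixes \<Delta> :: "'h \<Rightarrow> ('k, 'h \<times> 'h) aterm set" and \<epsilon> :: "'h \<Rightarrow> 'k" and \<sigma> :: "'h \<Rightarrow> 'h"
  assumes fin_type: "finite_type K H"
    and reduced: "h \<in> carrier H \<Longrightarrow> h [^]\<^bsub>H\<^esub> (n::nat) = \<zero>\<^bsub>H\<^esub> \<Longrightarrow> h = \<zero>\<^bsub>H\<^esub>"
    and comult: "alg_hom K H (tensor K H H) \<Delta>"
    and counit: "\<epsilon> \<in> points K H"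
    and antipode: "alg_hom K H H \<sigma>"
    and comult_assoc: "h \<in> carrier H \<Longrightarrow>
      tensor_map K (tensor K H H) H \<Delta> (\<lambda>x. x) (\<Delta> h) =
      tensor_assoc K H H H (tensor_map K H (tensor K H H) (\<lambda>x. x) \<Delta> (\<Delta> h))"
    and counit_left: "h \<in> carrier H \<Longrightarrow>
      tensor_lift H (\<lambda>x. \<epsilon> x \<odot>\<^bsub>H\<^esub> \<one>\<^bsub>H\<^esub>) (\<lambda>x. x) (\<Delta> h) = h"
    and counit_right: "h \<in> carrier H \<Longrightarrow>
      tensor_lift H (\<lambda>x. x) (\<lambda>x. \<epsilon> x \<odot>\<^bsub>H\<^esub> \<one>\<^bsub>H\<^esub>) (\<Delta> h) = h"
    and antipode_left: "h \<in> carrier H \<Longrightarrow>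
      tensor_lift H \<sigma> (\<lambda>x. x) (\<Delta> h) = \<epsilon> h \<odot>\<^bsub>H\<^esub> \<one>\<^bsub>H\<^esub>"
    and antipode_right: "h \<in> carrier H \<Longrightarrow>
      tensor_lift H (\<lambda>x. x) \<sigma> (\<Delta> h) = \<epsilon> h \<odot>\<^bsub>H\<^esub> \<one>\<^bsub>H\<^esub>"

text \<open>The coaction of an action on \<open>Spec A\<close>.\<close>

definition coaction ::
  "('k,'m) ring_scheme \<Rightarrow> ('k,'h,'n) module_scheme \<Rightarrow> ('h \<Rightarrow> ('k, 'h \<times> 'h) aterm set) \<Rightarrow> ('h \<Rightarrow> 'k)
     \<Rightarrow> ('k,'a,'p) module_scheme \<Rightarrow> ('a \<Rightarrow> ('k, 'h \<times> 'a) aterm set) \<Rightarrow> bool"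
where
  "coaction K H \<Delta> \<epsilon> A \<rho> \<longleftrightarrow> alg_hom K A (tensor K H A) \<rho> \<and>
     (\<forall>a\<in>carrier A.
        tensor_map K (tensor K H H) A \<Delta> (\<lambda>x. x) (\<rho> a) =
        tensor_assoc K H H A (tensor_map K H (tensor K H A) (\<lambda>x. x) \<rho> (\<rho> a))) \<and>
     (\<forall>a\<in>carrier A. tensor_lift A (\<lambda>h. \<epsilon> h \<odot>\<^bsub>A\<^esub> \<one>\<^bsub>A\<^esub>) (\<lambda>x. x) (\<rho> a) = a)"

text \<open>The comorphism \<open>(g \<otimes> id) \<circ> \<rho>\<close> of the action of a point \<open>g\<close> on \<open>Spec A\<close>.\<close>

definition point_action ::
  "('k,'a,'p) module_scheme \<Rightarrow> ('a \<Rightarrow> ('k, 'h \<times> 'a) aterm set) \<Rightarrow> ('h \<Rightarrow> 'k) \<Rightarrow> 'a \<Rightarrow> 'a"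
where
  "point_action A \<rho> g a = tensor_lift A (\<lambda>h. g h \<odot>\<^bsub>A\<^esub> \<one>\<^bsub>A\<^esub>) (\<lambda>x. x) (\<rho> a)"

definition poisson_action ::
  "('k,'m) ring_scheme \<Rightarrow> ('k,'h,'n) module_scheme \<Rightarrow> ('h \<Rightarrow> ('k, 'h \<times> 'h) aterm set) \<Rightarrow> ('h \<Rightarrow> 'k)
     \<Rightarrow> ('k,'a,'p) module_scheme \<Rightarrow> ('a \<Rightarrow> 'a \<Rightarrow> 'a) \<Rightarrow> ('a \<Rightarrow> ('k, 'h \<times> 'a) aterm set) \<Rightarrow> bool"
where
  "poisson_action K H \<Delta> \<epsilon> A P \<rho> \<longleftrightarrow> coaction K H \<Delta> \<epsilon> A \<rho> \<and>
     (\<forall>g\<in>points K H. poisson_automorphism K A P (point_action A \<rho> g))"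

definition invariants ::
  "('k,'m) ring_scheme \<Rightarrow> ('k,'h,'n) module_scheme \<Rightarrow> ('k,'a,'p) module_scheme
     \<Rightarrow> ('a \<Rightarrow> ('k, 'h \<times> 'a) aterm set) \<Rightarrow> 'a set"
where
  "invariants K H A \<rho> = {f \<in> carrier A. \<rho> f = tens K H A \<one>\<^bsub>H\<^esub> f}"

definition invariant_algebra ::
  "('k,'m) ring_scheme \<Rightarrow> ('k,'h,'n) module_scheme \<Rightarrow> ('k,'a,'p) module_scheme
     \<Rightarrow> ('a \<Rightarrow> ('k, 'h \<times> 'a) aterm set) \<Rightarrow> ('k,'a,'p) module_scheme"
where
  "invariant_algebra K H A \<rho> = A\<lparr>carrier := invariants K H A \<rho>\<rparr>"

text \<open>The canonical identification of the jet algebra of \<open>A \<otimes> B\<close> with the tensor product of the jet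
  algebras of \<open>A\<close> and \<open>B\<close>: the morphism of differential algebras that extends
  \<open>a \<otimes> b \<mapsto> a \<otimes> b\<close>.\<close>

definition jet_tensor ::
  "('k,'m) ring_scheme \<Rightarrow> ('k,'a,'n) module_scheme \<Rightarrow> ('k,'b,'p) module_scheme
     \<Rightarrow> ('k, nat \<times> ('k,'a \<times> 'b) aterm set) aterm set
     \<Rightarrow> ('k, ('k, nat \<times> 'a) aterm set \<times> ('k, nat \<times> 'b) aterm set) aterm set"
where
  "jet_tensor K A B =
     jet_lift (tensor K (jet K A) (jet K B))
       (tensor_der K (jet K A) (jet K B) (jet_der K A) (jet_der K B))
       (tensor_map K (jet K A) (jet K B) (jet_gen K A 0) (jet_gen K B 0))"

definition jet_coaction ::
  "('k,'m) ring_scheme \<Rightarrow> ('k,'h,'n) module_scheme \<Rightarrow> ('k,'a,'p) module_scheme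
     \<Rightarrow> ('a \<Rightarrow> ('k, 'h \<times> 'a) aterm set) \<Rightarrow> ('k, nat \<times> 'a) aterm set
     \<Rightarrow> ('k, ('k, nat \<times> 'h) aterm set \<times> ('k, nat \<times> 'a) aterm set) aterm set"
where
  "jet_coaction K H A \<rho> = jet_tensor K H A \<circ> jet_map K (tensor K H A) \<rho>"

definition jet_invariants ::
  "('k,'m) ring_scheme \<Rightarrow> ('k,'h,'n) module_scheme \<Rightarrow> ('k,'a,'p) module_scheme
     \<Rightarrow> ('a \<Rightarrow> ('k, 'h \<times> 'a) aterm set) \<Rightarrow> ('k, nat \<times> 'a) aterm set set"
where
  "jet_invariants K H A \<rho> = invariants K (jet K H) (jet K A) (jet_coaction K H A \<rho>)"

end

theory Submission
  imports Defs
begin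

text \<open>
  A \<open>\<lambda>\<close>-bracket on the jet algebra of \<open>A\<close> is a biderivation with values in the distributions
  supported on the diagonal, that is, in \<open>V[\<lambda>]\<close> with two commuting module structures over
  \<open>V\<close>, on which the derivation acts as \<open>-\<lambda>\<close> and as \<open>\<lambda> + \<partial>\<close>. Derivations into modules
  extend from \<open>A\<close> to its jet algebra because they are algebra morphisms into a square-zero
  extension; extending twice gives the bracket, and skew-symmetry, the Jacobi identity and
  functoriality are identities between biderivations, which only have to be checked on \<open>A\<close>.

  Since points separate the elements of a reduced algebra of finite type over an algebraically
  closed field, the coaction \<open>\<rho>\<close> intertwines the bracket of \<open>A\<close> with its \<open>k[G]\<close>-bilinear
  extension to \<open>k[G] \<otimes> A\<close>. Identifying the jet algebra of \<open>k[G] \<otimes> A\<close> with the tensor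
  product of the jet algebras, the jet invariants become the equalizer of the jets of \<open>\<rho>\<close> and of
  \<open>a \<mapsto> 1 \<otimes> a\<close>. Both preserve \<open>\<lambda>\<close>-brackets, so their equalizer is closed under them.
\<close>

section \<open>Presented algebras\<close>

text \<open>Comparing brackets asks less than a Poisson vertex algebra: on k[G] \<otimes> A and on
  its jet algebra only biderivations are built, and that suffices to transport brackets along both
  jets. The main obstacle is the Jacobi identity. In {{a_\<lambda> b}_{\<lambda>+\<mu>} c} the
  Leibniz rule for a product in the middle variable scatters derivatives over the other factor, so
  the identity is treated coefficient by coefficient in \<lambda>^l \<mu>^m, as an identity between
  integer combinations that reduces to binomials. It is propagated in the last and the middle
  variable only; the first is reached by skew-symmetry, since -\<lambda>-\<partial> becomes \<mu>
  inside the outer bracket. The second obstacle is that the action is Poisson only on points, while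
  jets need an identity over k[G]. The Nullstellensatz is obtained by adjoining generators one at a
  time inside a domain, keeping the property that every nonzero element is nonzero at some point. In
  k[G] \<otimes> A no basis is chosen: a shortest sum of pure tensors does the same job.\<close>

locale presentation = cring K
  for K :: "('k,'m) ring_scheme" (structure) and S :: "'x set"
    and R :: "(('k,'x) aterm \<times> ('k,'x) aterm) set"
begin

abbreviation "T \<equiv> aterms K S"
abbreviation "C \<equiv> acong K S R"
abbreviation "cl \<equiv> aclass K S R"
abbreviation "Q \<equiv> presented K S R"

lemmas aterms_simps [simp] = aterms.Gen aterms.Scal aterms.Plus aterms.Times

lemma acong_aterms: "(s,t) \<in> C \<Longrightarrow> s \<in> T \<and> t \<in> T"
  by (induction rule: acong.induct) (auto intro!: aterms.intros)

lemma equiv_acong: "equiv T C"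
  by (rule equivI)
    (auto simp: refl_on_def sym_def trans_def dest: acong_aterms intro: acong.refl acong.sym acong.trans)

lemma aclass_eq_iff: "s \<in> T \<Longrightarrow> t \<in> T \<Longrightarrow> cl s = cl t \<longleftrightarrow> (s,t) \<in> C"
  unfolding aclass_def by (rule eq_equiv_class_iff[OF equiv_acong])

lemma aclass_eqI: "(s,t) \<in> C \<Longrightarrow> cl s = cl t"
  using aclass_eq_iff acong_aterms by blast

text \<open>Operations on \<open>presented\<close> pass through a representative picked by
  \<open>SOME\<close>. The pick is congruent to the term it came from, so every operation can be
  computed on whatever term is at hand.\<close>

lemma arep_aclass: "t \<in> T \<Longrightarrow> (t, arep (cl t)) \<in> C"
proof -
  assume "t \<in> T"
  then have "t \<in> cl t" by (auto simp: aclass_def intro: acong.refl)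
  then have "arep (cl t) \<in> cl t" unfolding arep_def by (rule someI)
  then show ?thesis by (simp add: aclass_def)
qed

lemma carrier_presented: "carrier Q = cl ` T"
  by (auto simp: presented_def quotient_def aclass_def)

lemma aclass_closed [simp]: "t \<in> T \<Longrightarrow> cl t \<in> carrier Q"
  by (simp add: carrier_presented)

lemma presented_cases [consumes 1, case_names aclass]:
  assumes "x \<in> carrier Q" obtains t where "t \<in> T" "x = cl t"
  using assms by (auto simp: carrier_presented)

lemma aclass_Times: "s \<in> T \<Longrightarrow> t \<in> T \<Longrightarrow> cl s \<otimes>\<^bsub>Q\<^esub> cl t = cl (Times s t)"
  by (simp add: presented_def)
    (metis aclass_eqI acong.sym acong.times_cong arep_aclass)

lemma aclass_Plus: "s \<in> T \<Longrightarrow> t \<in> T \<Longrightarrow> cl s \<oplus>\<^bsub>Q\<^esub> cl t = cl (Plus s t)"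
  by (simp add: presented_def)
    (metis aclass_eqI acong.sym acong.plus_cong arep_aclass)

lemma aclass_smult: "c \<in> carrier K \<Longrightarrow> t \<in> T \<Longrightarrow> c \<odot>\<^bsub>Q\<^esub> cl t = cl (Times (Scal c) t)"
  by (simp add: presented_def)
    (metis aclass_eqI acong.sym acong.times_cong arep_aclass acong.refl aterms.Scal)

lemma presented_one: "\<one>\<^bsub>Q\<^esub> = cl (Scal \<one>)" and presented_zero: "\<zero>\<^bsub>Q\<^esub> = cl (Scal \<zero>)"
  by (simp_all add: presented_def)

lemmas aclass_simps = aclass_Times aclass_Plus aclass_smult presented_one presented_zero

lemma presented_cring: "cring Q"
proof (rule cringI)
  show "abelian_group Q"
  proof (rule abelian_groupI)
    fix x assume "x \<in> carrier Q"
    then obtain t where t: "t \<in> T" "x = cl t" by (cases rule: presented_cases)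
    then show "\<exists>y\<in>carrier Q. y \<oplus>\<^bsub>Q\<^esub> x = \<zero>\<^bsub>Q\<^esub>"
      using aclass_eqI[OF acong.plus_neg[of t]]
      by (intro bexI[of _ "cl (Times (Scal (\<ominus> \<one>)) t)"])
        (simp_all add: aclass_simps aterms.intros)
  qed ((elim presented_cases)?; simp add: aclass_simps aclass_eq_iff
      acong.plus_assoc acong.plus_comm acong.plus_zero)+
  show "comm_monoid Q"
    by (rule comm_monoidI; (elim presented_cases)?; simp
      add: aclass_simps aclass_eq_iff acong.times_assoc acong.times_comm acong.times_one)
qed (elim presented_cases; simp add: aclass_simps aclass_eq_iff acong.distrib)

lemma presented_algebra: "algebra K Q"
proof (rule algebraI)
  show "cring Q" by (rule presented_cring)
  show "(a \<oplus> b) \<odot>\<^bsub>Q\<^esub> x = a \<odot>\<^bsub>Q\<^esub> x \<oplus>\<^bsub>Q\<^esub> b \<odot>\<^bsub>Q\<^esub> x"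
    if "a \<in> carrier K" "b \<in> carrier K" "x \<in> carrier Q" for a b x
  proof -
    obtain t where t: "t \<in> T" "x = cl t" using \<open>x \<in> carrier Q\<close> by (cases rule: presented_cases)
    have "(Times (Scal (a \<oplus> b)) t, Plus (Times (Scal a) t) (Times (Scal b) t)) \<in> C"
      using that t by (meson acong.scal_plus acong.times_cong acong.trans acong.refl acong.distrib aterms.Scal)
    from aclass_eqI[OF this] show ?thesis using that t by (simp add: aclass_simps aterms.intros)
  qed
  show "a \<odot>\<^bsub>Q\<^esub> (x \<oplus>\<^bsub>Q\<^esub> y) = a \<odot>\<^bsub>Q\<^esub> x \<oplus>\<^bsub>Q\<^esub> a \<odot>\<^bsub>Q\<^esub> y"
    if "a \<in> carrier K" "x \<in> carrier Q" "y \<in> carrier Q" for a x y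
  proof -
    interpret Q: cring Q by (rule presented_cring)
    from that have "cl (Scal a) \<otimes>\<^bsub>Q\<^esub> (x \<oplus>\<^bsub>Q\<^esub> y) = cl (Scal a) \<otimes>\<^bsub>Q\<^esub> x \<oplus>\<^bsub>Q\<^esub> cl (Scal a) \<otimes>\<^bsub>Q\<^esub> y"
      by (intro Q.r_distr) (auto intro: aterms.intros)
    with that show ?thesis by (auto elim!: presented_cases simp: aclass_simps aterms.intros)
  qed
  show "(a \<otimes> b) \<odot>\<^bsub>Q\<^esub> x = a \<odot>\<^bsub>Q\<^esub> (b \<odot>\<^bsub>Q\<^esub> x)"
    if "a \<in> carrier K" "b \<in> carrier K" "x \<in> carrier Q" for a b x
  proof -
    obtain t where t: "t \<in> T" "x = cl t" using \<open>x \<in> carrier Q\<close> by (cases rule: presented_cases)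
    have "(Times (Scal (a \<otimes> b)) t, Times (Scal a) (Times (Scal b) t)) \<in> C"
      using that t by (meson acong.scal_times acong.times_cong acong.trans acong.refl acong.times_assoc aterms.Scal)
    from aclass_eqI[OF this] show ?thesis using that t by (simp add: aclass_simps aterms.intros)
  qed
qed ((elim presented_cases)?; simp add: aclass_simps aclass_eq_iff acong.times_one acong.times_assoc is_cring)+

lemma aclass_Scal: "c \<in> carrier K \<Longrightarrow> cl (Scal c) = c \<odot>\<^bsub>Q\<^esub> \<one>\<^bsub>Q\<^esub>"
  by (simp add: aclass_simps aterms.intros)
    (intro aclass_eqI, meson acong.intros aterms.intros one_closed)

lemma presented_induct [consumes 1, case_names Gen smult_one add mult]:
  assumes x: "x \<in> carrier Q"
    and g: "\<And>x. x \<in> S \<Longrightarrow> P (cl (Gen x))"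
    and s: "\<And>c. c \<in> carrier K \<Longrightarrow> P (c \<odot>\<^bsub>Q\<^esub> \<one>\<^bsub>Q\<^esub>)"
    and a: "\<And>x y. x \<in> carrier Q \<Longrightarrow> y \<in> carrier Q \<Longrightarrow> P x \<Longrightarrow> P y \<Longrightarrow> P (x \<oplus>\<^bsub>Q\<^esub> y)"
    and m: "\<And>x y. x \<in> carrier Q \<Longrightarrow> y \<in> carrier Q \<Longrightarrow> P x \<Longrightarrow> P y \<Longrightarrow> P (x \<otimes>\<^bsub>Q\<^esub> y)"
  shows "P x"
proof -
  obtain t where t: "t \<in> T" "x = cl t" using x by (cases rule: presented_cases)
  from t(1) have "P (cl t)"
  proof induction
    case (Plus s t) then show ?case using a[of "cl s" "cl t"] by (simp add: aclass_simps)
  next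
    case (Times s t) then show ?case using m[of "cl s" "cl t"] by (simp add: aclass_simps)
  qed (auto simp: g s aclass_Scal)
  with t show ?thesis by simp
qed

end

section \<open>Morphisms and derivations out of presented algebras\<close>

lemma alg_homD:
  assumes "alg_hom K A B f"
  shows "f \<in> ring_hom A B" "\<And>a. a \<in> carrier A \<Longrightarrow> f a \<in> carrier B"
    "\<And>a b. a \<in> carrier A \<Longrightarrow> b \<in> carrier A \<Longrightarrow> f (a \<oplus>\<^bsub>A\<^esub> b) = f a \<oplus>\<^bsub>B\<^esub> f b"
    "\<And>a b. a \<in> carrier A \<Longrightarrow> b \<in> carrier A \<Longrightarrow> f (a \<otimes>\<^bsub>A\<^esub> b) = f a \<otimes>\<^bsub>B\<^esub> f b"
    "\<And>c a. c \<in> carrier K \<Longrightarrow> a \<in> carrier A \<Longrightarrow> f (c \<odot>\<^bsub>A\<^esub> a) = c \<odot>\<^bsub>B\<^esub> f a"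
    "f \<one>\<^bsub>A\<^esub> = \<one>\<^bsub>B\<^esub>"
  using assms by (auto simp: alg_hom_def ring_hom_def)

lemma alg_homI:
  assumes "\<And>a. a \<in> carrier A \<Longrightarrow> f a \<in> carrier B"
    "\<And>a b. a \<in> carrier A \<Longrightarrow> b \<in> carrier A \<Longrightarrow> f (a \<oplus>\<^bsub>A\<^esub> b) = f a \<oplus>\<^bsub>B\<^esub> f b"
    "\<And>a b. a \<in> carrier A \<Longrightarrow> b \<in> carrier A \<Longrightarrow> f (a \<otimes>\<^bsub>A\<^esub> b) = f a \<otimes>\<^bsub>B\<^esub> f b"
    "\<And>c a. c \<in> carrier K \<Longrightarrow> a \<in> carrier A \<Longrightarrow> f (c \<odot>\<^bsub>A\<^esub> a) = c \<odot>\<^bsub>B\<^esub> f a"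
    "f \<one>\<^bsub>A\<^esub> = \<one>\<^bsub>B\<^esub>"
  shows "alg_hom K A B f"
  using assms by (auto simp: alg_hom_def ring_hom_def)

lemma alg_hom_id: "alg_hom K A A (\<lambda>x. x)"
  by (rule alg_homI) simp_all

lemma alg_hom_comp: "alg_hom K A B f \<Longrightarrow> alg_hom K B C g \<Longrightarrow> alg_hom K A C (\<lambda>x. g (f x))"
  by (rule alg_homI) (simp_all add: alg_homD)

lemma alg_hom_zero:
  assumes "algebra K A" "algebra K B" "alg_hom K A B f" shows "f \<zero>\<^bsub>A\<^esub> = \<zero>\<^bsub>B\<^esub>"
proof -
  interpret A: algebra K A by fact
  interpret B: algebra K B by fact
  show ?thesis using ring_hom_zero[of f A B] alg_homD(1)[OF assms(3)] A.ring_axioms B.ring_axioms by blast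
qed

lemma derivationD:
  assumes "derivation K A D"
  shows "\<And>a. a \<in> carrier A \<Longrightarrow> D a \<in> carrier A"
    "\<And>a b. a \<in> carrier A \<Longrightarrow> b \<in> carrier A \<Longrightarrow> D (a \<oplus>\<^bsub>A\<^esub> b) = D a \<oplus>\<^bsub>A\<^esub> D b"
    "\<And>c a. c \<in> carrier K \<Longrightarrow> a \<in> carrier A \<Longrightarrow> D (c \<odot>\<^bsub>A\<^esub> a) = c \<odot>\<^bsub>A\<^esub> D a"
    "\<And>a b. a \<in> carrier A \<Longrightarrow> b \<in> carrier A \<Longrightarrow>
       D (a \<otimes>\<^bsub>A\<^esub> b) = D a \<otimes>\<^bsub>A\<^esub> b \<oplus>\<^bsub>A\<^esub> a \<otimes>\<^bsub>A\<^esub> D b"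
  using assms by (auto simp: derivation_def)

lemma (in algebra) derivation_one:
  assumes "derivation R M D" shows "D \<one>\<^bsub>M\<^esub> = \<zero>\<^bsub>M\<^esub>"
proof -
  note d = derivationD[OF assms]
  have "D (\<one>\<^bsub>M\<^esub> \<otimes>\<^bsub>M\<^esub> \<one>\<^bsub>M\<^esub>) = D \<one>\<^bsub>M\<^esub> \<oplus>\<^bsub>M\<^esub> D \<one>\<^bsub>M\<^esub>"
    using d(1)[of "\<one>\<^bsub>M\<^esub>"] by (subst d(4)) auto
  then have "D \<one>\<^bsub>M\<^esub> \<oplus>\<^bsub>M\<^esub> D \<one>\<^bsub>M\<^esub> = D \<one>\<^bsub>M\<^esub>" by simp
  then show ?thesis using d(1)[of "\<one>\<^bsub>M\<^esub>"] by (simp add: M.add.l_cancel_one)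
qed

text \<open>Only the generators and the pairs in \<open>R\<close> need attention: the remaining
  rules of \<open>acong\<close> express an equivalence, a congruence or an axiom of commutative
  algebras, and evaluation in any \<open>B\<close> respects them.\<close>

locale presentation_lift = presentation K S R + B: algebra K B
  for K :: "('k,'m) ring_scheme" (structure) and S :: "'x set"
    and R :: "(('k,'x) aterm \<times> ('k,'x) aterm) set" and B :: "('k,'b,'n) module_scheme" +
  fixes \<phi> :: "'x \<Rightarrow> 'b"
  assumes gen_closed: "x \<in> S \<Longrightarrow> \<phi> x \<in> carrier B"
    and respects: "(s,t) \<in> R \<Longrightarrow> s \<in> T \<Longrightarrow> t \<in> T \<Longrightarrow> aeval B \<phi> s = aeval B \<phi> t"
begin

lemma aeval_closed [simp]: "t \<in> T \<Longrightarrow> aeval B \<phi> t \<in> carrier B"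
  by (induction rule: aterms.induct) (auto simp: gen_closed)

lemma aeval_acong: "(s,t) \<in> C \<Longrightarrow> aeval B \<phi> s = aeval B \<phi> t"
proof (induction rule: acong.induct)
  case (plus_neg t)
  then show ?case by (simp add: B.smult_l_minus B.l_minus B.l_neg)
next
  case (scal_times c d)
  then show ?case by (simp add: B.smult_assoc2 B.smult_assoc1)
next
  case (distrib s t u)
  then show ?case by (simp add: B.l_distr)
qed (auto simp: respects B.a_ac B.m_ac B.smult_l_distr B.smult_assoc2)

lemma pres_lift_aclass: "t \<in> T \<Longrightarrow> pres_lift B \<phi> (cl t) = aeval B \<phi> t"
  unfolding pres_lift_def using aeval_acong[OF arep_aclass] by simp

lemma pres_lift_Gen: "x \<in> S \<Longrightarrow> pres_lift B \<phi> (cl (Gen x)) = \<phi> x"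
  by (simp add: pres_lift_aclass aterms.intros)

lemma pres_lift_hom: "alg_hom K Q B (pres_lift B \<phi>)"
  by (rule alg_homI)
    (auto elim!: presented_cases simp: aclass_simps pres_lift_aclass aterms.intros B.smult_assoc2)

end

text \<open>A derivation descends as soon as it maps each relation to a consequence of the
  relations, not necessarily to a relation: hence \<open>acong\<close> in \<open>respects\<close>.
  The Leibniz rule built into \<open>aderiv\<close> takes care of the other rules.\<close>

locale presentation_der = presentation K S R
  for K :: "('k,'m) ring_scheme" (structure) and S :: "'x set"
    and R :: "(('k,'x) aterm \<times> ('k,'x) aterm) set" +
  fixes \<delta> :: "'x \<Rightarrow> ('k,'x) aterm"
  assumes gen_closed: "x \<in> S \<Longrightarrow> \<delta> x \<in> aterms K S"
    and respects: "(s,t) \<in> R \<Longrightarrow> s \<in> aterms K S \<Longrightarrow> t \<in> aterms K S \<Longrightarrow>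
      (aderiv K \<delta> s, aderiv K \<delta> t) \<in> acong K S R"
begin

lemma aderiv_closed [simp]: "t \<in> T \<Longrightarrow> aderiv K \<delta> t \<in> T"
  by (induction rule: aterms.induct) (auto simp: gen_closed intro!: aterms.intros)

lemma aderiv_acong: "(s,t) \<in> C \<Longrightarrow> (aderiv K \<delta> s, aderiv K \<delta> t) \<in> C"
proof -
  interpret Q: algebra K Q by (rule presented_algebra)
  note [simp] = aterms.Scal aterms.Plus aterms.Times aclass_simps[symmetric] aclass_Scal
  \<comment> \<open>Congruence is read as equality of classes, so that the ring laws of the quotient
    settle each rule.\<close>
  have eq: "(s,t) \<in> C \<longleftrightarrow> s \<in> T \<and> t \<in> T \<and> cl s = cl t" for s t
    using aclass_eq_iff acong_aterms by blast
  show "(aderiv K \<delta> s, aderiv K \<delta> t) \<in> C" if "(s,t) \<in> C"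
    using that
  proof (induction rule: acong.induct)
    case (rel s t) then show ?case by (rule respects)
  next
    case (sym s t) from sym.IH show ?case by (rule acong.sym)
  next
    case (trans s t u) then show ?case by (blast intro: acong.trans)
  next
    case (times_cong s s' t t')
    then show ?case by (simp add: eq)
  next
    case (plus_neg t)
    then show ?case by (simp add: eq Q.smult_l_minus Q.l_minus Q.l_neg)
  next
    case (times_assoc s t u)
    then show ?case by (simp add: eq Q.l_distr Q.r_distr Q.m_ac Q.a_ac)
  next
    case (times_comm s t)
    then show ?case by (simp add: eq Q.m_ac Q.a_ac)
  next
    case (distrib s t u)
    then show ?case by (simp add: eq Q.l_distr Q.r_distr Q.m_ac Q.a_ac)
  qed (auto simp: eq Q.a_ac Q.smult_assoc2)
qed

lemma pres_der_aclass: "t \<in> T \<Longrightarrow> pres_der K S R \<delta> (cl t) = cl (aderiv K \<delta> t)"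
  unfolding pres_der_def using aclass_eqI[OF aderiv_acong[OF arep_aclass]] by simp

lemma pres_der_Gen: "x \<in> S \<Longrightarrow> pres_der K S R \<delta> (cl (Gen x)) = cl (\<delta> x)"
  by (simp add: pres_der_aclass aterms.intros)

lemma pres_der_derivation: "derivation K Q (pres_der K S R \<delta>)"
proof -
  interpret Q: algebra K Q by (rule presented_algebra)
  note [simp] = aterms.Scal aterms.Plus aterms.Times
  have "pres_der K S R \<delta> (c \<odot>\<^bsub>Q\<^esub> x) = c \<odot>\<^bsub>Q\<^esub> pres_der K S R \<delta> x"
    if "c \<in> carrier K" "x \<in> carrier Q" for c x
  proof -
    obtain t where t: "t \<in> T" "x = cl t" using \<open>x \<in> carrier Q\<close> by (cases rule: presented_cases)
    have "cl (Plus (Times (Scal \<zero>) t) (Times (Scal c) (aderiv K \<delta> t))) = cl (Times (Scal c) (aderiv K \<delta> t))"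
      using that t by (simp add: aclass_simps[symmetric] aclass_Scal)
    then show ?thesis using that t by (simp add: aclass_smult pres_der_aclass)
  qed
  then show ?thesis unfolding derivation_def
    by (auto elim!: presented_cases simp: aclass_Plus aclass_Times pres_der_aclass)
qed

end

section \<open>Additive maps and integer combinations\<close>

text \<open>The operators below (\<partial>, multiplication by \<lambda>, \<lambda> + \<partial>, a
  bracket with one argument fixed) are in general neither ring morphisms nor linear over the
  algebra; additivity is what they share, and it is enough to move them through sums.\<close>

definition additive :: "('a,'m) ring_scheme \<Rightarrow> ('b,'n) ring_scheme \<Rightarrow> ('a \<Rightarrow> 'b) \<Rightarrow> bool" where
  "additive G H f \<longleftrightarrow> (\<forall>x\<in>carrier G. f x \<in> carrier H) \<and>
     (\<forall>x\<in>carrier G. \<forall>y\<in>carrier G. f (x \<oplus>\<^bsub>G\<^esub> y) = f x \<oplus>\<^bsub>H\<^esub> f y)"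

lemma additiveI:
  assumes "\<And>x. x \<in> carrier G \<Longrightarrow> f x \<in> carrier H"
    "\<And>x y. x \<in> carrier G \<Longrightarrow> y \<in> carrier G \<Longrightarrow> f (x \<oplus>\<^bsub>G\<^esub> y) = f x \<oplus>\<^bsub>H\<^esub> f y"
  shows "additive G H f"
  using assms by (simp add: additive_def)

lemma additiveD:
  assumes "additive G H f"
  shows "\<And>x. x \<in> carrier G \<Longrightarrow> f x \<in> carrier H"
    "\<And>x y. x \<in> carrier G \<Longrightarrow> y \<in> carrier G \<Longrightarrow> f (x \<oplus>\<^bsub>G\<^esub> y) = f x \<oplus>\<^bsub>H\<^esub> f y"
  using assms by (simp_all add: additive_def)

locale additive_map = G: abelian_group G + H: abelian_group H
  for G :: "('a,'m) ring_scheme" and H :: "('b,'n) ring_scheme" +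
  fixes f :: "'a \<Rightarrow> 'b"
  assumes additive: "additive G H f"
begin

lemmas closed [simp] = additiveD(1)[OF additive] and add [simp] = additiveD(2)[OF additive]

lemma group_hom: "group_hom (add_monoid G) (add_monoid H) f"
  by (simp add: G.a_group H.a_group group_hom_axioms_def group_hom_def hom_def)

lemma zero [simp]: "f \<zero>\<^bsub>G\<^esub> = \<zero>\<^bsub>H\<^esub>"
  using group_hom.hom_one[OF group_hom] by simp

lemma neg [simp]: "x \<in> carrier G \<Longrightarrow> f (\<ominus>\<^bsub>G\<^esub> x) = \<ominus>\<^bsub>H\<^esub> f x"
  using group_hom.hom_inv[OF group_hom, of x] by (simp add: a_inv_def)

lemma minus [simp]: "x \<in> carrier G \<Longrightarrow> y \<in> carrier G \<Longrightarrow> f (x \<ominus>\<^bsub>G\<^esub> y) = f x \<ominus>\<^bsub>H\<^esub> f y"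
  by (simp add: a_minus_def)

lemma finsum: "x \<in> S \<rightarrow> carrier G \<Longrightarrow> f (finsum G x S) = finsum H (\<lambda>i. f (x i)) S"
proof (induction S rule: infinite_finite_induct)
  case (insert i S)
  then show ?case by (simp add: Pi_def)
qed auto

lemma add_pow: "x \<in> carrier G \<Longrightarrow> f ([(n::nat)] \<cdot>\<^bsub>G\<^esub> x) = [n] \<cdot>\<^bsub>H\<^esub> f x"
  by (induction n) (simp_all add: G.add.nat_pow_Suc H.add.nat_pow_Suc)

lemma add_pow_int: "x \<in> carrier G \<Longrightarrow> f ([(n::int)] \<cdot>\<^bsub>G\<^esub> x) = [n] \<cdot>\<^bsub>H\<^esub> f x"
  using group_hom.hom_int_pow[OF group_hom, of x n] H.abelian_group_axioms
  by (simp add: add_pow_def)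

end

context abelian_group
begin

lemma additive_mapI: "abelian_group H \<Longrightarrow> additive G H f \<Longrightarrow> additive_map G H f"
  by (simp add: additive_map_def additive_map_axioms_def abelian_group_axioms)

lemma add_pow_int_of_nat: "[int n] \<cdot> x = [n] \<cdot> x"
  by (simp add: add_pow_def int_pow_int)

text \<open>Coefficients are integers acting through the additive group. They pass through every
  additive map, and comparing two such sums becomes a computation with binomials in
  \<open>int\<close>.\<close>

definition zlin :: "'i set \<Rightarrow> ('i \<Rightarrow> int) \<Rightarrow> ('i \<Rightarrow> 'a) \<Rightarrow> 'a" where
  "zlin S c x = (\<Oplus>i\<in>S. [c i] \<cdot> x i)"

lemma add_pow_int_add: "x \<in> carrier G \<Longrightarrow> [((a::int) + b)] \<cdot> x = [a] \<cdot> x \<oplus> [b] \<cdot> x"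
  using add.int_pow_mult by simp

lemma add_pow_int_zero [simp]: "[(0::int)] \<cdot> x = \<zero>"
  by (simp add: add_pow_def int_pow_def2)

lemma add_pow_int_one [simp]: "x \<in> carrier G \<Longrightarrow> [(1::int)] \<cdot> x = x"
  by (simp add: add_pow_def int_pow_def2)

lemma add_pow_int_closed [simp]: "x \<in> carrier G \<Longrightarrow> [(a::int)] \<cdot> x \<in> carrier G"
  using add.int_pow_closed by simp

lemma add_pow_int_distrib:
  "x \<in> carrier G \<Longrightarrow> y \<in> carrier G \<Longrightarrow> [(a::int)] \<cdot> (x \<oplus> y) = [a] \<cdot> x \<oplus> [a] \<cdot> y"
  using add.int_pow_distrib by simp

lemma add_pow_int_neg: "x \<in> carrier G \<Longrightarrow> [(- (a::int))] \<cdot> x = \<ominus> ([a] \<cdot> x)"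
  using add.int_pow_neg by simp

lemma add_pow_int_mult: "x \<in> carrier G \<Longrightarrow> [(a::int)] \<cdot> ([b] \<cdot> x) = [(a * b)] \<cdot> x"
  using add.int_pow_pow[of x a b] by (simp add: mult.commute)

lemma additive_add_pow: "additive G G (\<lambda>x. [(a::int)] \<cdot> x)"
  by (rule additiveI) (simp_all add: add_pow_int_distrib)

lemma add_pow_int_finsum:
  "x \<in> S \<rightarrow> carrier G \<Longrightarrow> [(a::int)] \<cdot> (\<Oplus>i\<in>S. x i) = (\<Oplus>i\<in>S. [a] \<cdot> x i)"
  by (rule additive_map.finsum[OF additive_mapI[OF abelian_group_axioms additive_add_pow]])

lemma zlin_closed [simp]: "x \<in> S \<rightarrow> carrier G \<Longrightarrow> zlin S c x \<in> carrier G"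
  unfolding zlin_def by (rule finsum_closed) auto

lemma zlin_cong:
  "S = S' \<Longrightarrow> (\<And>i. i \<in> S' \<Longrightarrow> c i = c' i) \<Longrightarrow> (\<And>i. i \<in> S' \<Longrightarrow> x i = x' i) \<Longrightarrow> x' \<in> S' \<rightarrow> carrier G \<Longrightarrow>
   zlin S c x = zlin S' c' x'"
  unfolding zlin_def by (rule finsum_cong') auto

lemma zlin_add:
  "x \<in> S \<rightarrow> carrier G \<Longrightarrow> zlin S c x \<oplus> zlin S d x = zlin S (\<lambda>i. c i + d i) x"
proof -
  assume x: "x \<in> S \<rightarrow> carrier G"
  have "zlin S (\<lambda>i. c i + d i) x = (\<Oplus>i\<in>S. [c i] \<cdot> x i \<oplus> [d i] \<cdot> x i)"
    unfolding zlin_def using x by (intro finsum_cong') (auto simp: add_pow_int_add[OF funcset_mem])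
  also have "\<dots> = zlin S c x \<oplus> zlin S d x"
    unfolding zlin_def using x by (intro finsum_addf) auto
  finally show ?thesis by simp
qed

lemma zlin_distrib:
  "x \<in> S \<rightarrow> carrier G \<Longrightarrow> y \<in> S \<rightarrow> carrier G \<Longrightarrow>
   zlin S c (\<lambda>i. x i \<oplus> y i) = zlin S c x \<oplus> zlin S c y"
proof -
  assume x: "x \<in> S \<rightarrow> carrier G" and y: "y \<in> S \<rightarrow> carrier G"
  have "zlin S c (\<lambda>i. x i \<oplus> y i) = (\<Oplus>i\<in>S. [c i] \<cdot> x i \<oplus> [c i] \<cdot> y i)"
    unfolding zlin_def using x y
    by (intro finsum_cong') (auto simp: add_pow_int_distrib[OF funcset_mem funcset_mem])
  also have "\<dots> = zlin S c x \<oplus> zlin S c y"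
    unfolding zlin_def using x y by (intro finsum_addf) auto
  finally show ?thesis .
qed

lemma zlin_neutral:
  assumes "finite T" "S \<subseteq> T" "x \<in> T \<rightarrow> carrier G" "\<And>i. i \<in> T - S \<Longrightarrow> c i = 0 \<or> x i = \<zero>"
  shows "zlin S c x = zlin T c x"
  unfolding zlin_def using assms
  by (intro add.finprod_mono_neutral_cong_left) (force simp: Pi_def)+

lemma zlin_Sigma:
  assumes "finite S" "\<And>i. i \<in> S \<Longrightarrow> finite (T i)"
    "\<And>i j. i \<in> S \<Longrightarrow> j \<in> T i \<Longrightarrow> x i j \<in> carrier G"
  shows "zlin S c (\<lambda>i. zlin (T i) (d i) (x i)) = zlin (Sigma S T) (\<lambda>(i,j). c i * d i j) (\<lambda>(i,j). x i j)"
  using assms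
proof (induction S rule: finite_induct)
  case empty then show ?case by (simp add: zlin_def)
next
  case (insert i S)
  have Sig: "Sigma (insert i S) T = Pair i ` T i \<union> Sigma S T" by auto
  have cl: "zlin (T k) (d k) (x k) \<in> carrier G" if "k \<in> insert i S" for k
    using that insert.prems by (intro zlin_closed) auto
  have 1: "[c i] \<cdot> zlin (T i) (d i) (x i) = (\<Oplus>p\<in>Pair i ` T i. [(case p of (i,j) \<Rightarrow> c i * d i j)] \<cdot> (case p of (i,j) \<Rightarrow> x i j))"
    using insert.prems unfolding zlin_def
    by (subst finsum_reindex) (auto simp: inj_on_def add_pow_int_finsum add_pow_int_mult Pi_def intro!: finsum_cong')
  show ?case unfolding Sig zlin_def[of "_ \<union> _"]
    using insert.prems insert.hyps cl
    apply (subst finsum_Un_disjoint)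
        apply (auto simp: finsum_insert)
    apply (subst 1[symmetric])
    using insert.IH
    apply (simp add: zlin_def[of "insert i S"] zlin_def[of S] zlin_def[of "Sigma _ _"] Pi_def)
    done
qed

text \<open>\<open>h\<close> need not be injective: equal vectors are collected and their
  coefficients added in \<open>int\<close>. This is how sums over different index sets are made
  comparable.\<close>

lemma zlin_fibers:
  assumes "finite S" "finite T" "h ` S \<subseteq> T" "x \<in> T \<rightarrow> carrier G"
  shows "zlin S c (\<lambda>i. x (h i)) = zlin T (\<lambda>t. \<Sum>i\<in>{i\<in>S. h i = t}. c i) x"
  using assms(1,3)
proof (induction S rule: finite_induct)
  case empty
  then show ?case using assms(4) by (simp add: zlin_def)
next
  case (insert i S)
  have hi: "h i \<in> T" using insert.prems by auto
  have "zlin (insert i S) c (\<lambda>i. x (h i)) = [c i] \<cdot> x (h i) \<oplus> zlin S c (\<lambda>i. x (h i))"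
    using insert.prems insert.hyps assms(4) unfolding zlin_def
    by (subst finsum_insert) auto
  also have "[c i] \<cdot> x (h i) = zlin {h i} (\<lambda>t. if t = h i then c i else 0) x"
    using funcset_mem[OF assms(4) hi] unfolding zlin_def by (subst finsum_insert) auto
  also have "\<dots> = zlin T (\<lambda>t. if t = h i then c i else 0) x"
    using hi assms(2,4) by (intro zlin_neutral) auto
  also have "zlin S c (\<lambda>i. x (h i)) = zlin T (\<lambda>t. \<Sum>i\<in>{i\<in>S. h i = t}. c i) x"
    using insert by simp
  also have "zlin T (\<lambda>t. if t = h i then c i else 0) x \<oplus> \<dots> =
     zlin T (\<lambda>t. (if t = h i then c i else 0) + (\<Sum>i\<in>{i\<in>S. h i = t}. c i)) x"
    by (rule zlin_add[OF assms(4)])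
  also have "\<dots> = zlin T (\<lambda>t. \<Sum>j\<in>{j\<in>insert i S. h j = t}. c j) x"
  proof (rule zlin_cong[OF HOL.refl _ HOL.refl assms(4)])
    fix t
    have "{j\<in>insert i S. h j = t} = (if t = h i then insert i {j\<in>S. h j = t} else {j\<in>S. h j = t})"
      by auto
    then show "(if t = h i then c i else 0) + (\<Sum>i\<in>{i\<in>S. h i = t}. c i) = (\<Sum>j\<in>{j\<in>insert i S. h j = t}. c j)"
      using insert.hyps by simp
  qed
  finally show ?case .
qed

definition binsum :: "nat \<Rightarrow> (nat \<Rightarrow> nat \<Rightarrow> 'a) \<Rightarrow> 'a" where
  "binsum k z = zlin {..k} (\<lambda>j. int (k choose j)) (\<lambda>j. z j (k - j))"

lemma binsum_0 [simp]: "z 0 0 \<in> carrier G \<Longrightarrow> binsum 0 z = z 0 0"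
  by (simp add: binsum_def zlin_def)

text \<open>Pascal's rule, arranged as the induction step of the higher Leibniz rule: one more
  derivative falls on the left or on the right factor.\<close>

lemma binsum_Suc:
  assumes z: "\<And>i j. z i j \<in> carrier G"
  shows "binsum (Suc k) z = binsum k (\<lambda>i j. z (Suc i) j) \<oplus> binsum k (\<lambda>i j. z i (Suc j))"
proof -
  \<comment> \<open>Both sums are spread over \<open>{..Suc k}\<close> with the same vectors
    \<open>?x\<close>, the first along \<open>Suc\<close> and the second along the identity; only
    coefficients remain to be compared.\<close>
  let ?x = "\<lambda>t. z t (Suc k - t)"
  have 1: "binsum k (\<lambda>i j. z (Suc i) j) = zlin {..Suc k} (\<lambda>t. \<Sum>i\<in>{i\<in>{..k}. Suc i = t}. int (k choose i)) ?x"
    unfolding binsum_def using z by (subst zlin_fibers[symmetric]) auto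
  have 2: "binsum k (\<lambda>i j. z i (Suc j)) = zlin {..Suc k} (\<lambda>t. \<Sum>i\<in>{i\<in>{..k}. i = t}. int (k choose i)) ?x"
    unfolding binsum_def using z
    by (subst zlin_fibers[symmetric]) (auto intro!: zlin_cong simp: Suc_diff_le)
  have *: "(\<Sum>i\<in>{i\<in>{..k}. Suc i = t}. int (k choose i)) + (\<Sum>i\<in>{i\<in>{..k}. i = t}. int (k choose i))
      = int (Suc k choose t)" if "t \<le> Suc k" for t
  proof (cases t)
    case 0
    then have "{i\<in>{..k}. Suc i = t} = {}" "{i\<in>{..k}. i = t} = {0}" by auto
    then show ?thesis using 0 by simp
  next
    case (Suc s)
    then have "{i\<in>{..k}. Suc i = t} = {s}" "{i\<in>{..k}. i = t} = (if t \<le> k then {t} else {})" using that by auto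
    then show ?thesis using Suc that by (auto simp: binomial_eq_0)
  qed
  show ?thesis unfolding 1 2 using z
    by (subst zlin_add)
      (auto simp del: binomial_Suc_Suc simp: binsum_def intro!: zlin_cong *[symmetric, simplified])
qed

lemma binsum_closed [simp]: "(\<And>i j. z i j \<in> carrier G) \<Longrightarrow> binsum k z \<in> carrier G"
  unfolding binsum_def by (rule zlin_closed) auto

end

lemma (in additive_map) zlin:
  "x \<in> S \<rightarrow> carrier G \<Longrightarrow> f (G.zlin S c x) = H.zlin S c (\<lambda>i. f (x i))"
  unfolding G.zlin_def H.zlin_def
  by (subst finsum) (auto simp: add_pow_int[OF funcset_mem] H.add_pow_int_closed[OF closed[OF funcset_mem]]
      intro!: H.finsum_cong')

lemma (in additive_map) binsum:
  "(\<And>i j. z i j \<in> carrier G) \<Longrightarrow> f (G.binsum k z) = H.binsum k (\<lambda>i j. f (z i j))"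
  unfolding G.binsum_def H.binsum_def by (rule zlin) auto

section \<open>The higher Leibniz rule, for derivations and for terms\<close>

lemma (in algebra) derivation_additive: "derivation R M D \<Longrightarrow> additive_map M M D"
  by unfold_locales (auto intro!: additiveI simp: derivationD)

lemma (in algebra) derivation_pow_closed [simp]:
  "derivation R M D \<Longrightarrow> x \<in> carrier M \<Longrightarrow> (D ^^ k) x \<in> carrier M"
  by (induction k) (auto simp: derivationD)

lemma (in algebra) derivation_pow_mult:
  assumes "derivation R M D" "x \<in> carrier M" "y \<in> carrier M"
  shows "(D ^^ k) (x \<otimes>\<^bsub>M\<^esub> y) = M.binsum k (\<lambda>i j. (D ^^ i) x \<otimes>\<^bsub>M\<^esub> (D ^^ j) y)"
proof (induction k)
  case 0
  then show ?case using assms by simp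
next
  case (Suc k)
  note cl = derivation_pow_closed[OF assms(1)]
  interpret D: additive_map M M D by (rule derivation_additive[OF assms(1)])
  have "(D ^^ Suc k) (x \<otimes>\<^bsub>M\<^esub> y) = D (M.binsum k (\<lambda>i j. (D ^^ i) x \<otimes>\<^bsub>M\<^esub> (D ^^ j) y))"
    using Suc by simp
  also have "\<dots> = M.binsum k (\<lambda>i j. D ((D ^^ i) x \<otimes>\<^bsub>M\<^esub> (D ^^ j) y))"
    using assms cl by (intro D.binsum) auto
  also have "\<dots> = M.binsum k (\<lambda>i j. (D ^^ Suc i) x \<otimes>\<^bsub>M\<^esub> (D ^^ j) y \<oplus>\<^bsub>M\<^esub> (D ^^ i) x \<otimes>\<^bsub>M\<^esub> (D ^^ Suc j) y)"
    using assms cl by (simp add: derivationD(4)[OF assms(1)])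
  also have "\<dots> = M.binsum (Suc k) (\<lambda>i j. (D ^^ i) x \<otimes>\<^bsub>M\<^esub> (D ^^ j) y)"
    using assms cl by (subst M.binsum_Suc) (auto simp: M.binsum_def M.zlin_distrib Pi_def derivationD)
  finally show ?case .
qed

text \<open>Evaluation in the quotient itself at the tautological generators recovers the class, so
  a relation between terms can be used, or verified, as an equation in \<open>Q\<close>.\<close>

lemma (in presentation) aclass_eq_aeval: "t \<in> T \<Longrightarrow> cl t = aeval Q (\<lambda>x. cl (Gen x)) t"
  by (induction rule: aterms.induct) (simp_all add: aclass_Scal aclass_Plus[symmetric] aclass_Times[symmetric])

lemma (in presentation) aeval_rel:
  "(s,t) \<in> R \<Longrightarrow> s \<in> T \<Longrightarrow> t \<in> T \<Longrightarrow>
     aeval Q (\<lambda>x. cl (Gen x)) s = aeval Q (\<lambda>x. cl (Gen x)) t"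
  using aclass_eqI[OF acong.rel] aclass_eq_aeval by metis

lemma (in presentation) acong_aevalI:
  "s \<in> T \<Longrightarrow> t \<in> T \<Longrightarrow> aeval Q (\<lambda>x. cl (Gen x)) s = aeval Q (\<lambda>x. cl (Gen x)) t \<Longrightarrow> (s,t) \<in> C"
  using aclass_eq_iff aclass_eq_aeval by metis

lemma (in algebra) smult_one_mult:
  "c \<in> carrier R \<Longrightarrow> x \<in> carrier M \<Longrightarrow> (c \<odot>\<^bsub>M\<^esub> \<one>\<^bsub>M\<^esub>) \<otimes>\<^bsub>M\<^esub> x = c \<odot>\<^bsub>M\<^esub> x"
  by (simp add: smult_assoc2)

lemma (in module) add_pow_smult_one:
  assumes "x \<in> carrier M" shows "([(n::nat)] \<cdot>\<^bsub>R\<^esub> \<one>) \<odot>\<^bsub>M\<^esub> x = [n] \<cdot>\<^bsub>M\<^esub> x"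
proof -
  interpret additive_map R M "\<lambda>c. c \<odot>\<^bsub>M\<^esub> x"
    using assms by unfold_locales (auto intro!: additiveI simp: smult_l_distr)
  show ?thesis using assms by (simp add: add_pow)
qed

lemma (in algebra) aeval_foldr_Plus:
  assumes "\<And>j. j < n \<Longrightarrow> aeval M \<phi> (f j) \<in> carrier M"
  shows "aeval M \<phi> (foldr Plus (map f [0..<n]) (Scal \<zero>)) = (\<Oplus>\<^bsub>M\<^esub>j\<in>{..<n}. aeval M \<phi> (f j))"
proof -
  have *: "aeval M \<phi> (foldr Plus (map f xs) (Scal \<zero>)) = (\<Oplus>\<^bsub>M\<^esub>j\<in>set xs. aeval M \<phi> (f j))"
    if "distinct xs" "\<And>j. j \<in> set xs \<Longrightarrow> aeval M \<phi> (f j) \<in> carrier M" for xs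
    using that by (induction xs) auto
  show ?thesis using *[of "[0..<n]"] assms by (simp add: atLeast0LessThan)
qed

text \<open>The right-hand side of \<open>jet_rel.leibniz\<close> with both families of factors
  abstracted, so that evaluating and differentiating the \<open>foldr\<close> is done once.\<close>

definition leibniz_term ::
  "('k,'m) ring_scheme \<Rightarrow> nat \<Rightarrow> (nat \<Rightarrow> ('k,'x) aterm) \<Rightarrow> (nat \<Rightarrow> ('k,'x) aterm) \<Rightarrow> ('k,'x) aterm" where
  "leibniz_term K k s t = foldr Plus
     (map (\<lambda>j. Times (Scal ([(k choose j)] \<cdot>\<^bsub>K\<^esub> \<one>\<^bsub>K\<^esub>)) (Times (s j) (t (k - j)))) [0..<Suc k])
     (Scal \<zero>\<^bsub>K\<^esub>)"

lemma (in algebra) aeval_leibniz_term: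
  assumes st: "\<And>j. aeval M \<phi> (s j) \<in> carrier M" "\<And>j. aeval M \<phi> (t j) \<in> carrier M"
  shows "aeval M \<phi> (leibniz_term R k s t) = M.binsum k (\<lambda>i j. aeval M \<phi> (s i) \<otimes>\<^bsub>M\<^esub> aeval M \<phi> (t j))"
  unfolding leibniz_term_def M.binsum_def M.zlin_def using st
  by (subst aeval_foldr_Plus)
    (auto simp: smult_one_mult add_pow_smult_one add_pow_ldistr M.add_pow_int_of_nat lessThan_Suc_atMost
      simp del: upt_Suc intro!: M.finsum_cong')

lemma (in cring) leibniz_term_closed:
  assumes "\<And>j. s j \<in> aterms R S" "\<And>j. t j \<in> aterms R S"
  shows "leibniz_term R k s t \<in> aterms R S"
proof -
  have "foldr Plus (map (\<lambda>j. Times (Scal ([(k choose j)] \<cdot>\<^bsub>R\<^esub> \<one>\<^bsub>R\<^esub>)) (Times (s j) (t (k - j)))) xs)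
     (Scal \<zero>\<^bsub>R\<^esub>) \<in> aterms R S" for xs
    using assms by (induction xs) (auto intro!: aterms.intros)
  then show ?thesis unfolding leibniz_term_def .
qed

lemma aderiv_foldr_Plus:
  "aderiv K \<delta> (foldr Plus (map f xs) (Scal c)) = foldr Plus (map (\<lambda>j. aderiv K \<delta> (f j)) xs) (Scal \<zero>\<^bsub>K\<^esub>)"
  by (induction xs) auto

lemma (in algebra) aeval_aderiv_leibniz_term:
  assumes st: "\<And>j. aeval M \<phi> (s j) \<in> carrier M" "\<And>j. aeval M \<phi> (t j) \<in> carrier M"
    "\<And>j. aeval M \<phi> (aderiv R \<delta> (s j)) \<in> carrier M" "\<And>j. aeval M \<phi> (aderiv R \<delta> (t j)) \<in> carrier M"
  shows "aeval M \<phi> (aderiv R \<delta> (leibniz_term R k s t)) =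
    M.binsum k (\<lambda>i j. aeval M \<phi> (aderiv R \<delta> (s i)) \<otimes>\<^bsub>M\<^esub> aeval M \<phi> (t j) \<oplus>\<^bsub>M\<^esub>
      aeval M \<phi> (s i) \<otimes>\<^bsub>M\<^esub> aeval M \<phi> (aderiv R \<delta> (t j)))"
  unfolding leibniz_term_def aderiv_foldr_Plus M.binsum_def M.zlin_def using st
  by (subst aeval_foldr_Plus)
    (auto simp: smult_one_mult add_pow_smult_one add_pow_ldistr M.add_pow_int_of_nat lessThan_Suc_atMost
      simp del: upt_Suc intro!: M.finsum_cong')

section \<open>Jet algebras\<close>

locale jets = A: algebra K A
  for K :: "('k,'m) ring_scheme" (structure) and A :: "('k,'a,'n) module_scheme"
begin

abbreviation "J \<equiv> jet K A"
abbreviation "gen \<equiv> jet_gen K A"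
abbreviation "D \<equiv> jet_der K A"

sublocale pr: presentation K "UNIV \<times> carrier A" "jet_rel K A"
  by unfold_locales

lemma jet_rel_leibniz:
  "a \<in> carrier A \<Longrightarrow> b \<in> carrier A \<Longrightarrow>
   (Gen (k, a \<otimes>\<^bsub>A\<^esub> b), leibniz_term K k (\<lambda>j. Gen (j,a)) (\<lambda>j. Gen (j,b))) \<in> jet_rel K A"
  unfolding leibniz_term_def by (rule jet_rel.leibniz)

lemma jet_leibniz_term_closed:
  "a \<in> carrier A \<Longrightarrow> b \<in> carrier A \<Longrightarrow> leibniz_term K k (\<lambda>j. Gen (j,a)) (\<lambda>j. Gen (j,b)) \<in> pr.T"
  by (rule A.R.leibniz_term_closed) simp_all

lemma jet_algebra: "algebra K J"
  unfolding jet_def by (rule pr.presented_algebra)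

sublocale J: algebra K "jet K A"
  by (rule jet_algebra)

lemma gen_closed [simp]: "a \<in> carrier A \<Longrightarrow> gen k a \<in> carrier J"
  unfolding jet_def jet_gen_def by simp

lemma aeval_rel: "(s,t) \<in> jet_rel K A \<Longrightarrow> s \<in> pr.T \<Longrightarrow> t \<in> pr.T \<Longrightarrow>
   aeval J (\<lambda>x. pr.cl (Gen x)) s = aeval J (\<lambda>x. pr.cl (Gen x)) t"
  using pr.aeval_rel by (simp add: jet_def)

lemma gen_add: "a \<in> carrier A \<Longrightarrow> b \<in> carrier A \<Longrightarrow> gen k (a \<oplus>\<^bsub>A\<^esub> b) = gen k a \<oplus>\<^bsub>J\<^esub> gen k b"
  using aeval_rel[OF jet_rel.add[of a A b k]] by (simp add: jet_gen_def)

lemma gen_smult: "c \<in> carrier K \<Longrightarrow> a \<in> carrier A \<Longrightarrow> gen k (c \<odot>\<^bsub>A\<^esub> a) = c \<odot>\<^bsub>J\<^esub> gen k a"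
  using aeval_rel[OF jet_rel.smult[of c K a A k]] gen_closed[of a k]
  by (simp add: jet_gen_def J.smult_one_mult)

lemma gen_one: "gen 0 \<one>\<^bsub>A\<^esub> = \<one>\<^bsub>J\<^esub>"
  using aeval_rel[OF jet_rel.unit] by (simp add: jet_gen_def)

lemma gen_mult:
  assumes "a \<in> carrier A" "b \<in> carrier A"
  shows "gen k (a \<otimes>\<^bsub>A\<^esub> b) = J.M.binsum k (\<lambda>i j. gen i a \<otimes>\<^bsub>J\<^esub> gen j b)"
proof -
  have "gen k (a \<otimes>\<^bsub>A\<^esub> b) = aeval J (\<lambda>x. pr.cl (Gen x)) (leibniz_term K k (\<lambda>j. Gen (j,a)) (\<lambda>j. Gen (j,b)))"
    using aeval_rel[OF jet_rel_leibniz[OF assms, of k]] assms jet_leibniz_term_closed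
    by (simp add: jet_gen_def)
  also have "\<dots> = J.M.binsum k (\<lambda>i j. gen i a \<otimes>\<^bsub>J\<^esub> gen j b)"
    using assms by (subst J.aeval_leibniz_term) (simp_all add: jet_gen_def[symmetric])
  finally show ?thesis .
qed

lemma gen_mult_0: "a \<in> carrier A \<Longrightarrow> b \<in> carrier A \<Longrightarrow> gen 0 (a \<otimes>\<^bsub>A\<^esub> b) = gen 0 a \<otimes>\<^bsub>J\<^esub> gen 0 b"
  by (simp add: gen_mult)

lemma gen_hom: "alg_hom K A J (gen 0)"
  by (rule alg_homI) (simp_all add: gen_add gen_smult gen_one gen_mult_0)

text \<open>The presentation only says \<partial>^0(1) = 1. That \<partial>(1) vanishes has to be
  extracted from the Leibniz relation for 1 = 1 \<cdot> 1; it is the derivative of the relation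
  \<open>unit\<close>.\<close>

lemma gen_Suc_one: "gen (Suc 0) \<one>\<^bsub>A\<^esub> = \<zero>\<^bsub>J\<^esub>"
proof -
  have "gen (Suc 0) (\<one>\<^bsub>A\<^esub> \<otimes>\<^bsub>A\<^esub> \<one>\<^bsub>A\<^esub>) = gen (Suc 0) \<one>\<^bsub>A\<^esub> \<oplus>\<^bsub>J\<^esub> gen (Suc 0) \<one>\<^bsub>A\<^esub>"
    by (simp only: gen_mult A.one_closed, subst J.M.binsum_Suc) (auto simp: gen_one)
  then have "gen (Suc 0) \<one>\<^bsub>A\<^esub> \<oplus>\<^bsub>J\<^esub> gen (Suc 0) \<one>\<^bsub>A\<^esub> = gen (Suc 0) \<one>\<^bsub>A\<^esub>" by simp
  then show ?thesis by (simp add: J.M.add.l_cancel_one)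
qed

text \<open>The relations are stable under raising all orders by one: by Pascal's rule the
  derivative of the Leibniz relation of order \<open>k\<close> is the one of order
  \<open>Suc k\<close>, and the linear relations just shift.\<close>

sublocale pd: presentation_der K "UNIV \<times> carrier A" "jet_rel K A" "\<lambda>(k,a). Gen (Suc k, a)"
proof
  fix s t
  assume "(s, t) \<in> jet_rel K A" "s \<in> pr.T" "t \<in> pr.T"
  then show "(aderiv K (\<lambda>(k,a). Gen (Suc k, a)) s, aderiv K (\<lambda>(k,a). Gen (Suc k, a)) t) \<in> pr.C"
  proof (cases rule: jet_rel.cases)
    case (add a b k)
    then show ?thesis
      by (intro pr.acong_aevalI)
        (simp_all add: jet_def[symmetric] jet_gen_def[symmetric] gen_add)
  next
    case (smult c a k)
    then show ?thesis
      by (intro pr.acong_aevalI)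
        (simp_all add: jet_def[symmetric] jet_gen_def[symmetric] gen_smult J.smult_one_mult)
  next
    case unit
    then show ?thesis
      by (intro pr.acong_aevalI)
        (simp_all add: jet_def[symmetric] jet_gen_def[symmetric] gen_Suc_one)
  next
    case (leibniz a b k)
    let ?t = "leibniz_term K k (\<lambda>j. Gen (j,a)) (\<lambda>j. Gen (j,b))"
    let ?d = "\<lambda>(k,a). Gen (Suc k, a)"
    have t: "t = ?t" using leibniz(2) by (simp add: leibniz_term_def)
    have "aeval J (\<lambda>x. pr.cl (Gen x)) (aderiv K ?d ?t) =
      J.M.binsum k (\<lambda>i j. gen (Suc i) a \<otimes>\<^bsub>J\<^esub> gen j b \<oplus>\<^bsub>J\<^esub> gen i a \<otimes>\<^bsub>J\<^esub> gen (Suc j) b)"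
      using leibniz by (subst J.aeval_aderiv_leibniz_term) (auto simp: jet_gen_def[symmetric])
    also have "\<dots> = J.M.binsum (Suc k) (\<lambda>i j. gen i a \<otimes>\<^bsub>J\<^esub> gen j b)"
      using leibniz by (subst J.M.binsum_Suc) (auto simp: J.M.binsum_def J.M.zlin_distrib Pi_def)
    also have "\<dots> = gen (Suc k) (a \<otimes>\<^bsub>A\<^esub> b)"
      using leibniz by (simp add: gen_mult)
    finally have *: "aeval J (\<lambda>x. pr.cl (Gen x)) (aderiv K ?d ?t) = gen (Suc k) (a \<otimes>\<^bsub>A\<^esub> b)" .
    have "aderiv K ?d ?t \<in> pr.T"
    proof -
      have "aderiv K ?d u \<in> pr.T" if "u \<in> pr.T" for u
        using that by induction auto
      then show ?thesis using leibniz jet_leibniz_term_closed by simp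
    qed
    then show ?thesis unfolding t using leibniz *
      by (intro pr.acong_aevalI) (simp_all add: jet_def[symmetric] jet_gen_def)
  qed
qed auto

lemma der_derivation: "derivation K J D"
  unfolding jet_def jet_der_def by (rule pd.pres_der_derivation)

lemma der_gen: "a \<in> carrier A \<Longrightarrow> D (gen k a) = gen (Suc k) a"
  unfolding jet_gen_def jet_der_def by (simp add: pd.pres_der_Gen)

lemma jet_induct_gen [consumes 1, case_names gen add smult mult]:
  assumes x: "x \<in> carrier J"
    and g: "\<And>k a. a \<in> carrier A \<Longrightarrow> P (gen k a)"
    and a: "\<And>x y. x \<in> carrier J \<Longrightarrow> y \<in> carrier J \<Longrightarrow> P x \<Longrightarrow> P y \<Longrightarrow> P (x \<oplus>\<^bsub>J\<^esub> y)"
    and s: "\<And>c x. c \<in> carrier K \<Longrightarrow> x \<in> carrier J \<Longrightarrow> P x \<Longrightarrow> P (c \<odot>\<^bsub>J\<^esub> x)"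
    and m: "\<And>x y. x \<in> carrier J \<Longrightarrow> y \<in> carrier J \<Longrightarrow> P x \<Longrightarrow> P y \<Longrightarrow> P (x \<otimes>\<^bsub>J\<^esub> y)"
  shows "P x"
proof -
  have one: "P \<one>\<^bsub>J\<^esub>" using g[of "\<one>\<^bsub>A\<^esub>" 0] by (simp add: gen_one)
  from x have "x \<in> carrier pr.Q" by (simp add: jet_def)
  then show ?thesis
  proof (induction rule: pr.presented_induct)
    case (Gen x) then show ?case using g by (auto simp: jet_gen_def)
  qed (use a m s[OF _ J.one_closed one] in \<open>simp_all add: jet_def\<close>)
qed

text \<open>The jet algebra is generated by \<open>A\<close> as a differential algebra, so only
  symbols of order 0 appear as base case. All later uniqueness arguments rest on this form.\<close>

lemma jet_induct [consumes 1, case_names gen add smult mult der]: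
  assumes "x \<in> carrier J"
    and g: "\<And>a. a \<in> carrier A \<Longrightarrow> P (gen 0 a)"
    and "\<And>x y. x \<in> carrier J \<Longrightarrow> y \<in> carrier J \<Longrightarrow> P x \<Longrightarrow> P y \<Longrightarrow> P (x \<oplus>\<^bsub>J\<^esub> y)"
    and "\<And>c x. c \<in> carrier K \<Longrightarrow> x \<in> carrier J \<Longrightarrow> P x \<Longrightarrow> P (c \<odot>\<^bsub>J\<^esub> x)"
    and "\<And>x y. x \<in> carrier J \<Longrightarrow> y \<in> carrier J \<Longrightarrow> P x \<Longrightarrow> P y \<Longrightarrow> P (x \<otimes>\<^bsub>J\<^esub> y)"
    and d: "\<And>x. x \<in> carrier J \<Longrightarrow> P x \<Longrightarrow> P (D x)"
  shows "P x"
  using assms(1)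
proof (induction rule: jet_induct_gen)
  case (gen k a)
  then show ?case by (induction k) (auto simp: der_gen[symmetric] g d)
qed (use assms in auto)

section \<open>The universal property of the jet algebra\<close>

context
  fixes B :: "('k,'b,'p) module_scheme" and E :: "'b \<Rightarrow> 'b" and \<phi> :: "'a \<Rightarrow> 'b"
  assumes B: "algebra K B" and E: "derivation K B E" and \<phi>: "alg_hom K A B \<phi>"
begin

text \<open>The Leibniz relations of all orders hold in any differential algebra by
  \<open>derivation_pow_mult\<close>; the others only need linearity of the powers of
  \<open>E\<close>.\<close>

lemma jet_presentation_lift:
  "presentation_lift K (UNIV \<times> carrier A) (jet_rel K A) B (\<lambda>(k,a). (E ^^ k) (\<phi> a))"
proof -
  interpret B: algebra K B by (rule B)
  note [simp] = alg_homD[OF \<phi>] B.derivation_pow_closed[OF E]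
  have pow_add: "(E ^^ k) (x \<oplus>\<^bsub>B\<^esub> y) = (E ^^ k) x \<oplus>\<^bsub>B\<^esub> (E ^^ k) y"
    if "x \<in> carrier B" "y \<in> carrier B" for k x y
    using that by (induction k) (auto simp: derivationD[OF E])
  have pow_smult: "(E ^^ k) (c \<odot>\<^bsub>B\<^esub> x) = c \<odot>\<^bsub>B\<^esub> (E ^^ k) x"
    if "c \<in> carrier K" "x \<in> carrier B" for k c x
    using that by (induction k) (auto simp: derivationD[OF E])
  show ?thesis
  proof
    fix s t
    assume "(s, t) \<in> jet_rel K A"
    then show "aeval B (\<lambda>(k,a). (E ^^ k) (\<phi> a)) s = aeval B (\<lambda>(k,a). (E ^^ k) (\<phi> a)) t"
    proof (cases rule: jet_rel.cases)
      case (leibniz a b k)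
      have t: "t = leibniz_term K k (\<lambda>j. Gen (j,a)) (\<lambda>j. Gen (j,b))"
        using leibniz(2) by (simp add: leibniz_term_def)
      show ?thesis unfolding t using leibniz
        by (subst B.aeval_leibniz_term) (auto simp: B.derivation_pow_mult[OF E])
    qed (auto simp: pow_add pow_smult B.smult_one_mult)
  qed auto
qed

lemma jet_lift_hom: "alg_hom K J B (jet_lift B E \<phi>)"
  unfolding jet_def jet_lift_def by (rule presentation_lift.pres_lift_hom[OF jet_presentation_lift])

lemma jet_lift_gen: "a \<in> carrier A \<Longrightarrow> jet_lift B E \<phi> (gen k a) = (E ^^ k) (\<phi> a)"
  unfolding jet_gen_def jet_lift_def
  by (subst presentation_lift.pres_lift_Gen[OF jet_presentation_lift]) auto

lemma jet_lift_der: "x \<in> carrier J \<Longrightarrow> jet_lift B E \<phi> (D x) = E (jet_lift B E \<phi> x)"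
proof (induction rule: jet_induct_gen)
  case (gen k a)
  then show ?case by (simp add: der_gen jet_lift_gen)
next
  case (add x y)
  then show ?case by (simp add: derivationD[OF der_derivation] alg_homD[OF jet_lift_hom] derivationD[OF E])
next
  case (smult c x)
  then show ?case by (simp add: derivationD[OF der_derivation] alg_homD[OF jet_lift_hom] derivationD[OF E])
next
  case (mult x y)
  then show ?case by (simp add: derivationD[OF der_derivation] alg_homD[OF jet_lift_hom] derivationD[OF E])
qed

end

end


section \<open>Tensor products\<close>

locale tensors = A: algebra K A + B: algebra K B
  for K :: "('k,'m) ring_scheme" (structure)
    and A :: "('k,'a,'n) module_scheme" and B :: "('k,'b,'p) module_scheme"
begin

abbreviation "AB \<equiv> tensor K A B"
abbreviation "tn \<equiv> tens K A B"

sublocale pr: presentation K "carrier A \<times> carrier B" "tensor_rel K A B"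
  by unfold_locales

lemma tensor_algebra: "algebra K AB"
  unfolding tensor_def by (rule pr.presented_algebra)

sublocale AB: algebra K "tensor K A B"
  by (rule tensor_algebra)

lemma tens_closed [simp]: "a \<in> carrier A \<Longrightarrow> b \<in> carrier B \<Longrightarrow> tn a b \<in> carrier AB"
  unfolding tensor_def tens_def by simp

lemma aeval_rel: "(s,t) \<in> tensor_rel K A B \<Longrightarrow> s \<in> pr.T \<Longrightarrow> t \<in> pr.T \<Longrightarrow>
   aeval AB (\<lambda>x. pr.cl (Gen x)) s = aeval AB (\<lambda>x. pr.cl (Gen x)) t"
  using pr.aeval_rel by (simp add: tensor_def)

lemma tens_add_left: "a \<in> carrier A \<Longrightarrow> a' \<in> carrier A \<Longrightarrow> b \<in> carrier B \<Longrightarrow>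
    tn (a \<oplus>\<^bsub>A\<^esub> a') b = tn a b \<oplus>\<^bsub>AB\<^esub> tn a' b"
  using aeval_rel[OF tensor_rel.add_left[of a A a' b B]] by (simp add: tens_def)

lemma tens_add_right: "a \<in> carrier A \<Longrightarrow> b \<in> carrier B \<Longrightarrow> b' \<in> carrier B \<Longrightarrow>
    tn a (b \<oplus>\<^bsub>B\<^esub> b') = tn a b \<oplus>\<^bsub>AB\<^esub> tn a b'"
  using aeval_rel[OF tensor_rel.add_right[of a A b B b']] by (simp add: tens_def)

lemma tens_smult_left: "c \<in> carrier K \<Longrightarrow> a \<in> carrier A \<Longrightarrow> b \<in> carrier B \<Longrightarrow>
    tn (c \<odot>\<^bsub>A\<^esub> a) b = c \<odot>\<^bsub>AB\<^esub> tn a b"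
  using aeval_rel[OF tensor_rel.smult_left[of c K a A b B]] tens_closed[of a b]
  by (simp add: tens_def AB.smult_one_mult)

lemma tens_smult_right: "c \<in> carrier K \<Longrightarrow> a \<in> carrier A \<Longrightarrow> b \<in> carrier B \<Longrightarrow>
    tn a (c \<odot>\<^bsub>B\<^esub> b) = c \<odot>\<^bsub>AB\<^esub> tn a b"
  using aeval_rel[OF tensor_rel.smult_right[of c K a A b B]] tens_closed[of a b]
  by (simp add: tens_def AB.smult_one_mult)

lemma tens_one: "tn \<one>\<^bsub>A\<^esub> \<one>\<^bsub>B\<^esub> = \<one>\<^bsub>AB\<^esub>"
  using aeval_rel[OF tensor_rel.one] by (simp add: tens_def)

lemma tens_mult: "a \<in> carrier A \<Longrightarrow> a' \<in> carrier A \<Longrightarrow> b \<in> carrier B \<Longrightarrow> b' \<in> carrier B \<Longrightarrow>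
    tn (a \<otimes>\<^bsub>A\<^esub> a') (b \<otimes>\<^bsub>B\<^esub> b') = tn a b \<otimes>\<^bsub>AB\<^esub> tn a' b'"
  using aeval_rel[OF tensor_rel.mult[of a A a' b B b']] by (simp add: tens_def)

lemma tens_left_hom: "alg_hom K A AB (\<lambda>a. tn a \<one>\<^bsub>B\<^esub>)"
  by (rule alg_homI)
    (simp_all add: tens_add_left tens_smult_left tens_one tens_mult[symmetric])

lemma tens_right_hom: "alg_hom K B AB (\<lambda>b. tn \<one>\<^bsub>A\<^esub> b)"
  by (rule alg_homI)
    (simp_all add: tens_add_right tens_smult_right tens_one tens_mult[symmetric])

lemma tens_eq_mult: "a \<in> carrier A \<Longrightarrow> b \<in> carrier B \<Longrightarrow> tn a b = tn a \<one>\<^bsub>B\<^esub> \<otimes>\<^bsub>AB\<^esub> tn \<one>\<^bsub>A\<^esub> b"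
  by (simp add: tens_mult[symmetric])

lemma tens_zero_left: "b \<in> carrier B \<Longrightarrow> tn \<zero>\<^bsub>A\<^esub> b = \<zero>\<^bsub>AB\<^esub>"
  using tens_smult_left[of "\<zero>" "\<one>\<^bsub>A\<^esub>" b] by simp

lemma tens_zero_right: "a \<in> carrier A \<Longrightarrow> tn a \<zero>\<^bsub>B\<^esub> = \<zero>\<^bsub>AB\<^esub>"
  using tens_smult_right[of "\<zero>" a "\<one>\<^bsub>B\<^esub>"] by simp

lemma tens_neg_left: "a \<in> carrier A \<Longrightarrow> b \<in> carrier B \<Longrightarrow> tn (\<ominus>\<^bsub>A\<^esub> a) b = \<ominus>\<^bsub>AB\<^esub> tn a b"
  using tens_add_left[of a "\<ominus>\<^bsub>A\<^esub> a" b] AB.minus_equality[of "tn (\<ominus>\<^bsub>A\<^esub> a) b" "tn a b"]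
  by (simp add: A.r_neg tens_zero_left AB.a_comm)

lemma tens_neg_right: "a \<in> carrier A \<Longrightarrow> b \<in> carrier B \<Longrightarrow> tn a (\<ominus>\<^bsub>B\<^esub> b) = \<ominus>\<^bsub>AB\<^esub> tn a b"
  using tens_add_right[of a b "\<ominus>\<^bsub>B\<^esub> b"] AB.minus_equality[of "tn a (\<ominus>\<^bsub>B\<^esub> b)" "tn a b"]
  by (simp add: B.r_neg tens_zero_right AB.a_comm)

lemma tensor_induct [consumes 1, case_names tens add smult mult]:
  assumes x: "x \<in> carrier AB"
    and g: "\<And>a b. a \<in> carrier A \<Longrightarrow> b \<in> carrier B \<Longrightarrow> P (tn a b)"
    and a: "\<And>x y. x \<in> carrier AB \<Longrightarrow> y \<in> carrier AB \<Longrightarrow> P x \<Longrightarrow> P y \<Longrightarrow> P (x \<oplus>\<^bsub>AB\<^esub> y)"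
    and s: "\<And>c x. c \<in> carrier K \<Longrightarrow> x \<in> carrier AB \<Longrightarrow> P x \<Longrightarrow> P (c \<odot>\<^bsub>AB\<^esub> x)"
    and m: "\<And>x y. x \<in> carrier AB \<Longrightarrow> y \<in> carrier AB \<Longrightarrow> P x \<Longrightarrow> P y \<Longrightarrow> P (x \<otimes>\<^bsub>AB\<^esub> y)"
  shows "P x"
proof -
  have one: "P \<one>\<^bsub>AB\<^esub>" using g[of "\<one>\<^bsub>A\<^esub>" "\<one>\<^bsub>B\<^esub>"] by (simp add: tens_one)
  from x have "x \<in> carrier pr.Q" by (simp add: tensor_def)
  then show ?thesis
  proof (induction rule: pr.presented_induct)
    case (Gen x) then show ?case using g by (auto simp: tens_def)
  qed (use a m s[OF _ AB.one_closed one] in \<open>simp_all add: tensor_def\<close>)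
qed

section \<open>Morphisms and derivations out of a tensor product\<close>

context
  fixes C :: "('k,'c,'q) module_scheme" and f :: "'a \<Rightarrow> 'c" and g :: "'b \<Rightarrow> 'c"
  assumes C: "algebra K C" and f: "alg_hom K A C f" and g: "alg_hom K B C g"
begin

lemma tensor_presentation_lift:
  "presentation_lift K (carrier A \<times> carrier B) (tensor_rel K A B) C (\<lambda>(a,b). f a \<otimes>\<^bsub>C\<^esub> g b)"
proof -
  interpret C: algebra K C by (rule C)
  note [simp] = alg_homD[OF f] alg_homD[OF g]
  show ?thesis
  proof
    fix s t
    assume "(s, t) \<in> tensor_rel K A B"
    then show "aeval C (\<lambda>(a,b). f a \<otimes>\<^bsub>C\<^esub> g b) s = aeval C (\<lambda>(a,b). f a \<otimes>\<^bsub>C\<^esub> g b) t"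
    proof (cases rule: tensor_rel.cases)
      case (smult_right c a b)
      then show ?thesis using C.smult_assoc2[of c "g b" "f a"] by (simp add: C.smult_one_mult C.m_comm)
    next
      case (mult a a' b b')
      then show ?thesis by (simp add: C.m_ac)
    qed (auto simp: C.l_distr C.r_distr C.smult_one_mult C.smult_assoc2)
  qed auto
qed

lemma tensor_lift_hom: "alg_hom K AB C (tensor_lift C f g)"
  unfolding tensor_def tensor_lift_def
  by (rule presentation_lift.pres_lift_hom[OF tensor_presentation_lift])

lemma tensor_lift_tens:
  "a \<in> carrier A \<Longrightarrow> b \<in> carrier B \<Longrightarrow> tensor_lift C f g (tn a b) = f a \<otimes>\<^bsub>C\<^esub> g b"
  unfolding tens_def tensor_lift_def
  by (subst presentation_lift.pres_lift_Gen[OF tensor_presentation_lift]) auto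

end

context
  fixes C :: "('k,'c,'q) module_scheme" and C' :: "('k,'d,'r) module_scheme"
    and f :: "'a \<Rightarrow> 'c" and g :: "'b \<Rightarrow> 'd"
  assumes C: "algebra K C" "algebra K C'" and f: "alg_hom K A C f" and g: "alg_hom K B C' g"
begin

lemma tensor_map_presentation_lift:
  "presentation_lift K (carrier A \<times> carrier B) (tensor_rel K A B) (tensor K C C')
     (\<lambda>(a,b). tens K C C' (f a) (g b))"
proof -
  interpret C: tensors K C C' using C by (simp add: tensors_def)
  note [simp] = alg_homD[OF f] alg_homD[OF g]
  show ?thesis
  proof
    fix s t
    assume "(s, t) \<in> tensor_rel K A B"
    then show "aeval C.AB (\<lambda>(a,b). C.tn (f a) (g b)) s = aeval C.AB (\<lambda>(a,b). C.tn (f a) (g b)) t"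
      by (cases rule: tensor_rel.cases)
        (auto simp: C.AB.smult_one_mult C.tens_add_left C.tens_add_right C.tens_smult_left
          C.tens_smult_right C.tens_one C.tens_mult)
  qed auto
qed

lemma tensor_map_hom: "alg_hom K AB (tensor K C C') (tensor_map K C C' f g)"
  unfolding tensor_map_def tensor_def[of K A]
  by (rule presentation_lift.pres_lift_hom[OF tensor_map_presentation_lift])

lemma tensor_map_tens:
  "a \<in> carrier A \<Longrightarrow> b \<in> carrier B \<Longrightarrow> tensor_map K C C' f g (tn a b) = tens K C C' (f a) (g b)"
  unfolding tens_def[of K A] tensor_map_def
  by (subst presentation_lift.pres_lift_Gen[OF tensor_map_presentation_lift]) auto

end

context
  fixes D :: "'a \<Rightarrow> 'a" and E :: "'b \<Rightarrow> 'b"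
  assumes D: "derivation K A D" and E: "derivation K B E"
begin

lemma tensor_presentation_der:
  "presentation_der K (carrier A \<times> carrier B) (tensor_rel K A B)
     (\<lambda>(a,b). Plus (Gen (D a, b)) (Gen (a, E b)))"
proof
  let ?d = "\<lambda>(a,b). Plus (Gen (D a, b)) (Gen (a, E b))"
  note [simp] = derivationD[OF D] derivationD[OF E] A.derivation_one[OF D] B.derivation_one[OF E]
  note [simp] = tensor_def[symmetric] tens_def[symmetric]
  fix s t
  assume "(s, t) \<in> tensor_rel K A B" "s \<in> pr.T" "t \<in> pr.T"
  then show "(aderiv K ?d s, aderiv K ?d t) \<in> pr.C"
  proof (cases rule: tensor_rel.cases)
    case (mult a a' b b')
    then show ?thesis
      by (intro pr.acong_aevalI)
        (simp_all add: tens_add_left tens_add_right tens_mult AB.l_distr AB.r_distr AB.a_ac)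
  next
    case one
    then show ?thesis by (intro pr.acong_aevalI) (simp_all add: tens_zero_left tens_zero_right)
  qed (intro pr.acong_aevalI; simp add: AB.smult_one_mult tens_add_left tens_add_right
       tens_smult_left tens_smult_right AB.a_ac AB.smult_r_distr)+
qed (auto simp: derivationD[OF D] derivationD[OF E])

lemma tensor_der_derivation: "derivation K AB (tensor_der K A B D E)"
  unfolding tensor_der_def tensor_def
  by (rule presentation_der.pres_der_derivation[OF tensor_presentation_der])

lemma tensor_der_tens:
  "a \<in> carrier A \<Longrightarrow> b \<in> carrier B \<Longrightarrow>
   tensor_der K A B D E (tn a b) = tn (D a) b \<oplus>\<^bsub>AB\<^esub> tn a (E b)"
  using derivationD(1)[OF D] derivationD(1)[OF E]
  unfolding tens_def tensor_der_def
  by (subst presentation_der.pres_der_Gen[OF tensor_presentation_der])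
    (auto simp: tensor_def pr.aclass_Plus)

end

end

lemma (in algebra) mult_smult_one:
  "c \<in> carrier R \<Longrightarrow> x \<in> carrier M \<Longrightarrow> x \<otimes>\<^bsub>M\<^esub> (c \<odot>\<^bsub>M\<^esub> \<one>\<^bsub>M\<^esub>) = c \<odot>\<^bsub>M\<^esub> x"
  using smult_assoc2[of c "\<one>\<^bsub>M\<^esub>" x] by (simp add: m_comm)

section \<open>Derivations with values in modules\<close>

text \<open>A \<open>K\<close>-linear derivation of \<open>A\<close> with values in the
  \<open>V\<close>-module \<open>M\<close>, on which \<open>A\<close> acts through \<open>f\<close>.
  Since \<open>M\<close> has scalars in \<open>V\<close> only, an element of \<open>K\<close> acts
  through its multiple of the unit of \<open>V\<close>.\<close>

definition mder ::
  "('k,'m) ring_scheme \<Rightarrow> ('k,'a,'n) module_scheme \<Rightarrow> ('k,'v,'p) module_scheme \<Rightarrow>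
   ('v,'q,'r) module_scheme \<Rightarrow> ('a \<Rightarrow> 'v) \<Rightarrow> ('a \<Rightarrow> 'q) \<Rightarrow> bool"
where
  "mder K A V M f \<xi> \<longleftrightarrow>
     (\<forall>a\<in>carrier A. \<xi> a \<in> carrier M) \<and>
     (\<forall>a\<in>carrier A. \<forall>b\<in>carrier A. \<xi> (a \<oplus>\<^bsub>A\<^esub> b) = \<xi> a \<oplus>\<^bsub>M\<^esub> \<xi> b) \<and>
     (\<forall>c\<in>carrier K. \<forall>a\<in>carrier A. \<xi> (c \<odot>\<^bsub>A\<^esub> a) = (c \<odot>\<^bsub>V\<^esub> \<one>\<^bsub>V\<^esub>) \<odot>\<^bsub>M\<^esub> \<xi> a) \<and>
     (\<forall>a\<in>carrier A. \<forall>b\<in>carrier A.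
        \<xi> (a \<otimes>\<^bsub>A\<^esub> b) = f a \<odot>\<^bsub>M\<^esub> \<xi> b \<oplus>\<^bsub>M\<^esub> f b \<odot>\<^bsub>M\<^esub> \<xi> a)"

lemma mderD:
  assumes "mder K A V M f \<xi>"
  shows "\<And>a. a \<in> carrier A \<Longrightarrow> \<xi> a \<in> carrier M"
    "\<And>a b. a \<in> carrier A \<Longrightarrow> b \<in> carrier A \<Longrightarrow> \<xi> (a \<oplus>\<^bsub>A\<^esub> b) = \<xi> a \<oplus>\<^bsub>M\<^esub> \<xi> b"
    "\<And>c a. c \<in> carrier K \<Longrightarrow> a \<in> carrier A \<Longrightarrow> \<xi> (c \<odot>\<^bsub>A\<^esub> a) = (c \<odot>\<^bsub>V\<^esub> \<one>\<^bsub>V\<^esub>) \<odot>\<^bsub>M\<^esub> \<xi> a"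
    "\<And>a b. a \<in> carrier A \<Longrightarrow> b \<in> carrier A \<Longrightarrow>
       \<xi> (a \<otimes>\<^bsub>A\<^esub> b) = f a \<odot>\<^bsub>M\<^esub> \<xi> b \<oplus>\<^bsub>M\<^esub> f b \<odot>\<^bsub>M\<^esub> \<xi> a"
  using assms by (auto simp: mder_def)

lemma mderI:
  assumes "\<And>a. a \<in> carrier A \<Longrightarrow> \<xi> a \<in> carrier M"
    "\<And>a b. a \<in> carrier A \<Longrightarrow> b \<in> carrier A \<Longrightarrow> \<xi> (a \<oplus>\<^bsub>A\<^esub> b) = \<xi> a \<oplus>\<^bsub>M\<^esub> \<xi> b"
    "\<And>c a. c \<in> carrier K \<Longrightarrow> a \<in> carrier A \<Longrightarrow> \<xi> (c \<odot>\<^bsub>A\<^esub> a) = (c \<odot>\<^bsub>V\<^esub> \<one>\<^bsub>V\<^esub>) \<odot>\<^bsub>M\<^esub> \<xi> a"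
    "\<And>a b. a \<in> carrier A \<Longrightarrow> b \<in> carrier A \<Longrightarrow>
       \<xi> (a \<otimes>\<^bsub>A\<^esub> b) = f a \<odot>\<^bsub>M\<^esub> \<xi> b \<oplus>\<^bsub>M\<^esub> f b \<odot>\<^bsub>M\<^esub> \<xi> a"
  shows "mder K A V M f \<xi>"
  using assms by (auto simp: mder_def)

text \<open>The square-zero extension turns module-valued derivations into algebra morphisms.\<close>

definition sqz :: "('k,'v,'p) module_scheme \<Rightarrow> ('v,'q,'r) module_scheme \<Rightarrow> ('k,'v \<times> 'q) module" where
  "sqz V M = \<lparr>
     carrier = carrier V \<times> carrier M,
     monoid.mult = (\<lambda>(x,p) (y,q). (x \<otimes>\<^bsub>V\<^esub> y, x \<odot>\<^bsub>M\<^esub> q \<oplus>\<^bsub>M\<^esub> y \<odot>\<^bsub>M\<^esub> p)),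
     one = (\<one>\<^bsub>V\<^esub>, \<zero>\<^bsub>M\<^esub>),
     zero = (\<zero>\<^bsub>V\<^esub>, \<zero>\<^bsub>M\<^esub>),
     add = (\<lambda>(x,p) (y,q). (x \<oplus>\<^bsub>V\<^esub> y, p \<oplus>\<^bsub>M\<^esub> q)),
     smult = (\<lambda>c (x,p). (c \<odot>\<^bsub>V\<^esub> x, (c \<odot>\<^bsub>V\<^esub> \<one>\<^bsub>V\<^esub>) \<odot>\<^bsub>M\<^esub> p))\<rparr>"

locale sqz_ext = V: algebra K V + M: module V M
  for K :: "('k,'m) ring_scheme" (structure)
    and V :: "('k,'v,'p) module_scheme" and M :: "('v,'q,'r) module_scheme"
begin

abbreviation "Z \<equiv> sqz V M"

lemma sqz_simps [simp]:
  "carrier Z = carrier V \<times> carrier M"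
  "(x,p) \<otimes>\<^bsub>Z\<^esub> (y,q) = (x \<otimes>\<^bsub>V\<^esub> y, x \<odot>\<^bsub>M\<^esub> q \<oplus>\<^bsub>M\<^esub> y \<odot>\<^bsub>M\<^esub> p)"
  "\<one>\<^bsub>Z\<^esub> = (\<one>\<^bsub>V\<^esub>, \<zero>\<^bsub>M\<^esub>)" "\<zero>\<^bsub>Z\<^esub> = (\<zero>\<^bsub>V\<^esub>, \<zero>\<^bsub>M\<^esub>)"
  "(x,p) \<oplus>\<^bsub>Z\<^esub> (y,q) = (x \<oplus>\<^bsub>V\<^esub> y, p \<oplus>\<^bsub>M\<^esub> q)"
  "c \<odot>\<^bsub>Z\<^esub> (x,p) = (c \<odot>\<^bsub>V\<^esub> x, (c \<odot>\<^bsub>V\<^esub> \<one>\<^bsub>V\<^esub>) \<odot>\<^bsub>M\<^esub> p)"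
  by (simp_all add: sqz_def)

lemma sqz_cring: "cring Z"
proof (rule cringI)
  show "abelian_group Z"
  proof (rule abelian_groupI)
    fix x assume "x \<in> carrier Z"
    then show "\<exists>y\<in>carrier Z. y \<oplus>\<^bsub>Z\<^esub> x = \<zero>\<^bsub>Z\<^esub>"
      by (intro bexI[of _ "(\<ominus>\<^bsub>V\<^esub> fst x, \<ominus>\<^bsub>M\<^esub> snd x)"]) (auto simp: V.l_neg M.M.l_neg)
  qed (auto simp: V.a_ac M.M.a_ac)
  show "comm_monoid Z"
    by (rule comm_monoidI)
      (auto simp: V.m_ac M.smult_r_distr M.smult_assoc1[symmetric] M.M.a_ac)
qed (auto simp: V.l_distr M.smult_l_distr M.smult_r_distr M.M.a_ac)

lemma sqz_algebra: "algebra K Z"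
proof (rule algebraI)
  show "cring Z" by (rule sqz_cring)
  fix a x y assume "a \<in> carrier K" "x \<in> carrier Z" "y \<in> carrier Z"
  then show "(a \<odot>\<^bsub>Z\<^esub> x) \<otimes>\<^bsub>Z\<^esub> y = a \<odot>\<^bsub>Z\<^esub> (x \<otimes>\<^bsub>Z\<^esub> y)"
    by (auto simp: V.smult_assoc2 M.smult_r_distr M.smult_assoc1[symmetric] V.smult_one_mult
        V.mult_smult_one)
next
  fix a b x assume "a \<in> carrier K" "b \<in> carrier K" "x \<in> carrier Z"
  then show "(a \<otimes> b) \<odot>\<^bsub>Z\<^esub> x = a \<odot>\<^bsub>Z\<^esub> (b \<odot>\<^bsub>Z\<^esub> x)"
    by (auto simp: V.smult_assoc1 M.smult_assoc1[symmetric] V.smult_one_mult)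
qed (auto simp: V.smult_l_distr V.smult_r_distr M.smult_l_distr M.smult_r_distr V.R.is_cring)

lemma mder_alg_hom:
  assumes "algebra K A" "alg_hom K A V f" "mder K A V M f \<xi>"
  shows "alg_hom K A Z (\<lambda>a. (f a, \<xi> a))"
proof (rule alg_homI)
  interpret A: algebra K A by fact
  note [simp] = alg_homD[OF assms(2)] mderD[OF assms(3)]
  have "\<xi> (\<one>\<^bsub>A\<^esub> \<otimes>\<^bsub>A\<^esub> \<one>\<^bsub>A\<^esub>) = \<xi> \<one>\<^bsub>A\<^esub> \<oplus>\<^bsub>M\<^esub> \<xi> \<one>\<^bsub>A\<^esub>"
    by (simp only: mderD(4)[OF assms(3)] A.one_closed) simp
  then have "\<xi> \<one>\<^bsub>A\<^esub> \<oplus>\<^bsub>M\<^esub> \<xi> \<one>\<^bsub>A\<^esub> = \<xi> \<one>\<^bsub>A\<^esub>" by simp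
  then show "(f \<one>\<^bsub>A\<^esub>, \<xi> \<one>\<^bsub>A\<^esub>) = \<one>\<^bsub>Z\<^esub>" by (simp add: M.M.add.l_cancel_one)
qed (auto simp: alg_homD[OF assms(2)] mderD[OF assms(3)])

lemma alg_hom_mder:
  assumes F: "alg_hom K A Z F" and f: "\<And>a. a \<in> carrier A \<Longrightarrow> fst (F a) = f a"
  shows "mder K A V M f (\<lambda>a. snd (F a))"
proof -
  have eq: "F a = (f a, snd (F a))" if "a \<in> carrier A" for a
    using f[OF that] by (metis prod.collapse)
  have cl: "f a \<in> carrier V" "snd (F a) \<in> carrier M" if "a \<in> carrier A" for a
    using alg_homD(2)[OF F that] eq[OF that] by (metis sqz_simps(1) mem_Sigma_iff)+
  show ?thesis
  proof (rule mderI)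
    fix a assume "a \<in> carrier A" then show "snd (F a) \<in> carrier M" by (rule cl)
  next
    fix a b assume ab: "a \<in> carrier A" "b \<in> carrier A"
    show "snd (F (a \<oplus>\<^bsub>A\<^esub> b)) = snd (F a) \<oplus>\<^bsub>M\<^esub> snd (F b)"
      unfolding alg_homD(3)[OF F ab]
      by (subst eq[OF ab(1)], subst eq[OF ab(2)]) simp
    show "snd (F (a \<otimes>\<^bsub>A\<^esub> b)) = f a \<odot>\<^bsub>M\<^esub> snd (F b) \<oplus>\<^bsub>M\<^esub> f b \<odot>\<^bsub>M\<^esub> snd (F a)"
      unfolding alg_homD(4)[OF F ab]
      by (subst eq[OF ab(1)], subst eq[OF ab(2)]) simp
  next
    fix c a assume ca: "c \<in> carrier K" "a \<in> carrier A"
    show "snd (F (c \<odot>\<^bsub>A\<^esub> a)) = (c \<odot>\<^bsub>V\<^esub> \<one>\<^bsub>V\<^esub>) \<odot>\<^bsub>M\<^esub> snd (F a)"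
      unfolding alg_homD(5)[OF F ca] by (subst eq[OF ca(2)]) simp
  qed
qed

end

context jets
begin

text \<open>The compatibility of \<open>E\<close> with \<open>D\<close> says exactly that
  \<open>(x, p) \<mapsto> (D x, E p)\<close> obeys the Leibniz rule in the square-zero extension;
  the universal property then lifts \<open>a \<mapsto> (gen 0 a, d a)\<close>. The operator
  \<open>E\<close> is kept general because the two arguments of the bracket use different ones,
  -\<lambda> and \<lambda> + \<partial>.\<close>

lemma jet_mder_extension:
  assumes M: "module J M" and E: "additive M M E"
    and ED: "\<And>x p. x \<in> carrier J \<Longrightarrow> p \<in> carrier M \<Longrightarrow>
      E (x \<odot>\<^bsub>M\<^esub> p) = D x \<odot>\<^bsub>M\<^esub> p \<oplus>\<^bsub>M\<^esub> x \<odot>\<^bsub>M\<^esub> E p"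
    and d: "mder K A J M (gen 0) d"
  obtains \<xi> where "mder K J J M (\<lambda>x. x) \<xi>"
    "\<And>x. x \<in> carrier J \<Longrightarrow> \<xi> (D x) = E (\<xi> x)" "\<And>a. a \<in> carrier A \<Longrightarrow> \<xi> (gen 0 a) = d a"
proof -
  interpret M: module J M by fact
  interpret sqz_ext K J M
    by (intro sqz_ext.intro jet_algebra M)
  let ?E = "\<lambda>(x,p). (D x, E p)" and ?\<phi> = "\<lambda>a. (gen 0 a, d a)"
  note [simp] = derivationD[OF der_derivation] additiveD[OF E]
  note D1 = J.derivation_one[OF der_derivation]
  have E': "derivation K Z ?E"
    unfolding derivation_def by (auto simp: ED D1 M.M.a_ac)
  have \<phi>: "alg_hom K A Z ?\<phi>"
    by (rule mder_alg_hom[OF A.algebra_axioms gen_hom d])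
  let ?F = "jet_lift Z ?E ?\<phi>"
  note F = jet_lift_hom[OF sqz_algebra E' \<phi>] jet_lift_gen[OF sqz_algebra E' \<phi>]
    jet_lift_der[OF sqz_algebra E' \<phi>]
  \<comment> \<open>The first component is an endomorphism of the differential algebra fixing
    \<open>A\<close>, hence the identity; this makes the second component a derivation over the
    identity.\<close>
  have fst: "fst (?F x) = x" if "x \<in> carrier J" for x
    using that
  proof (induction rule: jet_induct)
    case (gen a) then show ?case by (simp add: F)
  next
    case (add x y) then show ?case
      by (cases "?F x", cases "?F y") (auto simp: alg_homD[OF F(1)])
  next
    case (smult c x) then show ?case
      by (cases "?F x") (auto simp: alg_homD[OF F(1)])
  next
    case (mult x y) then show ?case
      by (cases "?F x", cases "?F y") (auto simp: alg_homD[OF F(1)])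
  next
    case (der x) then show ?case
      by (cases "?F x") (auto simp: F)
  qed
  show ?thesis
  proof (rule that)
    show "mder K J J M (\<lambda>x. x) (\<lambda>x. snd (?F x))"
      by (rule alg_hom_mder[OF F(1) fst])
    show "snd (?F (D x)) = E (snd (?F x))" if "x \<in> carrier J" for x
      using that by (cases "?F x") (simp add: F)
    show "snd (?F (gen 0 a)) = d a" if "a \<in> carrier A" for a
      using that by (simp add: F)
  qed
qed

end

context tensors
begin

text \<open>The two derivations give two morphisms into the square-zero extension, and their product
  on \<open>a \<otimes> b\<close> is the universal extension; no compatibility between
  \<open>d\<close> and \<open>e\<close> is required.\<close>

lemma tensor_mder_extension:
  assumes M: "module AB M"
    and d: "mder K A AB M (\<lambda>a. tn a \<one>\<^bsub>B\<^esub>) d" and e: "mder K B AB M (\<lambda>b. tn \<one>\<^bsub>A\<^esub> b) e"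
  obtains \<xi> where "mder K AB AB M (\<lambda>x. x) \<xi>"
    "\<And>a b. a \<in> carrier A \<Longrightarrow> b \<in> carrier B \<Longrightarrow>
       \<xi> (tn a b) = tn a \<one>\<^bsub>B\<^esub> \<odot>\<^bsub>M\<^esub> e b \<oplus>\<^bsub>M\<^esub> tn \<one>\<^bsub>A\<^esub> b \<odot>\<^bsub>M\<^esub> d a"
proof -
  interpret M: module AB M by fact
  interpret sqz_ext K AB M
    by (intro sqz_ext.intro tensor_algebra M)
  let ?f = "\<lambda>a. (tn a \<one>\<^bsub>B\<^esub>, d a)" and ?g = "\<lambda>b. (tn \<one>\<^bsub>A\<^esub> b, e b)"
  have f: "alg_hom K A Z ?f"
    by (rule mder_alg_hom[OF A.algebra_axioms tens_left_hom d])
  have g: "alg_hom K B Z ?g"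
    by (rule mder_alg_hom[OF B.algebra_axioms tens_right_hom e])
  let ?F = "tensor_lift Z ?f ?g"
  note F = tensor_lift_hom[OF sqz_algebra f g] tensor_lift_tens[OF sqz_algebra f g]
  have fst: "fst (?F x) = x" if "x \<in> carrier AB" for x
    using that
  proof (induction rule: tensor_induct)
    case (tens a b) then show ?case by (simp add: F tens_eq_mult[symmetric])
  next
    case (add x y) then show ?case
      by (cases "?F x", cases "?F y") (auto simp: alg_homD[OF F(1)])
  next
    case (smult c x) then show ?case
      by (cases "?F x") (auto simp: alg_homD[OF F(1)])
  next
    case (mult x y) then show ?case
      by (cases "?F x", cases "?F y") (auto simp: alg_homD[OF F(1)])
  qed
  show ?thesis
  proof (rule that)
    show "mder K AB AB M (\<lambda>x. x) (\<lambda>x. snd (?F x))"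
      by (rule alg_hom_mder[OF F(1) fst])
    show "snd (?F (tn a b)) = tn a \<one>\<^bsub>B\<^esub> \<odot>\<^bsub>M\<^esub> e b \<oplus>\<^bsub>M\<^esub> tn \<one>\<^bsub>A\<^esub> b \<odot>\<^bsub>M\<^esub> d a"
      if "a \<in> carrier A" "b \<in> carrier B" for a b
      using that by (simp add: F)
  qed
qed

end

section \<open>Polynomials in \<open>\<lambda>\<close> over a differential algebra\<close>

text \<open>Polynomials in \<open>UP\<close> are their own coefficient functions. The definition of
  a \<lambda>-bracket writes \<open>p n\<close>, the theory of \<open>UP\<close> writes
  \<open>coeff\<close>; this passes between the two.\<close>

lemma UP_coeff_eq: "p \<in> carrier (UP R) \<Longrightarrow> coeff (UP R) p n = p n"
  by (simp add: UP_def)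

lemma UP_mem: "p \<in> carrier (UP R) \<longleftrightarrow> (\<forall>n. p n \<in> carrier R) \<and> (\<exists>N. \<forall>n>N. p n = \<zero>\<^bsub>R\<^esub>)"
  by (auto simp: UP_def up_def bound_def)

lemma UP_add_apply:
  "p \<in> carrier (UP R) \<Longrightarrow> q \<in> carrier (UP R) \<Longrightarrow> (p \<oplus>\<^bsub>UP R\<^esub> q) n = p n \<oplus>\<^bsub>R\<^esub> q n"
  by (simp add: UP_def)

lemma UP_monom_apply:
  "v \<in> carrier R \<Longrightarrow> monom (UP R) v m n = (if n = m then v else \<zero>\<^bsub>R\<^esub>)"
  by (simp add: UP_def)

locale diff_algebra = V: algebra K V
  for K :: "('k,'m) ring_scheme" (structure) and V :: "('k,'v,'n) module_scheme" +
  fixes D :: "'v \<Rightarrow> 'v"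
  assumes der: "derivation K V D"
begin

lemmas D_simps [simp] = derivationD[OF der]

sublocale D: additive_map V V D by (rule V.derivation_additive[OF der])

abbreviation "U \<equiv> UP V"

sublocale U: UP_cring V "UP V" by unfold_locales

abbreviation "cf \<equiv> coeff (UP V)"

lemma U_mem: "p \<in> carrier U \<longleftrightarrow> (\<forall>n. p n \<in> carrier V) \<and> (\<exists>N. \<forall>n>N. p n = \<zero>\<^bsub>V\<^esub>)"
  by (rule UP_mem)

lemma cf_eq: "p \<in> carrier U \<Longrightarrow> cf p n = p n"
  by (rule UP_coeff_eq)

lemma up_induct [consumes 1, case_names monom add]:
  assumes p: "p \<in> carrier U" and m: "\<And>v n. v \<in> carrier V \<Longrightarrow> P (monom U v n)"
    and a: "\<And>p q. p \<in> carrier U \<Longrightarrow> q \<in> carrier U \<Longrightarrow> P p \<Longrightarrow> P q \<Longrightarrow> P (p \<oplus>\<^bsub>U\<^esub> q)"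
  shows "P p"
proof -
  have "P (\<Oplus>\<^bsub>U\<^esub>i\<in>S. monom U (coeff U p i) i)" if "finite S" for S
    using that
  proof (induction S rule: finite_induct)
    case empty
    then show ?case using m[of "\<zero>\<^bsub>V\<^esub>" 0] by simp
  next
    case (insert i S)
    then show ?case using p by (subst U.P.finsum_insert) (auto intro!: a m)
  qed
  from this[of "{..deg V p}"] show ?thesis using U.up_repr[OF p] by simp
qed

section \<open>The operators \<lambda> and \<lambda> + \<partial>\<close>

definition lm :: "(nat \<Rightarrow> 'v) \<Rightarrow> nat \<Rightarrow> 'v" where "lm p = lam V \<otimes>\<^bsub>U\<^esub> p"

abbreviation "T \<equiv> lam_plus_del V D"

lemma lam_closed [simp]: "lam V \<in> carrier U"
  by (simp add: lam_def)

lemma lm_closed [simp]: "p \<in> carrier U \<Longrightarrow> lm p \<in> carrier U"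
  by (simp add: lm_def)

lemma cf_lm: "p \<in> carrier U \<Longrightarrow> cf (lm p) n = (case n of 0 \<Rightarrow> \<zero>\<^bsub>V\<^esub> | Suc m \<Rightarrow> cf p m)"
proof (cases n)
  assume p: "p \<in> carrier U"
  case 0
  then show ?thesis using p by (simp add: lm_def lam_def)
next
  assume p: "p \<in> carrier U"
  case (Suc m)
  then show ?thesis using p U.coeff_monom_mult[of "\<one>\<^bsub>V\<^esub>" p 1 m]
    by (simp add: lm_def lam_def del: U.coeff_mult)
qed

lemma D_coeff_closed [simp]: "p \<in> carrier U \<Longrightarrow> (\<lambda>n. D (p n)) \<in> carrier U"
  unfolding U_mem using D.zero D.closed by metis

lemma cf_D: "p \<in> carrier U \<Longrightarrow> cf (\<lambda>n. D (p n)) n = D (cf p n)"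
  by (simp add: cf_eq)

lemma T_closed [simp]: "p \<in> carrier U \<Longrightarrow> T p \<in> carrier U"
  by (simp add: lam_plus_del_def)

lemma cf_T: "p \<in> carrier U \<Longrightarrow> cf (T p) n = cf (lm p) n \<oplus>\<^bsub>V\<^esub> D (cf p n)"
  by (simp add: lam_plus_del_def lm_def[symmetric] cf_D del: U.coeff_mult)

lemma lm_additive: "additive U U lm"
  by (rule additiveI) (simp_all add: lm_def U.P.r_distr)

lemma T_additive: "additive U U T"
  by (rule additiveI) (auto intro!: U.up_eqI simp: cf_T cf_lm V.a_ac split: nat.split)

sublocale lm: additive_map U U lm by unfold_locales (rule lm_additive)
sublocale T: additive_map U U T by unfold_locales (rule T_additive)

lemma lm_T: "p \<in> carrier U \<Longrightarrow> T (lm p) = lm (T p)"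
  by (rule U.up_eqI) (auto simp: cf_T cf_lm split: nat.split)

lemma lm_smult: "x \<in> carrier V \<Longrightarrow> p \<in> carrier U \<Longrightarrow> lm (x \<odot>\<^bsub>U\<^esub> p) = x \<odot>\<^bsub>U\<^esub> lm p"
  by (rule U.up_eqI) (auto simp: cf_lm split: nat.split)

lemma T_smult: "x \<in> carrier V \<Longrightarrow> p \<in> carrier U \<Longrightarrow> T (x \<odot>\<^bsub>U\<^esub> p) = D x \<odot>\<^bsub>U\<^esub> p \<oplus>\<^bsub>U\<^esub> x \<odot>\<^bsub>U\<^esub> T p"
  by (rule U.up_eqI) (auto simp: cf_T cf_lm V.r_distr V.a_ac split: nat.split)

lemma lm_monom: "v \<in> carrier V \<Longrightarrow> lm (monom U v n) = monom U v (Suc n)"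
  by (rule U.up_eqI) (auto simp: cf_lm split: nat.split)

lemma T_monom: "v \<in> carrier V \<Longrightarrow> T (monom U v n) = monom U v (Suc n) \<oplus>\<^bsub>U\<^esub> monom U (D v) n"
  by (rule U.up_eqI) (auto simp: cf_T cf_lm split: nat.split)

lemma smult_monom: "x \<in> carrier V \<Longrightarrow> v \<in> carrier V \<Longrightarrow> x \<odot>\<^bsub>U\<^esub> monom U v n = monom U (x \<otimes>\<^bsub>V\<^esub> v) n"
  by (rule U.up_eqI) auto

lemma T_pow_closed [simp]: "p \<in> carrier U \<Longrightarrow> (T ^^ n) p \<in> carrier U"
  by (induction n) auto

lemma T_pow_additive: "additive U U (T ^^ n)"
  by (induction n) (auto simp: additive_def)

lemma T_pow_add [simp]: "p \<in> carrier U \<Longrightarrow> q \<in> carrier U \<Longrightarrow> (T ^^ n) (p \<oplus>\<^bsub>U\<^esub> q) = (T ^^ n) p \<oplus>\<^bsub>U\<^esub> (T ^^ n) q"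
  using T_pow_additive by (simp add: additive_def)

lemma lm_T_pow: "p \<in> carrier U \<Longrightarrow> (T ^^ n) (lm p) = lm ((T ^^ n) p)"
  by (induction n) (auto simp: lm_T)

definition nT :: "(nat \<Rightarrow> 'v) \<Rightarrow> nat \<Rightarrow> 'v" where "nT q = \<ominus>\<^bsub>U\<^esub> T q"

lemma nT_closed [simp]: "p \<in> carrier U \<Longrightarrow> nT p \<in> carrier U"
  by (simp add: nT_def)

lemma nT_pow_closed [simp]: "p \<in> carrier U \<Longrightarrow> (nT ^^ n) p \<in> carrier U"
  by (induction n) auto

lemma nT_additive: "additive U U nT"
  by (rule additiveI) (auto simp: nT_def U.P.minus_add)

sublocale nT: additive_map U U nT by unfold_locales (rule nT_additive)

lemma nT_pow_additive: "additive U U (nT ^^ n)"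
  by (induction n) (auto simp: additive_def)

lemma nT_pow_add [simp]: "p \<in> carrier U \<Longrightarrow> q \<in> carrier U \<Longrightarrow> (nT ^^ n) (p \<oplus>\<^bsub>U\<^esub> q) = (nT ^^ n) p \<oplus>\<^bsub>U\<^esub> (nT ^^ n) q"
  using nT_pow_additive by (simp add: additive_def)

lemma lm_nT_pow: "p \<in> carrier U \<Longrightarrow> (nT ^^ n) (lm p) = lm ((nT ^^ n) p)"
  by (induction n) (auto simp: nT_def lm_T)

text \<open>The additive map whose value on \<open>v \<lambda>^n\<close> is \<open>g n v\<close>.
  Both \<open>shift_arrow\<close> and \<open>neg_shift\<close> are of this kind, so identities about
  them can be tested on monomials.\<close>

definition upext :: "(nat \<Rightarrow> 'v \<Rightarrow> nat \<Rightarrow> 'v) \<Rightarrow> (nat \<Rightarrow> 'v) \<Rightarrow> nat \<Rightarrow> 'v" where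
  "upext g p = (\<Oplus>\<^bsub>U\<^esub>n\<in>{..deg V p}. g n (p n))"

context
  fixes g :: "nat \<Rightarrow> 'v \<Rightarrow> nat \<Rightarrow> 'v"
  assumes g: "\<And>n. additive V U (g n)"
begin

text \<open>The degree depends on \<open>p\<close>, which obstructs additivity; any bound beyond
  which the coefficients vanish gives the same sum, so two polynomials can be summed over one
  range.\<close>

lemma upext_bound:
  assumes p: "p \<in> carrier U" and N: "\<And>n. n > N \<Longrightarrow> p n = \<zero>\<^bsub>V\<^esub>"
  shows "upext g p = (\<Oplus>\<^bsub>U\<^esub>n\<in>{..N}. g n (p n))"
proof -
  have g0: "g n \<zero>\<^bsub>V\<^esub> = \<zero>\<^bsub>U\<^esub>" for n
    using additive_map.zero[of V U "g n"] V.additive_mapI[OF U.P.abelian_group_axioms g] by simp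
  have cl: "g n (p n) \<in> carrier U" for n
    using additiveD(1)[OF g] p by (simp add: U_mem)
  have "deg V p \<le> N"
    using U.deg_aboveI[of N p] p N by (simp add: cf_eq)
  then show ?thesis unfolding upext_def
    using U.deg_aboveD[of p] p cl
    by (intro U.P.add.finprod_mono_neutral_cong_left) (auto simp: cf_eq g0)
qed

lemma upext_monom: assumes "v \<in> carrier V" shows "upext g (monom U v n) = g n v"
proof -
  have g0: "g i \<zero>\<^bsub>V\<^esub> = \<zero>\<^bsub>U\<^esub>" for i
    using additive_map.zero[of V U "g i"] V.additive_mapI[OF U.P.abelian_group_axioms g] by simp
  have m: "monom U v n i = (if i = n then v else \<zero>\<^bsub>V\<^esub>)" for i
    using assms by (simp add: UP_monom_apply)
  have "upext g (monom U v n) = (\<Oplus>\<^bsub>U\<^esub>i\<in>{..n}. if n = i then g i v else \<zero>\<^bsub>U\<^esub>)"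
    using assms additiveD(1)[OF g] by (subst upext_bound[of _ n]) (auto simp: m g0 intro!: U.P.finsum_cong')
  also have "\<dots> = g n v"
    using assms additiveD(1)[OF g] by (intro U.P.finsum_singleton) auto
  finally show ?thesis .
qed

lemma upext_additive: "additive U U (upext g)"
proof (rule additiveI)
  fix p assume "p \<in> carrier U"
  then show "upext g p \<in> carrier U"
    unfolding upext_def using additiveD(1)[OF g] by (intro U.P.finsum_closed) (auto simp: U_mem)
next
  fix p q assume p: "p \<in> carrier U" and q: "q \<in> carrier U"
  obtain N where N: "\<And>n. n > N \<Longrightarrow> p n = \<zero>\<^bsub>V\<^esub>" using p by (auto simp: U_mem)
  obtain M where M: "\<And>n. n > M \<Longrightarrow> q n = \<zero>\<^bsub>V\<^esub>" using q by (auto simp: U_mem)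
  have pq: "(p \<oplus>\<^bsub>U\<^esub> q) n = p n \<oplus>\<^bsub>V\<^esub> q n" for n
    using p q by (rule UP_add_apply)
  have pn: "p n \<in> carrier V" "q n \<in> carrier V" for n using p q by (auto simp: U_mem)
  have "upext g (p \<oplus>\<^bsub>U\<^esub> q) = (\<Oplus>\<^bsub>U\<^esub>n\<in>{..max N M}. g n ((p \<oplus>\<^bsub>U\<^esub> q) n))"
    using p q N M by (intro upext_bound) (auto simp: pq)
  also have "\<dots> = (\<Oplus>\<^bsub>U\<^esub>n\<in>{..max N M}. g n (p n) \<oplus>\<^bsub>U\<^esub> g n (q n))"
    using pn additiveD[OF g] by (intro U.P.finsum_cong') (auto simp: pq)
  also have "\<dots> = (\<Oplus>\<^bsub>U\<^esub>n\<in>{..max N M}. g n (p n)) \<oplus>\<^bsub>U\<^esub> (\<Oplus>\<^bsub>U\<^esub>n\<in>{..max N M}. g n (q n))"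
    using pn additiveD[OF g] by (intro U.P.finsum_addf) auto
  also have "\<dots> = upext g p \<oplus>\<^bsub>U\<^esub> upext g q"
    using p q N M by (simp add: upext_bound[of _ "max N M"])
  finally show "upext g (p \<oplus>\<^bsub>U\<^esub> q) = upext g p \<oplus>\<^bsub>U\<^esub> upext g q" .
qed

end

text \<open>\<open>act x p\<close> is the action of \<open>x\<close> at the first point on distributions supported on the
  diagonal; multiplication of the coefficients is the action at the second point.\<close>

definition act :: "'v \<Rightarrow> (nat \<Rightarrow> 'v) \<Rightarrow> nat \<Rightarrow> 'v" where "act x p = shift_arrow V D p x"

abbreviation "sg \<equiv> neg_shift V D"

lemma act_upext: "act x = upext (\<lambda>n v. v \<odot>\<^bsub>U\<^esub> (T ^^ n) (monom U x 0))"
  by (rule ext) (simp add: act_def shift_arrow_def upext_def)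

lemma sigma_upext: "sg = upext (\<lambda>n v. (nT ^^ n) (monom U v 0))"
  by (rule ext) (simp add: neg_shift_def upext_def nT_def[abs_def])

lemma act_additive: "x \<in> carrier V \<Longrightarrow> additive U U (act x)"
  unfolding act_upext
  by (rule upext_additive, rule additiveI) (simp_all add: U.smult_l_distr)

lemma act_monom: "x \<in> carrier V \<Longrightarrow> v \<in> carrier V \<Longrightarrow> act x (monom U v n) = v \<odot>\<^bsub>U\<^esub> (T ^^ n) (monom U x 0)"
  unfolding act_upext
  by (rule upext_monom, rule additiveI) (simp_all add: U.smult_l_distr)

lemma sigma_additive: "additive U U sg"
  unfolding sigma_upext
  by (rule upext_additive, rule additiveI) simp_all

lemma sigma_monom: "v \<in> carrier V \<Longrightarrow> sg (monom U v n) = (nT ^^ n) (monom U v 0)"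
  unfolding sigma_upext
  by (rule upext_monom, rule additiveI) simp_all

sublocale sigma: additive_map U U "neg_shift V D" by unfold_locales (rule sigma_additive)

lemma act_closed [simp]: "x \<in> carrier V \<Longrightarrow> p \<in> carrier U \<Longrightarrow> act x p \<in> carrier U"
  and act_add_right [simp]: "x \<in> carrier V \<Longrightarrow> p \<in> carrier U \<Longrightarrow> q \<in> carrier U \<Longrightarrow>
    act x (p \<oplus>\<^bsub>U\<^esub> q) = act x p \<oplus>\<^bsub>U\<^esub> act x q"
  using act_additive by (auto simp: additive_def)

lemma act_neg [simp]: "x \<in> carrier V \<Longrightarrow> p \<in> carrier U \<Longrightarrow> act x (\<ominus>\<^bsub>U\<^esub> p) = \<ominus>\<^bsub>U\<^esub> act x p"
  by (rule additive_map.neg[OF U.P.additive_mapI[OF U.P.abelian_group_axioms act_additive]])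

lemma act_add_left:
  assumes "x \<in> carrier V" "y \<in> carrier V" "p \<in> carrier U"
  shows "act (x \<oplus>\<^bsub>V\<^esub> y) p = act x p \<oplus>\<^bsub>U\<^esub> act y p"
  using assms(3)
proof (induction rule: up_induct)
  case (monom v n)
  then show ?case using assms by (simp add: act_monom U.smult_r_distr)
next
  case (add p q)
  then show ?case using assms by (simp add: U.P.a_ac)
qed

lemma T_act: assumes "x \<in> carrier V" "p \<in> carrier U" shows "T (act x p) = act x (T p)"
  using assms(2)
proof (induction rule: up_induct)
  case (monom v n)
  then show ?case using assms by (simp add: act_monom T_smult T_monom U.P.a_comm)
next
  case (add p q)
  then show ?case using assms by simp
qed

lemma T_pow_act: "x \<in> carrier V \<Longrightarrow> p \<in> carrier U \<Longrightarrow> (T ^^ n) (act x p) = act x ((T ^^ n) p)"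
  by (induction n) (auto simp: T_act)

lemma nT_act: "x \<in> carrier V \<Longrightarrow> p \<in> carrier U \<Longrightarrow> nT (act x p) = act x (nT p)"
  by (simp add: nT_def T_act)

lemma nT_pow_act: "x \<in> carrier V \<Longrightarrow> p \<in> carrier U \<Longrightarrow> (nT ^^ n) (act x p) = act x ((nT ^^ n) p)"
  by (induction n) (auto simp: nT_act)

text \<open>Read as a statement about -\<lambda>, this is its Leibniz rule with respect to
  \<open>act\<close>: -\<lambda> is the derivative at the first point. The counterpart at the second
  point is \<open>T_smult\<close>.\<close>

lemma lm_act:
  assumes "x \<in> carrier V" "p \<in> carrier U"
  shows "act x (lm p) = lm (act x p) \<oplus>\<^bsub>U\<^esub> act (D x) p"
  using assms(2)
proof (induction rule: up_induct)
  case (monom v n)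
  have "act x (lm (monom U v n)) = v \<odot>\<^bsub>U\<^esub> (T ^^ n) (T (monom U x 0))"
    using monom assms by (simp add: lm_monom act_monom funpow_swap1)
  also have "T (monom U x 0) = lm (monom U x 0) \<oplus>\<^bsub>U\<^esub> monom U (D x) 0"
    using assms by (simp add: T_monom lm_monom)
  finally show ?case using monom assms
    by (simp add: act_monom lm_T_pow lm_smult U.smult_r_distr)
next
  case (add p q)
  then show ?case using assms by (simp add: U.P.a_ac)
qed

lemma act_smult:
  assumes "x \<in> carrier V" "y \<in> carrier V" "p \<in> carrier U"
  shows "act x (y \<odot>\<^bsub>U\<^esub> p) = y \<odot>\<^bsub>U\<^esub> act x p"
  using assms(3)
proof (induction rule: up_induct)
  case (monom v n)
  then show ?case using assms by (simp add: act_monom smult_monom U.smult_assoc1)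
next
  case (add p q)
  then show ?case using assms by (simp add: U.smult_r_distr)
qed

text \<open>\<open>act x\<close> commutes with multiplication of coefficients and with
  \<open>T\<close>, so on \<open>v \<lambda>^n\<close> it can be moved to the innermost factor,
  where it is an ordinary product.\<close>

lemma act_act:
  assumes "x \<in> carrier V" "y \<in> carrier V" "p \<in> carrier U"
  shows "act x (act y p) = act (x \<otimes>\<^bsub>V\<^esub> y) p"
  using assms(3)
proof (induction rule: up_induct)
  case (monom v n)
  have "act x (act y (monom U v n)) = v \<odot>\<^bsub>U\<^esub> (T ^^ n) (act x (monom U y 0))"
    using monom assms by (simp add: act_monom act_smult T_pow_act[symmetric] smult_monom)
  then show ?case using monom assms by (simp add: act_monom smult_monom V.m_comm)
next
  case (add p q)
  then show ?case using assms by simp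
qed

lemma T_pow_scal: "x \<in> carrier V \<Longrightarrow> D x = \<zero>\<^bsub>V\<^esub> \<Longrightarrow> (T ^^ n) (monom U x 0) = monom U x n"
  by (induction n) (auto simp: T_monom)

text \<open>Elements killed by \<partial>, in particular scalars, act alike at both points, so
  \<open>K\<close>-linearity in either argument of a bracket can be written with the same scalar
  multiplication.\<close>

lemma act_scal:
  assumes "x \<in> carrier V" "D x = \<zero>\<^bsub>V\<^esub>" "p \<in> carrier U"
  shows "act x p = x \<odot>\<^bsub>U\<^esub> p"
  using assms(3)
proof (induction rule: up_induct)
  case (monom v n)
  then show ?case using assms(1,2) by (simp add: act_monom T_pow_scal smult_monom V.m_comm)
next
  case (add p q)
  then show ?case using assms by (simp add: U.smult_r_distr)
qed

lemma D_one: "D \<one>\<^bsub>V\<^esub> = \<zero>\<^bsub>V\<^esub>"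
  by (rule V.derivation_one[OF der])

lemma D_scal: "c \<in> carrier K \<Longrightarrow> D (c \<odot>\<^bsub>V\<^esub> \<one>\<^bsub>V\<^esub>) = \<zero>\<^bsub>V\<^esub>"
  by (simp add: D_one)

lemma act_module: "module V (U\<lparr>smult := act\<rparr>)"
proof (rule moduleI)
  show "cring V" by (rule V.is_cring)
  show "abelian_group (U\<lparr>smult := act\<rparr>)"
    using U.P.abelian_group_axioms
    by (simp add: abelian_group_def abelian_group_axioms_def abelian_monoid_def)
qed (simp_all add: act_add_left act_act[symmetric] act_scal D_one)

text \<open>\<open>sg\<close> exchanges the two points of the diagonal. This lemma and the next
  ones, up to \<open>sigma_act\<close>, say that it carries \<lambda> to -\<lambda>-\<partial>,
  \<lambda> + \<partial> to -\<lambda>, and interchanges \<open>act\<close> with multiplication of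
  coefficients.\<close>

lemma sigma_lm: assumes "p \<in> carrier U" shows "sg (lm p) = nT (sg p)"
  using assms
proof (induction rule: up_induct)
  case (monom v n)
  then show ?case using assms by (simp add: lm_monom sigma_monom)
next
  case (add p q)
  then show ?case by simp
qed

lemma sigma_T: assumes "p \<in> carrier U" shows "sg (T p) = \<ominus>\<^bsub>U\<^esub> lm (sg p)"
  using assms
proof (induction rule: up_induct)
  case (monom v n)
  have "sg (T (monom U v n)) = (nT ^^ n) (nT (monom U v 0) \<oplus>\<^bsub>U\<^esub> monom U (D v) 0)"
    using monom by (simp add: T_monom sigma_monom funpow_swap1)
  also have "nT (monom U v 0) \<oplus>\<^bsub>U\<^esub> monom U (D v) 0 = \<ominus>\<^bsub>U\<^esub> lm (monom U v 0)"
    using monom by (simp add: nT_def T_monom lm_monom U.P.minus_add U.P.a_assoc U.P.l_neg)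
  also have "(nT ^^ n) (\<ominus>\<^bsub>U\<^esub> lm (monom U v 0)) = \<ominus>\<^bsub>U\<^esub> lm ((nT ^^ n) (monom U v 0))"
    using monom
    by (subst additive_map.neg[OF U.P.additive_mapI[OF U.P.abelian_group_axioms nT_pow_additive]])
      (simp_all add: lm_nT_pow)
  finally show ?case using monom by (simp add: sigma_monom)
next
  case (add p q)
  then show ?case by (simp add: U.P.minus_add)
qed

lemma sigma_smult:
  assumes "x \<in> carrier V" "p \<in> carrier U" shows "sg (x \<odot>\<^bsub>U\<^esub> p) = act x (sg p)"
  using assms(2)
proof (induction rule: up_induct)
  case (monom v n)
  then show ?case using assms
    by (simp add: smult_monom sigma_monom nT_pow_act[symmetric] act_monom V.m_comm)
next
  case (add p q)
  then show ?case using assms by (simp add: U.smult_r_distr)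
qed

lemma sigma_T_pow: "p \<in> carrier U \<Longrightarrow> sg ((T ^^ n) p) = ((\<lambda>q. \<ominus>\<^bsub>U\<^esub> lm q) ^^ n) (sg p)"
  by (induction n) (auto simp: sigma_T)

lemma sigma_act:
  assumes "x \<in> carrier V" "p \<in> carrier U" shows "sg (act x p) = x \<odot>\<^bsub>U\<^esub> sg p"
  using assms(2)
proof (induction rule: up_induct)
  case (monom v n)
  \<comment> \<open>The same sign (-1)^n arises on both sides, from (-\<lambda>)^n on the left and
    from (-\<lambda>-\<partial>)^n on the right; without it, both are
    \<open>x \<cdot> (\<lambda> + \<partial>)^n v\<close> by \<open>act_monom\<close>.\<close>
  have *: "((\<lambda>q. \<ominus>\<^bsub>U\<^esub> lm q) ^^ n) (monom U x 0) \<in> carrier U \<and>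
     act v (((\<lambda>q. \<ominus>\<^bsub>U\<^esub> lm q) ^^ n) (monom U x 0)) = x \<odot>\<^bsub>U\<^esub> (nT ^^ n) (monom U v 0)"
  proof -
    have "((\<lambda>q. \<ominus>\<^bsub>U\<^esub> lm q) ^^ n) (monom U y 0) = (if even n then monom U y n else \<ominus>\<^bsub>U\<^esub> monom U y n)"
      if "y \<in> carrier V" for y
      using that by (induction n) (auto simp: lm_monom)
    moreover have "(nT ^^ n) (monom U v 0) = (if even n then (T ^^ n) (monom U v 0) else \<ominus>\<^bsub>U\<^esub> (T ^^ n) (monom U v 0))"
      using monom by (induction n) (auto simp: nT_def)
    ultimately show ?thesis using assms monom by (simp add: act_monom U.smult_r_minus)
  qed
  then show ?case using assms monom
    by (simp add: act_monom sigma_smult sigma_T_pow sigma_monom)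
next
  case (add p q)
  then show ?case using assms by (simp add: U.smult_r_distr)
qed

end

section \<open>Sesquilinear biderivations\<close>

context diff_algebra
begin

text \<open>The axioms of a \<lambda>-bracket other than skew-symmetry and Jacobi, phrased as
  \<open>mder\<close> in each argument so that the extension and uniqueness results for derivations
  apply to it directly.\<close>

definition lambda_bider :: "('v \<Rightarrow> 'v \<Rightarrow> nat \<Rightarrow> 'v) \<Rightarrow> bool" where
  "lambda_bider L \<longleftrightarrow>
     (\<forall>g\<in>carrier V. mder K V V (U\<lparr>smult := act\<rparr>) (\<lambda>x. x) (\<lambda>f. L f g)) \<and>
     (\<forall>f\<in>carrier V. mder K V V U (\<lambda>x. x) (L f)) \<and>
     (\<forall>f\<in>carrier V. \<forall>g\<in>carrier V. L (D f) g = \<ominus>\<^bsub>U\<^esub> lm (L f g)) \<and>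
     (\<forall>f\<in>carrier V. \<forall>g\<in>carrier V. L f (D g) = T (L f g))"

lemma lambda_biderD:
  assumes "lambda_bider L"
  shows "\<And>f g. f \<in> carrier V \<Longrightarrow> g \<in> carrier V \<Longrightarrow> L f g \<in> carrier U"
    "\<And>f f' g. f \<in> carrier V \<Longrightarrow> f' \<in> carrier V \<Longrightarrow> g \<in> carrier V \<Longrightarrow>
      L (f \<oplus>\<^bsub>V\<^esub> f') g = L f g \<oplus>\<^bsub>U\<^esub> L f' g"
    "\<And>f g g'. f \<in> carrier V \<Longrightarrow> g \<in> carrier V \<Longrightarrow> g' \<in> carrier V \<Longrightarrow>
      L f (g \<oplus>\<^bsub>V\<^esub> g') = L f g \<oplus>\<^bsub>U\<^esub> L f g'"
    "\<And>c f g. c \<in> carrier K \<Longrightarrow> f \<in> carrier V \<Longrightarrow> g \<in> carrier V \<Longrightarrow>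
      L (c \<odot>\<^bsub>V\<^esub> f) g = (c \<odot>\<^bsub>V\<^esub> \<one>\<^bsub>V\<^esub>) \<odot>\<^bsub>U\<^esub> L f g"
    "\<And>c f g. c \<in> carrier K \<Longrightarrow> f \<in> carrier V \<Longrightarrow> g \<in> carrier V \<Longrightarrow>
      L f (c \<odot>\<^bsub>V\<^esub> g) = (c \<odot>\<^bsub>V\<^esub> \<one>\<^bsub>V\<^esub>) \<odot>\<^bsub>U\<^esub> L f g"
    "\<And>f f' g. f \<in> carrier V \<Longrightarrow> f' \<in> carrier V \<Longrightarrow> g \<in> carrier V \<Longrightarrow>
      L (f \<otimes>\<^bsub>V\<^esub> f') g = act f (L f' g) \<oplus>\<^bsub>U\<^esub> act f' (L f g)"
    "\<And>f g g'. f \<in> carrier V \<Longrightarrow> g \<in> carrier V \<Longrightarrow> g' \<in> carrier V \<Longrightarrow>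
      L f (g \<otimes>\<^bsub>V\<^esub> g') = g \<odot>\<^bsub>U\<^esub> L f g' \<oplus>\<^bsub>U\<^esub> g' \<odot>\<^bsub>U\<^esub> L f g"
    "\<And>f g. f \<in> carrier V \<Longrightarrow> g \<in> carrier V \<Longrightarrow> L (D f) g = \<ominus>\<^bsub>U\<^esub> lm (L f g)"
    "\<And>f g. f \<in> carrier V \<Longrightarrow> g \<in> carrier V \<Longrightarrow> L f (D g) = T (L f g)"
proof -
  fix f f' g g' c assume f: "f \<in> carrier V" "f' \<in> carrier V" and g: "g \<in> carrier V" "g' \<in> carrier V"
  have l: "mder K V V (U\<lparr>smult := act\<rparr>) (\<lambda>x. x) (\<lambda>f. L f g)" and r: "mder K V V U (\<lambda>x. x) (L f)"
    using assms f g by (auto simp: lambda_bider_def)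
  show cl: "L f g \<in> carrier U" by (rule mderD(1)[OF r g(1)])
  show "L (f \<oplus>\<^bsub>V\<^esub> f') g = L f g \<oplus>\<^bsub>U\<^esub> L f' g" using mderD(2)[OF l f] by simp
  show "L f (g \<oplus>\<^bsub>V\<^esub> g') = L f g \<oplus>\<^bsub>U\<^esub> L f g'" using mderD(2)[OF r g] by simp
  show "L (f \<otimes>\<^bsub>V\<^esub> f') g = act f (L f' g) \<oplus>\<^bsub>U\<^esub> act f' (L f g)" using mderD(4)[OF l f] by simp
  show "L f (g \<otimes>\<^bsub>V\<^esub> g') = g \<odot>\<^bsub>U\<^esub> L f g' \<oplus>\<^bsub>U\<^esub> g' \<odot>\<^bsub>U\<^esub> L f g" using mderD(4)[OF r g] by simp
  show "L (D f) g = \<ominus>\<^bsub>U\<^esub> lm (L f g)" "L f (D g) = T (L f g)"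
    using assms f g by (auto simp: lambda_bider_def)
  assume c: "c \<in> carrier K"
  show "L (c \<odot>\<^bsub>V\<^esub> f) g = (c \<odot>\<^bsub>V\<^esub> \<one>\<^bsub>V\<^esub>) \<odot>\<^bsub>U\<^esub> L f g"
    using mderD(3)[OF l c f(1)] cl c by (simp add: act_scal D_one)
  show "L f (c \<odot>\<^bsub>V\<^esub> g) = (c \<odot>\<^bsub>V\<^esub> \<one>\<^bsub>V\<^esub>) \<odot>\<^bsub>U\<^esub> L f g"
    using mderD(3)[OF r c g(1)] by simp
qed

lemma lambda_biderI:
  assumes "\<And>f g. f \<in> carrier V \<Longrightarrow> g \<in> carrier V \<Longrightarrow> L f g \<in> carrier U"
    "\<And>f f' g. f \<in> carrier V \<Longrightarrow> f' \<in> carrier V \<Longrightarrow> g \<in> carrier V \<Longrightarrow>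
      L (f \<oplus>\<^bsub>V\<^esub> f') g = L f g \<oplus>\<^bsub>U\<^esub> L f' g"
    "\<And>f g g'. f \<in> carrier V \<Longrightarrow> g \<in> carrier V \<Longrightarrow> g' \<in> carrier V \<Longrightarrow>
      L f (g \<oplus>\<^bsub>V\<^esub> g') = L f g \<oplus>\<^bsub>U\<^esub> L f g'"
    "\<And>c f g. c \<in> carrier K \<Longrightarrow> f \<in> carrier V \<Longrightarrow> g \<in> carrier V \<Longrightarrow>
      L (c \<odot>\<^bsub>V\<^esub> f) g = (c \<odot>\<^bsub>V\<^esub> \<one>\<^bsub>V\<^esub>) \<odot>\<^bsub>U\<^esub> L f g"
    "\<And>c f g. c \<in> carrier K \<Longrightarrow> f \<in> carrier V \<Longrightarrow> g \<in> carrier V \<Longrightarrow>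
      L f (c \<odot>\<^bsub>V\<^esub> g) = (c \<odot>\<^bsub>V\<^esub> \<one>\<^bsub>V\<^esub>) \<odot>\<^bsub>U\<^esub> L f g"
    "\<And>f f' g. f \<in> carrier V \<Longrightarrow> f' \<in> carrier V \<Longrightarrow> g \<in> carrier V \<Longrightarrow>
      L (f \<otimes>\<^bsub>V\<^esub> f') g = act f (L f' g) \<oplus>\<^bsub>U\<^esub> act f' (L f g)"
    "\<And>f g g'. f \<in> carrier V \<Longrightarrow> g \<in> carrier V \<Longrightarrow> g' \<in> carrier V \<Longrightarrow>
      L f (g \<otimes>\<^bsub>V\<^esub> g') = g \<odot>\<^bsub>U\<^esub> L f g' \<oplus>\<^bsub>U\<^esub> g' \<odot>\<^bsub>U\<^esub> L f g"
    "\<And>f g. f \<in> carrier V \<Longrightarrow> g \<in> carrier V \<Longrightarrow> L (D f) g = \<ominus>\<^bsub>U\<^esub> lm (L f g)"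
    "\<And>f g. f \<in> carrier V \<Longrightarrow> g \<in> carrier V \<Longrightarrow> L f (D g) = T (L f g)"
  shows "lambda_bider L"
  unfolding lambda_bider_def mder_def using assms by (simp add: act_scal D_one)

text \<open>Turns skew-symmetry into an equality of two sesquilinear biderivations, which can be
  tested on \<open>A\<close>.\<close>

lemma lambda_bider_opposite:
  assumes L: "lambda_bider L"
  shows "lambda_bider (\<lambda>f g. \<ominus>\<^bsub>U\<^esub> sg (L g f))"
proof (rule lambda_biderI)
  fix c f g assume "c \<in> carrier K" "f \<in> carrier V" "g \<in> carrier V"
  then show "\<ominus>\<^bsub>U\<^esub> sg (L g (c \<odot>\<^bsub>V\<^esub> f)) = (c \<odot>\<^bsub>V\<^esub> \<one>\<^bsub>V\<^esub>) \<odot>\<^bsub>U\<^esub> (\<ominus>\<^bsub>U\<^esub> sg (L g f))"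
    "\<ominus>\<^bsub>U\<^esub> sg (L (c \<odot>\<^bsub>V\<^esub> g) f) = (c \<odot>\<^bsub>V\<^esub> \<one>\<^bsub>V\<^esub>) \<odot>\<^bsub>U\<^esub> (\<ominus>\<^bsub>U\<^esub> sg (L g f))"
    by (simp_all add: lambda_biderD[OF L] sigma_smult act_scal D_one U.smult_r_minus)
qed (simp_all add: lambda_biderD[OF L] sigma_smult sigma_act sigma_lm sigma_T U.P.minus_add
       U.smult_r_minus U.P.a_comm nT_def)

end

sublocale jets \<subseteq> dj: diff_algebra K "jet K A" "jet_der K A"
  by unfold_locales (rule der_derivation)

text \<open>A biderivation without antisymmetry or Jacobi identity: this determines an extension to
  the jet algebra, and it is the structure that will be established on
  \<open>H \<otimes> A\<close>.\<close>

locale bider = jets K A for K :: "('k,'m) ring_scheme" (structure)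
    and A :: "('k,'a,'n) module_scheme" +
  fixes P :: "'a \<Rightarrow> 'a \<Rightarrow> 'a"
  assumes br_closed: "a \<in> carrier A \<Longrightarrow> b \<in> carrier A \<Longrightarrow> P a b \<in> carrier A"
    and br_add_left: "a \<in> carrier A \<Longrightarrow> a' \<in> carrier A \<Longrightarrow> b \<in> carrier A \<Longrightarrow>
      P (a \<oplus>\<^bsub>A\<^esub> a') b = P a b \<oplus>\<^bsub>A\<^esub> P a' b"
    and br_add_right: "a \<in> carrier A \<Longrightarrow> b \<in> carrier A \<Longrightarrow> b' \<in> carrier A \<Longrightarrow>
      P a (b \<oplus>\<^bsub>A\<^esub> b') = P a b \<oplus>\<^bsub>A\<^esub> P a b'"
    and br_smult_left: "r \<in> carrier K \<Longrightarrow> a \<in> carrier A \<Longrightarrow> b \<in> carrier A \<Longrightarrow>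
      P (r \<odot>\<^bsub>A\<^esub> a) b = r \<odot>\<^bsub>A\<^esub> P a b"
    and br_smult_right: "r \<in> carrier K \<Longrightarrow> a \<in> carrier A \<Longrightarrow> b \<in> carrier A \<Longrightarrow>
      P a (r \<odot>\<^bsub>A\<^esub> b) = r \<odot>\<^bsub>A\<^esub> P a b"
    and br_mult_left: "a \<in> carrier A \<Longrightarrow> b \<in> carrier A \<Longrightarrow> c \<in> carrier A \<Longrightarrow>
      P (a \<otimes>\<^bsub>A\<^esub> b) c = a \<otimes>\<^bsub>A\<^esub> P b c \<oplus>\<^bsub>A\<^esub> b \<otimes>\<^bsub>A\<^esub> P a c"
    and br_mult_right: "a \<in> carrier A \<Longrightarrow> b \<in> carrier A \<Longrightarrow> c \<in> carrier A \<Longrightarrow>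
      P a (b \<otimes>\<^bsub>A\<^esub> c) = b \<otimes>\<^bsub>A\<^esub> P a c \<oplus>\<^bsub>A\<^esub> c \<otimes>\<^bsub>A\<^esub> P a b"

context jets
begin

lemma mder_eqI:
  assumes f: "f \<in> carrier J"
    and 1: "mder K J J M (\<lambda>x. x) \<xi>" "\<And>x. x \<in> carrier J \<Longrightarrow> \<xi> (D x) = E (\<xi> x)"
    and 2: "mder K J J M (\<lambda>x. x) \<eta>" "\<And>x. x \<in> carrier J \<Longrightarrow> \<eta> (D x) = E (\<eta> x)"
    and g: "\<And>a. a \<in> carrier A \<Longrightarrow> \<xi> (gen 0 a) = \<eta> (gen 0 a)"
  shows "\<xi> f = \<eta> f"
  using f by (induction rule: jet_induct) (simp_all add: mderD[OF 1(1)] mderD[OF 2(1)] 1(2) 2(2) g)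

text \<open>One variable at a time: with the first argument in \<open>A\<close>, both sides are
  derivations of the second commuting with \<lambda> + \<partial>; with the second argument
  arbitrary, they are derivations of the first for \<open>act\<close>.\<close>

lemma lambda_bider_eqI:
  assumes L: "dj.lambda_bider L" and M: "dj.lambda_bider M"
    and g: "\<And>a b. a \<in> carrier A \<Longrightarrow> b \<in> carrier A \<Longrightarrow> L (gen 0 a) (gen 0 b) = M (gen 0 a) (gen 0 b)"
    and fg: "f \<in> carrier J" "g \<in> carrier J"
  shows "L f g = M f g"
proof -
  have *: "L (gen 0 a) x = M (gen 0 a) x" if a: "a \<in> carrier A" and x: "x \<in> carrier J" for a x
    using L M a
    by (intro mder_eqI[OF x, of dj.U "L (gen 0 a)" dj.T "M (gen 0 a)"]) (auto simp: dj.lambda_bider_def g)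
  show ?thesis
    using L M fg
    by (intro mder_eqI[OF fg(1), of "dj.U\<lparr>smult := dj.act\<rparr>" "\<lambda>f. L f g" "\<lambda>p. \<ominus>\<^bsub>dj.U\<^esub> dj.lm p" "\<lambda>f. M f g"])
      (auto simp: dj.lambda_bider_def *)
qed

end

section \<open>Extension of a biderivation to the jet algebra\<close>

context bider
begin

lemma bider_gen_mder:
  assumes a: "a \<in> carrier A"
  shows "mder K A J dj.U (gen 0) (\<lambda>b. monom dj.U (gen 0 (P a b)) 0)"
  using a by (intro mderI)
    (simp_all add: br_closed br_add_right br_smult_right br_mult_right gen_add gen_smult gen_mult_0
      dj.smult_monom J.smult_one_mult)

text \<open>The second variable is extended first, with the first one in \<open>A\<close> and
  \<partial> acting as \<lambda> + \<partial>. Before the first variable can be extended, with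
  \<partial> acting as -\<lambda>, the result has to be a derivation in that variable for the action
  \<open>act\<close>.\<close>

lemma lambda_bider_exists:
  obtains L where "dj.lambda_bider L"
    "\<And>a b. a \<in> carrier A \<Longrightarrow> b \<in> carrier A \<Longrightarrow> L (gen 0 a) (gen 0 b) = monom dj.U (gen 0 (P a b)) 0"
proof -
  have "\<exists>\<xi>. mder K J J dj.U (\<lambda>x. x) \<xi> \<and> (\<forall>x\<in>carrier J. \<xi> (D x) = dj.T (\<xi> x)) \<and>
     (\<forall>b\<in>carrier A. \<xi> (gen 0 b) = monom dj.U (gen 0 (P a b)) 0)" if a: "a \<in> carrier A" for a
    by (rule jet_mder_extension[OF dj.U.module dj.T_additive _ bider_gen_mder[OF a]])
      (auto simp: dj.T_smult)
  then obtain \<xi> where \<xi>: "\<And>a. a \<in> carrier A \<Longrightarrow> mder K J J dj.U (\<lambda>x. x) (\<xi> a)"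
    "\<And>a x. a \<in> carrier A \<Longrightarrow> x \<in> carrier J \<Longrightarrow> \<xi> a (D x) = dj.T (\<xi> a x)"
    "\<And>a b. a \<in> carrier A \<Longrightarrow> b \<in> carrier A \<Longrightarrow> \<xi> a (gen 0 b) = monom dj.U (gen 0 (P a b)) 0"
    by metis
  note x = mderD[OF \<xi>(1)]
  have \<xi>_add: "\<xi> (a \<oplus>\<^bsub>A\<^esub> b) g = \<xi> a g \<oplus>\<^bsub>dj.U\<^esub> \<xi> b g"
    if "a \<in> carrier A" "b \<in> carrier A" "g \<in> carrier J" for a b g
    using that(3)
    by (induction rule: jet_induct)
      (use that(1,2) in \<open>simp_all add: x \<xi>(2,3) br_closed br_add_left gen_add dj.U.smult_r_distr dj.U.P.a_ac\<close>)
  have \<xi>_smult: "\<xi> (c \<odot>\<^bsub>A\<^esub> a) g = (c \<odot>\<^bsub>J\<^esub> \<one>\<^bsub>J\<^esub>) \<odot>\<^bsub>dj.U\<^esub> \<xi> a g"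
    if "c \<in> carrier K" "a \<in> carrier A" "g \<in> carrier J" for c a g
    using that(3)
  proof (induction rule: jet_induct)
    case (smult d g)
    with that(1,2) show ?case
      by (simp add: x dj.U.smult_assoc1[symmetric] J.smult_one_mult J.mult_smult_one)
        (simp add: J.smult_assoc1[symmetric] A.R.m_comm)
  next
    case (mult g h)
    with that(1,2) show ?case
      by (simp add: x dj.U.smult_assoc1[symmetric] J.smult_one_mult J.mult_smult_one dj.U.smult_r_distr)
  next
    case (der g)
    with that(1,2) show ?case
      by (simp add: x \<xi>(2) dj.T_smult dj.D_one)
  qed (use that(1,2) in \<open>simp_all add: x \<xi>(2,3) br_closed br_smult_left gen_smult dj.U.smult_r_distr
        dj.smult_monom J.smult_one_mult\<close>)
  \<comment> \<open>On generators all values are constant in \<lambda>, where \<open>act\<close> is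
    plain multiplication. The rule spreads to all \<open>g\<close> because \<open>act\<close>
    commutes with multiplication of coefficients and with \<open>T\<close>.\<close>
  have \<xi>_mult: "\<xi> (a \<otimes>\<^bsub>A\<^esub> b) g = dj.act (gen 0 a) (\<xi> b g) \<oplus>\<^bsub>dj.U\<^esub> dj.act (gen 0 b) (\<xi> a g)"
    if "a \<in> carrier A" "b \<in> carrier A" "g \<in> carrier J" for a b g
    using that(3)
  proof (induction rule: jet_induct)
    case (gen c)
    with that(1,2) show ?case
      by (simp add: \<xi>(3) br_closed br_mult_left gen_add gen_mult_0 dj.act_monom dj.smult_monom J.m_comm)
  next
    case (add g h)
    with that(1,2) show ?case by (simp add: x dj.U.P.a_ac)
  next
    case (smult c g)
    with that(1,2) show ?case
      by (simp add: x dj.act_smult dj.U.smult_r_distr)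
  next
    case (mult g h)
    with that(1,2) show ?case
      by (simp add: x dj.act_smult dj.U.smult_r_distr dj.U.P.a_ac)
  next
    case (der g)
    with that(1,2) show ?case by (simp add: x \<xi>(2) dj.T_act)
  qed
  have md: "mder K A J (dj.U\<lparr>smult := dj.act\<rparr>) (gen 0) (\<lambda>a. \<xi> a g)" if "g \<in> carrier J" for g
    using that by (intro mderI) (simp_all add: x \<xi>_add \<xi>_smult \<xi>_mult dj.act_scal dj.D_one)
  have "\<exists>\<eta>. mder K J J (dj.U\<lparr>smult := dj.act\<rparr>) (\<lambda>x. x) \<eta> \<and>
      (\<forall>x\<in>carrier J. \<eta> (D x) = \<ominus>\<^bsub>dj.U\<^esub> dj.lm (\<eta> x)) \<and> (\<forall>a\<in>carrier A. \<eta> (gen 0 a) = \<xi> a g)"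
    if g: "g \<in> carrier J" for g
    by (rule jet_mder_extension[OF dj.act_module _ _ md[OF g], of "\<lambda>p. \<ominus>\<^bsub>dj.U\<^esub> dj.lm p"])
      (auto simp: additive_def dj.U.P.minus_add dj.lm_act dj.U.P.a_ac dj.U.P.r_neg2)
  then obtain \<eta> where \<eta>: "\<And>g. g \<in> carrier J \<Longrightarrow> mder K J J (dj.U\<lparr>smult := dj.act\<rparr>) (\<lambda>x. x) (\<eta> g)"
    "\<And>f g. f \<in> carrier J \<Longrightarrow> g \<in> carrier J \<Longrightarrow> \<eta> g (D f) = \<ominus>\<^bsub>dj.U\<^esub> dj.lm (\<eta> g f)"
    "\<And>a g. a \<in> carrier A \<Longrightarrow> g \<in> carrier J \<Longrightarrow> \<eta> g (gen 0 a) = \<xi> a g"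
    by metis
  define L where "L f g = \<eta> g f" for f g
  have L: "\<And>g. g \<in> carrier J \<Longrightarrow> mder K J J (dj.U\<lparr>smult := dj.act\<rparr>) (\<lambda>x. x) (\<lambda>f. L f g)"
    "\<And>f g. f \<in> carrier J \<Longrightarrow> g \<in> carrier J \<Longrightarrow> L (D f) g = \<ominus>\<^bsub>dj.U\<^esub> dj.lm (L f g)"
    "\<And>a g. a \<in> carrier A \<Longrightarrow> g \<in> carrier J \<Longrightarrow> L (gen 0 a) g = \<xi> a g"
    using \<eta> by (simp_all add: L_def[abs_def])
  show ?thesis
  proof (rule that)
    show "L (gen 0 a) (gen 0 b) = monom dj.U (gen 0 (P a b)) 0" if "a \<in> carrier A" "b \<in> carrier A" for a b
      using that by (simp add: L(3) \<xi>(3))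
    have l: "f \<in> carrier J \<Longrightarrow> g \<in> carrier J \<Longrightarrow> L f g \<in> carrier dj.U"
      "f \<in> carrier J \<Longrightarrow> f' \<in> carrier J \<Longrightarrow> g \<in> carrier J \<Longrightarrow> L (f \<oplus>\<^bsub>J\<^esub> f') g = L f g \<oplus>\<^bsub>dj.U\<^esub> L f' g"
      "c \<in> carrier K \<Longrightarrow> f \<in> carrier J \<Longrightarrow> g \<in> carrier J \<Longrightarrow> L (c \<odot>\<^bsub>J\<^esub> f) g = (c \<odot>\<^bsub>J\<^esub> \<one>\<^bsub>J\<^esub>) \<odot>\<^bsub>dj.U\<^esub> L f g"
      "f \<in> carrier J \<Longrightarrow> f' \<in> carrier J \<Longrightarrow> g \<in> carrier J \<Longrightarrow>
         L (f \<otimes>\<^bsub>J\<^esub> f') g = dj.act f (L f' g) \<oplus>\<^bsub>dj.U\<^esub> dj.act f' (L f g)" for c f f' g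
      using mderD[OF L(1)] by (simp_all add: dj.act_scal dj.D_one)
    \<comment> \<open>\<open>\<eta>\<close> was chosen separately for each \<open>g\<close>, so
      nothing yet relates different \<open>g\<close>. The rules in \<open>g\<close> hold when
      \<open>f\<close> lies in \<open>A\<close>, and the derivation property in \<open>f\<close>
      carries them to all \<open>f\<close>.\<close>
    have r: "\<forall>g\<in>carrier J. \<forall>g'\<in>carrier J. \<forall>c\<in>carrier K.
        L f (g \<oplus>\<^bsub>J\<^esub> g') = L f g \<oplus>\<^bsub>dj.U\<^esub> L f g' \<and>
        L f (c \<odot>\<^bsub>J\<^esub> g) = (c \<odot>\<^bsub>J\<^esub> \<one>\<^bsub>J\<^esub>) \<odot>\<^bsub>dj.U\<^esub> L f g \<and>
        L f (g \<otimes>\<^bsub>J\<^esub> g') = g \<odot>\<^bsub>dj.U\<^esub> L f g' \<oplus>\<^bsub>dj.U\<^esub> g' \<odot>\<^bsub>dj.U\<^esub> L f g \<and>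
        L f (D g) = dj.T (L f g)" if "f \<in> carrier J" for f
      using that
    proof (induction rule: jet_induct)
      case (gen a)
      then show ?case by (simp add: L(3) x \<xi>(2))
    next
      case (add f f')
      then show ?case by (simp add: l dj.U.smult_r_distr dj.U.P.a_ac)
    next
      case (smult d f)
      then show ?case
        by (simp add: l dj.U.smult_r_distr dj.U.smult_assoc1[symmetric] J.smult_one_mult J.mult_smult_one
            dj.T_smult dj.D_one)
          (simp add: J.smult_assoc1[symmetric] A.R.m_comm)
    next
      case (mult f f')
      then show ?case
        by (simp add: l dj.act_smult dj.U.smult_r_distr dj.U.P.a_ac dj.T_act)
    next
      case (der f)
      then show ?case
        by (simp add: l L(2) dj.U.P.minus_add dj.lm_smult dj.lm_T dj.U.smult_r_minus)
    qed
    show "dj.lambda_bider L"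
      by (rule dj.lambda_biderI) ((simp add: l L(2); fail) | (use r A.R.one_closed in blast))+
  qed
qed

end

section \<open>The Jacobi identity\<close>

lemma (in abelian_group) zlin_cong_supp:
  assumes "x \<in> S \<rightarrow> carrier G" "y \<in> S \<rightarrow> carrier G"
    "\<And>i. i \<in> S \<Longrightarrow> (c i = d i \<and> (c i = 0 \<or> x i = y i)) \<or> (x i = \<zero> \<and> y i = \<zero>)"
  shows "zlin S c x = zlin S d y"
proof -
  have "[c i] \<cdot> x i = [d i] \<cdot> y i" if "i \<in> S" for i
    using assms(3)[OF that] by auto
  then show ?thesis unfolding zlin_def using assms(2) by (intro finsum_cong') auto
qed

text \<open>The comparison principle for the coefficient computations: coefficients have to match
  only at nonzero vectors, and vectors only at nonzero coefficients. This absorbs the boundary cases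
  of truncated subtraction.\<close>

lemma (in abelian_group) zlin_transfer:
  assumes "finite S" "finite T" "h ` S \<subseteq> T" "x \<in> T \<rightarrow> carrier G" "y \<in> S \<rightarrow> carrier G"
    and y: "\<And>i. i \<in> S \<Longrightarrow> c i = 0 \<or> y i = x (h i)"
    and d: "\<And>t. t \<in> T \<Longrightarrow> x t = \<zero> \<or> (\<Sum>i\<in>{i\<in>S. h i = t}. c i) = d t"
  shows "zlin S c y = zlin T d x"
proof -
  have "zlin S c y = zlin S c (\<lambda>i. x (h i))"
    using assms(3,4,5) y by (intro zlin_cong_supp) auto
  also have "\<dots> = zlin T (\<lambda>t. \<Sum>i\<in>{i\<in>S. h i = t}. c i) x"
    by (rule zlin_fibers) fact+
  also have "\<dots> = zlin T d x"
    using assms(4) d by (intro zlin_cong_supp) auto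
  finally show ?thesis .
qed

lemma (in cring) zlin_rdistr:
  assumes "a \<in> carrier R" "x \<in> S \<rightarrow> carrier R"
  shows "a \<otimes> zlin S c x = zlin S c (\<lambda>i. a \<otimes> x i)"
proof -
  interpret additive_map R R "\<lambda>x. a \<otimes> x"
    using assms by unfold_locales (auto intro!: additiveI simp: r_distr)
  show ?thesis using assms by (simp add: zlin)
qed

text \<open>The sum is the coefficient of x^l in (1 - x)^(t - m - 1). For t \<le> m the exponent is
  negative and the coefficient is the stated binomial; for t > m it is a polynomial of degree t - m
  - 1, which is below l exactly because t \<le> l + m. The induction on \<open>t\<close> is
  multiplication by 1 - x.\<close>

lemma alternating_sum_choose:
  "t \<le> l + m \<Longrightarrow>
   (\<Sum>n\<le>l. (-1) ^ n * int (t choose n) * int (l + m - n choose m)) =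
   (if t \<le> m then int (m - t + l choose l) else 0)"
proof (induction t arbitrary: l)
  case 0
  have "(\<Sum>n\<le>l. (-1) ^ n * int (0 choose n) * int (l + m - n choose m)) =
     (\<Sum>n\<in>{0}. (-1) ^ n * int (0 choose n) * int (l + m - n choose m))"
    by (rule sum.mono_neutral_right) (auto simp: binomial_eq_0)
  then show ?case using binomial_symmetric[of m "l + m"] by (simp add: add.commute)
next
  case (Suc t)
  let ?s = "\<lambda>t l. (\<Sum>n\<le>l. (-1) ^ n * int (t choose n) * int (l + m - n choose m))"
  show ?case
  proof (cases l)
    case 0
    then show ?thesis using Suc.prems by simp
  next
    case (Suc k)
    have "?s (Suc t) l = int (l + m choose m) +
        (\<Sum>n\<le>k. (-1) ^ Suc n * int (Suc t choose Suc n) * int (l + m - Suc n choose m))"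
      unfolding Suc by (subst sum.atMost_Suc_shift) simp
    also have "\<dots> = int (l + m choose m) +
        (\<Sum>n\<le>k. (-1) ^ Suc n * int (t choose Suc n) * int (l + m - Suc n choose m)) - ?s t k"
      unfolding Suc by (simp add: sum.distrib[symmetric] sum_subtractf[symmetric] algebra_simps
          flip: sum_negf)
    also have "int (l + m choose m) +
        (\<Sum>n\<le>k. (-1) ^ Suc n * int (t choose Suc n) * int (l + m - Suc n choose m)) = ?s t l"
      unfolding Suc by (simp only: sum.atMost_Suc_shift) simp
    finally have s: "?s (Suc t) l = ?s t l - ?s t k" .
    have l: "?s t l = (if t \<le> m then int (m - t + l choose l) else 0)"
      using Suc.prems by (intro Suc.IH) simp
    have k: "?s t k = (if t \<le> m then int (m - t + k choose k) else 0)"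
      using Suc.prems Suc by (intro Suc.IH) simp
    show ?thesis
    proof (cases "Suc t \<le> m")
      case True
      then obtain j where "m = Suc t + j" using le_Suc_ex by blast
      then show ?thesis using s l k Suc by simp
    next
      case False
      then show ?thesis using s l k Suc by (cases "t = m") auto
    qed
  qed
qed

section \<open>Explicit coefficients of the operators\<close>

context diff_algebra
begin

lemma D_pow_closed [simp]: "x \<in> carrier V \<Longrightarrow> (D ^^ k) x \<in> carrier V"
  by (rule V.derivation_pow_closed[OF der])

lemma D_pow_zero [simp]: "(D ^^ k) \<zero>\<^bsub>V\<^esub> = \<zero>\<^bsub>V\<^esub>"
  by (induction k) auto

text \<open>The binomial theorem for the commuting operators \<lambda> and \<partial>. For i > j the
  exponent \<open>j - i\<close> is truncated to 0, which is harmless as \<open>j choose i\<close>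
  vanishes.\<close>

lemma cf_T_pow:
  assumes p: "p \<in> carrier U"
  shows "cf ((T ^^ j) p) l = V.zlin {..l} (\<lambda>i. int (j choose i)) (\<lambda>i. (D ^^ (j - i)) (cf p (l - i)))"
proof (induction j arbitrary: l)
  case 0
  have "V.zlin {..l} (\<lambda>i. int (0 choose i)) (\<lambda>i. (D ^^ (0 - i)) (cf p (l - i))) =
        V.zlin {0} (\<lambda>i. int (0 choose i)) (\<lambda>i. (D ^^ (0 - i)) (cf p (l - i)))"
    using p by (intro V.zlin_neutral[symmetric]) (auto simp: binomial_eq_0)
  then show ?case using p by (simp add: V.zlin_def)
next
  case (Suc j)
  let ?x = "\<lambda>t. (D ^^ (Suc j - t)) (cf p (l - t))"
  have D: "D (cf ((T ^^ j) p) l) = V.zlin {..l} (\<lambda>i. int (j choose i)) ?x"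
    using p unfolding Suc
    by (subst D.zlin) (auto intro!: V.zlin_cong_supp, (metis Suc_diff_le comp_apply funpow.simps(2) not_le)+)
  have S: "cf (lm ((T ^^ j) p)) l = V.zlin {..l} (\<lambda>i. case i of 0 \<Rightarrow> 0 | Suc i \<Rightarrow> int (j choose i)) ?x"
  proof (cases l)
    case 0
    then show ?thesis using p by (simp add: cf_lm V.zlin_def)
  next
    case (Suc k)
    have "V.zlin {..k} (\<lambda>i. int (j choose i)) (\<lambda>i. (D ^^ (j - i)) (cf p (k - i))) =
          V.zlin {..l} (\<lambda>i. case i of 0 \<Rightarrow> 0 | Suc i \<Rightarrow> int (j choose i)) ?x"
    proof (rule V.zlin_transfer[where h = Suc])
      fix t assume t: "t \<in> {..l}"
      have "{i \<in> {..k}. Suc i = t} = (case t of 0 \<Rightarrow> {} | Suc i \<Rightarrow> {i})"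
        using t Suc by (auto split: nat.split)
      then show "?x t = \<zero>\<^bsub>V\<^esub> \<or> (\<Sum>i\<in>{i \<in> {..k}. Suc i = t}. int (j choose i)) =
          (case t of 0 \<Rightarrow> 0 | Suc i \<Rightarrow> int (j choose i))"
        by (simp split: nat.split)
    qed (use p Suc in auto)
    then show ?thesis using p Suc Suc.IH by (simp add: cf_lm)
  qed
  have "cf ((T ^^ Suc j) p) l = cf (lm ((T ^^ j) p)) l \<oplus>\<^bsub>V\<^esub> D (cf ((T ^^ j) p) l)"
    using p by (simp add: cf_T)
  also have "\<dots> = V.zlin {..l} (\<lambda>i. int (Suc j choose i)) ?x"
    unfolding D S using p by (subst V.zlin_add) (auto intro!: V.zlin_cong split: nat.split)
  finally show ?case .
qed

lemma cf_T_pow_monom: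
  assumes "v \<in> carrier V"
  shows "cf ((T ^^ j) (monom U v 0)) l = [(int (j choose l))] \<cdot>\<^bsub>V\<^esub> (D ^^ (j - l)) v"
proof -
  have "cf ((T ^^ j) (monom U v 0)) l =
    V.zlin {..l} (\<lambda>i. int (j choose i)) (\<lambda>i. (D ^^ (j - i)) (cf (monom U v 0) (l - i)))"
    using assms by (intro cf_T_pow) simp
  also have "\<dots> = V.zlin {l} (\<lambda>i. int (j choose i)) (\<lambda>i. (D ^^ (j - i)) (cf (monom U v 0) (l - i)))"
    using assms by (intro V.zlin_neutral[symmetric]) auto
  finally show ?thesis using assms by (simp add: V.zlin_def)
qed

text \<open>\<open>N\<close> may be any bound on the support instead of the degree, so that several
  brackets can be expanded over one common range.\<close>

lemma act_coeff:
  assumes "x \<in> carrier V" "p \<in> carrier U" "\<And>n. n > N \<Longrightarrow> p n = \<zero>\<^bsub>V\<^esub>"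
  shows "act x p l = V.zlin {..N} (\<lambda>n. int (n choose l)) (\<lambda>n. p n \<otimes>\<^bsub>V\<^esub> (D ^^ (n - l)) x)"
proof -
  have pn: "p n \<in> carrier V" for n using assms(2) by (simp add: U_mem)
  have g: "additive V U (\<lambda>v. v \<odot>\<^bsub>U\<^esub> (T ^^ n) (monom U x 0))" for n
    using assms(1) by (intro additiveI) (simp_all add: U.smult_l_distr)
  have eq: "act x p = (\<Oplus>\<^bsub>U\<^esub>n\<in>{..N}. p n \<odot>\<^bsub>U\<^esub> (T ^^ n) (monom U x 0))"
    unfolding act_upext using assms by (intro upext_bound g)
  have "act x p l = cf (act x p) l"
    using assms by (simp add: cf_eq)
  also have "\<dots> = (\<Oplus>\<^bsub>V\<^esub>n\<in>{..N}. p n \<otimes>\<^bsub>V\<^esub> cf ((T ^^ n) (monom U x 0)) l)"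
    unfolding eq using assms(1) pn by (subst U.coeff_finsum) auto
  also have "\<dots> = V.zlin {..N} (\<lambda>n. int (n choose l)) (\<lambda>n. p n \<otimes>\<^bsub>V\<^esub> (D ^^ (n - l)) x)"
    unfolding V.zlin_def using assms(1) pn
    by (intro V.finsum_cong') (auto simp: cf_T_pow_monom V.add_pow_rdistr_int)
  finally show ?thesis .
qed

lemma nT_pow_eq:
  "p \<in> carrier U \<Longrightarrow> (nT ^^ n) p = (if even n then (T ^^ n) p else \<ominus>\<^bsub>U\<^esub> (T ^^ n) p)"
  by (induction n) (auto simp: nT_def)

lemma sg_coeff:
  assumes "p \<in> carrier U" "\<And>n. n > N \<Longrightarrow> p n = \<zero>\<^bsub>V\<^esub>"
  shows "sg p l = V.zlin {..N} (\<lambda>n. (-1) ^ n * int (n choose l)) (\<lambda>n. (D ^^ (n - l)) (p n))"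
proof -
  have pn: "p n \<in> carrier V" for n using assms(1) by (simp add: U_mem)
  have g: "additive V U (\<lambda>v. (nT ^^ n) (monom U v 0))" for n
    by (intro additiveI) simp_all
  have eq: "sg p = (\<Oplus>\<^bsub>U\<^esub>n\<in>{..N}. (nT ^^ n) (monom U (p n) 0))"
    unfolding sigma_upext using assms by (intro upext_bound g)
  have "sg p l = cf (sg p) l"
    using assms by (simp add: cf_eq)
  also have "\<dots> = (\<Oplus>\<^bsub>V\<^esub>n\<in>{..N}. cf ((nT ^^ n) (monom U (p n) 0)) l)"
    unfolding eq using pn by (subst U.coeff_finsum) auto
  also have "\<dots> = V.zlin {..N} (\<lambda>n. (-1) ^ n * int (n choose l)) (\<lambda>n. (D ^^ (n - l)) (p n))"
    unfolding V.zlin_def using pn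
    by (intro V.finsum_cong') (auto simp: nT_pow_eq cf_T_pow_monom V.add_pow_int_neg)
  finally show ?thesis .
qed

end

text \<open>The commutator of two derivations is a derivation: \<open>s\<close> and \<open>t\<close>
  are the mixed products, occurring once on each side of the difference.\<close>

lemma (in abelian_group) minus_add_cancel_cross:
  assumes "p \<in> carrier G" "p' \<in> carrier G" "q \<in> carrier G" "q' \<in> carrier G" "s \<in> carrier G" "t \<in> carrier G"
  shows "((p \<oplus> s) \<oplus> (q \<oplus> t)) \<ominus> ((p' \<oplus> t) \<oplus> (q' \<oplus> s)) = (p \<ominus> p') \<oplus> (q \<ominus> q')"
  using assms by (simp add: a_minus_def minus_add a_ac r_neg2 r_neg1 r_neg)

lemma (in ring) mult_minus_distrib:
  "a \<in> carrier R \<Longrightarrow> x \<in> carrier R \<Longrightarrow> y \<in> carrier R \<Longrightarrow> a \<otimes> x \<ominus> a \<otimes> y = a \<otimes> (x \<ominus> y)"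
  by (simp add: a_minus_def r_minus r_distr)

lemma UP_minus_apply: "ring R \<Longrightarrow> p \<in> carrier (UP R) \<Longrightarrow> (\<ominus>\<^bsub>UP R\<^esub> p) n = \<ominus>\<^bsub>R\<^esub> p n"
proof -
  assume "ring R" and p: "p \<in> carrier (UP R)"
  interpret UP_ring R "UP R" using \<open>ring R\<close> by (simp add: UP_ring_def)
  show ?thesis using p coeff_a_inv[OF p, of n] UP_a_inv_closed[OF p] by (simp add: UP_coeff_eq)
qed

lemma UP_smult_apply: "x \<in> carrier R \<Longrightarrow> p \<in> carrier (UP R) \<Longrightarrow> (x \<odot>\<^bsub>UP R\<^esub> p) n = x \<otimes>\<^bsub>R\<^esub> p n"
  by (simp add: UP_def)

locale lambda_bracket = diff_algebra K V D
  for K :: "('k,'m) ring_scheme" (structure) and V :: "('k,'v,'n) module_scheme" and D +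
  fixes L :: "'v \<Rightarrow> 'v \<Rightarrow> nat \<Rightarrow> 'v"
  assumes bider: "lambda_bider L"
begin

lemmas L_bider = lambda_biderD[OF bider]

lemma L_poly [simp]: "a \<in> carrier V \<Longrightarrow> b \<in> carrier V \<Longrightarrow> L a b \<in> carrier U"
  by (rule L_bider)

lemma L_closed [simp]: "a \<in> carrier V \<Longrightarrow> b \<in> carrier V \<Longrightarrow> L a b n \<in> carrier V"
  using L_poly by (auto simp only: U_mem)

lemma L_add_left: "a \<in> carrier V \<Longrightarrow> a' \<in> carrier V \<Longrightarrow> b \<in> carrier V \<Longrightarrow>
    L (a \<oplus>\<^bsub>V\<^esub> a') b n = L a b n \<oplus>\<^bsub>V\<^esub> L a' b n"
  by (simp add: L_bider UP_add_apply)

lemma L_add_right: "a \<in> carrier V \<Longrightarrow> b \<in> carrier V \<Longrightarrow> b' \<in> carrier V \<Longrightarrow>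
    L a (b \<oplus>\<^bsub>V\<^esub> b') n = L a b n \<oplus>\<^bsub>V\<^esub> L a b' n"
  by (simp add: L_bider UP_add_apply)

lemma L_smult_left: "c \<in> carrier K \<Longrightarrow> a \<in> carrier V \<Longrightarrow> b \<in> carrier V \<Longrightarrow>
    L (c \<odot>\<^bsub>V\<^esub> a) b n = c \<odot>\<^bsub>V\<^esub> L a b n"
  by (simp add: L_bider UP_smult_apply V.smult_one_mult)

lemma L_smult_right: "c \<in> carrier K \<Longrightarrow> a \<in> carrier V \<Longrightarrow> b \<in> carrier V \<Longrightarrow>
    L a (c \<odot>\<^bsub>V\<^esub> b) n = c \<odot>\<^bsub>V\<^esub> L a b n"
  by (simp add: L_bider UP_smult_apply V.smult_one_mult)

lemma L_mult_right: "a \<in> carrier V \<Longrightarrow> b \<in> carrier V \<Longrightarrow> c \<in> carrier V \<Longrightarrow>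
    L a (b \<otimes>\<^bsub>V\<^esub> c) n = b \<otimes>\<^bsub>V\<^esub> L a c n \<oplus>\<^bsub>V\<^esub> c \<otimes>\<^bsub>V\<^esub> L a b n"
  by (simp add: L_bider UP_add_apply UP_smult_apply)

lemma L_mult_left: "a \<in> carrier V \<Longrightarrow> b \<in> carrier V \<Longrightarrow> c \<in> carrier V \<Longrightarrow>
    L (a \<otimes>\<^bsub>V\<^esub> b) c n = act a (L b c) n \<oplus>\<^bsub>V\<^esub> act b (L a c) n"
  by (simp add: L_bider UP_add_apply)

lemma L_D_left: "a \<in> carrier V \<Longrightarrow> b \<in> carrier V \<Longrightarrow>
    L (D a) b n = (if n = 0 then \<zero>\<^bsub>V\<^esub> else \<ominus>\<^bsub>V\<^esub> L a b (n - 1))"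
  using cf_lm[of "L a b" n]
  by (simp add: L_bider UP_minus_apply[OF V.ring_axioms] cf_eq split: nat.splits)

lemma L_D_right: "a \<in> carrier V \<Longrightarrow> b \<in> carrier V \<Longrightarrow>
    L a (D b) n = (if n = 0 then \<zero>\<^bsub>V\<^esub> else L a b (n - 1)) \<oplus>\<^bsub>V\<^esub> D (L a b n)"
  using cf_lm[of "L a b" n] cf_T[of "L a b" n]
  by (simp add: L_bider cf_eq split: nat.splits)

lemma L_left_additive: "c \<in> carrier V \<Longrightarrow> additive_map V V (\<lambda>x. L x c n)"
  by unfold_locales (auto intro!: additiveI simp: L_add_left)

lemma L_right_additive: "a \<in> carrier V \<Longrightarrow> additive_map V V (\<lambda>x. L a x n)"
  by unfold_locales (auto intro!: additiveI simp: L_add_right)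

lemma L_zero [simp]: "a \<in> carrier V \<Longrightarrow> L a \<zero>\<^bsub>V\<^esub> n = \<zero>\<^bsub>V\<^esub>" "a \<in> carrier V \<Longrightarrow> L \<zero>\<^bsub>V\<^esub> a n = \<zero>\<^bsub>V\<^esub>"
  by (rule additive_map.zero[OF L_right_additive] additive_map.zero[OF L_left_additive]; assumption)+

lemma L_D_pow_left: "x \<in> carrier V \<Longrightarrow> c \<in> carrier V \<Longrightarrow>
    L ((D ^^ j) x) c s = (if j \<le> s then [((-1) ^ j :: int)] \<cdot>\<^bsub>V\<^esub> L x c (s - j) else \<zero>\<^bsub>V\<^esub>)"
  by (induction j arbitrary: s) (auto simp: L_D_left V.add_pow_int_neg)

lemma L_D_pow_right: "a \<in> carrier V \<Longrightarrow> b \<in> carrier V \<Longrightarrow>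
    L a ((D ^^ j) b) l = V.zlin {..l} (\<lambda>i. int (j choose i)) (\<lambda>i. (D ^^ (j - i)) (L a b (l - i)))"
proof -
  assume ab: "a \<in> carrier V" "b \<in> carrier V"
  have "L a ((D ^^ j) b) = (T ^^ j) (L a b)"
    using ab by (induction j) (auto simp: L_bider)
  then show ?thesis using cf_T_pow[of "L a b" j l] ab by (simp add: cf_eq)
qed

lemma L_bound: "finite F \<Longrightarrow> F \<subseteq> carrier V \<times> carrier V \<Longrightarrow> \<exists>N. \<forall>(a,b)\<in>F. \<forall>n>N. L a b n = \<zero>\<^bsub>V\<^esub>"
proof (induction F rule: finite_induct)
  case (insert p F)
  obtain N where N: "\<forall>(a,b)\<in>F. \<forall>n>N. L a b n = \<zero>\<^bsub>V\<^esub>" using insert by auto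
  obtain M where M: "\<forall>n>M. L (fst p) (snd p) n = \<zero>\<^bsub>V\<^esub>"
    using L_poly[of "fst p" "snd p"] insert.prems by (auto simp: U_mem)
  show ?case using N M by (intro exI[of _ "max N M"]) auto
qed auto

text \<open>The coefficient of \<open>\<lambda>^l \<mu>^m\<close> in \<open>{{a_\<lambda> b}_{\<lambda>+\<mu>} c}\<close>.\<close>

definition nest :: "nat \<Rightarrow> nat \<Rightarrow> 'v \<Rightarrow> 'v \<Rightarrow> 'v \<Rightarrow> 'v" where
  "nest l m a b c = V.zlin {..l} (\<lambda>n. int (l - n + m choose m)) (\<lambda>n. L (L a b n) c (l - n + m))"

definition jac :: "'v \<Rightarrow> 'v \<Rightarrow> 'v \<Rightarrow> bool" where
  "jac a b c \<longleftrightarrow> (\<forall>l m. L a (L b c m) l \<ominus>\<^bsub>V\<^esub> L b (L a c l) m = nest l m a b c)"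

lemma nest_closed [simp]: "a \<in> carrier V \<Longrightarrow> b \<in> carrier V \<Longrightarrow> c \<in> carrier V \<Longrightarrow> nest l m a b c \<in> carrier V"
  unfolding nest_def by (rule V.zlin_closed) auto

text \<open>The coefficient of \<open>\<lambda>^l \<mu>^m\<close> in \<open>(\<lambda> + \<mu>) {{a_\<lambda> b}_{\<lambda>+\<mu>} c}\<close>.\<close>

lemma nest_pascal:
  assumes "a \<in> carrier V" "b \<in> carrier V" "c \<in> carrier V"
  shows "V.zlin {..l} (\<lambda>n. int (l - n + m choose m))
      (\<lambda>n. if l - n + m = 0 then \<zero>\<^bsub>V\<^esub> else L (L a b n) c (l - n + m - 1)) =
    (if l = 0 then \<zero>\<^bsub>V\<^esub> else nest (l - 1) m a b c) \<oplus>\<^bsub>V\<^esub> (if m = 0 then \<zero>\<^bsub>V\<^esub> else nest l (m - 1) a b c)"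
proof (cases "l + m = 0")
  case True
  then show ?thesis using assms by (simp add: V.zlin_def)
next
  case False
  \<comment> \<open>All three sums are written over the same vectors \<open>?x\<close>, set to zero
    where the exponent l + m - 1 - n would be negative. Elsewhere the coefficients satisfy
    \<open>?A = ?B + ?C\<close>, which is Pascal's rule.\<close>
  let ?x = "\<lambda>n. if l + m \<le> n then \<zero>\<^bsub>V\<^esub> else L (L a b n) c (l + m - 1 - n)"
  let ?A = "\<lambda>n. if n \<le> l then int (l - n + m choose m) else 0"
  let ?B = "\<lambda>n. if n < l then int (l - 1 - n + m choose m) else 0"
  let ?C = "\<lambda>n. if n \<le> l \<and> m > 0 then int (l - n + (m - 1) choose (m - 1)) else 0"
  have x: "?x \<in> S \<rightarrow> carrier V" for S using assms by auto
  have A: "V.zlin {..l} (\<lambda>n. int (l - n + m choose m))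
      (\<lambda>n. if l - n + m = 0 then \<zero>\<^bsub>V\<^esub> else L (L a b n) c (l - n + m - 1)) = V.zlin {..l} ?A ?x"
    using assms by (intro V.zlin_cong_supp) (auto simp: Suc_diff_le)
  have B: "(if l = 0 then \<zero>\<^bsub>V\<^esub> else nest (l - 1) m a b c) = V.zlin {..l} ?B ?x"
  proof (cases l)
    case 0
    then show ?thesis using assms by (simp add: V.zlin_def)
  next
    case (Suc k)
    have "nest k m a b c = V.zlin {..k} ?B ?x"
      unfolding nest_def using assms Suc by (intro V.zlin_cong_supp) auto
    also have "\<dots> = V.zlin {..l} ?B ?x"
      using x Suc by (intro V.zlin_neutral) auto
    finally show ?thesis using Suc by simp
  qed
  have C: "(if m = 0 then \<zero>\<^bsub>V\<^esub> else nest l (m - 1) a b c) = V.zlin {..l} ?C ?x"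
  proof (cases m)
    case 0
    then show ?thesis using assms by (simp add: V.zlin_def)
  next
    case (Suc k)
    then show ?thesis
      unfolding nest_def using assms by simp (intro V.zlin_cong_supp, auto)
  qed
  have *: "?A n = ?B n + ?C n" if "n \<le> l" "\<not> l + m \<le> n" for n
  proof -
    obtain j where j: "l = n + j" using le_Suc_ex[OF \<open>n \<le> l\<close>] by blast
    show ?thesis
    proof (cases m)
      case 0 then show ?thesis using that j by simp
    next
      case (Suc k) then show ?thesis using that j by (cases j) simp_all
    qed
  qed
  have "V.zlin {..l} ?A ?x = V.zlin {..l} (\<lambda>n. ?B n + ?C n) ?x"
  proof (rule V.zlin_cong_supp[OF x x])
    fix n assume "n \<in> {..l}"
    then show "(?A n = ?B n + ?C n \<and> (?A n = 0 \<or> ?x n = ?x n)) \<or> (?x n = \<zero>\<^bsub>V\<^esub> \<and> ?x n = \<zero>\<^bsub>V\<^esub>)"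
      using *[of n] by (cases "l + m \<le> n") (simp_all only: if_True atMost_iff simp_thms)
  qed
  also have "\<dots> = V.zlin {..l} ?B ?x \<oplus>\<^bsub>V\<^esub> V.zlin {..l} ?C ?x"
    by (rule V.zlin_add[OF x, symmetric])
  also note B[symmetric]
  also note C[symmetric]
  finally show ?thesis by (rule HOL.trans[OF A])
qed

text \<open>For fixed \<open>a\<close> and \<open>b\<close> both sides are derivations in the last
  variable: on the left as a commutator of derivations, on the right coefficient by
  coefficient.\<close>

lemma jac_mult_right:
  assumes V: "a \<in> carrier V" "b \<in> carrier V" "c \<in> carrier V" "d \<in> carrier V"
    and j: "jac a b c" "jac a b d"
  shows "jac a b (c \<otimes>\<^bsub>V\<^esub> d)"
  unfolding jac_def
proof (intro allI)
  fix l m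
  have "L a (L b (c \<otimes>\<^bsub>V\<^esub> d) m) l \<ominus>\<^bsub>V\<^esub> L b (L a (c \<otimes>\<^bsub>V\<^esub> d) l) m =
     (c \<otimes>\<^bsub>V\<^esub> L a (L b d m) l \<ominus>\<^bsub>V\<^esub> c \<otimes>\<^bsub>V\<^esub> L b (L a d l) m) \<oplus>\<^bsub>V\<^esub>
     (d \<otimes>\<^bsub>V\<^esub> L a (L b c m) l \<ominus>\<^bsub>V\<^esub> d \<otimes>\<^bsub>V\<^esub> L b (L a c l) m)"
    using V by (subst V.minus_add_cancel_cross[symmetric, where s = "L b d m \<otimes>\<^bsub>V\<^esub> L a c l" and t = "L b c m \<otimes>\<^bsub>V\<^esub> L a d l"])
      (simp_all add: L_mult_right L_add_right V.m_comm)
  also have "\<dots> = c \<otimes>\<^bsub>V\<^esub> nest l m a b d \<oplus>\<^bsub>V\<^esub> d \<otimes>\<^bsub>V\<^esub> nest l m a b c"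
    using j V by (simp add: jac_def V.mult_minus_distrib)
  also have "\<dots> = nest l m a b (c \<otimes>\<^bsub>V\<^esub> d)"
    unfolding nest_def using V
    by (simp add: V.zlin_rdistr V.zlin_distrib[symmetric] L_mult_right)
  finally show "L a (L b (c \<otimes>\<^bsub>V\<^esub> d) m) l \<ominus>\<^bsub>V\<^esub> L b (L a (c \<otimes>\<^bsub>V\<^esub> d) l) m = nest l m a b (c \<otimes>\<^bsub>V\<^esub> d)" .
qed

lemma jac_add_right:
  assumes V: "a \<in> carrier V" "b \<in> carrier V" "c \<in> carrier V" "d \<in> carrier V"
    and j: "jac a b c" "jac a b d"
  shows "jac a b (c \<oplus>\<^bsub>V\<^esub> d)"
  unfolding jac_def
proof (intro allI)
  fix l m
  have "L a (L b (c \<oplus>\<^bsub>V\<^esub> d) m) l \<ominus>\<^bsub>V\<^esub> L b (L a (c \<oplus>\<^bsub>V\<^esub> d) l) m =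
    (L a (L b c m) l \<ominus>\<^bsub>V\<^esub> L b (L a c l) m) \<oplus>\<^bsub>V\<^esub> (L a (L b d m) l \<ominus>\<^bsub>V\<^esub> L b (L a d l) m)"
    using V by (simp add: L_add_right a_minus_def V.minus_add V.a_ac)
  also have "\<dots> = nest l m a b (c \<oplus>\<^bsub>V\<^esub> d)"
    using j V by (simp add: jac_def) (simp add: nest_def V.zlin_distrib[symmetric] L_add_right)
  finally show "L a (L b (c \<oplus>\<^bsub>V\<^esub> d) m) l \<ominus>\<^bsub>V\<^esub> L b (L a (c \<oplus>\<^bsub>V\<^esub> d) l) m = nest l m a b (c \<oplus>\<^bsub>V\<^esub> d)" .
qed

lemma smult_zlin:
  assumes "r \<in> carrier K" "x \<in> S \<rightarrow> carrier V"
  shows "r \<odot>\<^bsub>V\<^esub> V.zlin S c x = V.zlin S c (\<lambda>i. r \<odot>\<^bsub>V\<^esub> x i)"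
proof -
  interpret r: additive_map V V "\<lambda>x. r \<odot>\<^bsub>V\<^esub> x"
    using assms by unfold_locales (auto intro!: additiveI simp: V.smult_r_distr)
  show ?thesis using assms by (simp add: r.zlin)
qed

lemma jac_smult_right:
  assumes V: "a \<in> carrier V" "b \<in> carrier V" "c \<in> carrier V" and r: "r \<in> carrier K"
    and j: "jac a b c"
  shows "jac a b (r \<odot>\<^bsub>V\<^esub> c)"
  unfolding jac_def
proof (intro allI)
  fix l m
  have "L a (L b (r \<odot>\<^bsub>V\<^esub> c) m) l \<ominus>\<^bsub>V\<^esub> L b (L a (r \<odot>\<^bsub>V\<^esub> c) l) m =
    r \<odot>\<^bsub>V\<^esub> (L a (L b c m) l \<ominus>\<^bsub>V\<^esub> L b (L a c l) m)"
    using V r by (simp add: L_smult_right a_minus_def V.smult_r_distr V.smult_r_minus)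
  also have "\<dots> = nest l m a b (r \<odot>\<^bsub>V\<^esub> c)"
    using j V r by (simp add: jac_def nest_def smult_zlin L_smult_right)
  finally show "L a (L b (r \<odot>\<^bsub>V\<^esub> c) m) l \<ominus>\<^bsub>V\<^esub> L b (L a (r \<odot>\<^bsub>V\<^esub> c) l) m = nest l m a b (r \<odot>\<^bsub>V\<^esub> c)" .
qed

text \<open>Replacing \<open>c\<close> by \<open>D c\<close> applies \<lambda> + \<mu> + \<partial>
  to both sides.\<close>

lemma jac_D_right:
  assumes V: "a \<in> carrier V" "b \<in> carrier V" "c \<in> carrier V" and j: "jac a b c"
  shows "jac a b (D c)"
  unfolding jac_def
proof (intro allI)
  fix l m

  have "L a (L b (D c) m) l \<ominus>\<^bsub>V\<^esub> L b (L a (D c) l) m =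
    (if l = 0 then \<zero>\<^bsub>V\<^esub> else L a (L b c m) (l - 1) \<ominus>\<^bsub>V\<^esub> L b (L a c (l - 1)) m) \<oplus>\<^bsub>V\<^esub>
    (if m = 0 then \<zero>\<^bsub>V\<^esub> else L a (L b c (m - 1)) l \<ominus>\<^bsub>V\<^esub> L b (L a c l) (m - 1)) \<oplus>\<^bsub>V\<^esub>
    D (L a (L b c m) l \<ominus>\<^bsub>V\<^esub> L b (L a c l) m)"
    using V by (simp add: L_D_right L_add_right a_minus_def V.minus_add V.a_ac)
  also have "\<dots> = ((if l = 0 then \<zero>\<^bsub>V\<^esub> else nest (l - 1) m a b c) \<oplus>\<^bsub>V\<^esub>
      (if m = 0 then \<zero>\<^bsub>V\<^esub> else nest l (m - 1) a b c)) \<oplus>\<^bsub>V\<^esub> D (nest l m a b c)"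
    using j V by (simp only: jac_def simp_thms)
  also have "\<dots> = nest l m a b (D c)"
    unfolding nest_pascal[OF V, symmetric] using V
    by (simp add: nest_def D.zlin V.zlin_distrib[symmetric] L_D_right cong: if_cong)
  finally show "L a (L b (D c) m) l \<ominus>\<^bsub>V\<^esub> L b (L a (D c) l) m = nest l m a b (D c)" .
qed

text \<open>Replacing \<open>b\<close> by \<open>D b\<close> multiplies both sides by -\<mu>. On the
  right, {a_\<lambda> \<partial>b} contributes \<lambda> + \<partial>, and \<partial> in the first
  argument of the outer bracket becomes -(\<lambda> + \<mu>), so \<lambda> cancels.\<close>

lemma jac_D_middle:
  assumes V: "a \<in> carrier V" "b \<in> carrier V" "c \<in> carrier V" and j: "jac a b c"
  shows "jac a (D b) c"
  unfolding jac_def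
proof (intro allI)
  fix l m
  have "L a (L (D b) c m) l \<ominus>\<^bsub>V\<^esub> L (D b) (L a c l) m =
    (if m = 0 then \<zero>\<^bsub>V\<^esub> else \<ominus>\<^bsub>V\<^esub> (L a (L b c (m - 1)) l \<ominus>\<^bsub>V\<^esub> L b (L a c l) (m - 1)))"
    using V by (simp add: L_D_left additive_map.neg[OF L_right_additive] a_minus_def V.minus_add)
  also have "\<dots> = (if m = 0 then \<zero>\<^bsub>V\<^esub> else \<ominus>\<^bsub>V\<^esub> nest l (m - 1) a b c)"
    using j by (simp only: jac_def simp_thms)
  also have "\<dots> = nest l m a (D b) c"
  proof -
    \<comment> \<open>\<open>?s\<close> and \<open>?t\<close> are the coefficients of the nested
      bracket multiplied by \<lambda> + \<mu> and by \<lambda>; their difference leaves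
      \<mu>.\<close>
    let ?s = "V.zlin {..l} (\<lambda>n. int (l - n + m choose m))
        (\<lambda>n. if l - n + m = 0 then \<zero>\<^bsub>V\<^esub> else L (L a b n) c (l - n + m - 1))"
    let ?t = "V.zlin {..l} (\<lambda>n. int (l - n + m choose m))
        (\<lambda>n. if n = 0 then \<zero>\<^bsub>V\<^esub> else L (L a b (n - 1)) c (l - n + m))"
    have t: "?t = (if l = 0 then \<zero>\<^bsub>V\<^esub> else nest (l - 1) m a b c)"
    proof (cases l)
      case 0 then show ?thesis using V by (simp add: V.zlin_def)
    next
      case (Suc k)
      have "nest k m a b c = ?t" unfolding nest_def
      proof (rule V.zlin_transfer[where h = Suc])
        fix t assume t: "t \<in> {..l}"
        have "{i \<in> {..k}. Suc i = t} = (case t of 0 \<Rightarrow> {} | Suc i \<Rightarrow> {i})"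
          using t Suc by (auto split: nat.split)
        then show "(if t = 0 then \<zero>\<^bsub>V\<^esub> else L (L a b (t - 1)) c (l - t + m)) = \<zero>\<^bsub>V\<^esub> \<or>
           (\<Sum>i\<in>{i \<in> {..k}. Suc i = t}. int (k - i + m choose m)) = int (l - t + m choose m)"
          using Suc by (simp split: nat.split)
      qed (use V Suc in auto)
      then show ?thesis using Suc by simp
    qed
    have "nest l m a (D b) c = V.zlin {..l} (\<lambda>n. int (l - n + m choose m))
        (\<lambda>n. (if n = 0 then \<zero>\<^bsub>V\<^esub> else L (L a b (n - 1)) c (l - n + m)) \<oplus>\<^bsub>V\<^esub>
           (if l - n + m = 0 then \<zero>\<^bsub>V\<^esub> else \<ominus>\<^bsub>V\<^esub> L (L a b n) c (l - n + m - 1)))"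
      unfolding nest_def using V
      by (intro V.zlin_cong HOL.refl)
        (auto simp: L_D_right L_add_left L_D_left, (subgoal_tac "m = 0"; simp))
    also have "\<dots> = ?t \<oplus>\<^bsub>V\<^esub> V.zlin {..l} (\<lambda>n. int (l - n + m choose m))
        (\<lambda>n. if l - n + m = 0 then \<zero>\<^bsub>V\<^esub> else \<ominus>\<^bsub>V\<^esub> L (L a b n) c (l - n + m - 1))"
      using V by (intro V.zlin_distrib) auto
    also have "V.zlin {..l} (\<lambda>n. int (l - n + m choose m))
        (\<lambda>n. if l - n + m = 0 then \<zero>\<^bsub>V\<^esub> else \<ominus>\<^bsub>V\<^esub> L (L a b n) c (l - n + m - 1)) = \<ominus>\<^bsub>V\<^esub> ?s"
    proof -
      interpret neg: additive_map V V "\<lambda>x. \<ominus>\<^bsub>V\<^esub> x"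
        by unfold_locales (auto intro!: additiveI simp: V.minus_add)
      show ?thesis using V by (subst neg.zlin) (auto intro!: V.zlin_cong)
    qed
    finally show ?thesis unfolding t nest_pascal[OF V] using V
      by (simp add: V.minus_add V.r_neg1 V.r_neg2 V.a_ac)
  qed
  finally show "L a (L (D b) c m) l \<ominus>\<^bsub>V\<^esub> L (D b) (L a c l) m = nest l m a (D b) c" .
qed

end

text \<open>Both sides count pairs of disjoint subsets of sizes u and m in a set of size t. Out of
  range both vanish, so truncated subtraction does no harm.\<close>

lemma choose_shift_eq:
  "int (t choose u) * int (t - u choose m) = int (u + m choose m) * int (t choose (u + m))"
proof (cases "u + m \<le> t")
  case True
  have "(t choose (u + m)) * (u + m choose u) = (t choose u) * (t - u choose m)"
    using choose_mult[of u "u + m" t] True by simp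
  moreover have "u + m choose u = u + m choose m"
    using binomial_symmetric[of u "u + m"] by simp
  ultimately show ?thesis by (metis mult.commute of_nat_mult)
next
  case False
  then have "u + m > t" "u \<le> t \<Longrightarrow> m > t - u" by auto
  then show ?thesis by (cases "u \<le> t") (auto simp: binomial_eq_0)
qed

lemma (in cring) zlin_ldistr:
  assumes "a \<in> carrier R" "x \<in> S \<rightarrow> carrier R"
  shows "zlin S c x \<otimes> a = zlin S c (\<lambda>i. x i \<otimes> a)"
proof -
  interpret additive_map R R "\<lambda>x. x \<otimes> a"
    using assms by unfold_locales (auto intro!: additiveI simp: l_distr)
  show ?thesis using assms by (simp add: zlin)
qed

section \<open>The Jacobi identity under exchange of arguments and for products\<close>

context lambda_bracket
begin

text \<open>Exchanging \<open>a\<close> with \<open>b\<close> and \<lambda> with \<mu> changes the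
  sign of the left side. On the right, skew-symmetry gives -{{b_{-\<lambda>-\<partial>}
  a}_{\<lambda>+\<mu>} c}, and \<partial> in the first argument of the outer bracket is -(\<lambda>
  + \<mu>), so that -\<lambda>-\<partial> turns into \<mu>.\<close>

lemma jac_swap:
  assumes V: "a \<in> carrier V" "b \<in> carrier V" "c \<in> carrier V"
    and skew: "L a b = \<ominus>\<^bsub>U\<^esub> sg (L b a)" and j: "jac a b c"
  shows "jac b a c"
proof -
  have "nest l m a b c = \<ominus>\<^bsub>V\<^esub> nest m l b a c" for l m
  proof -
    obtain N0 where N0: "\<And>n. n > N0 \<Longrightarrow> L b a n = \<zero>\<^bsub>V\<^esub>"
      using L_poly[OF V(2,1)] by (auto simp only: U_mem)
    \<comment> \<open>The range must contain the support of {b_\<lambda> a} and, for the final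
      restriction to \<open>{..m}\<close>, also reach m.\<close>
    define N where "N = max N0 (l + m)"
    have N: "\<And>n. n > N \<Longrightarrow> L b a n = \<zero>\<^bsub>V\<^esub>" and lmN: "l + m \<le> N"
      using N0 by (auto simp: N_def)
    \<comment> \<open>Once the k - n derivatives are turned into powers of -(\<lambda> + \<mu>), a
      summand depends on k alone up to an integer factor, and it vanishes for k > l + m.\<close>
    let ?x = "\<lambda>t. if t \<le> l + m then L (L b a t) c (l + m - t) else \<zero>\<^bsub>V\<^esub>"
    let ?S = "Sigma {..l} (\<lambda>_. {..N})"
    let ?c = "\<lambda>(n,k). int (l - n + m choose m) * ((-1) ^ k * int (k choose n) * (-1) ^ (k - n)) :: int"
    have x: "?x \<in> F \<rightarrow> carrier V" for F using V by auto
    have ab: "L a b n = \<ominus>\<^bsub>V\<^esub> V.zlin {..N} (\<lambda>k. (-1) ^ k * int (k choose n)) (\<lambda>k. (D ^^ (k - n)) (L b a k))" for n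
      using V N unfolding skew by (simp add: UP_minus_apply[OF V.ring_axioms] sg_coeff[of _ N])
    have inner: "L (L a b n) c (l - n + m) = \<ominus>\<^bsub>V\<^esub> V.zlin {..N} (\<lambda>k. (-1) ^ k * int (k choose n) * (-1) ^ (k - n)) ?x"
      if n: "n \<le> l" for n
    proof -
      interpret l: additive_map V V "\<lambda>x. L x c (l - n + m)" by (rule L_left_additive[OF V(3)])
      have "L (L a b n) c (l - n + m) = \<ominus>\<^bsub>V\<^esub> V.zlin {..N} (\<lambda>k. (-1) ^ k * int (k choose n))
          (\<lambda>k. L ((D ^^ (k - n)) (L b a k)) c (l - n + m))"
        unfolding ab using V by (subst l.neg) (auto simp: l.zlin intro!: V.zlin_closed)
      also have "V.zlin {..N} (\<lambda>k. (-1) ^ k * int (k choose n))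
          (\<lambda>k. L ((D ^^ (k - n)) (L b a k)) c (l - n + m)) =
        V.zlin {..N} (\<lambda>k. (-1) ^ k * int (k choose n) * (-1) ^ (k - n)) ?x"
        unfolding V.zlin_def
      proof (rule V.finsum_cong'[OF HOL.refl])
        fix k assume "k \<in> {..N}"
        show "[((-1) ^ k * int (k choose n))] \<cdot>\<^bsub>V\<^esub> L ((D ^^ (k - n)) (L b a k)) c (l - n + m) =
          [((-1) ^ k * int (k choose n) * (-1) ^ (k - n))] \<cdot>\<^bsub>V\<^esub> ?x k"
        proof (cases "n \<le> k")
          case True
          then have "k - n \<le> l - n + m \<longleftrightarrow> k \<le> l + m" "l - n + m - (k - n) = l + m - k" using n by auto
          then show ?thesis using V by (simp add: L_D_pow_left V.add_pow_int_mult)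
        qed (use V in \<open>simp add: binomial_eq_0\<close>)
      qed (use V in auto)
      finally show ?thesis .
    qed
    have "nest l m a b c = V.zlin {..l} (\<lambda>n. int (l - n + m choose m))
        (\<lambda>n. \<ominus>\<^bsub>V\<^esub> V.zlin {..N} (\<lambda>k. (-1) ^ k * int (k choose n) * (-1) ^ (k - n)) ?x)"
      unfolding nest_def using x
      by (intro V.zlin_cong HOL.refl) (simp only: inner atMost_iff, use x in auto)
    also have "\<dots> = \<ominus>\<^bsub>V\<^esub> V.zlin {..l} (\<lambda>n. int (l - n + m choose m))
        (\<lambda>n. V.zlin {..N} (\<lambda>k. (-1) ^ k * int (k choose n) * (-1) ^ (k - n)) ?x)"
    proof -
      interpret neg: additive_map V V "\<lambda>x. \<ominus>\<^bsub>V\<^esub> x"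
        by unfold_locales (auto intro!: additiveI simp: V.minus_add)
      show ?thesis using x by (subst neg.zlin) auto
    qed
    also have "V.zlin {..l} (\<lambda>n. int (l - n + m choose m))
        (\<lambda>n. V.zlin {..N} (\<lambda>k. (-1) ^ k * int (k choose n) * (-1) ^ (k - n)) ?x) =
      V.zlin ?S ?c (\<lambda>(n,k). ?x k)"
      using V by (intro V.zlin_Sigma) auto
    \<comment> \<open>Collecting the pairs (n, k) with the same k leaves the alternating sum of
      \<open>alternating_sum_choose\<close>; the signs from skew-symmetry and from the derivatives
      combine to (-1)^n.\<close>
    also have "\<dots> = V.zlin {..N} (\<lambda>t. if t \<le> m then int (m - t + l choose l) else 0) ?x"
    proof (rule V.zlin_transfer[where h = snd])
      fix t assume t: "t \<in> {..N}"
      have "(\<Sum>i\<in>{i \<in> ?S. snd i = t}. ?c i) = (if t \<le> m then int (m - t + l choose l) else 0)" if "t \<le> l + m"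
      proof -
        have eq: "{i \<in> ?S. snd i = t} = (\<lambda>n. (n,t)) ` {..l}" using t by auto
        have "(\<Sum>i\<in>{i \<in> ?S. snd i = t}. ?c i) = (\<Sum>n\<le>l. ?c (n,t))"
          unfolding eq by (subst sum.reindex) (auto simp: inj_on_def)
        also have "\<dots> = (\<Sum>n\<le>l. (-1) ^ n * int (t choose n) * int (l + m - n choose m))"
        proof (rule sum.cong[OF HOL.refl])
          fix n assume n: "n \<in> {..l}"
          show "?c (n,t) = (-1) ^ n * int (t choose n) * int (l + m - n choose m)"
          proof (cases "n \<le> t")
            case True
            then obtain k where k: "t = n + k" using le_Suc_ex by blast
            have "(-1) ^ t * (-1) ^ (t - n) = ((-1) ^ n :: int)"
              unfolding k by (simp add: power_add mult.assoc flip: power_mult_distrib)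
            then show ?thesis using n by (simp add: mult.commute mult.left_commute)
          qed (simp add: binomial_eq_0)
        qed
        finally show ?thesis using alternating_sum_choose[OF that] by simp
      qed
      then show "?x t = \<zero>\<^bsub>V\<^esub> \<or> (\<Sum>i\<in>{i \<in> ?S. snd i = t}. ?c i) = (if t \<le> m then int (m - t + l choose l) else 0)"
        by simp
    qed (use x V in auto)
    also have "\<dots> = V.zlin {..m} (\<lambda>t. if t \<le> m then int (m - t + l choose l) else 0) ?x"
      using x lmN by (intro V.zlin_neutral[symmetric]) auto
    also have "\<dots> = nest m l b a c"
      unfolding nest_def using V by (intro V.zlin_cong HOL.refl) (auto simp: add.commute)
    finally show ?thesis .
  qed
  note n = this
  show ?thesis unfolding jac_def
  proof (intro allI)
    fix l m
    have "L b (L a c m) l \<ominus>\<^bsub>V\<^esub> L a (L b c l) m = \<ominus>\<^bsub>V\<^esub> (L a (L b c l) m \<ominus>\<^bsub>V\<^esub> L b (L a c m) l)"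
      using V by (simp add: a_minus_def V.minus_add V.a_comm)
    also have "\<dots> = \<ominus>\<^bsub>V\<^esub> nest m l a b c" using j by (simp only: jac_def)
    also have "\<dots> = nest l m b a c" using V by (simp add: n[of m l])
    finally show "L b (L a c m) l \<ominus>\<^bsub>V\<^esub> L a (L b c l) m = nest l m b a c" .
  qed
qed

text \<open>Expanding the left side by the left Leibniz rule gives terms where \<open>a\<close>
  meets the bracket with \<open>c\<close>, handled by the Jacobi identity of one factor, and terms
  where \<open>a\<close> meets derivatives of the other factor. The right side, expanded first in
  {a_\<lambda> bb'} and then in the outer bracket, gives the same four terms, paired
  crosswise.\<close>

lemma jac_mult_middle:
  assumes V: "a \<in> carrier V" "b \<in> carrier V" "b' \<in> carrier V" "c \<in> carrier V"
    and j: "jac a b c" "jac a b' c"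
  shows "jac a (b \<otimes>\<^bsub>V\<^esub> b') c"
  unfolding jac_def
proof (intro allI)
  fix l m
  \<comment> \<open>One bound for all brackets that are about to be expanded by
    \<open>act_coeff\<close>.\<close>
  have "\<exists>N. \<forall>(u,v)\<in>{(b,c),(b',c),(b, L a c l),(b', L a c l)} \<union> (\<lambda>i. (L a b i, c)) ` {..l} \<union> (\<lambda>i. (L a b' i, c)) ` {..l}.
     \<forall>n>N. L u v n = \<zero>\<^bsub>V\<^esub>"
    using V by (intro L_bound) auto
  then obtain N where N': "\<forall>(u,v)\<in>{(b,c),(b',c),(b, L a c l),(b', L a c l)} \<union> (\<lambda>i. (L a b i, c)) ` {..l} \<union> (\<lambda>i. (L a b' i, c)) ` {..l}.
     \<forall>n>N. L u v n = \<zero>\<^bsub>V\<^esub>" ..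
  have N: "\<And>n. n > N \<Longrightarrow> L b c n = \<zero>\<^bsub>V\<^esub>" "\<And>n. n > N \<Longrightarrow> L b' c n = \<zero>\<^bsub>V\<^esub>"
    "\<And>n. n > N \<Longrightarrow> L b (L a c l) n = \<zero>\<^bsub>V\<^esub>" "\<And>n. n > N \<Longrightarrow> L b' (L a c l) n = \<zero>\<^bsub>V\<^esub>"
    "\<And>n i. n > N \<Longrightarrow> i \<le> l \<Longrightarrow> L (L a b i) c n = \<zero>\<^bsub>V\<^esub>"
    "\<And>n i. n > N \<Longrightarrow> i \<le> l \<Longrightarrow> L (L a b' i) c n = \<zero>\<^bsub>V\<^esub>"
    using N' by (auto simp: ball_Un)
  \<comment> \<open>In \<open>G x y\<close> the nested bracket of \<open>a\<close>,
    \<open>x\<close>, \<open>c\<close> multiplies derivatives of \<open>y\<close>; in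
    \<open>H x y\<close> the bracket of \<open>x\<close> with \<open>c\<close> multiplies the
    bracket of \<open>a\<close> with derivatives of \<open>y\<close>.\<close>
  define G where "G x y = V.zlin {..N} (\<lambda>n. int (n choose m)) (\<lambda>n. nest l n a x c \<otimes>\<^bsub>V\<^esub> (D ^^ (n - m)) y)" for x y
  define H where "H x y = V.zlin {..N} (\<lambda>n. int (n choose m)) (\<lambda>n. L x c n \<otimes>\<^bsub>V\<^esub> L a ((D ^^ (n - m)) y) l)" for x y
  have GH_closed [simp]: "G x y \<in> carrier V" "H x y \<in> carrier V" if "x \<in> carrier V" "y \<in> carrier V" for x y
    using that V unfolding G_def H_def by auto
  have lhs: "L a (act y (L x c) m) l \<ominus>\<^bsub>V\<^esub> act y (L x (L a c l)) m = G x y \<oplus>\<^bsub>V\<^esub> H x y"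
    if x: "x \<in> carrier V" and y: "y \<in> carrier V" and jx: "jac a x c"
      and Nx: "\<And>n. n > N \<Longrightarrow> L x c n = \<zero>\<^bsub>V\<^esub>" "\<And>n. n > N \<Longrightarrow> L x (L a c l) n = \<zero>\<^bsub>V\<^esub>" for x y
  proof -
    let ?z = "\<lambda>f. V.zlin {..N} (\<lambda>n. int (n choose m)) f"
    let ?d = "\<lambda>n. (D ^^ (n - m)) y"
    interpret r: additive_map V V "\<lambda>x. L a x l" by (rule L_right_additive[OF V(1)])
    have "L a (act y (L x c) m) l = ?z (\<lambda>n. L a (L x c n \<otimes>\<^bsub>V\<^esub> ?d n) l)"
      using V x y Nx by (simp add: act_coeff[of _ _ N] r.zlin)
    also have "\<dots> = ?z (\<lambda>n. L x c n \<otimes>\<^bsub>V\<^esub> L a (?d n) l) \<oplus>\<^bsub>V\<^esub> ?z (\<lambda>n. L a (L x c n) l \<otimes>\<^bsub>V\<^esub> ?d n)"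
      using V x y by (subst V.zlin_distrib[symmetric]) (auto simp: L_mult_right V.m_comm intro!: V.zlin_cong)
    finally have 1: "L a (act y (L x c) m) l =
      ?z (\<lambda>n. L x c n \<otimes>\<^bsub>V\<^esub> L a (?d n) l) \<oplus>\<^bsub>V\<^esub> ?z (\<lambda>n. L a (L x c n) l \<otimes>\<^bsub>V\<^esub> ?d n)" .
    have 2: "act y (L x (L a c l)) m = ?z (\<lambda>n. L x (L a c l) n \<otimes>\<^bsub>V\<^esub> ?d n)"
      using V x y Nx by (simp add: act_coeff[of _ _ N])
    have "G x y = ?z (\<lambda>n. (L a (L x c n) l \<ominus>\<^bsub>V\<^esub> L x (L a c l) n) \<otimes>\<^bsub>V\<^esub> ?d n)"
      unfolding G_def using jx by (simp only: jac_def)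
    moreover have "\<dots> \<oplus>\<^bsub>V\<^esub> ?z (\<lambda>n. L x (L a c l) n \<otimes>\<^bsub>V\<^esub> ?d n) = ?z (\<lambda>n. L a (L x c n) l \<otimes>\<^bsub>V\<^esub> ?d n)"
      using V x y
      by (subst V.zlin_distrib[symmetric])
        (auto intro!: V.zlin_cong simp: V.l_distr[symmetric] a_minus_def V.a_assoc V.l_neg)
    ultimately have 3: "?z (\<lambda>n. L a (L x c n) l \<otimes>\<^bsub>V\<^esub> ?d n) = G x y \<oplus>\<^bsub>V\<^esub> act y (L x (L a c l)) m"
      unfolding 2 by simp
    have "act y (L x (L a c l)) m \<in> carrier V"
      unfolding 2 using V x y by (intro V.zlin_closed) auto
    then have "(H x y \<oplus>\<^bsub>V\<^esub> (G x y \<oplus>\<^bsub>V\<^esub> act y (L x (L a c l)) m)) \<ominus>\<^bsub>V\<^esub> act y (L x (L a c l)) m =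
        H x y \<oplus>\<^bsub>V\<^esub> G x y"
      using x y by (simp add: a_minus_def V.a_assoc V.r_neg)
    then show ?thesis unfolding 1 3 H_def[symmetric] using x y by (simp add: V.a_comm)
  qed
  have G: "G x y = V.zlin {..l} (\<lambda>n. int (l - n + m choose m)) (\<lambda>n. act y (L (L a x n) c) (l - n + m))"
    if x: "x \<in> carrier V" and y: "y \<in> carrier V"
      and Nx: "\<And>n i. n > N \<Longrightarrow> i \<le> l \<Longrightarrow> L (L a x i) c n = \<zero>\<^bsub>V\<^esub>" for x y
  proof -
    let ?S = "Sigma {..N} (\<lambda>_. {..l})" and ?T = "Sigma {..l} (\<lambda>_. {..N + l})"
    let ?x = "\<lambda>(i,t). L (L a x i) c t \<otimes>\<^bsub>V\<^esub> (D ^^ (t - (l - i + m))) y"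
    let ?c = "\<lambda>(n,i). int (n choose m) * int (l - i + n choose n)"
    \<comment> \<open>The new index t = l - i + n is the coefficient index in the outer bracket. It
      comes from some n only if l - i \<le> t; otherwise the fibre is empty and the binomial on the
      other side is zero. Indices t > N carry zero vectors.\<close>
    let ?h = "\<lambda>(n,i). (i, l - i + n)"
    have "G x y = V.zlin {..N} (\<lambda>n. int (n choose m)) (\<lambda>n. V.zlin {..l} (\<lambda>i. int (l - i + n choose n))
        (\<lambda>i. L (L a x i) c (l - i + n) \<otimes>\<^bsub>V\<^esub> (D ^^ (n - m)) y))"
      unfolding G_def nest_def using V x y
      by (intro V.zlin_cong HOL.refl) (auto simp: V.zlin_ldistr intro!: V.zlin_closed)
    also have "\<dots> = V.zlin ?S ?c (\<lambda>(n,i). L (L a x i) c (l - i + n) \<otimes>\<^bsub>V\<^esub> (D ^^ (n - m)) y)"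
      using V x y by (intro V.zlin_Sigma) auto
    also have "\<dots> = V.zlin ?T (\<lambda>(i,t). int (l - i + m choose m) * int (t choose (l - i + m))) ?x"
    proof (rule V.zlin_transfer[where h = ?h])
      fix p assume "p \<in> ?T"
      then obtain i t where p: "p = (i,t)" "i \<le> l" "t \<le> N + l" by auto
      have "(\<Sum>q\<in>{q \<in> ?S. ?h q = p}. ?c q) = int (l - i + m choose m) * int (t choose (l - i + m))" if "t \<le> N"
      proof (cases "l - i \<le> t")
        case True
        then have "{q \<in> ?S. ?h q = p} = {(t - (l - i), i)}" using p that by auto
        moreover have "int (t - (l - i) choose m) * int (t choose (t - (l - i))) =
            int (l - i + m choose m) * int (t choose (l - i + m))"
          using choose_shift_eq[of t "l - i" m] binomial_symmetric[OF True] by (simp add: mult.commute)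
        ultimately show ?thesis using True by simp
      next
        case False
        then have "(\<Sum>q\<in>{q \<in> ?S. ?h q = p}. ?c q) = 0" using p by (intro sum.neutral) auto
        then show ?thesis using False by (simp add: binomial_eq_0)
      qed
      then show "?x p = \<zero>\<^bsub>V\<^esub> \<or> (\<Sum>q\<in>{q \<in> ?S. ?h q = p}. ?c q) =
          (case p of (i,t) \<Rightarrow> int (l - i + m choose m) * int (t choose (l - i + m)))"
        using p Nx[of t i] V y by (cases "t \<le> N") auto
    next
      fix q assume "q \<in> ?S"
      then show "?c q = 0 \<or> (case q of (n,i) \<Rightarrow> L (L a x i) c (l - i + n) \<otimes>\<^bsub>V\<^esub> (D ^^ (n - m)) y) = ?x (?h q)"
        by auto
    qed (use V x y in auto)
    also have "\<dots> = V.zlin {..l} (\<lambda>n. int (l - n + m choose m))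
      (\<lambda>n. V.zlin {..N + l} (\<lambda>t. int (t choose (l - n + m))) (\<lambda>t. L (L a x n) c t \<otimes>\<^bsub>V\<^esub> (D ^^ (t - (l - n + m))) y))"
      using V x y by (intro V.zlin_Sigma[symmetric]) auto
    also have "\<dots> = V.zlin {..l} (\<lambda>n. int (l - n + m choose m)) (\<lambda>n. act y (L (L a x n) c) (l - n + m))"
      using V x y Nx
      by (intro V.zlin_cong HOL.refl) (auto simp: act_coeff[of _ _ "N + l"] U_mem[symmetric] intro: V.zlin_closed)
    finally show ?thesis .
  qed
  have H: "H y x = V.zlin {..l} (\<lambda>n. int (l - n + m choose m)) (\<lambda>n. act (L a x n) (L y c) (l - n + m))"
    if x: "x \<in> carrier V" and y: "y \<in> carrier V" and Ny: "\<And>n. n > N \<Longrightarrow> L y c n = \<zero>\<^bsub>V\<^esub>" for x y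
  proof -
    let ?S = "Sigma {..N} (\<lambda>_. {..l})" and ?T = "Sigma {..l} (\<lambda>_. {..N})"
    let ?x = "\<lambda>(j,n). L y c n \<otimes>\<^bsub>V\<^esub> (D ^^ (n - (l - j + m))) (L a x j)"
    let ?c = "\<lambda>(n,i). int (n choose m) * int (n - m choose i)"
    \<comment> \<open>Here i is the power of \<lambda> taken from (\<lambda> + \<partial>)^(n - m),
      and j = l - i is the coefficient of {a_\<lambda> x} that remains. This reindexing has
      one-element fibres.\<close>
    let ?h = "\<lambda>(n,i). (l - i, n)"
    have "H y x = V.zlin {..N} (\<lambda>n. int (n choose m)) (\<lambda>n. V.zlin {..l} (\<lambda>i. int (n - m choose i))
        (\<lambda>i. L y c n \<otimes>\<^bsub>V\<^esub> (D ^^ (n - m - i)) (L a x (l - i))))"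
      unfolding H_def using V x y
      by (intro V.zlin_cong HOL.refl) (auto simp: V.zlin_rdistr L_D_pow_right intro!: V.zlin_closed)
    also have "\<dots> = V.zlin ?S ?c (\<lambda>(n,i). L y c n \<otimes>\<^bsub>V\<^esub> (D ^^ (n - m - i)) (L a x (l - i)))"
      using V x y by (intro V.zlin_Sigma) auto
    also have "\<dots> = V.zlin ?T (\<lambda>(j,n). int (l - j + m choose m) * int (n choose (l - j + m))) ?x"
    proof (rule V.zlin_transfer[where h = ?h])
      fix p assume "p \<in> ?T"
      then obtain j n where p: "p = (j,n)" "j \<le> l" "n \<le> N" by auto
      have "{q \<in> ?S. ?h q = p} = {(n, l - j)}" using p by auto
      moreover have "int (n choose m) * int (n - m choose (l - j)) = int (l - j + m choose m) * int (n choose (l - j + m))"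
        using choose_shift_eq[of n m "l - j"] binomial_symmetric[of m "m + (l - j)"]
        by (simp add: add.commute)
      ultimately show "?x p = \<zero>\<^bsub>V\<^esub> \<or> (\<Sum>q\<in>{q \<in> ?S. ?h q = p}. ?c q) =
          (case p of (j,n) \<Rightarrow> int (l - j + m choose m) * int (n choose (l - j + m)))"
        using p by simp
    next
      fix q assume "q \<in> ?S"
      then show "?c q = 0 \<or> (case q of (n,i) \<Rightarrow> L y c n \<otimes>\<^bsub>V\<^esub> (D ^^ (n - m - i)) (L a x (l - i))) = ?x (?h q)"
        by (auto simp: add.commute)
    qed (use V x y in auto)
    also have "\<dots> = V.zlin {..l} (\<lambda>n. int (l - n + m choose m))
      (\<lambda>j. V.zlin {..N} (\<lambda>n. int (n choose (l - j + m))) (\<lambda>n. L y c n \<otimes>\<^bsub>V\<^esub> (D ^^ (n - (l - j + m))) (L a x j)))"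
      using V x y by (intro V.zlin_Sigma[symmetric]) auto
    also have "\<dots> = V.zlin {..l} (\<lambda>n. int (l - n + m choose m)) (\<lambda>n. act (L a x n) (L y c) (l - n + m))"
      using V x y Ny
      by (intro V.zlin_cong HOL.refl) (auto simp: act_coeff[of _ _ N] intro: V.zlin_closed)
    finally show ?thesis .
  qed
  have act_cl: "act y p n \<in> carrier V" if "y \<in> carrier V" "p \<in> carrier U" for y p n
    using act_closed[OF that] by (auto simp only: U_mem)
  have "L a (L (b \<otimes>\<^bsub>V\<^esub> b') c m) l \<ominus>\<^bsub>V\<^esub> L (b \<otimes>\<^bsub>V\<^esub> b') (L a c l) m =
     (L a (act b (L b' c) m) l \<ominus>\<^bsub>V\<^esub> act b (L b' (L a c l)) m) \<oplus>\<^bsub>V\<^esub>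
     (L a (act b' (L b c) m) l \<ominus>\<^bsub>V\<^esub> act b' (L b (L a c l)) m)"
    using V act_cl by (simp add: L_mult_left L_add_right a_minus_def V.minus_add V.a_ac)
  also have "\<dots> = (G b' b \<oplus>\<^bsub>V\<^esub> H b' b) \<oplus>\<^bsub>V\<^esub> (G b b' \<oplus>\<^bsub>V\<^esub> H b b')"
    using V j N by (simp add: lhs)
  \<comment> \<open>The two \<open>H\<close> terms change places: {a_\<lambda> b'} acting on {b c}
    accompanies the \<open>b'\<close>-term of the nested bracket, although it arose from the other
    half of the left side.\<close>
  also have "\<dots> = (G b' b \<oplus>\<^bsub>V\<^esub> H b b') \<oplus>\<^bsub>V\<^esub> (G b b' \<oplus>\<^bsub>V\<^esub> H b' b)"
    using V by (simp add: V.a_ac)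
  also have "\<dots> = nest l m a (b \<otimes>\<^bsub>V\<^esub> b') c"
  proof -
    let ?z = "\<lambda>f. V.zlin {..l} (\<lambda>n. int (l - n + m choose m)) f"
    have "nest l m a (b \<otimes>\<^bsub>V\<^esub> b') c = ?z (\<lambda>n.
        (act b (L (L a b' n) c) (l - n + m) \<oplus>\<^bsub>V\<^esub> act (L a b' n) (L b c) (l - n + m)) \<oplus>\<^bsub>V\<^esub>
        (act b' (L (L a b n) c) (l - n + m) \<oplus>\<^bsub>V\<^esub> act (L a b n) (L b' c) (l - n + m)))"
      unfolding nest_def using V act_cl
      by (intro V.zlin_cong HOL.refl) (auto simp: L_mult_right L_add_left L_mult_left)
    also have "\<dots> = (?z (\<lambda>n. act b (L (L a b' n) c) (l - n + m)) \<oplus>\<^bsub>V\<^esub> ?z (\<lambda>n. act (L a b' n) (L b c) (l - n + m))) \<oplus>\<^bsub>V\<^esub>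
       (?z (\<lambda>n. act b' (L (L a b n) c) (l - n + m)) \<oplus>\<^bsub>V\<^esub> ?z (\<lambda>n. act (L a b n) (L b' c) (l - n + m)))"
      using V act_cl by (simp add: V.zlin_distrib Pi_iff)
    finally show ?thesis using V N by (simp add: G H)
  qed
  finally show "L a (L (b \<otimes>\<^bsub>V\<^esub> b') c m) l \<ominus>\<^bsub>V\<^esub> L (b \<otimes>\<^bsub>V\<^esub> b') (L a c l) m = nest l m a (b \<otimes>\<^bsub>V\<^esub> b') c" .
qed

end

section \<open>Poisson vertex algebras\<close>

context diff_algebra
begin

lemma smult_scal:
  assumes "c \<in> carrier K" "p \<in> carrier U"
  shows "(c \<odot>\<^bsub>V\<^esub> \<one>\<^bsub>V\<^esub>) \<odot>\<^bsub>U\<^esub> p = (\<lambda>n. c \<odot>\<^bsub>V\<^esub> p n)"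
proof
  fix n
  have "p n \<in> carrier V" using assms by (simp add: U_mem)
  then show "((c \<odot>\<^bsub>V\<^esub> \<one>\<^bsub>V\<^esub>) \<odot>\<^bsub>U\<^esub> p) n = c \<odot>\<^bsub>V\<^esub> p n"
    using assms by (simp add: UP_smult_apply V.smult_one_mult)
qed

lemma pvaI:
  assumes L: "lambda_bider L"
    and skew: "\<And>a b. a \<in> carrier V \<Longrightarrow> b \<in> carrier V \<Longrightarrow> L a b = \<ominus>\<^bsub>U\<^esub> sg (L b a)"
    and jac: "\<And>a b c l m. a \<in> carrier V \<Longrightarrow> b \<in> carrier V \<Longrightarrow> c \<in> carrier V \<Longrightarrow>
      L a (L b c m) l \<ominus>\<^bsub>V\<^esub> L b (L a c l) m =
        (\<Oplus>\<^bsub>V\<^esub>n\<in>{..l}. [((l - n + m) choose m)] \<cdot>\<^bsub>V\<^esub> L (L a b n) c (l - n + m))"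
  shows "poisson_vertex_algebra K V D L"
proof
  note L = lambda_biderD[OF L]
  fix a b c assume abc: "a \<in> carrier V" "b \<in> carrier V" "c \<in> carrier V"
  show "L (a \<otimes>\<^bsub>V\<^esub> b) c = shift_arrow V D (L a c) b \<oplus>\<^bsub>U\<^esub> shift_arrow V D (L b c) a"
    using abc by (simp add: L act_def[symmetric] U.P.a_comm)
  show "L a (b \<otimes>\<^bsub>V\<^esub> c) = c \<odot>\<^bsub>U\<^esub> L a b \<oplus>\<^bsub>U\<^esub> b \<odot>\<^bsub>U\<^esub> L a c"
    using abc by (simp add: L U.P.a_comm)
next
  note L = lambda_biderD[OF L]
  fix r a b assume "r \<in> carrier K" "a \<in> carrier V" "b \<in> carrier V"
  then show "L (r \<odot>\<^bsub>V\<^esub> a) b = (\<lambda>n. r \<odot>\<^bsub>V\<^esub> L a b n)" "L a (r \<odot>\<^bsub>V\<^esub> b) = (\<lambda>n. r \<odot>\<^bsub>V\<^esub> L a b n)"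
    by (simp_all add: L smult_scal)
qed ((rule der skew jac; assumption) | (simp add: lambda_biderD[OF L] lm_def[symmetric] der; fail))+

lemma pva_lambda_bider:
  assumes "poisson_vertex_algebra K V D L" shows "lambda_bider L"
proof -
  interpret P: poisson_vertex_algebra K V D L by fact
  show ?thesis
  proof (rule lambda_biderI)
    fix c f g assume c: "c \<in> carrier K" "f \<in> carrier V" "g \<in> carrier V"
    then show "L (c \<odot>\<^bsub>V\<^esub> f) g = (c \<odot>\<^bsub>V\<^esub> \<one>\<^bsub>V\<^esub>) \<odot>\<^bsub>U\<^esub> L f g" "L f (c \<odot>\<^bsub>V\<^esub> g) = (c \<odot>\<^bsub>V\<^esub> \<one>\<^bsub>V\<^esub>) \<odot>\<^bsub>U\<^esub> L f g"
      by (simp_all add: P.lbr_smult_left P.lbr_smult_right P.lbr_closed smult_scal)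
  qed (auto simp: P.lbr_closed P.lbr_add_left P.lbr_add_right P.leibniz_right P.leibniz_left
      P.sesqui_left P.sesqui_right act_def[symmetric] lm_def U.P.a_comm)
qed

text \<open>\<open>jet_bracket\<close> is selected among extensional functions, while the extension
  of derivations gives no control outside the carrier; the biderivation axioms only look inside
  it.\<close>

lemma lambda_bider_restrict:
  "lambda_bider L \<Longrightarrow> lambda_bider (\<lambda>f\<in>carrier V. \<lambda>g\<in>carrier V. L f g)"
  unfolding lambda_bider_def mder_def by simp

end

context lambda_bracket
begin

lemma jac_iff:
  assumes "a \<in> carrier V" "b \<in> carrier V" "c \<in> carrier V"
  shows "jac a b c \<longleftrightarrow> (\<forall>l m. L a (L b c m) l \<ominus>\<^bsub>V\<^esub> L b (L a c l) m =
        (\<Oplus>\<^bsub>V\<^esub>n\<in>{..l}. [((l - n + m) choose m)] \<cdot>\<^bsub>V\<^esub> L (L a b n) c (l - n + m)))"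
  unfolding jac_def nest_def V.zlin_def by (simp add: V.add_pow_int_of_nat)

lemma jac_add_middle:
  assumes V: "a \<in> carrier V" "b \<in> carrier V" "b' \<in> carrier V" "c \<in> carrier V"
    and j: "jac a b c" "jac a b' c"
  shows "jac a (b \<oplus>\<^bsub>V\<^esub> b') c"
  unfolding jac_def
proof (intro allI)
  fix l m
  have "L a (L (b \<oplus>\<^bsub>V\<^esub> b') c m) l \<ominus>\<^bsub>V\<^esub> L (b \<oplus>\<^bsub>V\<^esub> b') (L a c l) m =
    (L a (L b c m) l \<ominus>\<^bsub>V\<^esub> L b (L a c l) m) \<oplus>\<^bsub>V\<^esub> (L a (L b' c m) l \<ominus>\<^bsub>V\<^esub> L b' (L a c l) m)"
    using V by (simp add: L_add_right L_add_left a_minus_def V.minus_add V.a_ac)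
  also have "\<dots> = nest l m a (b \<oplus>\<^bsub>V\<^esub> b') c"
    using j V by (simp add: jac_def) (simp add: nest_def V.zlin_distrib[symmetric] L_add_right L_add_left)
  finally show "L a (L (b \<oplus>\<^bsub>V\<^esub> b') c m) l \<ominus>\<^bsub>V\<^esub> L (b \<oplus>\<^bsub>V\<^esub> b') (L a c l) m = nest l m a (b \<oplus>\<^bsub>V\<^esub> b') c" .
qed

lemma jac_smult_middle:
  assumes V: "a \<in> carrier V" "b \<in> carrier V" "c \<in> carrier V" and r: "r \<in> carrier K"
    and j: "jac a b c"
  shows "jac a (r \<odot>\<^bsub>V\<^esub> b) c"
  unfolding jac_def
proof (intro allI)
  fix l m
  have "L a (L (r \<odot>\<^bsub>V\<^esub> b) c m) l \<ominus>\<^bsub>V\<^esub> L (r \<odot>\<^bsub>V\<^esub> b) (L a c l) m =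
    r \<odot>\<^bsub>V\<^esub> (L a (L b c m) l \<ominus>\<^bsub>V\<^esub> L b (L a c l) m)"
    using V r by (simp add: L_smult_right L_smult_left a_minus_def V.smult_r_distr V.smult_r_minus)
  also have "\<dots> = nest l m a (r \<odot>\<^bsub>V\<^esub> b) c"
    using j V r by (simp add: jac_def nest_def smult_zlin L_smult_right L_smult_left)
  finally show "L a (L (r \<odot>\<^bsub>V\<^esub> b) c m) l \<ominus>\<^bsub>V\<^esub> L (r \<odot>\<^bsub>V\<^esub> b) (L a c l) m = nest l m a (r \<odot>\<^bsub>V\<^esub> b) c" .
qed

end

lemma (in poisson_algebra) bracket_skew:
  assumes "a \<in> carrier A" "b \<in> carrier A"
  shows "P b a = \<ominus>\<^bsub>A\<^esub> P a b"
proof -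
  have "P (a \<oplus>\<^bsub>A\<^esub> b) (a \<oplus>\<^bsub>A\<^esub> b) = (P a a \<oplus>\<^bsub>A\<^esub> P b a) \<oplus>\<^bsub>A\<^esub> (P a b \<oplus>\<^bsub>A\<^esub> P b b)"
    using assms by (simp add: bracket_add_left bracket_add_right bracket_closed M.a_ac)
  then have "P b a \<oplus>\<^bsub>A\<^esub> P a b = \<zero>\<^bsub>A\<^esub>"
    using assms by (simp add: bracket_alt bracket_closed)
  then show ?thesis using assms by (simp add: minus_equality bracket_closed)
qed

lemma (in poisson_algebra) bider: "bider K A P"
proof (intro bider.intro bider_axioms.intro jets.intro)
  show "algebra K A" by (rule algebra_axioms)
  fix a b c assume abc: "a \<in> carrier A" "b \<in> carrier A" "c \<in> carrier A"
  show r: "P a (b \<otimes>\<^bsub>A\<^esub> c) = b \<otimes>\<^bsub>A\<^esub> P a c \<oplus>\<^bsub>A\<^esub> c \<otimes>\<^bsub>A\<^esub> P a b"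
    unfolding bracket_leibniz[OF abc] using abc bracket_closed
    by (simp add: M.a_comm m_comm[of "P a b" c])
  have "P (a \<otimes>\<^bsub>A\<^esub> b) c = \<ominus>\<^bsub>A\<^esub> P c (a \<otimes>\<^bsub>A\<^esub> b)"
    using abc by (intro bracket_skew) auto
  also have "\<dots> = \<ominus>\<^bsub>A\<^esub> (P c a \<otimes>\<^bsub>A\<^esub> b \<oplus>\<^bsub>A\<^esub> a \<otimes>\<^bsub>A\<^esub> P c b)"
    by (simp only: bracket_leibniz[OF abc(3,1,2)])
  also have "\<dots> = a \<otimes>\<^bsub>A\<^esub> (\<ominus>\<^bsub>A\<^esub> P c b) \<oplus>\<^bsub>A\<^esub> b \<otimes>\<^bsub>A\<^esub> (\<ominus>\<^bsub>A\<^esub> P c a)"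
    using abc bracket_closed by (simp add: M.minus_add r_minus M.a_comm m_comm[of "P c a" b])
  also have "\<dots> = a \<otimes>\<^bsub>A\<^esub> P b c \<oplus>\<^bsub>A\<^esub> b \<otimes>\<^bsub>A\<^esub> P a c"
    by (simp only: bracket_skew[OF abc(3,2)] bracket_skew[OF abc(3,1)])
  finally show "P (a \<otimes>\<^bsub>A\<^esub> b) c = a \<otimes>\<^bsub>A\<^esub> P b c \<oplus>\<^bsub>A\<^esub> b \<otimes>\<^bsub>A\<^esub> P a c" .
qed (rule bracket_closed bracket_add_left bracket_add_right bracket_smult_left bracket_smult_right; assumption)+

context bider
begin

text \<open>The Jacobi identity is spread from \<open>A\<close> to the last variable, then to the
  middle one. Two further steps, an exchange and a second induction in the middle variable, replace
  an induction in the first.\<close>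

lemma jet_pvaI:
  assumes pa: "poisson_algebra K A P" and L: "dj.lambda_bider L"
    and g: "\<And>a b. a \<in> carrier A \<Longrightarrow> b \<in> carrier A \<Longrightarrow>
      L (gen 0 a) (gen 0 b) = monom (UP (jet K A)) (gen 0 (P a b)) 0"
  shows "poisson_vertex_algebra K (jet K A) (jet_der K A) L"
proof (rule dj.pvaI[OF L])
  note bracket_skew = poisson_algebra.bracket_skew[OF pa] and bracket_jacobi = poisson_algebra.bracket_jacobi[OF pa]
  interpret lb: lambda_bracket K "jet K A" "jet_der K A" L
    by unfold_locales (rule L)
  note [simp] = br_closed
  have skew: "L a b = \<ominus>\<^bsub>dj.U\<^esub> dj.sg (L b a)" if "a \<in> carrier J" "b \<in> carrier J" for a b
  proof (rule lambda_bider_eqI[OF L dj.lambda_bider_opposite[OF L] _ that])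
    fix a b assume ab: "a \<in> carrier A" "b \<in> carrier A"
    have "gen 0 (\<ominus>\<^bsub>A\<^esub> P a b) = \<ominus>\<^bsub>J\<^esub> gen 0 (P a b)"
    proof -
      interpret h: additive_map A J "gen 0"
        by unfold_locales (auto intro!: additiveI simp: gen_add)
      show ?thesis using ab by simp
    qed
    then show "L (gen 0 a) (gen 0 b) = \<ominus>\<^bsub>dj.U\<^esub> dj.sg (L (gen 0 b) (gen 0 a))"
      using ab by (simp add: g dj.sigma_monom bracket_skew[of a b])
  qed
  then show "\<And>a b. a \<in> carrier J \<Longrightarrow> b \<in> carrier J \<Longrightarrow> L a b = \<ominus>\<^bsub>dj.U\<^esub> dj.sg (L b a)" .
  have gn: "L (gen 0 a) (gen 0 b) n = (if n = 0 then gen 0 (P a b) else \<zero>\<^bsub>J\<^esub>)"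
    if "a \<in> carrier A" "b \<in> carrier A" for a b n
    using that by (simp add: g UP_monom_apply)
  \<comment> \<open>On \<open>A\<close> all brackets are constant in \<lambda>, so only the
    coefficient with l = m = 0 says anything, and there it is the Jacobi identity of
    \<open>P\<close>.\<close>
  have 1: "lb.jac (gen 0 a) (gen 0 b) (gen 0 c)"
    if abc: "a \<in> carrier A" "b \<in> carrier A" "c \<in> carrier A" for a b c
    unfolding lb.jac_def
  proof (intro allI)
    fix l m
    have "lb.nest l m (gen 0 a) (gen 0 b) (gen 0 c) =
      J.M.zlin {0} (\<lambda>n. int (l - n + m choose m)) (\<lambda>n. L (L (gen 0 a) (gen 0 b) n) (gen 0 c) (l - n + m))"
      unfolding lb.nest_def using abc by (intro J.M.zlin_neutral[symmetric]) (auto simp: gn)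
    also have "\<dots> = (if l + m = 0 then gen 0 (P (P a b) c) else \<zero>\<^bsub>J\<^esub>)"
      using abc by (simp add: J.M.zlin_def gn)
    also have "gen 0 (P (P a b) c) = gen 0 (P a (P b c)) \<ominus>\<^bsub>J\<^esub> gen 0 (P b (P a c))"
    proof -
      interpret h: additive_map A J "gen 0"
        by unfold_locales (auto intro!: additiveI simp: gen_add)
      interpret r: additive_map A A "\<lambda>x. P b x"
        using abc by unfold_locales (auto intro!: additiveI simp: br_add_right)
      have "P a (P b c) \<oplus>\<^bsub>A\<^esub> P b (P c a) = \<ominus>\<^bsub>A\<^esub> P c (P a b)"
        using bracket_jacobi[OF abc] abc by (simp add: A.minus_equality[symmetric])
      then have "P (P a b) c = P a (P b c) \<ominus>\<^bsub>A\<^esub> P b (P a c)"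
        using abc by (simp add: bracket_skew[of c "P a b"] bracket_skew[of a c] a_minus_def)
      then show ?thesis using abc by simp
    qed
    finally show "L (gen 0 a) (L (gen 0 b) (gen 0 c) m) l \<ominus>\<^bsub>J\<^esub>
        L (gen 0 b) (L (gen 0 a) (gen 0 c) l) m =
        lb.nest l m (gen 0 a) (gen 0 b) (gen 0 c)"
      using abc by (simp add: gn a_minus_def)
  qed
  have 2: "lb.jac (gen 0 a) (gen 0 b) z"
    if ab: "a \<in> carrier A" "b \<in> carrier A" and z: "z \<in> carrier J" for a b z
    using z by (induction rule: jet_induct)
      (use ab in \<open>simp_all add: 1 lb.jac_add_right lb.jac_smult_right lb.jac_mult_right lb.jac_D_right\<close>)
  have 3: "lb.jac (gen 0 a) y z"
    if a: "a \<in> carrier A" and y: "y \<in> carrier J" and z: "z \<in> carrier J" for a y z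
    using y by (induction rule: jet_induct)
      (use a z in \<open>simp_all add: 2 lb.jac_add_middle lb.jac_smult_middle lb.jac_mult_middle lb.jac_D_middle\<close>)
  \<comment> \<open>Swapping \<open>3\<close> frees the first slot and puts an element of
    \<open>A\<close> in the middle, which is the base case of the induction in
    \<open>5\<close>.\<close>
  have 4: "lb.jac x (gen 0 a) z"
    if "a \<in> carrier A" "x \<in> carrier J" "z \<in> carrier J" for a x z
    using that by (intro lb.jac_swap[OF _ _ _ _ 3]) (auto intro: skew)
  have 5: "lb.jac x y z"
    if x: "x \<in> carrier J" and y: "y \<in> carrier J" and z: "z \<in> carrier J" for x y z
    using y by (induction rule: jet_induct)
      (use x z in \<open>simp_all add: 4 lb.jac_add_middle lb.jac_smult_middle lb.jac_mult_middle lb.jac_D_middle\<close>)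
  show "L a (L b c m) l \<ominus>\<^bsub>J\<^esub> L b (L a c l) m =
        (\<Oplus>\<^bsub>J\<^esub>n\<in>{..l}. [((l - n + m) choose m)] \<cdot>\<^bsub>J\<^esub> L (L a b n) c (l - n + m))"
    if "a \<in> carrier J" "b \<in> carrier J" "c \<in> carrier J" for a b c l m
    using 5[OF that] lb.jac_iff[OF that] by blast
qed

lemma jet_bracket:
  assumes pa: "poisson_algebra K A P"
  shows "poisson_vertex_algebra K (jet K A) (jet_der K A) (jet_bracket K A P)" (is ?pva)
    and "a \<in> carrier A \<Longrightarrow> b \<in> carrier A \<Longrightarrow>
      jet_bracket K A P (jet_gen K A 0 a) (jet_gen K A 0 b) = monom (UP (jet K A)) (jet_gen K A 0 (P a b)) 0"
proof -
  let ?Q = "\<lambda>L. L \<in> carrier (jet K A) \<rightarrow>\<^sub>E (carrier (jet K A) \<rightarrow>\<^sub>E carrier (UP (jet K A))) \<and>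
     poisson_vertex_algebra K (jet K A) (jet_der K A) L \<and>
     (\<forall>a\<in>carrier A. \<forall>b\<in>carrier A.
        L (jet_gen K A 0 a) (jet_gen K A 0 b) = monom (UP (jet K A)) (jet_gen K A 0 (P a b)) 0)"
  have "\<exists>!L. ?Q L"
  proof (rule ex_ex1I)
    obtain L where L: "dj.lambda_bider L"
      "\<And>a b. a \<in> carrier A \<Longrightarrow> b \<in> carrier A \<Longrightarrow> L (gen 0 a) (gen 0 b) = monom dj.U (gen 0 (P a b)) 0"
      by (rule lambda_bider_exists) (rule that; assumption)
    let ?L = "\<lambda>f\<in>carrier J. \<lambda>g\<in>carrier J. L f g"
    have "poisson_vertex_algebra K (jet K A) (jet_der K A) ?L"
      by (rule jet_pvaI[OF pa dj.lambda_bider_restrict[OF L(1)]]) (simp add: L(2))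
    moreover have "?L \<in> carrier J \<rightarrow>\<^sub>E (carrier J \<rightarrow>\<^sub>E carrier dj.U)"
      using dj.lambda_biderD(1)[OF L(1)] by (simp only: restrict_PiE Pi_iff) blast
    moreover have "\<forall>a\<in>carrier A. \<forall>b\<in>carrier A. ?L (gen 0 a) (gen 0 b) = monom dj.U (gen 0 (P a b)) 0"
      by (simp add: L(2))
    ultimately have "?Q ?L" by (intro conjI)
    then show "\<exists>L. ?Q L" by (rule exI[of ?Q])
  next
    fix L M assume L: "?Q L" and M: "?Q M"
    have "L f g = M f g" if "f \<in> carrier J" "g \<in> carrier J" for f g
    proof (rule lambda_bider_eqI[OF _ _ _ that])
      show "dj.lambda_bider L" "dj.lambda_bider M"
        by (rule dj.pva_lambda_bider, rule conjunct1[OF conjunct2[OF L]])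
          (rule dj.pva_lambda_bider, rule conjunct1[OF conjunct2[OF M]])
      show "L (gen 0 a) (gen 0 b) = M (gen 0 a) (gen 0 b)" if "a \<in> carrier A" "b \<in> carrier A" for a b
        using bspec[OF bspec[OF conjunct2[OF conjunct2[OF L]] that(1)] that(2)]
          bspec[OF bspec[OF conjunct2[OF conjunct2[OF M]] that(1)] that(2)] by (rule HOL.trans[OF _ HOL.sym])
    qed
    then have fg: "L f = M f" if "f \<in> carrier J" for f
      using that by (intro PiE_ext[OF PiE_mem[OF conjunct1[OF L] that] PiE_mem[OF conjunct1[OF M] that]])
    show "L = M"
      by (rule PiE_ext[OF conjunct1[OF L] conjunct1[OF M] fg])
  qed
  note q = theI'[OF this, folded jet_bracket_def]
  show ?pva by (rule conjunct1[OF conjunct2[OF q]])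
  show "a \<in> carrier A \<Longrightarrow> b \<in> carrier A \<Longrightarrow>
      jet_bracket K A P (jet_gen K A 0 a) (jet_gen K A 0 b) = monom (UP (jet K A)) (jet_gen K A 0 (P a b)) 0"
    using conjunct2[OF conjunct2[OF q]] by blast
qed

end

section \<open>Morphisms of differential algebras and brackets\<close>

locale diff_hom = V: diff_algebra K V D + W: diff_algebra K W E
  for K :: "('k,'m) ring_scheme" (structure) and V :: "('k,'v,'n) module_scheme" and D
    and W :: "('k,'w,'p) module_scheme" and E +
  fixes F :: "'v \<Rightarrow> 'w"
  assumes hom: "alg_hom K V W F" and F_D: "x \<in> carrier V \<Longrightarrow> F (D x) = E (F x)"
begin

lemmas F_simps [simp] = alg_homD(2-)[OF hom] F_D

sublocale F: additive_map V W F
  by unfold_locales (auto intro!: additiveI)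

definition Fm :: "(nat \<Rightarrow> 'v) \<Rightarrow> nat \<Rightarrow> 'w" where "Fm p = (\<lambda>n. F (p n))"

lemma Fm_closed [simp]: "p \<in> carrier V.U \<Longrightarrow> Fm p \<in> carrier W.U"
  unfolding V.U_mem W.U_mem Fm_def using F.zero F.closed by metis

lemma cf_Fm: "p \<in> carrier V.U \<Longrightarrow> W.cf (Fm p) n = F (V.cf p n)"
  by (simp add: W.cf_eq V.cf_eq) (simp add: Fm_def)

lemma Fm_add [simp]: "p \<in> carrier V.U \<Longrightarrow> q \<in> carrier V.U \<Longrightarrow> Fm (p \<oplus>\<^bsub>V.U\<^esub> q) = Fm p \<oplus>\<^bsub>W.U\<^esub> Fm q"
  by (rule W.U.up_eqI) (auto simp: cf_Fm)

sublocale Fm: additive_map V.U W.U Fm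
  by unfold_locales (auto intro!: additiveI)

lemma Fm_smult [simp]: "x \<in> carrier V \<Longrightarrow> p \<in> carrier V.U \<Longrightarrow> Fm (x \<odot>\<^bsub>V.U\<^esub> p) = F x \<odot>\<^bsub>W.U\<^esub> Fm p"
  by (rule W.U.up_eqI) (auto simp: cf_Fm)

lemma Fm_lm [simp]: "p \<in> carrier V.U \<Longrightarrow> Fm (V.lm p) = W.lm (Fm p)"
  by (rule W.U.up_eqI) (auto simp: cf_Fm V.cf_lm W.cf_lm split: nat.split)

lemma Fm_T [simp]: "p \<in> carrier V.U \<Longrightarrow> Fm (V.T p) = W.T (Fm p)"
  by (rule W.U.up_eqI) (auto simp: cf_Fm V.cf_lm W.cf_lm V.cf_T W.cf_T split: nat.split)

lemma Fm_monom [simp]: "v \<in> carrier V \<Longrightarrow> Fm (monom V.U v n) = monom W.U (F v) n"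
  by (rule W.U.up_eqI) (auto simp: cf_Fm)

lemma Fm_T_pow: "p \<in> carrier V.U \<Longrightarrow> Fm ((V.T ^^ n) p) = (W.T ^^ n) (Fm p)"
  by (induction n) auto

lemma Fm_nT_pow: "p \<in> carrier V.U \<Longrightarrow> Fm ((V.nT ^^ n) p) = (W.nT ^^ n) (Fm p)"
  by (induction n) (auto simp: V.nT_def W.nT_def)

lemma Fm_act [simp]:
  assumes "x \<in> carrier V" "p \<in> carrier V.U" shows "Fm (V.act x p) = W.act (F x) (Fm p)"
  using assms(2)
proof (induction rule: V.up_induct)
  case (monom v n)
  then show ?case using assms by (simp add: V.act_monom W.act_monom Fm_T_pow)
next
  case (add p q)
  then show ?case using assms by simp
qed

lemma Fm_sg [simp]: assumes "p \<in> carrier V.U" shows "Fm (V.sg p) = W.sg (Fm p)"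
  using assms
proof (induction rule: V.up_induct)
  case (monom v n)
  then show ?case using assms by (simp add: V.sigma_monom W.sigma_monom Fm_nT_pow)
next
  case (add p q)
  then show ?case by simp
qed

text \<open>Meant for inclusions of subalgebras. The axioms over \<open>V\<close> live in another
  polynomial ring than those over \<open>W\<close>, so they cannot just be restricted;
  \<open>Fm\<close> commutes with all operators involved, and an injective \<open>F\<close> reflects
  equations.\<close>

lemma pva_pullback:
  assumes inj: "inj_on F (carrier V)" and pva: "poisson_vertex_algebra K W E M"
    and L: "\<And>a b. a \<in> carrier V \<Longrightarrow> b \<in> carrier V \<Longrightarrow> L a b \<in> carrier V.U"
    and FL: "\<And>a b n. a \<in> carrier V \<Longrightarrow> b \<in> carrier V \<Longrightarrow> F (L a b n) = M (F a) (F b) n"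
  shows "poisson_vertex_algebra K V D L"
proof -
  interpret P: poisson_vertex_algebra K W E M by fact
  have M: "W.lambda_bider M" by (rule W.pva_lambda_bider[OF pva])
  note M' = W.lambda_biderD[OF M]
  have eqI: "p = q" if "p \<in> carrier V.U" "q \<in> carrier V.U" "Fm p = Fm q" for p q
  proof
    fix n
    have "F (p n) = F (q n)" using that(3) by (simp add: Fm_def fun_eq_iff)
    then show "p n = q n" using that(1,2) inj by (simp add: V.U_mem inj_on_def)
  qed
  have FmL: "Fm (L a b) = M (F a) (F b)" if "a \<in> carrier V" "b \<in> carrier V" for a b
    using FL[OF that] by (simp add: Fm_def)
  have Ln: "L a b n \<in> carrier V" if "a \<in> carrier V" "b \<in> carrier V" for a b n
    using L[OF that] by (simp only: V.U_mem)
  show ?thesis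
  proof (rule V.pvaI)
    show "V.lambda_bider L"
      by (rule V.lambda_biderI; (rule eqI)?; simp add: L FmL M' V.D_scal)
    show "L a b = \<ominus>\<^bsub>V.U\<^esub> V.sg (L b a)" if "a \<in> carrier V" "b \<in> carrier V" for a b
    proof (rule eqI)
      have "M (F a) (F b) = \<ominus>\<^bsub>W.U\<^esub> W.sg (M (F b) (F a))" using that by (intro P.skew) auto
      then show "Fm (L a b) = Fm (\<ominus>\<^bsub>V.U\<^esub> V.sg (L b a))"
        using that FmL[OF that] FmL[OF that(2,1)] L[OF that(2,1)]
        by (simp only: Fm.neg Fm_sg V.sigma.closed)
    qed (use that L in auto)
    fix a b c l m assume abc: "a \<in> carrier V" "b \<in> carrier V" "c \<in> carrier V"
    have "F (L a (L b c m) l \<ominus>\<^bsub>V\<^esub> L b (L a c l) m) =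
      M (F a) (M (F b) (F c) m) l \<ominus>\<^bsub>W\<^esub> M (F b) (M (F a) (F c) l) m"
      using abc by (simp add: Ln FL)
    also have "\<dots> = (\<Oplus>\<^bsub>W\<^esub>n\<in>{..l}. [((l - n + m) choose m)] \<cdot>\<^bsub>W\<^esub> M (M (F a) (F b) n) (F c) (l - n + m))"
      using abc by (intro P.jacobi) auto
    also have "\<dots> = F (\<Oplus>\<^bsub>V\<^esub>n\<in>{..l}. [((l - n + m) choose m)] \<cdot>\<^bsub>V\<^esub> L (L a b n) c (l - n + m))"
      using abc by (subst F.finsum) (auto simp: Ln FL F.add_pow)
    finally show "L a (L b c m) l \<ominus>\<^bsub>V\<^esub> L b (L a c l) m =
        (\<Oplus>\<^bsub>V\<^esub>n\<in>{..l}. [((l - n + m) choose m)] \<cdot>\<^bsub>V\<^esub> L (L a b n) c (l - n + m))"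
      using abc by (intro inj_onD[OF inj]) (auto simp: Ln)
  qed
qed

end

text \<open>In each argument both sides are derivations over \<open>F\<close> compatible with
  \<partial>, so the comparison is decided on \<open>A\<close>.\<close>

lemma bider_hom_bracket:
  fixes A :: "('k,'a,'n) module_scheme" and W :: "('k,'w,'p) module_scheme"
  assumes A: "jets K A" and F: "diff_hom K (jet K A) (jet_der K A) W E F"
    and L: "diff_algebra.lambda_bider K (jet K A) (jet_der K A) L"
    and M: "diff_algebra.lambda_bider K W E M"
    and g: "\<And>a b n. a \<in> carrier A \<Longrightarrow> b \<in> carrier A \<Longrightarrow>
      F (L (jet_gen K A 0 a) (jet_gen K A 0 b) n) = M (F (jet_gen K A 0 a)) (F (jet_gen K A 0 b)) n"
    and xy: "x \<in> carrier (jet K A)" "y \<in> carrier (jet K A)"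
  shows "M (F x) (F y) = (\<lambda>n. F (L x y n))"
proof -
  interpret jets K A by fact
  interpret F: diff_hom K J D W E F by fact
  note l = dj.lambda_biderD[OF L] and m = F.W.lambda_biderD[OF M]
  have 1: "F.Fm (L (gen 0 a) y) = M (F (gen 0 a)) (F y)" if a: "a \<in> carrier A" and y: "y \<in> carrier J" for a y
    using y
  proof (induction rule: jet_induct)
    case (gen b)
    then show ?case using g[OF a] by (simp add: F.Fm_def)
  qed (use a in \<open>simp_all add: l m\<close>)
  have 2: "F.Fm (L x y) = M (F x) (F y)"
    using xy(1)
  proof (induction rule: jet_induct)
    case (gen a)
    then show ?case using 1 xy by simp
  qed (use xy(2) in \<open>simp_all add: l m\<close>)
  then show ?thesis by (simp add: F.Fm_def)
qed

section \<open>Points of reduced algebras of finite type\<close>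

lemma (in "domain") nat_pow_nonzero: "a \<in> carrier R \<Longrightarrow> a \<noteq> \<zero> \<Longrightarrow> a [^] (n::nat) \<noteq> \<zero>"
  by (induction n) (auto simp: integral_iff)

text \<open>Algebraic closedness is stated for polynomials as lists with the leading coefficient in
  front, whence \<open>rev\<close>; this links them to finite sums of powers.\<close>

lemma (in ring) eval_map_rev:
  assumes "f \<in> {..<n} \<rightarrow> carrier R" "x \<in> carrier R"
  shows "eval (map f (rev [0..<n])) x = (\<Oplus>i\<in>{..<n}. f i \<otimes> x [^] i)"
  using assms(1)
proof (induction n)
  case 0
  then show ?case by simp
next
  case (Suc n)
  then have "eval (map f (rev [0..<n])) x = (\<Oplus>i\<in>{..<n}. f i \<otimes> x [^] i)" by (intro Suc.IH) auto
  then show ?case using Suc.prems assms(2) by (simp add: lessThan_Suc Pi_iff)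
qed

lemma (in algebraically_closed) root_exists:
  assumes f: "\<And>i. f i \<in> carrier L" and n: "n > 0" "f n \<noteq> \<zero>"
  obtains x where "x \<in> carrier L" "(\<Oplus>i\<in>{..n}. f i \<otimes> x [^] (i::nat)) = \<zero>"
proof -
  define p where "p = map f (rev [0..<Suc n])"
  have deg: "degree p = n" by (simp add: p_def)
  have hd: "p \<noteq> []" "lead_coeff p = f n" by (simp_all add: p_def)
  have "set p \<subseteq> carrier L" using f unfolding p_def by auto
  then have p: "p \<in> carrier (poly_ring L)"
    unfolding univ_poly_carrier[symmetric] polynomial_def using hd n(2) by simp
  have "size (roots p) = n"
    using roots_over_carrier[OF p] unfolding splitted_def deg .
  then have "roots p \<noteq> {#}" using n(1) by force
  then obtain x where "x \<in># roots p" by blast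
  then have x: "is_root p x" unfolding roots_mem_iff_is_root[OF p] .
  show ?thesis
  proof (rule that)
    show xc: "x \<in> carrier L" using x unfolding is_root_def by blast
    have "eval p x = \<zero>" using x unfolding is_root_def by blast
    then show "(\<Oplus>i\<in>{..n}. f i \<otimes> x [^] i) = \<zero>"
      unfolding p_def using eval_map_rev[of f "Suc n" x] f xc unfolding lessThan_Suc_atMost by auto
  qed
qed

lemma (in algebraically_closed) non_root_exists:
  assumes f: "\<And>i. f i \<in> carrier L" and n: "f n \<noteq> \<zero>"
  obtains x where "x \<in> carrier L" "(\<Oplus>i\<in>{..n}. f i \<otimes> x [^] (i::nat)) \<noteq> \<zero>"
proof (cases "n = 0")
  case True
  then show ?thesis using f n by (intro that[of "\<zero>"]) auto
next
  case False
  \<comment> \<open>A root of f - 1 is a point where f takes the value 1. For n > 0 the leading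
    coefficient is unchanged, so such a root exists, and the infinitude of the field does not
    enter.\<close>
  define g where "g i = (if i = 0 then f 0 \<ominus> \<one> else f i)" for i
  have g: "\<And>i. g i \<in> carrier L" using f by (simp add: g_def)
  obtain x where x: "x \<in> carrier L" "(\<Oplus>i\<in>{..n}. g i \<otimes> x [^] i) = \<zero>"
    using root_exists[of g n] g False n by (auto simp: g_def)
  have *: "(\<Oplus>i\<in>{..m}. f i \<otimes> x [^] i) = (\<Oplus>i\<in>{..m}. g i \<otimes> x [^] i) \<oplus> \<one>" for m
  proof (induction m)
    case 0
    then show ?case using f x by (simp add: g_def a_minus_def a_assoc l_neg)
  next
    case (Suc m)
    have "g (Suc m) = f (Suc m)" by (simp add: g_def)
    then show ?case using Suc f g x by (simp add: a_assoc)
  qed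
  show ?thesis using x by (intro that[of x]) (simp_all add: *)
qed

lemma ring_hom_factor:
  assumes "ring S" "ring Q" "ring K"
    and f: "f \<in> ring_hom S Q" and g: "g \<in> ring_hom S K"
    and ker: "\<And>x. x \<in> carrier S \<Longrightarrow> f x = \<zero>\<^bsub>Q\<^esub> \<Longrightarrow> g x = \<zero>\<^bsub>K\<^esub>"
  obtains h where "h \<in> ring_hom (Q\<lparr>carrier := f ` carrier S\<rparr>) K" "\<And>x. x \<in> carrier S \<Longrightarrow> h (f x) = g x"
proof -
  interpret S: ring S by fact
  interpret Q: ring Q by fact
  interpret K: ring K by fact
  interpret f: ring_hom_ring S Q f by unfold_locales (rule f)
  interpret g: ring_hom_ring S K g by unfold_locales (rule g)
  define h where "h y = g (SOME x. x \<in> carrier S \<and> f x = y)" for y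
  have h: "h (f x) = g x" if x: "x \<in> carrier S" for x
  proof -
    define y where "y = (SOME x'. x' \<in> carrier S \<and> f x' = f x)"
    have y: "y \<in> carrier S" "f y = f x"
      unfolding y_def by (rule someI2[of _ x]; use x in simp)+
    have "g (y \<ominus>\<^bsub>S\<^esub> x) = \<zero>\<^bsub>K\<^esub>"
      using x y by (intro ker) (simp_all add: a_minus_def Q.r_neg)
    then have "g y \<ominus>\<^bsub>K\<^esub> g x = \<zero>\<^bsub>K\<^esub>" using x y by (simp add: a_minus_def)
    then show ?thesis using x y unfolding h_def y_def[symmetric] by (simp add: K.r_right_minus_eq)
  qed
  show ?thesis
  proof (rule that[of h])
    show "h \<in> ring_hom (Q\<lparr>carrier := f ` carrier S\<rparr>) K"
    proof (rule ring_hom_memI)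
      fix u assume "u \<in> carrier (Q\<lparr>carrier := f ` carrier S\<rparr>)"
      then show "h u \<in> carrier K" using h by auto
    next
      fix u v assume "u \<in> carrier (Q\<lparr>carrier := f ` carrier S\<rparr>)" "v \<in> carrier (Q\<lparr>carrier := f ` carrier S\<rparr>)"
      then obtain x y where xy: "x \<in> carrier S" "y \<in> carrier S" "u = f x" "v = f y" by auto
      show "h (u \<otimes>\<^bsub>Q\<lparr>carrier := f ` carrier S\<rparr>\<^esub> v) = h u \<otimes>\<^bsub>K\<^esub> h v"
        using h[of "x \<otimes>\<^bsub>S\<^esub> y"] xy by (simp add: h)
      show "h (u \<oplus>\<^bsub>Q\<lparr>carrier := f ` carrier S\<rparr>\<^esub> v) = h u \<oplus>\<^bsub>K\<^esub> h v"
        using h[of "x \<oplus>\<^bsub>S\<^esub> y"] xy by (simp add: h)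
    next
      show "h \<one>\<^bsub>Q\<lparr>carrier := f ` carrier S\<rparr>\<^esub> = \<one>\<^bsub>K\<^esub>" using h[of "\<one>\<^bsub>S\<^esub>"] by simp
    qed
  qed (rule h)
qed

text \<open>A form of the Nullstellensatz made for induction over generators: every nonzero element
  of \<open>R\<close> is nonzero at some \<open>K\<close>-point of \<open>R\<close>. The domain
  \<open>Q\<close> stays fixed while \<open>R\<close> grows inside it, and \<open>\<kappa>\<close>
  is its structure map.\<close>

definition separating ::
  "('k,'m) ring_scheme \<Rightarrow> ('q,'n) ring_scheme \<Rightarrow> ('k \<Rightarrow> 'q) \<Rightarrow> 'q set \<Rightarrow> bool" where
  "separating K Q \<kappa> R \<longleftrightarrow> subring R Q \<and> \<kappa> ` carrier K \<subseteq> R \<and>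
     (\<forall>s\<in>R. s \<noteq> \<zero>\<^bsub>Q\<^esub> \<longrightarrow> (\<exists>\<phi>\<in>ring_hom (Q\<lparr>carrier := R\<rparr>) K. (\<forall>c\<in>carrier K. \<phi> (\<kappa> c) = c) \<and> \<phi> s \<noteq> \<zero>\<^bsub>K\<^esub>))"

locale separating_ext = K: algebraically_closed K + Q: "domain" Q
  for K :: "('k,'m) ring_scheme" and Q :: "('q,'n) ring_scheme" +
  fixes \<kappa> :: "'k \<Rightarrow> 'q" and R :: "'q set" and x :: 'q
  assumes sep: "separating K Q \<kappa> R" and x: "x \<in> carrier Q"
begin

lemma subring: "subring R Q"
  using sep by (simp add: separating_def)

lemma R_sub: "R \<subseteq> carrier Q"
  by (rule subringE(1)[OF subring])

abbreviation "R' \<equiv> Q\<lparr>carrier := R\<rparr>"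

sublocale R: "domain" R'
  by (rule Q.subring_is_domain[OF subring])

sublocale U: UP_domain R' "UP R'"
  by unfold_locales

lemma incl_hom: "ring_hom_cring R' Q (\<lambda>y. y)"
  by (intro ring_hom_cringI R.is_cring Q.is_cring ring_hom_memI) (use R_sub in auto)

abbreviation "ev \<equiv> UnivPoly.eval R' Q (\<lambda>y. y) x"

lemma ev_pre: "UP_pre_univ_prop R' Q (\<lambda>y. y)"
  using incl_hom by (simp add: UP_pre_univ_prop_def U.UP_cring_axioms)

lemma ev_hom: "ring_hom_cring (UP R') Q ev"
  by (intro ring_hom_cringI U.UP_cring Q.is_cring UP_pre_univ_prop.eval_ring_hom[OF ev_pre x])

sublocale ev: ring_hom_cring "UP R'" Q ev
  by (rule ev_hom)

lemma ev_const: "r \<in> R \<Longrightarrow> ev (up_ring.monom (UP R') r 0) = r"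
  using UP_pre_univ_prop.eval_const[OF ev_pre x, of r] by simp

lemma ev_x: "ev (up_ring.monom (UP R') \<one>\<^bsub>Q\<^esub> 1) = x"
  using UP_pre_univ_prop.eval_monom1[OF ev_pre x] by simp

lemma ev_smult: "r \<in> R \<Longrightarrow> p \<in> carrier (UP R') \<Longrightarrow> ev (r \<odot>\<^bsub>UP R'\<^esub> p) = r \<otimes>\<^bsub>Q\<^esub> ev p"
  by (simp add: U.monom_mult_is_smult[symmetric] ev_const)

abbreviation "Rx \<equiv> ev ` carrier (UP R')"

lemma subring_Rx: "subring Rx Q"
proof (rule Q.subringI)
  show "Rx \<subseteq> carrier Q" by auto
  show "\<one>\<^bsub>Q\<^esub> \<in> Rx" using ev.hom_one by (metis U.UP_one_closed image_eqI)
  fix h assume "h \<in> Rx"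
  then obtain p where "p \<in> carrier (UP R')" "h = ev p" by auto
  then show "\<ominus>\<^bsub>Q\<^esub> h \<in> Rx" by (metis U.UP_a_inv_closed ev.hom_a_inv image_eqI)
next
  fix h k assume "h \<in> Rx" "k \<in> Rx"
  then obtain p q where pq: "p \<in> carrier (UP R')" "h = ev p" "q \<in> carrier (UP R')" "k = ev q" by auto
  then show "h \<otimes>\<^bsub>Q\<^esub> k \<in> Rx" "h \<oplus>\<^bsub>Q\<^esub> k \<in> Rx"
    by (metis U.UP_mult_closed ev.hom_mult image_eqI, metis U.UP_a_closed ev.hom_add image_eqI)
qed

lemma R_Rx: "R \<subseteq> Rx"
proof
  fix r assume r: "r \<in> R"
  then have "up_ring.monom (UP R') r 0 \<in> carrier (UP R')" by (intro U.monom_closed) simp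
  from imageI[OF this, of ev] show "r \<in> Rx" unfolding ev_const[OF r] .
qed

lemma x_Rx: "x \<in> Rx"
proof -
  have "up_ring.monom (UP R') \<one>\<^bsub>Q\<^esub> 1 \<in> carrier (UP R')"
    using subringE(3)[OF subring] by (intro U.monom_closed) simp
  from imageI[OF this, of ev] show ?thesis unfolding ev_x .
qed

lemma point_extension:
  assumes \<phi>: "\<phi> \<in> ring_hom R' K" and \<xi>: "\<xi> \<in> carrier K"
  shows "ring_hom_cring (UP R') K (UnivPoly.eval R' K \<phi> \<xi>)"
    and "r \<in> R \<Longrightarrow> UnivPoly.eval R' K \<phi> \<xi> (up_ring.monom (UP R') r 0) = \<phi> r"
    and "p \<in> carrier (UP R') \<Longrightarrow> UnivPoly.eval R' K \<phi> \<xi> p =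
       (\<Oplus>\<^bsub>K\<^esub>i\<in>{..deg R' p}. \<phi> (up_ring.coeff (UP R') p i) \<otimes>\<^bsub>K\<^esub> \<xi> [^]\<^bsub>K\<^esub> i)"
proof -
  have pre: "UP_pre_univ_prop R' K \<phi>"
    by (intro UP_pre_univ_prop.intro ring_hom_cringI R.is_cring K.is_cring U.UP_cring_axioms \<phi>)
  show "ring_hom_cring (UP R') K (UnivPoly.eval R' K \<phi> \<xi>)"
    by (intro ring_hom_cringI U.UP_cring K.is_cring UP_pre_univ_prop.eval_ring_hom[OF pre \<xi>])
  show "r \<in> R \<Longrightarrow> UnivPoly.eval R' K \<phi> \<xi> (up_ring.monom (UP R') r 0) = \<phi> r"
    using UP_pre_univ_prop.eval_const[OF pre \<xi>, of r] by simp
  show "p \<in> carrier (UP R') \<Longrightarrow> UnivPoly.eval R' K \<phi> \<xi> p =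
       (\<Oplus>\<^bsub>K\<^esub>i\<in>{..deg R' p}. \<phi> (up_ring.coeff (UP R') p i) \<otimes>\<^bsub>K\<^esub> \<xi> [^]\<^bsub>K\<^esub> i)"
    by (rule U.eval_on_carrier)
qed

lemma point_on_Rx:
  assumes \<phi>: "\<phi> \<in> ring_hom R' K" "\<forall>c\<in>carrier K. \<phi> (\<kappa> c) = c" and \<xi>: "\<xi> \<in> carrier K"
    and ker: "\<And>q. q \<in> carrier (UP R') \<Longrightarrow> ev q = \<zero>\<^bsub>Q\<^esub> \<Longrightarrow> UnivPoly.eval R' K \<phi> \<xi> q = \<zero>\<^bsub>K\<^esub>"
  obtains \<psi> where "\<psi> \<in> ring_hom (Q\<lparr>carrier := Rx\<rparr>) K" "\<forall>c\<in>carrier K. \<psi> (\<kappa> c) = c"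
    "\<And>q. q \<in> carrier (UP R') \<Longrightarrow> \<psi> (ev q) = UnivPoly.eval R' K \<phi> \<xi> q"
proof -
  note e = point_extension[OF \<phi>(1) \<xi>]
  obtain \<psi> where \<psi>: "\<psi> \<in> ring_hom (Q\<lparr>carrier := Rx\<rparr>) K"
    "\<And>q. q \<in> carrier (UP R') \<Longrightarrow> \<psi> (ev q) = UnivPoly.eval R' K \<phi> \<xi> q"
    using ring_hom_factor[OF U.UP_ring Q.ring_axioms K.ring_axioms ev.homh ring_hom_cring.homh[OF e(1)] ker]
    by metis
  have "\<psi> (\<kappa> c) = c" if "c \<in> carrier K" for c
  proof -
    have "\<kappa> c \<in> R" using sep that by (auto simp: separating_def)
    then show ?thesis using \<psi>(2)[of "up_ring.monom (UP R') (\<kappa> c) 0"] e(2) \<phi>(2) that by (simp add: ev_const)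
  qed
  then show ?thesis using that \<psi> by blast
qed

text \<open>\<open>R[x]\<close> is a polynomial ring here. A point of \<open>R\<close> not killing
  the leading coefficient of \<open>q\<close> leaves a nonzero polynomial over \<open>K\<close>, and
  any value outside its roots extends the point.\<close>

lemma separating_Rx_transcendental:
  assumes inj: "\<And>q. q \<in> carrier (UP R') \<Longrightarrow> ev q = \<zero>\<^bsub>Q\<^esub> \<Longrightarrow> q = \<zero>\<^bsub>UP R'\<^esub>"
    and q: "q \<in> carrier (UP R')" "ev q \<noteq> \<zero>\<^bsub>Q\<^esub>"
  shows "\<exists>\<psi>\<in>ring_hom (Q\<lparr>carrier := Rx\<rparr>) K. (\<forall>c\<in>carrier K. \<psi> (\<kappa> c) = c) \<and> \<psi> (ev q) \<noteq> \<zero>\<^bsub>K\<^esub>"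
proof -
  let ?a = "up_ring.coeff (UP R') q"
  have q0: "q \<noteq> \<zero>\<^bsub>UP R'\<^esub>" using q(2) ev.hom_zero by metis
  have a: "?a (deg R' q) \<in> R" "?a (deg R' q) \<noteq> \<zero>\<^bsub>Q\<^esub>"
    using U.lcoeff_closed[OF q(1)] U.lcoeff_nonzero2[OF q(1) q0] by simp_all
  obtain \<phi> where \<phi>: "\<phi> \<in> ring_hom R' K" "\<forall>c\<in>carrier K. \<phi> (\<kappa> c) = c" "\<phi> (?a (deg R' q)) \<noteq> \<zero>\<^bsub>K\<^esub>"
    using sep a unfolding separating_def by blast
  have f: "\<phi> (?a i) \<in> carrier K" for i
    using ring_hom_closed[OF \<phi>(1) U.coeff_closed[OF q(1), of i]] .
  obtain \<xi> where \<xi>: "\<xi> \<in> carrier K" "(\<Oplus>\<^bsub>K\<^esub>i\<in>{..deg R' q}. \<phi> (?a i) \<otimes>\<^bsub>K\<^esub> \<xi> [^]\<^bsub>K\<^esub> i) \<noteq> \<zero>\<^bsub>K\<^esub>"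
    using K.non_root_exists[of "\<lambda>i. \<phi> (?a i)", OF f \<phi>(3)] .
  note e = point_extension[OF \<phi>(1) \<xi>(1)]
  have ker: "UnivPoly.eval R' K \<phi> \<xi> p = \<zero>\<^bsub>K\<^esub>" if "p \<in> carrier (UP R')" "ev p = \<zero>\<^bsub>Q\<^esub>" for p
    unfolding inj[OF that] by (rule ring_hom_cring.hom_zero[OF e(1)])
  obtain \<psi> where "\<psi> \<in> ring_hom (Q\<lparr>carrier := Rx\<rparr>) K" "\<forall>c\<in>carrier K. \<psi> (\<kappa> c) = c"
    "\<psi> (ev q) = UnivPoly.eval R' K \<phi> \<xi> q"
    using point_on_Rx[OF \<phi>(1,2) \<xi>(1) ker] q(1) by metis
  then show ?thesis using \<xi>(2) e(3)[OF q(1)] by auto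
qed

lemma lcoeff_R: "q \<in> carrier (UP R') \<Longrightarrow> up_ring.coeff (UP R') q n \<in> R"
  using U.coeff_closed[of q n] by simp

lemma pow_R: "r \<in> R \<Longrightarrow> r [^]\<^bsub>R'\<^esub> (k::nat) \<in> R"
  using R.nat_pow_closed[of r k] by simp

lemma pow_R_nonzero: "r \<in> R \<Longrightarrow> r \<noteq> \<zero>\<^bsub>Q\<^esub> \<Longrightarrow> r [^]\<^bsub>R'\<^esub> (k::nat) \<noteq> \<zero>\<^bsub>Q\<^esub>"
  using R.nat_pow_nonzero[of r k] by simp

text \<open>Dividing over \<open>R\<close> instead of its fraction field costs a power of the
  leading coefficient. The power is recorded because a point that does not kill the leading
  coefficient does not kill it either.\<close>

lemma pseudo_division:
  assumes "g \<in> carrier (UP R')" "g \<noteq> \<zero>\<^bsub>UP R'\<^esub>" "f \<in> carrier (UP R')"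
  obtains c q r where "c \<in> R" "c \<noteq> \<zero>\<^bsub>Q\<^esub>" "q \<in> carrier (UP R')" "r \<in> carrier (UP R')"
    "\<exists>k::nat. c = up_ring.coeff (UP R') g (deg R' g) [^]\<^bsub>R'\<^esub> k"
    "c \<odot>\<^bsub>UP R'\<^esub> f = g \<otimes>\<^bsub>UP R'\<^esub> q \<oplus>\<^bsub>UP R'\<^esub> r" "r = \<zero>\<^bsub>UP R'\<^esub> \<or> deg R' r < deg R' g"
proof -
  let ?a = "up_ring.coeff (UP R') g (deg R' g)"
  have a: "?a \<in> R" "?a \<noteq> \<zero>\<^bsub>Q\<^esub>"
    using lcoeff_R[OF assms(1)] U.lcoeff_nonzero2[OF assms(1,2)] by simp_all
  obtain q r and k :: nat where "q \<in> carrier (UP R')" "r \<in> carrier (UP R')"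
    "?a [^]\<^bsub>R'\<^esub> k \<odot>\<^bsub>UP R'\<^esub> f = g \<otimes>\<^bsub>UP R'\<^esub> q \<oplus>\<^bsub>UP R'\<^esub> r" "r = \<zero>\<^bsub>UP R'\<^esub> \<or> deg R' r < deg R' g"
    using U.long_div_theorem[OF assms(1,3,2)] by blast
  then show ?thesis using that[of "?a [^]\<^bsub>R'\<^esub> k" q r] pow_R[OF a(1)] pow_R_nonzero[OF a] by blast
qed

text \<open>If \<open>x\<close> is algebraic over \<open>R\<close>, every nonzero element of \<open>R[x]\<close> divides a nonzero element of
  \<open>R\<close>; and points not killing the leading coefficient of a relation of minimal degree extend.\<close>

context
  fixes p :: "nat \<Rightarrow> 'q"
  assumes p: "p \<in> carrier (UP R')" "p \<noteq> \<zero>\<^bsub>UP R'\<^esub>" "ev p = \<zero>\<^bsub>Q\<^esub>"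
    and p_min: "\<And>q. q \<in> carrier (UP R') \<Longrightarrow> q \<noteq> \<zero>\<^bsub>UP R'\<^esub> \<Longrightarrow> deg R' q < deg R' p \<Longrightarrow> ev q \<noteq> \<zero>\<^bsub>Q\<^esub>"
begin

lemma deg_p: "deg R' p > 0"
proof (rule ccontr)
  assume "\<not> ?thesis"
  then have d: "deg R' p = 0" by simp
  define c where "c = up_ring.coeff (UP R') p 0"
  have c: "c \<in> R" unfolding c_def by (rule lcoeff_R[OF p(1)])
  have pm: "p = up_ring.monom (UP R') c 0"
    unfolding c_def using U.deg_zero_impl_monom[OF p(1) d] .
  have "c = \<zero>\<^bsub>Q\<^esub>" using p(3) ev_const[OF c] pm by simp
  then show False using p(2) pm U.monom_zero[of 0] by simp
qed

lemma divides_constant: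
  assumes q: "q \<in> carrier (UP R')" "ev q \<noteq> \<zero>\<^bsub>Q\<^esub>"
  obtains c t where "c \<in> R" "c \<noteq> \<zero>\<^bsub>Q\<^esub>" "t \<in> carrier (UP R')" "c = ev q \<otimes>\<^bsub>Q\<^esub> ev t"
proof -
  \<comment> \<open>\<open>S\<close> collects the nonzero polynomials of degree below
    \<open>p\<close> whose value is a multiple of \<open>ev q\<close>. One of least degree is
    constant: pseudo-dividing \<open>p\<close> by it leaves a smaller member of \<open>S\<close>, or
    no remainder, and then the quotient is a relation of smaller degree than
    \<open>p\<close>.\<close>
  define S where "S u \<longleftrightarrow> u \<in> carrier (UP R') \<and> u \<noteq> \<zero>\<^bsub>UP R'\<^esub> \<and> deg R' u < deg R' p \<and>
     (\<exists>t\<in>carrier (UP R'). ev u = ev q \<otimes>\<^bsub>Q\<^esub> ev t)" for u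
  have "\<exists>u. S u"
  proof -
    obtain c v r where c: "c \<in> R" "c \<noteq> \<zero>\<^bsub>Q\<^esub>" "v \<in> carrier (UP R')" "r \<in> carrier (UP R')"
      "c \<odot>\<^bsub>UP R'\<^esub> q = p \<otimes>\<^bsub>UP R'\<^esub> v \<oplus>\<^bsub>UP R'\<^esub> r" "r = \<zero>\<^bsub>UP R'\<^esub> \<or> deg R' r < deg R' p"
      using pseudo_division[OF p(1,2) q(1)] by metis
    have "ev (c \<odot>\<^bsub>UP R'\<^esub> q) = ev r" unfolding c(5) using c p by simp
    then have er: "ev r = ev q \<otimes>\<^bsub>Q\<^esub> c" using c(1) q(1) R_sub by (simp add: ev_smult Q.m_comm subsetD)
    have cc: "c \<in> carrier Q" using c(1) R_sub by blast
    then have "ev r \<noteq> \<zero>\<^bsub>Q\<^esub>" unfolding er using Q.integral[of "ev q" c] q c(2) by auto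
    then have "r \<noteq> \<zero>\<^bsub>UP R'\<^esub>" using ev.hom_zero by metis
    moreover have "up_ring.monom (UP R') c 0 \<in> carrier (UP R')" using c(1) by (intro U.monom_closed) simp
    ultimately have "S r" unfolding S_def using c er ev_const[OF c(1)] by metis
    then show ?thesis by blast
  qed
  then obtain u where u: "S u" and u_min: "\<And>w. S w \<Longrightarrow> deg R' u \<le> deg R' w"
    using ex_has_least_nat[of S _ "deg R'"] by metis
  obtain t where t: "t \<in> carrier (UP R')" "ev u = ev q \<otimes>\<^bsub>Q\<^esub> ev t" using u by (auto simp: S_def)
  have u': "u \<in> carrier (UP R')" "u \<noteq> \<zero>\<^bsub>UP R'\<^esub>" "deg R' u < deg R' p" using u by (auto simp: S_def)
  have "deg R' u = 0"
  proof (rule ccontr)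
    assume d: "deg R' u \<noteq> 0"
    obtain c v w where c: "c \<in> R" "c \<noteq> \<zero>\<^bsub>Q\<^esub>" "v \<in> carrier (UP R')" "w \<in> carrier (UP R')"
      "c \<odot>\<^bsub>UP R'\<^esub> p = u \<otimes>\<^bsub>UP R'\<^esub> v \<oplus>\<^bsub>UP R'\<^esub> w" "w = \<zero>\<^bsub>UP R'\<^esub> \<or> deg R' w < deg R' u"
      using pseudo_division[OF u'(1,2) p(1)] by metis
    have "ev (c \<odot>\<^bsub>UP R'\<^esub> p) = \<zero>\<^bsub>Q\<^esub>" using c(1) p R_sub by (simp add: ev_smult subsetD)
    then have e0: "ev u \<otimes>\<^bsub>Q\<^esub> ev v \<oplus>\<^bsub>Q\<^esub> ev w = \<zero>\<^bsub>Q\<^esub>" unfolding c(5) using c u'(1) by simp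
    show False
    proof (cases "w = \<zero>\<^bsub>UP R'\<^esub>")
      case True
      then have "ev u \<otimes>\<^bsub>Q\<^esub> ev v = \<zero>\<^bsub>Q\<^esub>" using e0 u'(1) c(3) by simp
      then have ev0: "ev v = \<zero>\<^bsub>Q\<^esub>"
        using Q.integral[of "ev u" "ev v"] p_min[OF u'] u'(1) c(3) by auto
      have cp: "c \<odot>\<^bsub>UP R'\<^esub> p = u \<otimes>\<^bsub>UP R'\<^esub> v" unfolding c(5) True using u'(1) c(3) by simp
      have dcp: "deg R' (c \<odot>\<^bsub>UP R'\<^esub> p) = deg R' p"
        using c(1,2) p(1) U.deg_smult[of c p] by simp
      have v0: "v \<noteq> \<zero>\<^bsub>UP R'\<^esub>"
      proof
        assume "v = \<zero>\<^bsub>UP R'\<^esub>"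
        then have "deg R' (c \<odot>\<^bsub>UP R'\<^esub> p) = 0" unfolding cp using u'(1) by simp
        then show False using dcp deg_p by simp
      qed
      have "deg R' p = deg R' u + deg R' v"
        unfolding dcp[symmetric] cp by (rule U.deg_mult[OF u'(2) v0 u'(1) c(3)])
      then show False using p_min[OF c(3) v0] d ev0 by simp
    next
      case False
      have "ev w = \<ominus>\<^bsub>Q\<^esub> (ev u \<otimes>\<^bsub>Q\<^esub> ev v)"
        using e0 u'(1) c(3,4) Q.minus_equality[of "ev w" "ev u \<otimes>\<^bsub>Q\<^esub> ev v"] by (simp add: Q.a_comm)
      also have "\<dots> = ev q \<otimes>\<^bsub>Q\<^esub> ev (\<ominus>\<^bsub>UP R'\<^esub> (t \<otimes>\<^bsub>UP R'\<^esub> v))"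
        using t q(1) c(3) by (simp add: Q.r_minus Q.m_assoc)
      finally have "S w" unfolding S_def using False c u' t(1) by (auto intro!: bexI[of _ "\<ominus>\<^bsub>UP R'\<^esub> (t \<otimes>\<^bsub>UP R'\<^esub> v)"])
      then show False using u_min[of w] False c(6) by simp
    qed
  qed
  define c where "c = up_ring.coeff (UP R') u 0"
  have c: "c \<in> R" unfolding c_def by (rule lcoeff_R[OF u'(1)])
  have um: "u = up_ring.monom (UP R') c 0"
    unfolding c_def using U.deg_zero_impl_monom[OF u'(1) \<open>deg R' u = 0\<close>] .
  have euc: "ev u = c" using ev_const[OF c] um by simp
  moreover have "c \<noteq> \<zero>\<^bsub>Q\<^esub>" using p_min[OF u'] euc by simp
  ultimately show ?thesis using that c t by metis
qed

text \<open>Take a point of \<open>R\<close> that kills neither the leading coefficient of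
  \<open>p\<close> nor a nonzero \<open>c\<close> divisible by \<open>ev q\<close>, and send
  \<open>x\<close> to a root of the specialised \<open>p\<close>. Then the value at
  \<open>ev q\<close> divides the nonzero value at \<open>c\<close>.\<close>

lemma separating_Rx_algebraic:
  assumes q: "q \<in> carrier (UP R')" "ev q \<noteq> \<zero>\<^bsub>Q\<^esub>"
  shows "\<exists>\<psi>\<in>ring_hom (Q\<lparr>carrier := Rx\<rparr>) K. (\<forall>c\<in>carrier K. \<psi> (\<kappa> c) = c) \<and> \<psi> (ev q) \<noteq> \<zero>\<^bsub>K\<^esub>"
proof -
  obtain c t where c: "c \<in> R" "c \<noteq> \<zero>\<^bsub>Q\<^esub>" "t \<in> carrier (UP R')" "c = ev q \<otimes>\<^bsub>Q\<^esub> ev t"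
    by (rule divides_constant[OF q])
  let ?a = "up_ring.coeff (UP R') p"
  let ?l = "?a (deg R' p)"
  have l: "?l \<in> R" "?l \<noteq> \<zero>\<^bsub>Q\<^esub>"
    using lcoeff_R[OF p(1)] U.lcoeff_nonzero2[OF p(1,2)] by simp_all
  have lc: "?l \<otimes>\<^bsub>Q\<^esub> c \<in> R" "?l \<otimes>\<^bsub>Q\<^esub> c \<noteq> \<zero>\<^bsub>Q\<^esub>"
    using subringE(6)[OF subring l(1) c(1)] Q.integral[of ?l c] l c R_sub by auto
  obtain \<phi> where \<phi>: "\<phi> \<in> ring_hom R' K" "\<forall>c\<in>carrier K. \<phi> (\<kappa> c) = c" "\<phi> (?l \<otimes>\<^bsub>Q\<^esub> c) \<noteq> \<zero>\<^bsub>K\<^esub>"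
    using sep lc unfolding separating_def by blast
  interpret \<phi>: ring_hom_cring R' K \<phi>
    by (intro ring_hom_cringI R.is_cring K.is_cring \<phi>)
  have "\<phi> (?l \<otimes>\<^bsub>Q\<^esub> c) = \<phi> ?l \<otimes>\<^bsub>K\<^esub> \<phi> c" using ring_hom_mult[OF \<phi>(1), of ?l c] l c by simp
  moreover have \<phi>cl: "\<phi> ?l \<in> carrier K" "\<phi> c \<in> carrier K"
    using ring_hom_closed[OF \<phi>(1)] l c by simp_all
  ultimately have \<phi>0: "\<phi> ?l \<noteq> \<zero>\<^bsub>K\<^esub>" "\<phi> c \<noteq> \<zero>\<^bsub>K\<^esub>" using \<phi>(3) by auto
  have f: "\<phi> (?a i) \<in> carrier K" for i
    using ring_hom_closed[OF \<phi>(1) U.coeff_closed[OF p(1), of i]] .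
  obtain \<xi> where \<xi>: "\<xi> \<in> carrier K" "(\<Oplus>\<^bsub>K\<^esub>i\<in>{..deg R' p}. \<phi> (?a i) \<otimes>\<^bsub>K\<^esub> \<xi> [^]\<^bsub>K\<^esub> i) = \<zero>\<^bsub>K\<^esub>"
    using K.root_exists[of "\<lambda>i. \<phi> (?a i)", OF f deg_p \<phi>0(1)] .
  note e = point_extension[OF \<phi>(1) \<xi>(1)]
  let ?e = "UnivPoly.eval R' K \<phi> \<xi>"
  interpret e: ring_hom_cring "UP R'" K ?e by (rule e(1))
  have ep: "?e p = \<zero>\<^bsub>K\<^esub>" using e(3)[OF p(1)] \<xi>(2) by simp
  \<comment> \<open>The extension is well defined: if \<open>f\<close> vanishes at \<open>x\<close>,
    a power of the leading coefficient times \<open>f\<close> is a multiple of \<open>p\<close>,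
    since the remainder vanishes by minimality; the point kills \<open>p\<close> but not that
    power.\<close>
  have ker: "?e f = \<zero>\<^bsub>K\<^esub>" if f: "f \<in> carrier (UP R')" "ev f = \<zero>\<^bsub>Q\<^esub>" for f
  proof -
    obtain d v r and k :: nat where d: "d \<in> R" "d \<noteq> \<zero>\<^bsub>Q\<^esub>" "v \<in> carrier (UP R')" "r \<in> carrier (UP R')"
      "d = ?l [^]\<^bsub>R'\<^esub> k"
      "d \<odot>\<^bsub>UP R'\<^esub> f = p \<otimes>\<^bsub>UP R'\<^esub> v \<oplus>\<^bsub>UP R'\<^esub> r" "r = \<zero>\<^bsub>UP R'\<^esub> \<or> deg R' r < deg R' p"
      using pseudo_division[OF p(1,2) f(1)] by metis
    have "ev (d \<odot>\<^bsub>UP R'\<^esub> f) = \<zero>\<^bsub>Q\<^esub>" using d(1) f R_sub by (simp add: ev_smult subsetD)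
    then have "ev r = \<zero>\<^bsub>Q\<^esub>" unfolding d(6) using d p by simp
    then have r0: "r = \<zero>\<^bsub>UP R'\<^esub>" using p_min[OF d(4)] d(7) by blast
    have "?e (up_ring.monom (UP R') d 0 \<otimes>\<^bsub>UP R'\<^esub> f) = ?e (p \<otimes>\<^bsub>UP R'\<^esub> v)"
      using d f p(1) r0 U.monom_mult_is_smult[of d f] by simp
    moreover have "up_ring.monom (UP R') d 0 \<in> carrier (UP R')" using d(1) by (intro U.monom_closed) simp
    ultimately have "\<phi> d \<otimes>\<^bsub>K\<^esub> ?e f = \<zero>\<^bsub>K\<^esub>"
      using f d p(1) ep e(2)[OF d(1)] by simp
    moreover have "\<phi> d = \<phi> ?l [^]\<^bsub>K\<^esub> k" unfolding d(5) using \<phi>.hom_pow[of ?l k] l by simp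
    moreover have "\<phi> ?l [^]\<^bsub>K\<^esub> k \<noteq> \<zero>\<^bsub>K\<^esub>" by (rule K.nat_pow_nonzero[OF \<phi>cl(1) \<phi>0(1)])
    ultimately show ?thesis using K.integral[of "\<phi> d" "?e f"] \<phi>cl f(1) by auto
  qed
  obtain \<psi> where \<psi>: "\<psi> \<in> ring_hom (Q\<lparr>carrier := Rx\<rparr>) K" "\<forall>c\<in>carrier K. \<psi> (\<kappa> c) = c"
    "\<And>q. q \<in> carrier (UP R') \<Longrightarrow> \<psi> (ev q) = ?e q"
    using point_on_Rx[OF \<phi>(1,2) \<xi>(1) ker] by metis
  have cm: "up_ring.monom (UP R') c 0 \<in> carrier (UP R')" using c(1) by (intro U.monom_closed) simp
  have "\<psi> c = \<phi> c" using \<psi>(3)[OF cm] e(2)[OF c(1)] by (simp add: ev_const[OF c(1)])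
  moreover have "\<psi> c = ?e q \<otimes>\<^bsub>K\<^esub> ?e t"
    using \<psi>(3)[of "q \<otimes>\<^bsub>UP R'\<^esub> t"] q(1) c(3,4) by simp
  ultimately have "?e q \<noteq> \<zero>\<^bsub>K\<^esub>" using \<phi>0(2) c(3) by auto
  then show ?thesis using \<psi> q(1) by auto
qed

end

lemma separating_Rx: "separating K Q \<kappa> Rx"
proof -
  have "\<exists>\<psi>\<in>ring_hom (Q\<lparr>carrier := Rx\<rparr>) K. (\<forall>c\<in>carrier K. \<psi> (\<kappa> c) = c) \<and> \<psi> s \<noteq> \<zero>\<^bsub>K\<^esub>"
    if s: "s \<in> Rx" "s \<noteq> \<zero>\<^bsub>Q\<^esub>" for s
  proof -
    obtain q where q: "q \<in> carrier (UP R')" "s = ev q" using s(1) by auto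
    let ?Z = "\<lambda>p. p \<in> carrier (UP R') \<and> p \<noteq> \<zero>\<^bsub>UP R'\<^esub> \<and> ev p = \<zero>\<^bsub>Q\<^esub>"
    show ?thesis
    proof (cases "\<exists>p. ?Z p")
      case True
      then obtain p where p: "?Z p" "\<And>q. ?Z q \<Longrightarrow> deg R' p \<le> deg R' q"
        using ex_has_least_nat[of ?Z _ "deg R'"] by metis
      then show ?thesis unfolding q(2)
        by (intro separating_Rx_algebraic[of p]) (use q s(2) p in \<open>auto simp: not_le[symmetric]\<close>)
    next
      case False
      then show ?thesis unfolding q(2)
        by (intro separating_Rx_transcendental) (use q s(2) in auto)
    qed
  qed
  moreover have "\<kappa> ` carrier K \<subseteq> Rx" using sep R_Rx by (auto simp: separating_def)
  ultimately show ?thesis using subring_Rx by (simp add: separating_def)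
qed

end

lemma separating_base:
  assumes K: "field K" and Q: "domain Q" and \<kappa>: "\<kappa> \<in> ring_hom K Q"
  shows "separating K Q \<kappa> (\<kappa> ` carrier K)"
proof -
  interpret K: field K by fact
  interpret Q: "domain" Q by fact
  interpret \<kappa>: ring_hom_ring K Q \<kappa> by unfold_locales (rule \<kappa>)
  have "\<kappa> \<one>\<^bsub>K\<^esub> \<in> \<kappa> ` carrier K" by (rule imageI) simp
  then have "\<kappa> ` carrier K \<noteq> {\<zero>\<^bsub>Q\<^esub>}" using Q.one_not_zero by (metis \<kappa>.hom_one singletonD)
  then have "inj_on \<kappa> (carrier K)"
    by (rule \<kappa>.non_trivial_field_hom_imp_inj[OF K])
  then have ker: "c = \<zero>\<^bsub>K\<^esub>" if "c \<in> carrier K" "\<kappa> c = \<zero>\<^bsub>Q\<^esub>" for c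
    using inj_onD[of \<kappa> "carrier K" c "\<zero>\<^bsub>K\<^esub>"] that by simp
  have id: "(\<lambda>c. c) \<in> ring_hom K K" by (rule ring_hom_memI) auto
  obtain h where h: "h \<in> ring_hom (Q\<lparr>carrier := \<kappa> ` carrier K\<rparr>) K" "\<And>c. c \<in> carrier K \<Longrightarrow> h (\<kappa> c) = c"
    using ring_hom_factor[OF K.ring_axioms Q.ring_axioms K.ring_axioms \<kappa> id ker] by metis
  have "\<exists>\<phi>\<in>ring_hom (Q\<lparr>carrier := \<kappa> ` carrier K\<rparr>) K. (\<forall>c\<in>carrier K. \<phi> (\<kappa> c) = c) \<and> \<phi> s \<noteq> \<zero>\<^bsub>K\<^esub>"
    if "s \<in> \<kappa> ` carrier K" "s \<noteq> \<zero>\<^bsub>Q\<^esub>" for s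
    using that h by (intro bexI[of _ h]) auto
  moreover have "subring (\<kappa> ` carrier K) Q"
    by (rule \<kappa>.img_is_subring[OF K.carrier_is_subring])
  ultimately show ?thesis by (simp add: separating_def)
qed

lemma separating_finite:
  assumes K: "algebraically_closed K" and Q: "domain Q" and \<kappa>: "\<kappa> \<in> ring_hom K Q"
    and S: "finite S" "S \<subseteq> carrier Q"
  obtains R where "separating K Q \<kappa> R" "S \<subseteq> R"
proof -
  have "\<exists>R. separating K Q \<kappa> R \<and> S \<subseteq> R"
    using S
  proof (induction S rule: finite_induct)
    case empty
    then show ?case
      using separating_base[OF algebraically_closed.axioms(1)[OF K] Q \<kappa>] by blast
  next
    case (insert x S)
    then obtain R where R: "separating K Q \<kappa> R" "S \<subseteq> R" by auto
    interpret separating_ext K Q \<kappa> R x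
      using K Q R(1) insert.prems by (simp add: separating_ext_def separating_ext_axioms_def)
    show ?case
      using separating_Rx x_Rx R_Rx R(2) by blast
  qed
  then show ?thesis using that by blast
qed

text \<open>An ideal maximal among those missing all powers of \<open>h\<close> is prime: two larger
  ideals each contain a power of \<open>h\<close>, and the product of these powers would lie in the
  ideal.\<close>

lemma (in cring) prime_avoiding:
  assumes h: "h \<in> carrier R" "\<And>n::nat. h [^] n \<noteq> \<zero>"
  obtains I where "primeideal I R" "h \<notin> I"
proof -
  define A where "A = {I. ideal I R \<and> (\<forall>n::nat. h [^] n \<notin> I)}"
  have "\<exists>M\<in>A. \<forall>Y\<in>A. M \<subseteq> Y \<longrightarrow> Y = M"
  proof (rule subset_Zorn_nonempty)
    show "A \<noteq> {}" using zeroideal h by (auto simp: A_def)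
    fix C assume C: "C \<noteq> {}" "subset.chain A C"
    then have "subset.chain {I. ideal I R} C"
      by (auto simp: A_def subset_chain_def)
    from chain_Union_is_ideal[OF this] have "ideal (\<Union>C) R" using C(1) by simp
    then show "\<Union>C \<in> A" using C by (auto simp: A_def subset_chain_def)
  qed
  then obtain M where M: "M \<in> A" "\<And>Y. Y \<in> A \<Longrightarrow> M \<subseteq> Y \<Longrightarrow> Y = M" by blast
  interpret M: ideal M R using M(1) by (simp add: A_def)
  have Mh: "h [^] n \<notin> M" for n :: nat using M(1) by (simp add: A_def)
  have ext: "\<exists>n::nat. \<exists>i\<in>M. \<exists>x\<in>carrier R. h [^] n = i \<oplus> x \<otimes> a" if a: "a \<in> carrier R" "a \<notin> M" for a
  proof -
    have id: "ideal (M <+>\<^bsub>R\<^esub> PIdl a) R"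
      by (rule add_ideals[OF M.is_ideal cgenideal_ideal[OF a(1)]])
    have "i \<in> M <+>\<^bsub>R\<^esub> PIdl a" if "i \<in> M" for i
      using that a(1) M.a_Hcarr[OF that] zero_closed
      by (auto simp: set_add_def' cgenideal_def intro!: bexI[of _ i] exI[of _ \<zero>])
    moreover have "a \<in> M <+>\<^bsub>R\<^esub> PIdl a"
      unfolding set_add_def'
      by (rule UN_I[OF M.zero_closed], rule UN_I[OF cgenideal_self[OF a(1)]]) (use a(1) in simp)
    ultimately have "M <+>\<^bsub>R\<^esub> PIdl a \<notin> A" using M(2)[of "M <+>\<^bsub>R\<^esub> PIdl a"] a(2) by blast
    then obtain n :: nat where "h [^] n \<in> M <+>\<^bsub>R\<^esub> PIdl a" using id by (auto simp: A_def)
    then show ?thesis by (auto simp: set_add_def' cgenideal_def)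
  qed
  have "primeideal M R"
  proof (rule primeidealI[OF M.is_ideal is_cring])
    show "carrier R \<noteq> M" using Mh[of 0] by auto
    fix a b assume ab: "a \<in> carrier R" "b \<in> carrier R" "a \<otimes> b \<in> M"
    show "a \<in> M \<or> b \<in> M"
    proof (rule ccontr)
      assume "\<not> ?thesis"
      then obtain m n :: nat and i j x y where
        1: "i \<in> M" "x \<in> carrier R" "h [^] m = i \<oplus> x \<otimes> a" and
        2: "j \<in> M" "y \<in> carrier R" "h [^] n = j \<oplus> y \<otimes> b"
        using ext[OF ab(1)] ext[OF ab(2)] by blast
      have ij: "i \<in> carrier R" "j \<in> carrier R" using 1 2 M.a_Hcarr by auto
      have "h [^] (m + n) = i \<otimes> (j \<oplus> y \<otimes> b) \<oplus> ((x \<otimes> a) \<otimes> j \<oplus> (x \<otimes> y) \<otimes> (a \<otimes> b))"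
        unfolding nat_pow_mult[OF h(1), symmetric] 1(3) 2(3) using ij ab 1 2
        by (simp add: l_distr r_distr m_ac a_ac)
      also have "\<dots> \<in> M"
        using ij ab 1 2 by (intro M.a_closed M.I_r_closed[OF 1(1)] M.I_l_closed[OF 2(1)] M.I_l_closed[OF ab(3)]) auto
      finally show False using Mh by blast
    qed
  qed
  then show ?thesis using that Mh[of 1] h(1) by (metis nat_pow_eone)
qed

text \<open>Reducedness provides a prime ideal missing \<open>h\<close>, hence a domain in which
  \<open>h\<close> survives; finite type places the image of \<open>H\<close> inside a subring with
  enough points.\<close>

lemma points_separate:
  assumes K: "algebraically_closed K" and H: "algebra K H" and ft: "finite_type K H"
    and red: "\<forall>h\<in>carrier H. \<forall>n::nat. h [^]\<^bsub>H\<^esub> n = \<zero>\<^bsub>H\<^esub> \<longrightarrow> h = \<zero>\<^bsub>H\<^esub>"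
    and h: "h \<in> carrier H" "h \<noteq> \<zero>\<^bsub>H\<^esub>"
  obtains g where "g \<in> points K H" "g h \<noteq> \<zero>\<^bsub>K\<^esub>"
proof -
  interpret K: algebraically_closed K by fact
  interpret H: algebra K H by fact
  obtain I where I: "primeideal I H" "h \<notin> I"
    using H.prime_avoiding[of h] h red by metis
  interpret I: primeideal I H by fact
  define Q where "Q = H Quot I"
  define \<pi> where "\<pi> = (+>\<^bsub>H\<^esub>) I"
  have Q: "domain Q" unfolding Q_def by (rule I.quotient_is_domain)
  interpret Q: "domain" Q by (rule Q)
  interpret \<pi>: ring_hom_cring H Q \<pi> unfolding Q_def \<pi>_def by (rule I.rcos_ring_hom_cring)
  define \<kappa> where "\<kappa> c = \<pi> (c \<odot>\<^bsub>H\<^esub> \<one>\<^bsub>H\<^esub>)" for c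
  have \<kappa>: "\<kappa> \<in> ring_hom K Q"
    unfolding \<kappa>_def by (rule ring_hom_memI)
      (simp_all add: H.smult_l_distr H.smult_one_mult H.smult_assoc1 flip: \<pi>.hom_mult)
  obtain S where S: "finite S" "S \<subseteq> carrier H" "\<And>B. subalg K H B \<Longrightarrow> S \<subseteq> B \<Longrightarrow> B = carrier H"
    using ft by (auto simp: finite_type_def)
  obtain R where R: "separating K Q \<kappa> R" "\<pi> ` S \<subseteq> R"
    using separating_finite[OF K Q \<kappa>, of "\<pi> ` S"] S(1,2) by (metis \<pi>.hom_closed finite_imageI image_subset_iff subsetD)
  have sub: "subring R Q" and \<kappa>R: "\<And>c. c \<in> carrier K \<Longrightarrow> \<kappa> c \<in> R"
    using R(1) by (auto simp: separating_def)
  \<comment> \<open>Finite type is phrased by subalgebras: the preimage of \<open>R\<close> is one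
    that contains the generators, hence is everything.\<close>
  define B where "B = {b \<in> carrier H. \<pi> b \<in> R}"
  have \<pi>s: "\<pi> (c \<odot>\<^bsub>H\<^esub> b) = \<kappa> c \<otimes>\<^bsub>Q\<^esub> \<pi> b" if "c \<in> carrier K" "b \<in> carrier H" for c b
    using that by (simp add: \<kappa>_def H.smult_one_mult flip: \<pi>.hom_mult)
  have "subalg K H B"
    unfolding subalg_def
  proof
    show "subring B H"
      by (rule H.subringI) (use subringE[OF sub] in \<open>auto simp: B_def\<close>)
    show "\<forall>c\<in>carrier K. \<forall>b\<in>B. c \<odot>\<^bsub>H\<^esub> b \<in> B"
      using subringE(6)[OF sub] \<kappa>R by (auto simp: B_def \<pi>s)
  qed
  moreover have "S \<subseteq> B" using S(2) R(2) by (auto simp: B_def)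
  ultimately have "B = carrier H" by (rule S(3))
  then have \<pi>R: "\<pi> b \<in> R" if "b \<in> carrier H" for b using that by (auto simp: B_def)
  have "\<pi> h \<noteq> \<zero>\<^bsub>Q\<^esub>"
  proof
    assume "\<pi> h = \<zero>\<^bsub>Q\<^esub>"
    then have "I +>\<^bsub>H\<^esub> h = I" by (simp add: \<pi>_def Q_def FactRing_def)
    then show False using I.rcos_const_imp_mem[OF h(1)] I(2) by simp
  qed
  then obtain \<phi> where \<phi>: "\<phi> \<in> ring_hom (Q\<lparr>carrier := R\<rparr>) K" "\<forall>c\<in>carrier K. \<phi> (\<kappa> c) = c" "\<phi> (\<pi> h) \<noteq> \<zero>\<^bsub>K\<^esub>"
    using R(1) \<pi>R[OF h(1)] unfolding separating_def by blast
  have "(\<lambda>b. \<phi> (\<pi> b)) \<in> points K H"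
    unfolding points_def
  proof (intro CollectI conjI ballI ring_hom_memI)
    fix c b assume "c \<in> carrier K" "b \<in> carrier H"
    then show "\<phi> (\<pi> (c \<odot>\<^bsub>H\<^esub> b)) = c \<otimes>\<^bsub>K\<^esub> \<phi> (\<pi> b)"
      using ring_hom_mult[OF \<phi>(1), of "\<kappa> c" "\<pi> b"] \<phi>(2) \<pi>R \<kappa>R by (simp add: \<pi>s)
  next
    show "\<phi> (\<pi> \<one>\<^bsub>H\<^esub>) = \<one>\<^bsub>K\<^esub>" using ring_hom_one[OF \<phi>(1)] by simp
  qed (use ring_hom_closed[OF \<phi>(1)] ring_hom_mult[OF \<phi>(1)] ring_hom_add[OF \<phi>(1)] \<pi>R in auto)
  then show ?thesis using that \<phi>(3) by blast
qed

section \<open>Brackets on \<open>H \<otimes> A\<close>\<close>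

context tensors
begin

text \<open>Representations as sums of pure tensors are kept as lists, because
  \<open>at_points_separate\<close> compares their lengths.\<close>

definition tsum :: "('a \<times> 'b) list \<Rightarrow> ('k, 'a \<times> 'b) aterm set" where
  "tsum ps = foldr (\<lambda>p s. tn (fst p) (snd p) \<oplus>\<^bsub>AB\<^esub> s) ps \<zero>\<^bsub>AB\<^esub>"

abbreviation "pairs ps \<equiv> set ps \<subseteq> carrier A \<times> carrier B"

lemma tsum_Nil [simp]: "tsum [] = \<zero>\<^bsub>AB\<^esub>"
  and tsum_Cons [simp]: "tsum (p # ps) = tn (fst p) (snd p) \<oplus>\<^bsub>AB\<^esub> tsum ps"
  by (simp_all add: tsum_def)

lemma tsum_closed [simp]: "pairs ps \<Longrightarrow> tsum ps \<in> carrier AB"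
  by (induction ps) auto

lemma tsum_append: "pairs ps \<Longrightarrow> pairs qs \<Longrightarrow> tsum (ps @ qs) = tsum ps \<oplus>\<^bsub>AB\<^esub> tsum qs"
  by (induction ps) (auto simp: AB.a_assoc)

lemma tsum_tens_mult: "pairs qs \<Longrightarrow> a \<in> carrier A \<Longrightarrow> b \<in> carrier B \<Longrightarrow>
   tn a b \<otimes>\<^bsub>AB\<^esub> tsum qs = tsum (map (\<lambda>q. (a \<otimes>\<^bsub>A\<^esub> fst q, b \<otimes>\<^bsub>B\<^esub> snd q)) qs)"
  by (induction qs) (auto simp: AB.r_distr tens_mult)

lemma tsum_smult: "pairs qs \<Longrightarrow> c \<in> carrier K \<Longrightarrow>
   c \<odot>\<^bsub>AB\<^esub> tsum qs = tsum (map (\<lambda>q. (c \<odot>\<^bsub>A\<^esub> fst q, snd q)) qs)"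
  by (induction qs) (auto simp: AB.smult_r_distr tens_smult_left)

lemma tsum_mult: "pairs ps \<Longrightarrow> pairs qs \<Longrightarrow> \<exists>rs. pairs rs \<and> tsum ps \<otimes>\<^bsub>AB\<^esub> tsum qs = tsum rs"
proof (induction ps)
  case Nil
  then show ?case by (intro exI[of _ "[]"]) simp
next
  case (Cons p ps)
  then obtain rs where rs: "pairs rs" "tsum ps \<otimes>\<^bsub>AB\<^esub> tsum qs = tsum rs" by auto
  obtain a b where p: "p = (a,b)" "a \<in> carrier A" "b \<in> carrier B" using Cons.prems by (cases p) auto
  let ?q = "map (\<lambda>q. (a \<otimes>\<^bsub>A\<^esub> fst q, b \<otimes>\<^bsub>B\<^esub> snd q)) qs"
  have q: "pairs ?q" using Cons.prems p by auto
  have "tsum (p # ps) \<otimes>\<^bsub>AB\<^esub> tsum qs = tsum (?q @ rs)"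
    using Cons.prems p rs by (simp add: AB.l_distr tsum_tens_mult tsum_append[OF q rs(1)])
  then show ?case using q rs(1) by (intro exI[of _ "?q @ rs"]) simp
qed

lemma tensor_tsum:
  assumes "z \<in> carrier AB" shows "\<exists>ps. pairs ps \<and> z = tsum ps"
  using assms
proof (induction rule: tensor_induct)
  case (tens a b)
  then show ?case by (intro exI[of _ "[(a,b)]"]) simp
next
  case (add x y)
  then obtain ps qs where "pairs ps" "x = tsum ps" "pairs qs" "y = tsum qs" by auto
  then show ?case by (intro exI[of _ "ps @ qs"]) (simp add: tsum_append)
next
  case (smult c x)
  then obtain ps where "pairs ps" "x = tsum ps" by auto
  then show ?case using smult
    by (intro exI[of _ "map (\<lambda>q. (c \<odot>\<^bsub>A\<^esub> fst q, snd q)) ps"]) (auto simp: tsum_smult)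
next
  case (mult x y)
  then show ?case using tsum_mult by metis
qed

definition at_point :: "('a \<Rightarrow> 'k) \<Rightarrow> ('k, 'a \<times> 'b) aterm set \<Rightarrow> 'b" where
  "at_point g = tensor_lift B (\<lambda>h. g h \<odot>\<^bsub>B\<^esub> \<one>\<^bsub>B\<^esub>) (\<lambda>x. x)"

context
  fixes g assumes g: "g \<in> points K A"
begin

lemma pointsD:
  "\<And>a. a \<in> carrier A \<Longrightarrow> g a \<in> carrier K"
  "\<And>a b. a \<in> carrier A \<Longrightarrow> b \<in> carrier A \<Longrightarrow> g (a \<oplus>\<^bsub>A\<^esub> b) = g a \<oplus> g b"
  "\<And>a b. a \<in> carrier A \<Longrightarrow> b \<in> carrier A \<Longrightarrow> g (a \<otimes>\<^bsub>A\<^esub> b) = g a \<otimes> g b"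
  "\<And>c a. c \<in> carrier K \<Longrightarrow> a \<in> carrier A \<Longrightarrow> g (c \<odot>\<^bsub>A\<^esub> a) = c \<otimes> g a"
  "g \<one>\<^bsub>A\<^esub> = \<one>"
  using g by (auto simp: points_def ring_hom_def)

lemma point_hom: "alg_hom K A B (\<lambda>h. g h \<odot>\<^bsub>B\<^esub> \<one>\<^bsub>B\<^esub>)"
  by (rule alg_homI) (simp_all add: pointsD B.smult_l_distr B.smult_assoc1 B.smult_one_mult)

lemma at_point_hom: "alg_hom K AB B (at_point g)"
  unfolding at_point_def by (rule tensor_lift_hom[OF B.algebra_axioms point_hom alg_hom_id])

lemma at_point_tens: "a \<in> carrier A \<Longrightarrow> b \<in> carrier B \<Longrightarrow> at_point g (tn a b) = g a \<odot>\<^bsub>B\<^esub> b"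
  unfolding at_point_def
  by (subst tensor_lift_tens[OF B.algebra_axioms point_hom alg_hom_id]) (simp_all add: pointsD B.smult_one_mult)

text \<open>If c times \<open>g h\<close> is 1, the new left factors are all killed by
  \<open>g\<close>. The correction is a single pure tensor with left factor \<open>h\<close>, so it
  can absorb a term \<open>h \<otimes> b\<close>.\<close>

lemma tsum_shift:
  assumes "pairs rs" "h \<in> carrier A" "c \<in> carrier K"
  shows "tsum (map (\<lambda>q. (fst q \<ominus>\<^bsub>A\<^esub> (c \<otimes> g (fst q)) \<odot>\<^bsub>A\<^esub> h, snd q)) rs) =
     tsum rs \<ominus>\<^bsub>AB\<^esub> tn h (c \<odot>\<^bsub>B\<^esub> at_point g (tsum rs))"
  using assms(1)
proof (induction rs)
  case Nil
  then show ?case using assms alg_hom_zero[OF tensor_algebra B.algebra_axioms at_point_hom]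
    by (simp add: tens_zero_right a_minus_def)
next
  case (Cons q rs)
  obtain a b where q: "q = (a,b)" "a \<in> carrier A" "b \<in> carrier B" using Cons.prems by (cases q) auto
  have cl: "at_point g (tsum rs) \<in> carrier B" "tsum rs \<in> carrier AB"
    using Cons.prems alg_homD(2)[OF at_point_hom] by auto
  have "tsum (map (\<lambda>q. (fst q \<ominus>\<^bsub>A\<^esub> (c \<otimes> g (fst q)) \<odot>\<^bsub>A\<^esub> h, snd q)) (q # rs)) =
     tn (a \<ominus>\<^bsub>A\<^esub> (c \<otimes> g a) \<odot>\<^bsub>A\<^esub> h) b \<oplus>\<^bsub>AB\<^esub> (tsum rs \<ominus>\<^bsub>AB\<^esub> tn h (c \<odot>\<^bsub>B\<^esub> at_point g (tsum rs)))"
    using Cons q by simp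
  also have "tn (a \<ominus>\<^bsub>A\<^esub> (c \<otimes> g a) \<odot>\<^bsub>A\<^esub> h) b = tn a b \<ominus>\<^bsub>AB\<^esub> tn h ((c \<otimes> g a) \<odot>\<^bsub>B\<^esub> b)"
    using q assms pointsD(1)[of a]
    by (simp add: a_minus_def tens_add_left tens_neg_left tens_smult_left tens_smult_right)
  also have "(tn a b \<ominus>\<^bsub>AB\<^esub> tn h ((c \<otimes> g a) \<odot>\<^bsub>B\<^esub> b)) \<oplus>\<^bsub>AB\<^esub> (tsum rs \<ominus>\<^bsub>AB\<^esub> tn h (c \<odot>\<^bsub>B\<^esub> at_point g (tsum rs))) =
     (tn a b \<oplus>\<^bsub>AB\<^esub> tsum rs) \<ominus>\<^bsub>AB\<^esub> tn h ((c \<otimes> g a) \<odot>\<^bsub>B\<^esub> b \<oplus>\<^bsub>B\<^esub> c \<odot>\<^bsub>B\<^esub> at_point g (tsum rs))"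
    using q assms cl pointsD(1)[of a]
    by (simp add: a_minus_def tens_add_right AB.minus_add AB.a_ac)
  also have "(c \<otimes> g a) \<odot>\<^bsub>B\<^esub> b \<oplus>\<^bsub>B\<^esub> c \<odot>\<^bsub>B\<^esub> at_point g (tsum rs) = c \<odot>\<^bsub>B\<^esub> at_point g (tsum (q # rs))"
    using q assms cl pointsD(1)[of a]
    by (simp add: alg_homD[OF at_point_hom] at_point_tens B.smult_assoc1 B.smult_r_distr)
  finally show ?case using q by simp
qed

end

text \<open>In a shortest representation of \<open>z\<close>, suppose some \<open>g\<close> does not
  kill a left factor \<open>h\<close>. As \<open>z\<close> vanishes at \<open>g\<close>, the right
  factor of \<open>h\<close> is determined by the other terms, and \<open>tsum_shift\<close> absorbs
  it into them, giving a shorter sum. So every left factor vanishes at all points and is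
  zero.\<close>

lemma at_points_separate:
  assumes K: "algebraically_closed K" and ft: "finite_type K A"
    and red: "\<forall>h\<in>carrier A. \<forall>n::nat. h [^]\<^bsub>A\<^esub> n = \<zero>\<^bsub>A\<^esub> \<longrightarrow> h = \<zero>\<^bsub>A\<^esub>"
    and z: "z \<in> carrier AB" and 0: "\<And>g. g \<in> points K A \<Longrightarrow> at_point g z = \<zero>\<^bsub>B\<^esub>"
  shows "z = \<zero>\<^bsub>AB\<^esub>"
proof -
  interpret K: algebraically_closed K by fact
  obtain ps where ps: "pairs ps" "z = tsum ps"
    and min: "\<And>qs. pairs qs \<Longrightarrow> z = tsum qs \<Longrightarrow> length ps \<le> length qs"
    using ex_has_least_nat[of "\<lambda>ps. pairs ps \<and> z = tsum ps" _ length] tensor_tsum[OF z] by metis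
  show ?thesis
  proof (cases "\<exists>p\<in>set ps. \<exists>g\<in>points K A. g (fst p) \<noteq> \<zero>")
    case True
    then obtain h b g where hb: "(h,b) \<in> set ps" and g: "g \<in> points K A" "g h \<noteq> \<zero>" by auto
    obtain us vs where split: "ps = us @ (h,b) # vs" using split_list[OF hb] by blast
    have h: "h \<in> carrier A" "b \<in> carrier B" and uv: "pairs us" "pairs vs" using ps(1) split by auto
    let ?rs = "us @ vs"
    define c where "c = inv (g h)"
    note pg = pointsD[OF g(1)]
    have c: "c \<in> carrier K" "c \<otimes> g h = \<one>"
      unfolding c_def using K.field_Units pg(1)[OF h(1)] g(2) by (auto intro: A.R.Units_inv_closed A.R.Units_l_inv)
    have rs: "pairs ?rs" using uv by auto
    have zs: "z = tn h b \<oplus>\<^bsub>AB\<^esub> tsum ?rs"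
      unfolding ps(2) split using uv h by (simp add: tsum_append AB.a_ac)
    have apcl: "at_point g (tsum ?rs) \<in> carrier B"
      using alg_homD(2)[OF at_point_hom[OF g(1)]] rs by simp
    have "g h \<odot>\<^bsub>B\<^esub> b \<oplus>\<^bsub>B\<^esub> at_point g (tsum ?rs) = \<zero>\<^bsub>B\<^esub>"
      using 0[OF g(1)] h rs unfolding zs
      by (simp add: alg_homD[OF at_point_hom[OF g(1)]] at_point_tens[OF g(1)])
    then have "at_point g (tsum ?rs) = \<ominus>\<^bsub>B\<^esub> (g h \<odot>\<^bsub>B\<^esub> b)"
      using apcl h pg(1)[OF h(1)] B.minus_equality[of "at_point g (tsum ?rs)" "g h \<odot>\<^bsub>B\<^esub> b"] by (simp add: B.a_comm)
    then have cb: "c \<odot>\<^bsub>B\<^esub> at_point g (tsum ?rs) = \<ominus>\<^bsub>B\<^esub> b"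
      using c h pg(1)[OF h(1)] by (simp add: B.smult_r_minus B.smult_assoc1[symmetric])
    let ?qs = "map (\<lambda>q. (fst q \<ominus>\<^bsub>A\<^esub> (c \<otimes> g (fst q)) \<odot>\<^bsub>A\<^esub> h, snd q)) ?rs"
    have "tsum ?qs = tsum ?rs \<ominus>\<^bsub>AB\<^esub> tn h (\<ominus>\<^bsub>B\<^esub> b)"
      using tsum_shift[OF g(1) rs h(1) c(1)] unfolding cb .
    also have "\<dots> = z"
      unfolding zs using h rs by (simp add: a_minus_def tens_neg_right AB.a_comm)
    finally have "z = tsum ?qs" by simp
    moreover have "pairs ?qs" using rs c h pg(1) by auto
    ultimately have "length ps \<le> length ?qs" by (intro min)
    then show ?thesis unfolding split by simp
  next
    case False
    have "fst p = \<zero>\<^bsub>A\<^esub>" if "p \<in> set ps" for p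
    proof (rule ccontr)
      assume "fst p \<noteq> \<zero>\<^bsub>A\<^esub>"
      moreover have fp: "fst p \<in> carrier A" using that ps(1) by auto
      ultimately obtain g where "g \<in> points K A" "g (fst p) \<noteq> \<zero>"
        using points_separate[OF K A.algebra_axioms ft red fp] by blast
      then show False using False that by blast
    qed
    then have "tsum ps = \<zero>\<^bsub>AB\<^esub>"
      using ps(1) by (induction ps) (auto simp: tens_zero_left)
    then show ?thesis using ps(2) by simp
  qed
qed

end

lemma (in algebra) mult_smult_right:
  "c \<in> carrier R \<Longrightarrow> x \<in> carrier M \<Longrightarrow> y \<in> carrier M \<Longrightarrow>
   x \<otimes>\<^bsub>M\<^esub> (c \<odot>\<^bsub>M\<^esub> y) = c \<odot>\<^bsub>M\<^esub> (x \<otimes>\<^bsub>M\<^esub> y)"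
  using smult_assoc2[of c y x] by (simp add: m_comm)

text \<open>Makes the results on module-valued derivations available for derivations of an algebra
  into itself.\<close>

definition self_module :: "('v,'n) ring_scheme \<Rightarrow> ('v,'v) module" where
  "self_module V = \<lparr>carrier = carrier V, monoid.mult = monoid.mult V, one = one V, zero = zero V,
     add = add V, smult = monoid.mult V\<rparr>"

lemma self_module_simps [simp]:
  "carrier (self_module V) = carrier V" "add (self_module V) = add V" "zero (self_module V) = zero V"
  "smult (self_module V) = monoid.mult V"
  by (simp_all add: self_module_def)

lemma (in cring) self_module: "module R (self_module R)"
proof (rule moduleI)
  show "cring R" by (rule is_cring)
  show "abelian_group (self_module R)"
  proof (rule abelian_groupI)
    fix x assume "x \<in> carrier (self_module R)"
    then show "\<exists>y\<in>carrier (self_module R). y \<oplus>\<^bsub>self_module R\<^esub> x = \<zero>\<^bsub>self_module R\<^esub>"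
      by (intro bexI[of _ "\<ominus> x"]) (simp_all add: l_neg)
  qed (simp_all add: a_ac)
qed (simp_all add: l_distr r_distr m_assoc)

locale tensor_bider = T: tensors K H A + P: bider K A P
  for K :: "('k,'m) ring_scheme" (structure) and H :: "('k,'h,'p) module_scheme"
    and A :: "('k,'a,'n) module_scheme" and P
begin

abbreviation "HA \<equiv> tensor K H A"
abbreviation "tn \<equiv> tens K H A"

text \<open>The bracket for which \<open>H\<close> consists of constants: in each variable the
  derivation is zero on \<open>H\<close> and prescribed on \<open>A\<close>. As for the
  \<lambda>-bracket, one variable is extended after the other and the rules in the earlier one are
  checked again.\<close>

lemma tensor_bracket_exists:
  obtains P' where "bider K HA P'"
    "\<And>h a h' b. h \<in> carrier H \<Longrightarrow> a \<in> carrier A \<Longrightarrow> h' \<in> carrier H \<Longrightarrow> b \<in> carrier A \<Longrightarrow>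
      P' (tn h a) (tn h' b) = tn (h \<otimes>\<^bsub>H\<^esub> h') (P a b)"
proof -
  let ?M = "self_module HA"
  note [simp] = P.br_closed
  have z: "mder K H HA ?M (\<lambda>h. tn h \<one>\<^bsub>A\<^esub>) (\<lambda>h. \<zero>\<^bsub>HA\<^esub>)"
    by (rule mderI) simp_all
  have e: "mder K A HA ?M (\<lambda>b. tn \<one>\<^bsub>H\<^esub> b) (\<lambda>b. tn \<one>\<^bsub>H\<^esub> (P a b))" if "a \<in> carrier A" for a
    using that by (intro mderI)
      (simp_all add: P.br_add_right P.br_smult_right P.br_mult_right T.tens_add_right T.tens_smult_right
        T.AB.smult_one_mult T.tens_mult[symmetric])
  have "\<exists>\<xi>. mder K HA HA ?M (\<lambda>x. x) \<xi> \<and> (\<forall>h\<in>carrier H. \<forall>b\<in>carrier A. \<xi> (tn h b) = tn h (P a b))"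
    if a: "a \<in> carrier A" for a
    by (rule T.tensor_mder_extension[OF T.AB.self_module z e[OF a]])
      (use a in \<open>auto simp: T.tens_mult[symmetric] intro!: exI\<close>)
  then obtain \<xi> where \<xi>: "\<And>a. a \<in> carrier A \<Longrightarrow> mder K HA HA ?M (\<lambda>x. x) (\<xi> a)"
    "\<And>a h b. a \<in> carrier A \<Longrightarrow> h \<in> carrier H \<Longrightarrow> b \<in> carrier A \<Longrightarrow> \<xi> a (tn h b) = tn h (P a b)"
    by metis
  have x: "\<And>a x. a \<in> carrier A \<Longrightarrow> x \<in> carrier HA \<Longrightarrow> \<xi> a x \<in> carrier HA"
    "\<And>a x y. a \<in> carrier A \<Longrightarrow> x \<in> carrier HA \<Longrightarrow> y \<in> carrier HA \<Longrightarrow> \<xi> a (x \<oplus>\<^bsub>HA\<^esub> y) = \<xi> a x \<oplus>\<^bsub>HA\<^esub> \<xi> a y"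
    "\<And>a c x. a \<in> carrier A \<Longrightarrow> c \<in> carrier K \<Longrightarrow> x \<in> carrier HA \<Longrightarrow> \<xi> a (c \<odot>\<^bsub>HA\<^esub> x) = c \<odot>\<^bsub>HA\<^esub> \<xi> a x"
    "\<And>a x y. a \<in> carrier A \<Longrightarrow> x \<in> carrier HA \<Longrightarrow> y \<in> carrier HA \<Longrightarrow>
       \<xi> a (x \<otimes>\<^bsub>HA\<^esub> y) = x \<otimes>\<^bsub>HA\<^esub> \<xi> a y \<oplus>\<^bsub>HA\<^esub> y \<otimes>\<^bsub>HA\<^esub> \<xi> a x"
    using mderD[OF \<xi>(1)] by (simp_all add: T.AB.smult_one_mult)
  have md: "mder K A HA ?M (\<lambda>a. tn \<one>\<^bsub>H\<^esub> a) (\<lambda>a. \<xi> a x)" if "x \<in> carrier HA" for x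
  proof (rule mderI)
    fix a b assume ab: "a \<in> carrier A" "b \<in> carrier A"
    have "\<xi> (a \<oplus>\<^bsub>A\<^esub> b) x = \<xi> a x \<oplus>\<^bsub>HA\<^esub> \<xi> b x"
      using that
    proof (induction rule: T.tensor_induct)
      case (tens h c)
      then show ?case using ab by (simp add: \<xi>(2) P.br_add_left T.tens_add_right)
    next
      case (add y z)
      then show ?case using ab by (simp add: x T.AB.a_ac)
    next
      case (smult c z)
      then show ?case using ab by (simp add: x T.AB.smult_r_distr)
    next
      case (mult y z)
      then show ?case using ab by (simp add: x T.AB.r_distr T.AB.a_ac)
    qed
    then show "\<xi> (a \<oplus>\<^bsub>A\<^esub> b) x = \<xi> a x \<oplus>\<^bsub>?M\<^esub> \<xi> b x" by simp
    have "\<xi> (a \<otimes>\<^bsub>A\<^esub> b) x = tn \<one>\<^bsub>H\<^esub> a \<otimes>\<^bsub>HA\<^esub> \<xi> b x \<oplus>\<^bsub>HA\<^esub> tn \<one>\<^bsub>H\<^esub> b \<otimes>\<^bsub>HA\<^esub> \<xi> a x"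
      using that
    proof (induction rule: T.tensor_induct)
      case (tens h c)
      then show ?case using ab by (simp add: \<xi>(2) P.br_mult_left T.tens_add_right T.tens_mult[symmetric])
    next
      case (add y z)
      then show ?case using ab by (simp add: x T.AB.r_distr T.AB.a_ac)
    next
      case (smult c z)
      then show ?case using ab
        by (simp add: x T.AB.smult_r_distr T.AB.mult_smult_right)
    next
      case (mult y z)
      then show ?case using ab by (simp add: x T.AB.r_distr T.AB.a_ac T.AB.m_ac)
    qed
    then show "\<xi> (a \<otimes>\<^bsub>A\<^esub> b) x = tn \<one>\<^bsub>H\<^esub> a \<odot>\<^bsub>?M\<^esub> \<xi> b x \<oplus>\<^bsub>?M\<^esub> tn \<one>\<^bsub>H\<^esub> b \<odot>\<^bsub>?M\<^esub> \<xi> a x" by simp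
  next
    fix c a assume ca: "c \<in> carrier K" "a \<in> carrier A"
    have "\<xi> (c \<odot>\<^bsub>A\<^esub> a) x = c \<odot>\<^bsub>HA\<^esub> \<xi> a x"
      using that
    proof (induction rule: T.tensor_induct)
      case (tens h b)
      then show ?case using ca by (simp add: \<xi>(2) P.br_smult_left T.tens_smult_right)
    next
      case (add y z)
      then show ?case using ca by (simp add: x T.AB.smult_r_distr)
    next
      case (smult d z)
      then show ?case using ca by (simp add: x T.AB.smult_assoc1[symmetric] T.A.R.m_comm)
    next
      case (mult y z)
      then show ?case using ca
        by (simp add: x T.AB.smult_r_distr T.AB.mult_smult_right)
    qed
    then show "\<xi> (c \<odot>\<^bsub>A\<^esub> a) x = (c \<odot>\<^bsub>HA\<^esub> \<one>\<^bsub>HA\<^esub>) \<odot>\<^bsub>?M\<^esub> \<xi> a x"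
      using ca that by (simp add: T.AB.smult_one_mult x)
  qed (use that x in simp)
  have "\<exists>\<eta>. mder K HA HA ?M (\<lambda>x. x) \<eta> \<and>
      (\<forall>h\<in>carrier H. \<forall>a\<in>carrier A. \<eta> (tn h a) = tn h \<one>\<^bsub>A\<^esub> \<otimes>\<^bsub>HA\<^esub> \<xi> a x)"
    if "x \<in> carrier HA" for x
    by (rule T.tensor_mder_extension[OF T.AB.self_module z md[OF that]])
      (use that x in \<open>auto intro!: exI\<close>)
  then obtain \<eta> where \<eta>: "\<And>x. x \<in> carrier HA \<Longrightarrow> mder K HA HA ?M (\<lambda>x. x) (\<eta> x)"
    "\<And>x h a. x \<in> carrier HA \<Longrightarrow> h \<in> carrier H \<Longrightarrow> a \<in> carrier A \<Longrightarrow> \<eta> x (tn h a) = tn h \<one>\<^bsub>A\<^esub> \<otimes>\<^bsub>HA\<^esub> \<xi> a x"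
    by metis
  have y: "\<And>a x. a \<in> carrier HA \<Longrightarrow> x \<in> carrier HA \<Longrightarrow> \<eta> a x \<in> carrier HA"
    "\<And>a x y. a \<in> carrier HA \<Longrightarrow> x \<in> carrier HA \<Longrightarrow> y \<in> carrier HA \<Longrightarrow> \<eta> a (x \<oplus>\<^bsub>HA\<^esub> y) = \<eta> a x \<oplus>\<^bsub>HA\<^esub> \<eta> a y"
    "\<And>a c x. a \<in> carrier HA \<Longrightarrow> c \<in> carrier K \<Longrightarrow> x \<in> carrier HA \<Longrightarrow> \<eta> a (c \<odot>\<^bsub>HA\<^esub> x) = c \<odot>\<^bsub>HA\<^esub> \<eta> a x"
    "\<And>a x y. a \<in> carrier HA \<Longrightarrow> x \<in> carrier HA \<Longrightarrow> y \<in> carrier HA \<Longrightarrow>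
       \<eta> a (x \<otimes>\<^bsub>HA\<^esub> y) = x \<otimes>\<^bsub>HA\<^esub> \<eta> a y \<oplus>\<^bsub>HA\<^esub> y \<otimes>\<^bsub>HA\<^esub> \<eta> a x"
    using mderD[OF \<eta>(1)] by (simp_all add: T.AB.smult_one_mult)
  have right: "\<forall>x\<in>carrier HA. \<forall>x'\<in>carrier HA. \<forall>c\<in>carrier K.
      \<eta> (x \<oplus>\<^bsub>HA\<^esub> x') z = \<eta> x z \<oplus>\<^bsub>HA\<^esub> \<eta> x' z \<and>
      \<eta> (c \<odot>\<^bsub>HA\<^esub> x) z = c \<odot>\<^bsub>HA\<^esub> \<eta> x z \<and>
      \<eta> (x \<otimes>\<^bsub>HA\<^esub> x') z = x \<otimes>\<^bsub>HA\<^esub> \<eta> x' z \<oplus>\<^bsub>HA\<^esub> x' \<otimes>\<^bsub>HA\<^esub> \<eta> x z" if "z \<in> carrier HA" for z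
    using that
  proof (induction rule: T.tensor_induct)
    case (tens h a)
    then show ?case
      by (simp add: \<eta>(2) x T.AB.r_distr T.AB.m_lcomm T.AB.mult_smult_right)
  next
    case (add u v)
    then show ?case by (simp add: y T.AB.r_distr T.AB.smult_r_distr T.AB.a_ac)
  next
    case (smult d u)
    then show ?case
      by (simp add: y T.AB.smult_r_distr T.AB.smult_assoc1[symmetric] T.A.R.m_comm T.AB.mult_smult_right)
  next
    case (mult u v)
    then show ?case
      by (simp add: y T.AB.r_distr T.AB.smult_r_distr T.AB.a_ac T.AB.m_ac T.AB.mult_smult_right)
  qed
  show ?thesis
  proof (rule that)
    show "bider K HA (\<lambda>x y. \<eta> y x)"
      by (intro bider.intro jets.intro T.tensor_algebra bider_axioms.intro)
        ((simp add: y; fail) | (use right T.A.R.one_closed in blast))+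
    show "\<eta> (tn h' b) (tn h a) = tn (h \<otimes>\<^bsub>H\<^esub> h') (P a b)"
      if "h \<in> carrier H" "a \<in> carrier A" "h' \<in> carrier H" "b \<in> carrier A" for h a h' b
      using that by (simp add: \<eta>(2) \<xi>(2) T.tens_mult[symmetric])
  qed
qed

end

section \<open>Jets of actions\<close>

context tensor_bider
begin

lemma at_point_bracket:
  assumes P': "bider K HA P'"
    "\<And>h a h' b. h \<in> carrier H \<Longrightarrow> a \<in> carrier A \<Longrightarrow> h' \<in> carrier H \<Longrightarrow> b \<in> carrier A \<Longrightarrow>
      P' (tn h a) (tn h' b) = tn (h \<otimes>\<^bsub>H\<^esub> h') (P a b)"
    and g: "g \<in> points K H" and xy: "x \<in> carrier HA" "y \<in> carrier HA"
  shows "T.at_point g (P' x y) = P (T.at_point g x) (T.at_point g y)"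
proof -
  interpret P': bider K HA P' by fact
  note h = alg_homD[OF T.at_point_hom[OF g]] and pg = T.pointsD[OF g]
  have 1: "T.at_point g (P' (tn h a) y) = P (T.at_point g (tn h a)) (T.at_point g y)"
    if ha: "h \<in> carrier H" "a \<in> carrier A" for h a
    using xy(2)
  proof (induction rule: T.tensor_induct)
    case (tens h' b)
    then show ?case using ha
      by (simp add: P'(2) T.at_point_tens[OF g] P.br_closed P.br_smult_left P.br_smult_right pg
          T.B.smult_assoc1[symmetric] T.A.R.m_comm)
  qed (use ha in \<open>simp_all add: P'.br_closed P'.br_add_right P.br_add_right P'.br_smult_right
      P.br_smult_right P'.br_mult_right P.br_mult_right h\<close>)
  show ?thesis
    using xy(1)
  proof (induction rule: T.tensor_induct)
    case (tens h a)
    then show ?case by (rule 1)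
  qed (use xy(2) in \<open>simp_all add: P'.br_closed P'.br_add_left P.br_add_left P'.br_smult_left
      P.br_smult_left P'.br_mult_left P.br_mult_left h\<close>)
qed

text \<open>Over an algebraically closed field the points of a reduced algebra of finite type detect
  equality in \<open>H \<otimes> A\<close>, so an action by Poisson automorphisms on points is Poisson universally.\<close>

lemma coaction_bracket:
  assumes K: "algebraically_closed K" and ft: "finite_type K H"
    and red: "\<forall>h\<in>carrier H. \<forall>n::nat. h [^]\<^bsub>H\<^esub> n = \<zero>\<^bsub>H\<^esub> \<longrightarrow> h = \<zero>\<^bsub>H\<^esub>"
    and P': "bider K HA P'"
    "\<And>h a h' b. h \<in> carrier H \<Longrightarrow> a \<in> carrier A \<Longrightarrow> h' \<in> carrier H \<Longrightarrow> b \<in> carrier A \<Longrightarrow>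
      P' (tn h a) (tn h' b) = tn (h \<otimes>\<^bsub>H\<^esub> h') (P a b)"
    and \<rho>: "alg_hom K A HA \<rho>"
    and auto: "\<And>g a b. g \<in> points K H \<Longrightarrow> a \<in> carrier A \<Longrightarrow> b \<in> carrier A \<Longrightarrow>
      T.at_point g (\<rho> (P a b)) = P (T.at_point g (\<rho> a)) (T.at_point g (\<rho> b))"
    and ab: "a \<in> carrier A" "b \<in> carrier A"
  shows "\<rho> (P a b) = P' (\<rho> a) (\<rho> b)"
proof -
  interpret P': bider K HA P' by fact
  note r = alg_homD[OF \<rho>]
  have cl: "\<rho> (P a b) \<in> carrier HA" "P' (\<rho> a) (\<rho> b) \<in> carrier HA"
    using ab by (simp_all add: r P.br_closed P'.br_closed)
  have "T.at_point g (\<rho> (P a b) \<ominus>\<^bsub>HA\<^esub> P' (\<rho> a) (\<rho> b)) = \<zero>\<^bsub>A\<^esub>" if g: "g \<in> points K H" for g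
  proof -
    interpret ap: additive_map HA A "T.at_point g"
      by unfold_locales (auto intro!: additiveI simp: alg_homD[OF T.at_point_hom[OF g]])
    have "T.at_point g (P' (\<rho> a) (\<rho> b)) = T.at_point g (\<rho> (P a b))"
      using at_point_bracket[OF P' g] auto[OF g ab] ab by (simp add: r)
    then show ?thesis using cl by (simp add: a_minus_def T.B.r_neg)
  qed
  then have "\<rho> (P a b) \<ominus>\<^bsub>HA\<^esub> P' (\<rho> a) (\<rho> b) = \<zero>\<^bsub>HA\<^esub>"
    using cl by (intro T.at_points_separate[OF K ft red]) auto
  then show ?thesis using cl by (simp add: T.AB.r_right_minus_eq)
qed

end

lemma jet_map_facts:
  assumes A: "algebra K A" and B: "algebra K B" and f: "alg_hom K A B f"
  shows "alg_hom K (jet K A) (jet K B) (jet_map K B f)"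
    and "\<And>a. a \<in> carrier A \<Longrightarrow> jet_map K B f (jet_gen K A 0 a) = jet_gen K B 0 (f a)"
    and "\<And>x. x \<in> carrier (jet K A) \<Longrightarrow> jet_map K B f (jet_der K A x) = jet_der K B (jet_map K B f x)"
    and "diff_hom K (jet K A) (jet_der K A) (jet K B) (jet_der K B) (jet_map K B f)"
proof -
  interpret A: jets K A by (rule jets.intro) fact
  interpret B: jets K B by (rule jets.intro) fact
  have \<phi>: "alg_hom K A B.J (\<lambda>a. B.gen 0 (f a))"
    by (rule alg_hom_comp[OF f B.gen_hom])
  note 1 = A.jet_lift_hom[OF B.jet_algebra B.der_derivation \<phi>, folded jet_map_def]
  note 2 = A.jet_lift_gen[OF B.jet_algebra B.der_derivation \<phi>, folded jet_map_def]
  note 3 = A.jet_lift_der[OF B.jet_algebra B.der_derivation \<phi>, folded jet_map_def]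
  show "alg_hom K A.J B.J (jet_map K B f)" by (rule 1)
  show "\<And>a. a \<in> carrier A \<Longrightarrow> jet_map K B f (A.gen 0 a) = B.gen 0 (f a)" by (simp add: 2)
  show 4: "\<And>x. x \<in> carrier A.J \<Longrightarrow> jet_map K B f (A.D x) = B.D (jet_map K B f x)" by (rule 3)
  show "diff_hom K A.J A.D B.J B.D (jet_map K B f)"
    by (intro diff_hom.intro diff_hom_axioms.intro A.dj.diff_algebra_axioms B.dj.diff_algebra_axioms 1 4)
qed

lemma jet_map_bracket:
  assumes A: "bider K A P" and B: "bider K B P'" and f: "alg_hom K A B f"
    and fP: "\<And>a b. a \<in> carrier A \<Longrightarrow> b \<in> carrier A \<Longrightarrow> f (P a b) = P' (f a) (f b)"
    and L: "diff_algebra.lambda_bider K (jet K A) (jet_der K A) L"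
    "\<And>a b. a \<in> carrier A \<Longrightarrow> b \<in> carrier A \<Longrightarrow>
      L (jet_gen K A 0 a) (jet_gen K A 0 b) = monom (UP (jet K A)) (jet_gen K A 0 (P a b)) 0"
    and M: "diff_algebra.lambda_bider K (jet K B) (jet_der K B) M"
    "\<And>a b. a \<in> carrier B \<Longrightarrow> b \<in> carrier B \<Longrightarrow>
      M (jet_gen K B 0 a) (jet_gen K B 0 b) = monom (UP (jet K B)) (jet_gen K B 0 (P' a b)) 0"
    and xy: "x \<in> carrier (jet K A)" "y \<in> carrier (jet K A)"
  shows "M (jet_map K B f x) (jet_map K B f y) = (\<lambda>n. jet_map K B f (L x y n))"
proof -
  interpret A: bider K A P by fact
  interpret B: bider K B P' by fact
  note jm = jet_map_facts[OF A.A.algebra_axioms B.A.algebra_axioms f]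
  show ?thesis
  proof (rule bider_hom_bracket[OF A.jets_axioms jm(4) L(1) M(1) _ xy])
    fix a b n assume ab: "a \<in> carrier A" "b \<in> carrier A"
    interpret h: additive_map A.J B.J "jet_map K B f"
      by unfold_locales (auto intro!: additiveI simp: alg_homD[OF jm(1)])
    show "jet_map K B f (L (A.gen 0 a) (A.gen 0 b) n) =
       M (jet_map K B f (A.gen 0 a)) (jet_map K B f (A.gen 0 b)) n"
      using ab by (simp add: L(2) M(2) jm(2) alg_homD[OF f] UP_monom_apply A.br_closed B.br_closed fP)
  qed
qed

section \<open>Jets of a tensor product and the jet invariants\<close>

locale jet_tensors = tensors K H A for K :: "('k,'m) ring_scheme" (structure)
  and H :: "('k,'h,'p) module_scheme" and A :: "('k,'a,'n) module_scheme"
begin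

sublocale jH: jets K H by (rule jets.intro) (rule A.algebra_axioms)
sublocale jA: jets K A by (rule jets.intro) (rule B.algebra_axioms)
sublocale jT: jets K AB by (rule jets.intro) (rule tensor_algebra)
sublocale TJ: tensors K "jet K H" "jet K A"
  by (rule tensors.intro) (rule jH.jet_algebra jA.jet_algebra)+

abbreviation "\<delta> \<equiv> tensor_der K (jet K H) (jet K A) (jet_der K H) (jet_der K A)"
abbreviation "\<tau> \<equiv> tensor_map K (jet K H) (jet K A) (jet_gen K H 0) (jet_gen K A 0)"
abbreviation "jtH \<equiv> jet_map K AB (\<lambda>h. tn h \<one>\<^bsub>A\<^esub>)"
abbreviation "jtA \<equiv> jet_map K AB (\<lambda>a. tn \<one>\<^bsub>H\<^esub> a)"

lemmas \<delta>_derivation = TJ.tensor_der_derivation[OF jH.der_derivation jA.der_derivation]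
lemmas \<delta>_tens = TJ.tensor_der_tens[OF jH.der_derivation jA.der_derivation]
lemmas \<tau>_hom = tensor_map_hom[OF jH.jet_algebra jA.jet_algebra jH.gen_hom jA.gen_hom]
lemmas \<tau>_tens = tensor_map_tens[OF jH.jet_algebra jA.jet_algebra jH.gen_hom jA.gen_hom]

lemmas jet_tensor_hom = jT.jet_lift_hom[OF TJ.tensor_algebra \<delta>_derivation \<tau>_hom, folded jet_tensor_def]
lemmas jet_tensor_gen = jT.jet_lift_gen[OF TJ.tensor_algebra \<delta>_derivation \<tau>_hom, folded jet_tensor_def]
lemmas jet_tensor_der = jT.jet_lift_der[OF TJ.tensor_algebra \<delta>_derivation \<tau>_hom, folded jet_tensor_def]

lemmas jtH = jet_map_facts[OF A.algebra_axioms tensor_algebra tens_left_hom]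
lemmas jtA = jet_map_facts[OF B.algebra_axioms tensor_algebra tens_right_hom]

text \<open>Built from the jets of the two inclusions into \<open>H \<otimes> A\<close>. It is a
  left inverse of \<open>jet_tensor\<close>, which therefore is injective.\<close>

definition untensor :: "('k, ('k, nat \<times> 'h) aterm set \<times> ('k, nat \<times> 'a) aterm set) aterm set \<Rightarrow>
    ('k, nat \<times> ('k, 'h \<times> 'a) aterm set) aterm set" where
  "untensor = tensor_lift (jet K AB) jtH jtA"

lemmas untensor_hom = TJ.tensor_lift_hom[OF jT.jet_algebra jtH(1) jtA(1), folded untensor_def]
lemmas untensor_tens = TJ.tensor_lift_tens[OF jT.jet_algebra jtH(1) jtA(1), folded untensor_def]

lemma untensor_\<delta>: "z \<in> carrier TJ.AB \<Longrightarrow> untensor (\<delta> z) = jT.D (untensor z)"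
proof (induction rule: TJ.tensor_induct)
  case (tens x y)
  then show ?case
    using derivationD(1)[OF jH.der_derivation] derivationD(1)[OF jA.der_derivation]
    by (simp add: \<delta>_tens alg_homD[OF untensor_hom] untensor_tens jtH(3) jtA(3)
        derivationD[OF jT.der_derivation] alg_homD[OF jtH(1)] alg_homD[OF jtA(1)])
qed (simp_all add: derivationD[OF \<delta>_derivation] alg_homD[OF untensor_hom] derivationD[OF jT.der_derivation])

lemma untensor_\<tau>: "x \<in> carrier AB \<Longrightarrow> untensor (\<tau> x) = jT.gen 0 x"
proof (induction rule: tensor_induct)
  case (tens h a)
  then show ?case
    by (simp add: \<tau>_tens untensor_tens jtH(2) jtA(2) jT.gen_mult_0[symmetric] tens_eq_mult[symmetric])
qed (simp_all add: alg_homD[OF \<tau>_hom] alg_homD[OF untensor_hom] jT.gen_add jT.gen_smult jT.gen_mult_0)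

lemma untensor_jet_tensor: "z \<in> carrier jT.J \<Longrightarrow> untensor (jet_tensor K H A z) = z"
proof (induction rule: jT.jet_induct)
  case (gen x)
  then show ?case by (simp add: jet_tensor_gen untensor_\<tau>)
next
  case (der x)
  then show ?case by (simp add: jet_tensor_der untensor_\<delta> alg_homD[OF jet_tensor_hom])
qed (simp_all add: alg_homD[OF jet_tensor_hom] alg_homD[OF untensor_hom])

lemma jet_tensor_jtA: "f \<in> carrier jA.J \<Longrightarrow> jet_tensor K H A (jtA f) = TJ.tn \<one>\<^bsub>jH.J\<^esub> f"
proof (induction rule: jA.jet_induct)
  case (gen a)
  then show ?case by (simp add: jtA(2) jet_tensor_gen \<tau>_tens jH.gen_one)
next
  case (der f)
  from der show ?case
    using derivationD(1)[OF jA.der_derivation, of f]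
    by (simp add: jtA(3) jet_tensor_der alg_homD[OF jtA(1)] \<delta>_tens
        jH.J.derivation_one[OF jH.der_derivation] TJ.tens_zero_left)
qed (simp_all add: alg_homD[OF jtA(1)] alg_homD[OF jet_tensor_hom] alg_homD[OF TJ.tens_right_hom])

text \<open>Moves the invariance condition from the tensor product of the jet algebras to the jet
  algebra of \<open>H \<otimes> A\<close>, where a \<lambda>-bracket is available.\<close>

lemma jet_invariants_equalizer:
  assumes \<rho>: "alg_hom K A AB \<rho>"
  shows "jet_invariants K H A \<rho> = {f \<in> carrier jA.J. jet_map K AB \<rho> f = jtA f}"
proof -
  note jr = jet_map_facts[OF B.algebra_axioms tensor_algebra \<rho>]
  have "jet_tensor K H A (jet_map K AB \<rho> f) = TJ.tn \<one>\<^bsub>jH.J\<^esub> f \<longleftrightarrow> jet_map K AB \<rho> f = jtA f"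
    if f: "f \<in> carrier jA.J" for f
  proof
    assume "jet_tensor K H A (jet_map K AB \<rho> f) = TJ.tn \<one>\<^bsub>jH.J\<^esub> f"
    then have "untensor (jet_tensor K H A (jet_map K AB \<rho> f)) = untensor (jet_tensor K H A (jtA f))"
      using jet_tensor_jtA[OF f] by simp
    then show "jet_map K AB \<rho> f = jtA f"
      using f by (simp add: untensor_jet_tensor alg_homD[OF jr(1)] alg_homD[OF jtA(1)])
  qed (simp add: jet_tensor_jtA[OF f])
  then show ?thesis
    by (auto simp: jet_invariants_def invariants_def jet_coaction_def)
qed

end

section \<open>Subalgebras and equalizers\<close>

lemma (in algebra) subalg_algebra:
  assumes "subalg R M B" shows "algebra R (M\<lparr>carrier := B\<rparr>)"
proof -
  have sub: "subring B M" and sm: "\<And>c b. c \<in> carrier R \<Longrightarrow> b \<in> B \<Longrightarrow> c \<odot>\<^bsub>M\<^esub> b \<in> B"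
    using assms by (auto simp: subalg_def)
  have cl: "\<And>b. b \<in> B \<Longrightarrow> b \<in> carrier M" using subringE(1)[OF sub] by auto
  have "cring (M\<lparr>carrier := B\<rparr>)"
    using subcringI'[OF sub] subcring_iff[OF subringE(1)[OF sub]] by blast
  then show ?thesis
    by (intro algebraI) (simp_all add: sm cl smult_l_distr smult_r_distr smult_assoc1 smult_assoc2 R.is_cring)
qed

lemma (in algebra) equalizer_subalg:
  assumes N: "algebra R N" and f: "alg_hom R M N f" and g: "alg_hom R M N g"
  shows "subalg R M {x \<in> carrier M. f x = g x}"
  unfolding subalg_def
proof
  interpret N: algebra R N by fact
  interpret f: additive_map M N f
    by unfold_locales (auto intro!: additiveI simp: alg_homD[OF f])
  interpret g: additive_map M N g
    by unfold_locales (auto intro!: additiveI simp: alg_homD[OF g])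
  show "subring {x \<in> carrier M. f x = g x} M"
    by (rule subringI) (auto simp: alg_homD[OF f] alg_homD[OF g])
qed (auto simp: alg_homD[OF f] alg_homD[OF g])

lemma (in poisson_algebra) poisson_subalgebra:
  assumes B: "subalg K A B" and P: "\<And>a b. a \<in> B \<Longrightarrow> b \<in> B \<Longrightarrow> P a b \<in> B"
  shows "poisson_algebra K (A\<lparr>carrier := B\<rparr>) P"
proof -
  have cl: "\<And>b. b \<in> B \<Longrightarrow> b \<in> carrier A"
    using B subringE(1)[of B A] by (auto simp: subalg_def)
  interpret B: algebra K "A\<lparr>carrier := B\<rparr>" by (rule subalg_algebra[OF B])
  show ?thesis
    by unfold_locales
      (simp_all add: P cl bracket_add_left bracket_add_right bracket_smult_left bracket_smult_right
        bracket_alt bracket_jacobi bracket_leibniz)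
qed

lemma pva_subalgebra:
  assumes pvs: "poisson_vertex_subalgebra K V D L W"
  shows "poisson_vertex_algebra K (V\<lparr>carrier := W\<rparr>) D L"
proof -
  have V: "poisson_vertex_algebra K V D L" and W: "subalg K V W"
    and DW: "\<And>a. a \<in> W \<Longrightarrow> D a \<in> W" and LW: "\<And>a b n. a \<in> W \<Longrightarrow> b \<in> W \<Longrightarrow> L a b n \<in> W"
    using pvs by (auto simp: poisson_vertex_subalgebra_def)
  interpret P: poisson_vertex_algebra K V D L by (rule V)
  interpret V: diff_algebra K V D by unfold_locales (rule P.der)
  interpret W: algebra K "V\<lparr>carrier := W\<rparr>" by (rule P.subalg_algebra[OF W])
  have cl: "\<And>a. a \<in> W \<Longrightarrow> a \<in> carrier V"
    using W subringE(1)[of W V] by (auto simp: subalg_def)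
  interpret W: diff_algebra K "V\<lparr>carrier := W\<rparr>" D
    by unfold_locales (auto simp: derivation_def DW derivationD[OF P.der] cl)
  interpret F: diff_hom K "V\<lparr>carrier := W\<rparr>" D V D "\<lambda>x. x"
    by unfold_locales (auto simp: cl intro!: alg_homI)
  show ?thesis
  proof (rule F.pva_pullback[OF _ V])
    show "inj_on (\<lambda>x. x) (carrier (V\<lparr>carrier := W\<rparr>))" by simp
    fix a b assume "a \<in> carrier (V\<lparr>carrier := W\<rparr>)" "b \<in> carrier (V\<lparr>carrier := W\<rparr>)"
    then have ab: "a \<in> W" "b \<in> W" by simp_all
    show "L a b \<in> carrier W.U"
      using P.lbr_closed[OF cl[OF ab(1)] cl[OF ab(2)]] LW[OF ab] unfolding W.U_mem V.U_mem by simp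
  qed simp
qed

theorem theorem1p2:
  fixes K :: "('k,'m) ring_scheme"
    and A :: "('k,'a,'n) module_scheme" and P :: "'a \<Rightarrow> 'a \<Rightarrow> 'a"
    and H :: "('k,'h,'p) module_scheme"
    and \<Delta> :: "'h \<Rightarrow> ('k, 'h \<times> 'h) aterm set" and \<epsilon> :: "'h \<Rightarrow> 'k" and \<sigma> :: "'h \<Rightarrow> 'h"
    and \<rho> :: "'a \<Rightarrow> ('k, 'h \<times> 'a) aterm set"
  assumes K: "algebraically_closed K"
    and char0: "\<And>n::nat. n > 0 \<Longrightarrow> [n] \<cdot>\<^bsub>K\<^esub> \<one>\<^bsub>K\<^esub> \<noteq> \<zero>\<^bsub>K\<^esub>"
    and A: "poisson_algebra K A P" "finite_type K A"
    and G: "affine_algebraic_group K H \<Delta> \<epsilon> \<sigma>"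
    and action: "poisson_action K H \<Delta> \<epsilon> A P \<rho>"
  shows "poisson_vertex_subalgebra K (jet K A) (jet_der K A) (jet_bracket K A P)
           (jet_invariants K H A \<rho>) \<and>
         pva_hom K
           (jet K (invariant_algebra K H A \<rho>)) (jet_der K (invariant_algebra K H A \<rho>))
           (jet_bracket K (invariant_algebra K H A \<rho>) P)
           ((jet K A)\<lparr>carrier := jet_invariants K H A \<rho>\<rparr>) (jet_der K A) (jet_bracket K A P)
           (jet_map K A (\<lambda>a. a))"
proof -
  interpret P: poisson_algebra K A P by (rule A(1))
  interpret G: affine_algebraic_group K H \<Delta> \<epsilon> \<sigma> by (rule G)
  interpret bA: bider K A P by (rule P.bider)
  have HA: "tensors K H A" by (intro tensors.intro G.algebra_axioms P.algebra_axioms)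
  interpret T: jet_tensors K H A by (intro jet_tensors.intro HA)
  interpret TB: tensor_bider K H A P
    by (intro tensor_bider.intro HA bA.bider_axioms)
  have \<rho>: "alg_hom K A T.AB \<rho>"
    using action by (simp add: poisson_action_def coaction_def)
  have auto: "T.at_point g (\<rho> (P a b)) = P (T.at_point g (\<rho> a)) (T.at_point g (\<rho> b))"
    if "g \<in> points K H" "a \<in> carrier A" "b \<in> carrier A" for g a b
    using action that
    by (simp add: poisson_action_def poisson_automorphism_def point_action_def T.at_point_def)
  obtain P' where P': "bider K T.AB P'"
    "\<And>h a h' b. h \<in> carrier H \<Longrightarrow> a \<in> carrier A \<Longrightarrow> h' \<in> carrier H \<Longrightarrow> b \<in> carrier A \<Longrightarrow>
      P' (T.tn h a) (T.tn h' b) = T.tn (h \<otimes>\<^bsub>H\<^esub> h') (P a b)"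
    by (rule TB.tensor_bracket_exists) (rule that; assumption)
  interpret P': bider K T.AB P' by (rule P'(1))
  have red: "\<forall>h\<in>carrier H. \<forall>n::nat. h [^]\<^bsub>H\<^esub> n = \<zero>\<^bsub>H\<^esub> \<longrightarrow> h = \<zero>\<^bsub>H\<^esub>"
    using G.reduced by blast
  have \<rho>P: "\<rho> (P a b) = P' (\<rho> a) (\<rho> b)" if "a \<in> carrier A" "b \<in> carrier A" for a b
    by (rule TB.coaction_bracket[OF K G.fin_type red P' \<rho> auto that])
  have \<iota>P: "T.tn \<one>\<^bsub>H\<^esub> (P a b) = P' (T.tn \<one>\<^bsub>H\<^esub> a) (T.tn \<one>\<^bsub>H\<^esub> b)" if "a \<in> carrier A" "b \<in> carrier A" for a b
    using that by (simp add: P'(2))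
  \<comment> \<open>\<open>P'\<close> is known as a biderivation, so its extension \<open>L'\<close>
    is a sesquilinear biderivation; \<open>jet_map_bracket\<close> asks no more of its
    target.\<close>
  obtain L' where L': "T.jT.dj.lambda_bider L'"
    "\<And>x y. x \<in> carrier T.AB \<Longrightarrow> y \<in> carrier T.AB \<Longrightarrow>
      L' (T.jT.gen 0 x) (T.jT.gen 0 y) = up_ring.monom T.jT.dj.U (T.jT.gen 0 (P' x y)) 0"
    by (rule P'.lambda_bider_exists) (rule that; assumption)
  let ?L = "jet_bracket K A P"
  note pva = bA.jet_bracket[OF A(1)]
  note L = bA.dj.pva_lambda_bider[OF pva(1)]
  note jr = jet_map_facts[OF P.algebra_axioms T.tensor_algebra \<rho>]
  note ji = T.jtA
  have jrL: "L' (jet_map K T.AB \<rho> x) (jet_map K T.AB \<rho> y) = (\<lambda>n. jet_map K T.AB \<rho> (?L x y n))"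
    if "x \<in> carrier (jet K A)" "y \<in> carrier (jet K A)" for x y
    by (rule jet_map_bracket[OF bA.bider_axioms P'(1) \<rho> \<rho>P L pva(2) L' that])
  have jiL: "L' (T.jtA x) (T.jtA y) = (\<lambda>n. T.jtA (?L x y n))"
    if "x \<in> carrier (jet K A)" "y \<in> carrier (jet K A)" for x y
    by (rule jet_map_bracket[OF bA.bider_axioms P'(1) T.tens_right_hom \<iota>P L pva(2) L' that])
  let ?W = "jet_invariants K H A \<rho>"
  note W = T.jet_invariants_equalizer[OF \<rho>]
  have W_sub: "subalg K (jet K A) ?W"
    unfolding W by (rule bA.J.equalizer_subalg[OF T.jT.jet_algebra jr(1) ji(1)])
  have pvs: "poisson_vertex_subalgebra K (jet K A) (jet_der K A) ?L ?W"
    unfolding poisson_vertex_subalgebra_def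
  proof (intro conjI pva(1) W_sub ballI allI)
    fix a assume "a \<in> ?W"
    then show "jet_der K A a \<in> ?W"
      unfolding W by (auto simp: jr(3) ji(3) derivationD(1)[OF bA.der_derivation])
  next
    fix a b n assume "a \<in> ?W" "b \<in> ?W"
    then have a: "a \<in> carrier (jet K A)" "jet_map K T.AB \<rho> a = T.jtA a"
      and b: "b \<in> carrier (jet K A)" "jet_map K T.AB \<rho> b = T.jtA b"
      unfolding W by auto
    \<comment> \<open>Both jets send the bracket of \<open>a\<close> and \<open>b\<close> to the
      \<open>L'\<close>-bracket of their images, and on \<open>a\<close> and \<open>b\<close> the
      two jets agree.\<close>
    have "jet_map K T.AB \<rho> (?L a b n) = T.jtA (?L a b n)"
      using fun_cong[OF jrL[OF a(1) b(1)], of n] fun_cong[OF jiL[OF a(1) b(1)], of n] a(2) b(2) by simp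
    moreover have "?L a b n \<in> carrier (jet K A)"
      using bA.dj.lambda_biderD(1)[OF L a(1) b(1)] unfolding bA.dj.U_mem by blast
    ultimately show "?L a b n \<in> ?W" unfolding W by simp
  qed
  let ?I = "invariants K H A \<rho>" and ?AG = "invariant_algebra K H A \<rho>"
  have I: "?I = {f \<in> carrier A. \<rho> f = T.tn \<one>\<^bsub>H\<^esub> f}" by (simp add: invariants_def)
  have I_sub: "subalg K A ?I"
    unfolding I by (rule P.equalizer_subalg[OF T.tensor_algebra \<rho> T.tens_right_hom])
  have IP: "P a b \<in> ?I" if "a \<in> ?I" "b \<in> ?I" for a b
    using that unfolding I by (auto simp: P.bracket_closed \<rho>P \<iota>P)
  have AG: "poisson_algebra K ?AG P"
    unfolding invariant_algebra_def by (rule P.poisson_subalgebra[OF I_sub IP])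
  interpret AG: poisson_algebra K ?AG P by (rule AG)
  interpret bG: bider K ?AG P by (rule AG.bider)
  note pvaG = bG.jet_bracket[OF AG]
  have incl: "alg_hom K ?AG A (\<lambda>a. a)"
    unfolding invariant_algebra_def by (rule alg_homI) (auto simp: I)
  note j = jet_map_facts[OF AG.algebra_axioms P.algebra_axioms incl]
  let ?j = "jet_map K A (\<lambda>a. a)"
  \<comment> \<open>The coaction and \<open>a \<mapsto> 1 \<otimes> a\<close> agree on the
    invariants of \<open>A\<close> by definition, so their jets agree on everything that these
    generate under the operations and \<partial>.\<close>
  have j_inv: "?j x \<in> ?W" if "x \<in> carrier (jet K ?AG)" for x
  proof -
    have "jet_map K T.AB \<rho> (?j x) = T.jtA (?j x)"
      using that
    proof (induction rule: bG.jet_induct)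
      case (gen a)
      then have "a \<in> carrier A" "\<rho> a = T.tn \<one>\<^bsub>H\<^esub> a" by (auto simp: invariant_algebra_def I)
      then show ?case using gen by (simp add: j(2) jr(2) ji(2))
    qed (simp_all add: alg_homD[OF j(1)] j(3) jr(3) ji(3) alg_homD[OF jr(1)] alg_homD[OF ji(1)])
    then show ?thesis unfolding W using that alg_homD(2)[OF j(1)] by simp
  qed
  have "pva_hom K (jet K ?AG) (jet_der K ?AG) (jet_bracket K ?AG P)
     ((jet K A)\<lparr>carrier := ?W\<rparr>) (jet_der K A) ?L ?j"
    unfolding pva_hom_def
  proof (intro conjI pvaG(1) pva_subalgebra[OF pvs] ballI j(3))
    show "alg_hom K (jet K ?AG) ((jet K A)\<lparr>carrier := ?W\<rparr>) ?j"
      by (rule alg_homI) (simp_all add: j_inv alg_homD[OF j(1)])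
    fix a b assume ab: "a \<in> carrier (jet K ?AG)" "b \<in> carrier (jet K ?AG)"
    show "?L (?j a) (?j b) = (\<lambda>n. ?j (jet_bracket K ?AG P a b n))"
      by (rule jet_map_bracket[OF bG.bider_axioms bA.bider_axioms incl HOL.refl
            bG.dj.pva_lambda_bider[OF pvaG(1)] pvaG(2) L pva(2) ab])
  qed
  with pvs show ?thesis ..
qed

end
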